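(* Let $p\ge2$, $\Lambda\ge1$, $N\ge 1$. There exists a constant $C>0$ depending only on $N,p,\Lambda$ with the following property. Fix $\ell_0>p$ and let $0\le t\le s<1$ (with $s>0$) be such that $$t+s(p+1)\ge\ell_0 .$$ Let $\Omega\subset\mathbb{R}^N$ be open, let $K:\mathbb{R}^N\to[0,+\infty)$ be measurable with $\frac1\Lambda|z|^{N+sp}\le K(z)\le\Lambda|z|^{N+sp}$ for all $z$, let $f\in W^{s,p'}_{loc}(\Omega)$ and let $u\in W^{s,p}_{loc}(\Omega)\cap\mathcal{Y}^{t,p}_s$ be a local weak solution of $(-\Delta_{p,K})^su=f$ in $\Omega$. Set $\Gamma:=\frac{1+t+sp}{p}$ and, for every ball $B_R\Subset\Omega$ (with concentric balls $B_\rho$), $$\begin{aligned}\mathcal{A}_R(u,f):=&\Big(R^{sp}[u]^p_{W^{s,p}(B_R)}+\frac{1}{s(1-s)}\|u\|^p_{L^p(B_R)}\Big)+\frac1s\langle u\rangle^p_{\mathcal{X}^p_s(B_{\frac34R};B_R)}+R^{tp}\langle u\rangle^p_{\mathcal{Y}^{t,p}_s(B_{\frac34R};B_{\frac78R})}\\&+R^{s\,p\,p'}\Big(R^{sp'}\big[(1-s)f\big]^{p'}_{W^{s,p'}(B_R)}+\frac{1}{s(1-s)}\big\|(1-s)f\big\|^{p'}_{L^{p'}(B_R)}\Big).\end{aligned}$$ Then for every ball $B_R\Subset\Omega$ and every $0<\tau<\Gamma-1$, $$\|\nabla u\|^p_{L^p(B_{R/2})}\le\frac{C}{(\ell_0-p)^p}\,(1-s)\,\frac{\mathcal{A}_R(u,f)}{R^p}$$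 and $$[\nabla u]^p_{W^{\tau,p}(B_{R/4})}\le\frac{(2-\Gamma)^{-p}(\Gamma-1)^{-p}}{(\Gamma-1-\tau)\,\tau}\,\frac{C}{(\ell_0-p)^p}\,(1-s)\,\frac{\mathcal{A}_R(u,f)}{R^{p(1+\tau)}}.$$
   Context: Here $p'=p/(p-1)$. $F\Subset E$ means that $F,E$ are open and the closure of $F$ is a compact subset of $E$. For $0<\alpha<1$ and $1\le q<\infty$, $[\psi]_{W^{\alpha,q}(E)}=\left(\int_E\int_E\frac{|\psi(x)-\psi(y)|^q}{|x-y|^{N+\alpha q}}dx\,dy\right)^{1/q}$; $W^{\alpha,q}(E)$ is the set of $\psi\in L^q(E)$ with $[\psi]_{W^{\alpha,q}(E)}<\infty$; $W^{\alpha,q}_{loc}(\Omega)$ is the corresponding local space. (The condition $t+s(p+1)\ge \ell_0>p$ forces $t+sp>p-1$, i.e. $\Gamma>1$.) Weighted spaces: $\mathcal{X}^p_s=\{\psi\in L^p_{loc}(\mathbb{R}^N):\int_{\mathbb{R}^N}\frac{|\psi(x)|^p}{(1+|x|)^{N+sp}}dx<\infty\}$, and for $0\le t\le1$, $\mathcal{Y}^{t,p}_s$ is the set of $\psi\in\mathcal{X}^p_s$ such that for some $h_0>0$, $\sup_{0<|h|<h_0}\int_{\mathbb{R}^N}\left|\frac{\psi(x+h)-\psi(x)}{|h|^t}\right|^p\frac{dx}{(1+|x|)^{N+sp}}<\infty$ (with $|h|^0=1$). Snail quantities: for $E$ open and bounded and $\psi\in\mathcal{X}^p_s$, $\mathrm{Snail}(\psi;x,E):=\left[|E|^{\frac{sp}{N}}\int_{\mathbb{R}^N\setminus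 E}\frac{|\psi(y)|^p}{|x-y|^{N+sp}}dy\right]^{1/p}$ for $x\in E$. For $F\Subset E\Subset\mathbb{R}^N$, $$\langle\psi\rangle_{\mathcal{X}^p_s(F;E)}:=\Big(\int_E|\psi|^pdx+\int_F\mathrm{Snail}(\psi;x,E)^pdx\Big)^{1/p},$$ and for $\psi\in\mathcal{Y}^{t,p}_s$, $$\langle\psi\rangle_{\mathcal{Y}^{t,p}_s(F;E)}:=\sup_{0<|h|<\frac12 d(F,E)}\Big(\int_F\mathrm{Snail}\Big(\frac{\psi(\cdot+h)-\psi}{|h|^t};x,E\Big)^pdx\Big)^{1/p},\quad d(F,E):=\mathrm{dist}(F,\mathbb{R}^N\setminus E).$$ Local weak solution: given $f\in L^{p'}_{loc}(\Omega)$, $u\in W^{s,p}_{loc}(\Omega)\cap\mathcal{X}^p_s$ is a local weak solution of $(-\Delta_{p,K})^su=f$ in $\Omega$ if $$\int_{\mathbb{R}^N}\int_{\mathbb{R}^N}\frac{|u(x)-u(y)|^{p-2}(u(x)-u(y))}{K(x-y)}(\varphi(x)-\varphi(y))\,dx\,dy=\int_{\Omega'}f\varphi\,dx$$ for every $\Omega'\Subset\Omega$ and every $\varphi\in W^{s,p}(\Omega)$ with $\varphi\equiv0$ in $\Omega\setminus\Omega'$ ($\varphi$ is extended by $0$ outside $\Omega$). *)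

theory Defs
  imports "HOL-Analysis.Analysis"
begin

text \<open>
  The space \<open>R^N\<close> is a type \<open>'a::euclidean_space\<close> with \<open>N = DIM('a)\<close>. Integrals over
  \<open>R^N \<times> R^N\<close> are integrals for Lebesgue measure on the Euclidean space \<open>'a \<times> 'a\<close>. Functions take
  values in a Euclidean space \<open>'b\<close>, so that the same definitions serve \<open>u\<close> and its gradient.
  Norms and seminorms are extended nonnegative reals. A function on an open set is a total function
  of which only the values on that set are used.
\<close>

text \<open>Powers of extended nonnegative reals, meant for exponents \<open>a > 0\<close>.\<close>

definition epow :: "ennreal \<Rightarrow> real \<Rightarrow> ennreal" where
  "epow x a = (if x = \<infinity> then \<infinity> else ennreal (enn2real x powr a))"

definition conj_exp :: "real \<Rightarrow> real" where
  "conj_exp p = p / (p - 1)"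

definition compactly_in :: "'a::euclidean_space set \<Rightarrow> 'a set \<Rightarrow> bool" (infix "\<Subset>" 50) where
  "F \<Subset> E \<longleftrightarrow> open F \<and> open E \<and> compact (closure F) \<and> closure F \<subseteq> E"

definition Lp_norm ::
  "real \<Rightarrow> 'a::euclidean_space set \<Rightarrow> ('a \<Rightarrow> 'b::euclidean_space) \<Rightarrow> ennreal" where
  "Lp_norm q E \<psi> = epow (\<integral>\<^sup>+x\<in>E. ennreal (norm (\<psi> x) powr q) \<partial>lebesgue) (1 / q)"

definition Lp :: "real \<Rightarrow> 'a::euclidean_space set \<Rightarrow> ('a \<Rightarrow> 'b::euclidean_space) set" where
  "Lp q E = {\<psi>. \<psi> \<in> borel_measurable (lebesgue_on E) \<and> Lp_norm q E \<psi> < \<infinity>}"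

definition Lp_loc :: "real \<Rightarrow> 'a::euclidean_space set \<Rightarrow> ('a \<Rightarrow> 'b::euclidean_space) set" where
  "Lp_loc q \<Omega> = {\<psi>. \<forall>E. E \<Subset> \<Omega> \<longrightarrow> \<psi> \<in> Lp q E}"

text \<open>On the diagonal the integrand is \<open>0 / 0 = 0\<close>; the diagonal is a null set.\<close>

definition W_seminorm ::
  "real \<Rightarrow> real \<Rightarrow> 'a::euclidean_space set \<Rightarrow> ('a \<Rightarrow> 'b::euclidean_space) \<Rightarrow> ennreal" where
  "W_seminorm \<alpha> q E \<psi> =
     epow (\<integral>\<^sup>+z\<in>E \<times> E. (case z of (x, y) \<Rightarrow>
             ennreal (norm (\<psi> x - \<psi> y) powr q / norm (x - y) powr (real DIM('a) + \<alpha> * q)))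
           \<partial>lebesgue) (1 / q)"

definition W :: "real \<Rightarrow> real \<Rightarrow> 'a::euclidean_space set \<Rightarrow> ('a \<Rightarrow> 'b::euclidean_space) set" where
  "W \<alpha> q E = {\<psi>. \<psi> \<in> Lp q E \<and> W_seminorm \<alpha> q E \<psi> < \<infinity>}"

definition W_loc ::
  "real \<Rightarrow> real \<Rightarrow> 'a::euclidean_space set \<Rightarrow> ('a \<Rightarrow> 'b::euclidean_space) set" where
  "W_loc \<alpha> q \<Omega> = {\<psi>. \<forall>E. E \<Subset> \<Omega> \<longrightarrow> \<psi> \<in> W \<alpha> q E}"

definition X_space :: "real \<Rightarrow> real \<Rightarrow> ('a::euclidean_space \<Rightarrow> real) set" where
  "X_space s p = {\<psi>. \<psi> \<in> Lp_loc p UNIV \<and>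
     (\<integral>\<^sup>+x. ennreal (\<bar>\<psi> x\<bar> powr p / (1 + norm x) powr (real DIM('a) + s * p)) \<partial>lebesgue) < \<infinity>}"

definition diff_quot ::
  "real \<Rightarrow> 'a::euclidean_space \<Rightarrow> ('a \<Rightarrow> real) \<Rightarrow> 'a \<Rightarrow> real" where
  "diff_quot t h \<psi> x = (\<psi> (x + h) - \<psi> x) / norm h powr t"

definition Y_space :: "real \<Rightarrow> real \<Rightarrow> real \<Rightarrow> ('a::euclidean_space \<Rightarrow> real) set" where
  "Y_space t s p = {\<psi>. \<psi> \<in> X_space s p \<and>
     (\<exists>h\<^sub>0>0. (SUP h\<in>{h. 0 < norm h \<and> norm h < h\<^sub>0}.
        \<integral>\<^sup>+x. ennreal (\<bar>diff_quot t h \<psi> x\<bar> powr p / (1 + norm x) powr (real DIM('a) + s * p))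
          \<partial>lebesgue) < \<infinity>)}"

definition Snail ::
  "real \<Rightarrow> real \<Rightarrow> ('a::euclidean_space \<Rightarrow> real) \<Rightarrow> 'a \<Rightarrow> 'a set \<Rightarrow> ennreal" where
  "Snail s p \<psi> x E =
     epow (ennreal (measure lebesgue E powr (s * p / real DIM('a))) *
           (\<integral>\<^sup>+y\<in>- E. ennreal (\<bar>\<psi> y\<bar> powr p / norm (x - y) powr (real DIM('a) + s * p)) \<partial>lebesgue))
          (1 / p)"

definition X_local ::
  "real \<Rightarrow> real \<Rightarrow> 'a::euclidean_space set \<Rightarrow> 'a set \<Rightarrow> ('a \<Rightarrow> real) \<Rightarrow> ennreal" where
  "X_local s p F E \<psi> =
     epow ((\<integral>\<^sup>+x\<in>E. ennreal (\<bar>\<psi> x\<bar> powr p) \<partial>lebesgue) +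
           (\<integral>\<^sup>+x\<in>F. epow (Snail s p \<psi> x E) p \<partial>lebesgue)) (1 / p)"

definition Y_local ::
  "real \<Rightarrow> real \<Rightarrow> real \<Rightarrow> 'a::euclidean_space set \<Rightarrow> 'a set \<Rightarrow> ('a \<Rightarrow> real) \<Rightarrow> ennreal" where
  "Y_local t s p F E \<psi> =
     (SUP h\<in>{h. 0 < norm h \<and> norm h < setdist F (- E) / 2}.
        epow (\<integral>\<^sup>+x\<in>F. epow (Snail s p (diff_quot t h \<psi>) x E) p \<partial>lebesgue) (1 / p))"

text \<open>
  A test function is defined on all of \<open>R^N\<close> and vanishes outside \<open>\<Omega>'\<close>, which includes its
  extension by zero outside \<open>\<Omega>\<close>. The kernel may vanish at \<open>0\<close>, which only affects the diagonal.
\<close>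

definition local_weak_solution ::
  "real \<Rightarrow> real \<Rightarrow> ('a::euclidean_space \<Rightarrow> real) \<Rightarrow> 'a set \<Rightarrow> ('a \<Rightarrow> real) \<Rightarrow> ('a \<Rightarrow> real) \<Rightarrow> bool" where
  "local_weak_solution s p K \<Omega> f u \<longleftrightarrow>
     f \<in> Lp_loc (conj_exp p) \<Omega> \<and> u \<in> W_loc s p \<Omega> \<and> u \<in> X_space s p \<and>
     (\<forall>\<Omega>' \<phi>. \<Omega>' \<Subset> \<Omega> \<and> \<phi> \<in> W s p \<Omega> \<and> (\<forall>x. x \<notin> \<Omega>' \<longrightarrow> \<phi> x = 0) \<longrightarrow>
        (LINT z|lebesgue. (case z of (x, y) \<Rightarrow>
           \<bar>u x - u y\<bar> powr (p - 2) * (u x - u y) / K (x - y) * (\<phi> x - \<phi> y)))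
        = (LINT x:\<Omega>'|lebesgue. f x * \<phi> x))"

primrec Ck :: "nat \<Rightarrow> ('a::euclidean_space \<Rightarrow> real) \<Rightarrow> bool" where
  "Ck 0 \<phi> \<longleftrightarrow> continuous_on UNIV \<phi>"
| "Ck (Suc k) \<phi> \<longleftrightarrow> \<phi> differentiable_on UNIV \<and>
     (\<forall>e\<in>Basis. Ck k (\<lambda>x. frechet_derivative \<phi> (at x) e))"

definition test_function :: "'a::euclidean_space set \<Rightarrow> ('a \<Rightarrow> real) \<Rightarrow> bool" where
  "test_function \<Omega> \<phi> \<longleftrightarrow> (\<forall>k. Ck k \<phi>) \<and> (\<exists>S. compact S \<and> S \<subseteq> \<Omega> \<and> (\<forall>x. x \<notin> S \<longrightarrow> \<phi> x = 0))"

definition weak_gradient ::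
  "'a::euclidean_space set \<Rightarrow> ('a \<Rightarrow> real) \<Rightarrow> ('a \<Rightarrow> 'a) \<Rightarrow> bool" where
  "weak_gradient \<Omega> u G \<longleftrightarrow> u \<in> Lp_loc 1 \<Omega> \<and> G \<in> Lp_loc 1 \<Omega> \<and>
     (\<forall>\<phi>. test_function \<Omega> \<phi> \<longrightarrow> (\<forall>e\<in>Basis.
        (LINT x:\<Omega>|lebesgue. u x * frechet_derivative \<phi> (at x) e)
        = - (LINT x:\<Omega>|lebesgue. (G x \<bullet> e) * \<phi> x)))"

definition A_quantity ::
  "real \<Rightarrow> real \<Rightarrow> real \<Rightarrow> 'a::euclidean_space \<Rightarrow> real \<Rightarrow> ('a \<Rightarrow> real) \<Rightarrow> ('a \<Rightarrow> real) \<Rightarrow> ennreal" where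
  "A_quantity t s p c R u f = (let p' = conj_exp p; g = (\<lambda>x. (1 - s) * f x) in
     (ennreal (R powr (s * p)) * epow (W_seminorm s p (ball c R) u) p
       + ennreal (1 / (s * (1 - s))) * epow (Lp_norm p (ball c R) u) p)
     + ennreal (1 / s) * epow (X_local s p (ball c (3 / 4 * R)) (ball c R) u) p
     + ennreal (R powr (t * p))
         * epow (Y_local t s p (ball c (3 / 4 * R)) (ball c (7 / 8 * R)) u) p
     + ennreal (R powr (s * p * p'))
         * (ennreal (R powr (s * p')) * epow (W_seminorm s p' (ball c R) g) p'
            + ennreal (1 / (s * (1 - s))) * epow (Lp_norm p' (ball c R) g) p'))"

end

(* The nonlocal difference quotient method. Write d_h u = u(. + h) - u. Test the equation minus its
   translate by h with eta^2 d_h u, where eta is a cutoff: the coercivity of a |-> |a|^(p-2) a and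
   Young's inequality bound [d_h u]^p in W^{s,p} of a smaller ball by A (|h|^(2s) + |h|^(s+t)), as soon
   as ||d_h u||^p in L^p is at most (1-s) A |h|^(sp). Since W^{s,p} controls differences of order s, with
   a gain of 1 - s, this yields ||d_h d_h u||^p <= C (1-s) A |h|^(t + s(p+1)), whose order exceeds p.
   The telescoping identity 2^n d_{h/2^n} u = d_h u - sum_{j<n} 2^j d_{h/2^(j+1)} d_{h/2^(j+1)} u
   then shows that the dyadic difference quotients converge, to the weak derivative, and that ||d_h u||
   is of order |h| with the constant 1/(l0 - p). Repeating the test with this better bound gives
   ||d_k d_h u||^p <= C |k|^(sp) |h|^(1+t), and telescoping in h = k/2^m shows that the differences of the
   gradient have order Gamma - 1 = (1 + t + sp)/p - 1. *)

theory Submission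
  imports Defs
begin

text \<open>The obstacle is uniformity: the constant may depend only on the dimension,
  \<open>p\<close> and \<open>\<Lambda>\<close>, so every 1 / (1 - s) has to be paid for. The cutoff
  error integrates |x - y|^(p - sp - N), whose mass is about 1 / (1 - s), and the difference of the
  source carries 1 / (1 - s) as well. Both are compensated by the factor 1 - s in the L^p bound of
  the difference. Young's inequality is used with two free sizes, \<theta> for d_h u on the ball and
  l = (|h| / R)^t for d_h u in the tail; the outcome is \<theta>^2 + l \<theta>. This single
  estimate serves twice, with \<theta> of order |h|^s and then of order |h| / (l0 - p). The
  hypotheses force s > 1/2, so factors 1 / s are harmless. The quantity A may be infinite on a large
  ball, where the bounds are trivial; existence of the gradient therefore comes from small balls and
  compactness. The analysis is done for Borel representatives, because translations and Tonelli need
  measurability on the product space.\<close>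

section \<open>Differences, kernels and powers of norms for Borel measure\<close>

definition dlt :: "'a::euclidean_space \<Rightarrow> ('a \<Rightarrow> real) \<Rightarrow> 'a \<Rightarrow> real" where
  "dlt h v x = v (x + h) - v x"

text \<open>The value at the origin is \<open>0\<close>, by \<open>0 powr b = 0\<close> and division
  by zero, which agrees with the convention for the diagonal in \<open>W_seminorm\<close>.\<close>

definition krn :: "real \<Rightarrow> 'a::euclidean_space \<Rightarrow> real" where
  "krn b z = 1 / norm z powr b"

text \<open>Powers of norms scale and add without roots, and Borel measure instead of its completion
  lets translations and Tonelli apply directly. The link to the given norms is
  \<open>Lp_norm_Lpow\<close>, and \<open>W_seminorm_Wpow\<close> for \<open>Wpow\<close>.\<close>

definition Lpow :: "real \<Rightarrow> 'a::euclidean_space set \<Rightarrow> ('a \<Rightarrow> real) \<Rightarrow> ennreal" where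
  "Lpow q E v = (\<integral>\<^sup>+x. ennreal (\<bar>v x\<bar> powr q) * indicator E x \<partial>lborel)"

definition dint :: "('a::euclidean_space \<Rightarrow> 'a \<Rightarrow> ennreal) \<Rightarrow> ennreal" where
  "dint F = (\<integral>\<^sup>+x. \<integral>\<^sup>+y. F x y \<partial>lborel \<partial>lborel)"

definition Wpow :: "real \<Rightarrow> real \<Rightarrow> 'a::euclidean_space set \<Rightarrow> ('a \<Rightarrow> real) \<Rightarrow> ennreal" where
  "Wpow \<alpha> q E v = dint (\<lambda>x y. ennreal (\<bar>v x - v y\<bar> powr q * krn (real DIM('a) + \<alpha> * q) (x - y))
      * (indicator E x * indicator E y))"

subsection \<open>Elementary inequalities\<close>

lemma powr_convex_nonneg:
  assumes "1 \<le> p"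
  shows "convex_on {0..} (\<lambda>x::real. x powr p)"
proof (rule convex_onI)
  fix t x y :: real
  assume t: "0 < t" "t < 1" and xy: "x \<in> {0..}" "y \<in> {0..}"
  \<comment> \<open>This settles the endpoint \<open>0\<close>, where only one term of the convex
    combination survives.\<close>
  have le: "c powr p \<le> c" if "0 < c" "c < 1" for c :: real
    using powr_mono'[of 1 p c] that assms by simp
  show "((1 - t) *\<^sub>R x + t *\<^sub>R y) powr p \<le> (1 - t) * x powr p + t * y powr p"
  proof (cases "x = 0 \<or> y = 0")
    case True
    then show ?thesis using t xy le[of t] le[of "1 - t"] assms
      by (auto simp: powr_mult intro!: mult_right_mono)
  next
    case False
    then show ?thesis using convex_onD[OF powr_convex[OF assms], of t x y] t xy by auto
  qed
qed simp

lemma abs_add_powr_le: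
  fixes a b q :: real
  assumes "1 \<le> q"
  shows "\<bar>a + b\<bar> powr q \<le> 2 powr (q - 1) * (\<bar>a\<bar> powr q + \<bar>b\<bar> powr q)"
proof -
  have c: "convex_on {0..} (\<lambda>x::real. x powr q)" by (rule powr_convex_nonneg[OF assms])
  have "((1/2) * \<bar>a\<bar> + (1/2) * \<bar>b\<bar>) powr q \<le> (1/2) * \<bar>a\<bar> powr q + (1/2) * \<bar>b\<bar> powr q"
    using convex_onD[OF c, of "1/2" "\<bar>a\<bar>" "\<bar>b\<bar>"] by (simp add: field_simps)
  then have "2 powr q * ((1/2) * \<bar>a\<bar> + (1/2) * \<bar>b\<bar>) powr q
      \<le> 2 powr q * ((1/2) * \<bar>a\<bar> powr q + (1/2) * \<bar>b\<bar> powr q)"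
    by (intro mult_left_mono) auto
  also have "\<dots> = 2 powr (q - 1) * (\<bar>a\<bar> powr q + \<bar>b\<bar> powr q)"
    by (simp add: powr_diff field_simps)
  also have "2 powr q * ((1/2) * \<bar>a\<bar> + (1/2) * \<bar>b\<bar>) powr q = (\<bar>a\<bar> + \<bar>b\<bar>) powr q"
    by (subst powr_mult[symmetric]) (simp add: distrib_left)
  finally have "(\<bar>a\<bar> + \<bar>b\<bar>) powr q \<le> 2 powr (q - 1) * (\<bar>a\<bar> powr q + \<bar>b\<bar> powr q)" .
  moreover have "\<bar>a + b\<bar> powr q \<le> (\<bar>a\<bar> + \<bar>b\<bar>) powr q"
    using assms by (intro powr_mono2) auto
  ultimately show ?thesis by linarith
qed

lemma abs_add_powr_le':
  fixes a b q :: real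
  assumes "1 \<le> q"
  shows "\<bar>a + b\<bar> powr q \<le> 2 powr q * (\<bar>a\<bar> powr q + \<bar>b\<bar> powr q)"
proof -
  have "(2::real) powr (q - 1) \<le> 2 powr q" by simp
  then have "2 powr (q - 1) * (\<bar>a\<bar> powr q + \<bar>b\<bar> powr q) \<le> 2 powr q * (\<bar>a\<bar> powr q + \<bar>b\<bar> powr q)"
    by (intro mult_right_mono) auto
  then show ?thesis using abs_add_powr_le[OF assms, of a b] by linarith
qed

lemma abs_diff_powr_le:
  fixes a b q :: real
  assumes "1 \<le> q"
  shows "\<bar>a - b\<bar> powr q \<le> 2 powr q * (\<bar>a\<bar> powr q + \<bar>b\<bar> powr q)"
  using abs_add_powr_le'[OF assms, of a "- b"] by simp

text \<open>Jensen's inequality for the power \<open>p\<close> at the points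
  \<open>a j / l j\<close> with weights \<open>l j / S\<close>. A geometric \<open>l\<close> makes
  the right-hand side bounded independently of the number of terms.\<close>

lemma sum_powr_weighted:
  fixes l a :: "nat \<Rightarrow> real"
  assumes p: "1 \<le> p" and l: "\<And>j. 0 < l j" and a: "\<And>j. 0 \<le> a j"
  shows "(\<Sum>j<n. a j) powr p \<le> (\<Sum>j<n. l j) powr (p - 1) * (\<Sum>j<n. l j powr (1 - p) * a j powr p)"
proof (cases "n = 0")
  case False
  define S where "S = (\<Sum>j<n. l j)"
  have S: "S > 0" unfolding S_def using False l by (intro sum_pos) auto
  have c: "convex_on {0..} (\<lambda>x::real. x powr p)" by (rule powr_convex_nonneg[OF p])
  have w: "(\<Sum>j<n. l j / S) = 1" using S by (simp add: S_def flip: sum_divide_distrib)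
  have "(\<Sum>j<n. (l j / S) *\<^sub>R (a j / l j)) powr p \<le> (\<Sum>j<n. (l j / S) * (a j / l j) powr p)"
    using False l a S by (intro convex_on_sum[OF _ _ c]) (auto simp: w less_imp_le)
  moreover have "(\<Sum>j<n. (l j / S) *\<^sub>R (a j / l j)) = (\<Sum>j<n. a j) / S"
    unfolding sum_divide_distrib using l by (intro sum.cong) (auto simp: less_imp_neq[THEN not_sym])
  moreover have "(\<Sum>j<n. (l j / S) * (a j / l j) powr p) = (\<Sum>j<n. l j powr (1 - p) * a j powr p) / S"
    unfolding sum_divide_distrib using l a
    by (intro sum.cong) (auto simp: powr_divide powr_diff less_imp_le less_imp_neq[THEN not_sym])
  ultimately have "(\<Sum>j<n. a j) powr p / S powr p \<le> (\<Sum>j<n. l j powr (1 - p) * a j powr p) / S"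
    using S a by (simp add: powr_divide sum_nonneg)
  then show ?thesis using S unfolding S_def[symmetric]
    by (simp add: powr_diff field_simps)
qed simp

text \<open>A geometric series of ratio 2^(-x) has a sum of order 1 / x for small x. This is where
  the denominators \<open>1 - s\<close>, \<open>\<sigma> - 1\<close>, \<open>\<tau>\<close> and
  \<open>\<Gamma> - 1 - \<tau>\<close> of the later estimates come from.\<close>

lemma one_minus_two_powr:
  assumes "0 < (x::real)"
  shows "1 / (1 - 2 powr (- x)) \<le> 2 * (1 + x) / x" "2 powr (- x) < (1::real)"
proof -
  have l2: "ln (2::real) \<ge> 1/2" using ln2_ge_two_thirds by simp
  have "2 powr x = exp (x * ln 2)" by (simp add: powr_def)
  also have "\<dots> \<ge> 1 + x * ln 2" by simp
  also have "1 + x * ln 2 \<ge> 1 + x / 2" using l2 assms by (simp add: field_simps)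
  finally have g: "2 powr x \<ge> 1 + x / 2" by simp
  have e: "2 powr (- x) = 1 / 2 powr x" by (simp add: powr_minus field_simps)
  show "2 powr (- x) < (1::real)" using powr_less_mono[of "-x" 0 "2::real"] assms by simp
  have "1 - 1 / 2 powr x = (2 powr x - 1) / 2 powr x" by (simp add: field_simps)
  then have "1 / (1 - 2 powr (- x)) = 1 + 1 / (2 powr x - 1)"
    using g assms unfolding e by (simp add: field_simps)
  also have "\<dots> \<le> 1 + 2 / x" using g assms by (simp add: field_simps)
  also have "\<dots> \<le> 2 * (1 + x) / x" using assms by (simp add: field_simps)
  finally show "1 / (1 - 2 powr (- x)) \<le> 2 * (1 + x) / x" .
qed

text \<open>The converse comparison, from ln 2 \<le> 1. It turns a sum over dyadic scales into the
  gain \<open>1 - s\<close> in \<open>nikolskii\<close>.\<close>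

lemma one_minus_two_powr_upper:
  assumes "0 < (x::real)"
  shows "1 / x \<le> 1 / (1 - 2 powr (- x))"
proof -
  have l2: "ln (2::real) \<le> 1" using ln_2_less_1 by simp
  have "2 powr (-x) = exp (- x * ln 2)" by (simp add: powr_def)
  also have "\<dots> \<ge> 1 - x * ln 2" using exp_ge_add_one_self[of "-x * ln 2"] by simp
  also have "1 - x * ln 2 \<ge> 1 - x" using l2 assms by (simp add: field_simps)
  finally have g: "1 - 2 powr (-x) \<le> x" by simp
  then show ?thesis using one_minus_two_powr(2)[OF assms] assms by (intro divide_left_mono) auto
qed

subsection \<open>Integrals over the Euclidean space\<close>

lemma borel_measurable_dlt[measurable]:
  assumes [measurable]: "v \<in> borel_measurable borel"
  shows "dlt h v \<in> borel_measurable borel"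
  unfolding dlt_def[abs_def] by measurable

lemma borel_measurable_krn[measurable]: "krn b \<in> borel_measurable borel"
  unfolding krn_def[abs_def] by measurable

lemma ball_in_sets_borel[measurable]: "ball c r \<in> sets borel"
  by (simp add: borel_open)

lemma krn_nonneg[simp]: "0 \<le> krn b z" by (simp add: krn_def)

lemma krn_minus[simp]: "krn b (- z) = krn b z" by (simp add: krn_def)

lemma krn_minus_commute: "krn b (x - y) = krn b (y - x)"
  using krn_minus[of b "x - y"] by simp

lemma nn_integral_lborel_plus:
  fixes F :: "'a::euclidean_space \<Rightarrow> ennreal"
  assumes [measurable]: "F \<in> borel_measurable borel"
  shows "(\<integral>\<^sup>+x. F (x + h) \<partial>lborel) = (\<integral>\<^sup>+x. F x \<partial>lborel)"
proof -
  have "(\<integral>\<^sup>+x. F x \<partial>lborel) = (\<integral>\<^sup>+x. F x \<partial>distr lborel borel ((+) h))"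
    by (simp add: lborel_distr_plus)
  also have "\<dots> = (\<integral>\<^sup>+x. F (h + x) \<partial>lborel)" by (rule nn_integral_distr) auto
  finally show ?thesis by (simp add: add.commute)
qed

lemma nn_integral_lborel_reflect:
  fixes F :: "'a::euclidean_space \<Rightarrow> ennreal"
  assumes [measurable]: "F \<in> borel_measurable borel"
  shows "(\<integral>\<^sup>+x. F (h - x) \<partial>lborel) = (\<integral>\<^sup>+x. F x \<partial>lborel)"
proof -
  have "lborel = density (distr lborel borel (\<lambda>x::'a. h + (-1) *\<^sub>R x)) (\<lambda>_. ennreal (\<bar>-1\<bar> ^ DIM('a)))"
    by (rule lborel_affine) simp
  then have "lborel = distr lborel borel (\<lambda>x::'a. h - x)" by (simp add: density_1)
  then have "(\<integral>\<^sup>+x. F x \<partial>lborel) = (\<integral>\<^sup>+x. F x \<partial>distr lborel borel (\<lambda>x::'a. h - x))" by simp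
  also have "\<dots> = (\<integral>\<^sup>+x. F (h - x) \<partial>lborel)" by (rule nn_integral_distr) auto
  finally show ?thesis by simp
qed

lemma dint_mono: "(\<And>x y. F x y \<le> G x y) \<Longrightarrow> dint F \<le> dint G"
  unfolding dint_def by (intro nn_integral_mono)

lemma dint_add:
  fixes F G :: "'a::euclidean_space \<Rightarrow> 'a \<Rightarrow> ennreal"
  assumes [measurable]: "case_prod F \<in> borel_measurable (borel \<Otimes>\<^sub>M borel)"
    "case_prod G \<in> borel_measurable (borel \<Otimes>\<^sub>M borel)"
  shows "dint (\<lambda>x y. F x y + G x y) = dint F + dint G"
proof -
  have "dint (\<lambda>x y. F x y + G x y) = (\<integral>\<^sup>+x. ((\<integral>\<^sup>+y. F x y \<partial>lborel) + (\<integral>\<^sup>+y. G x y \<partial>lborel)) \<partial>lborel)"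
    unfolding dint_def by (intro nn_integral_cong nn_integral_add) auto
  also have "\<dots> = dint F + dint G"
    unfolding dint_def by (intro nn_integral_add) auto
  finally show ?thesis .
qed

lemma dint_cmult:
  fixes F :: "'a::euclidean_space \<Rightarrow> 'a \<Rightarrow> ennreal"
  assumes [measurable]: "case_prod F \<in> borel_measurable (borel \<Otimes>\<^sub>M borel)"
  shows "dint (\<lambda>x y. c * F x y) = c * dint F"
proof -
  have "dint (\<lambda>x y. c * F x y) = (\<integral>\<^sup>+x. c * (\<integral>\<^sup>+y. F x y \<partial>lborel) \<partial>lborel)"
    unfolding dint_def by (intro nn_integral_cong nn_integral_cmult) auto
  also have "\<dots> = c * dint F"
    unfolding dint_def by (intro nn_integral_cmult) auto
  finally show ?thesis .
qed

lemma dint_swap: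
  fixes F :: "'a::euclidean_space \<Rightarrow> 'a \<Rightarrow> ennreal"
  assumes [measurable]: "case_prod F \<in> borel_measurable (borel \<Otimes>\<^sub>M borel)"
  shows "dint (\<lambda>x y. F y x) = dint F"
  unfolding dint_def by (rule lborel_pair.Fubini') simp

lemma dint_pair:
  fixes F :: "'a::euclidean_space \<Rightarrow> 'a \<Rightarrow> ennreal"
  assumes [measurable]: "case_prod F \<in> borel_measurable (borel \<Otimes>\<^sub>M borel)"
  shows "(\<integral>\<^sup>+z. case_prod F z \<partial>(lborel \<Otimes>\<^sub>M lborel)) = dint F"
  unfolding dint_def by (subst lborel.nn_integral_fst[symmetric]) auto

lemma dint_shift:
  fixes F :: "'a::euclidean_space \<Rightarrow> 'a \<Rightarrow> ennreal"
  assumes [measurable]: "case_prod F \<in> borel_measurable (borel \<Otimes>\<^sub>M borel)"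
  shows "dint (\<lambda>x y. F (x + h) (y + h)) = dint F"
proof -
  have "dint (\<lambda>x y. F (x + h) (y + h)) = (\<integral>\<^sup>+x. (\<integral>\<^sup>+y. F (x + h) y \<partial>lborel) \<partial>lborel)"
    unfolding dint_def by (intro nn_integral_cong nn_integral_lborel_plus) measurable
  also have "\<dots> = dint F"
    unfolding dint_def by (rule nn_integral_lborel_plus) measurable
  finally show ?thesis .
qed

text \<open>Substituting y = x + z and integrating in x first turns a Gagliardo seminorm into a
  weighted average over z of L^q powers of the difference with step z.\<close>

lemma dint_diff_var:
  fixes F :: "'a::euclidean_space \<Rightarrow> 'a \<Rightarrow> ennreal"
  assumes [measurable]: "case_prod F \<in> borel_measurable (borel \<Otimes>\<^sub>M borel)"
  shows "dint F = (\<integral>\<^sup>+z. \<integral>\<^sup>+x. F x (x + z) \<partial>lborel \<partial>lborel)"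
proof -
  have "dint F = (\<integral>\<^sup>+x. \<integral>\<^sup>+z. F x (z + x) \<partial>lborel \<partial>lborel)"
    unfolding dint_def by (intro nn_integral_cong nn_integral_lborel_plus[symmetric]) measurable
  also have "\<dots> = dint (\<lambda>x z. F x (z + x))" by (simp add: dint_def)
  also have "\<dots> = dint (\<lambda>z x. F x (z + x))" by (rule dint_swap[symmetric]) measurable
  finally show ?thesis by (simp add: dint_def add.commute)
qed

text \<open>Tonelli with a uniform bound for the inner mass of the kernel. The bound is required
  only where the weight is nonzero, that is, for x in the relevant ball.\<close>

lemma dint_weight_le:
  fixes k :: "'a::euclidean_space \<Rightarrow> 'a \<Rightarrow> ennreal"
  assumes [measurable]: "case_prod k \<in> borel_measurable (borel \<Otimes>\<^sub>M borel)" "g \<in> borel_measurable borel"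
  and k: "\<And>x. g x \<noteq> 0 \<Longrightarrow> (\<integral>\<^sup>+y. k x y \<partial>lborel) \<le> c"
  shows "dint (\<lambda>x y. g x * k x y) \<le> c * (\<integral>\<^sup>+x. g x \<partial>lborel)"
proof -
  have "dint (\<lambda>x y. g x * k x y) = (\<integral>\<^sup>+x. g x * (\<integral>\<^sup>+y. k x y \<partial>lborel) \<partial>lborel)"
    unfolding dint_def by (intro nn_integral_cong nn_integral_cmult) auto
  also have "\<dots> \<le> (\<integral>\<^sup>+x. c * g x \<partial>lborel)"
  proof (intro nn_integral_mono)
    fix x show "g x * (\<integral>\<^sup>+y. k x y \<partial>lborel) \<le> c * g x"
      using k[of x] by (cases "g x = 0") (auto simp: mult.commute[of c] intro: mult_left_mono)
  qed
  also have "\<dots> = c * (\<integral>\<^sup>+x. g x \<partial>lborel)" by (intro nn_integral_cmult) auto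
  finally show ?thesis .
qed

subsection \<open>Kernel integrals over dyadic annuli\<close>

lemma suminf_geometric_ennreal:
  assumes "0 \<le> c" "0 \<le> q" "q < 1"
  shows "(\<Sum>j. ennreal (c * q ^ j)) = ennreal (c / (1 - q))"
proof -
  have "(\<lambda>j. c * q ^ j) sums (c * (1 / (1 - q)))"
    using assms by (intro sums_mult geometric_sums) auto
  then show ?thesis using assms by (intro suminf_ennreal_eq) auto
qed

text \<open>Summing \<open>m j\<close> times the volume of the j-th ball bounds the integral by a
  geometric series of ratio 2^(-\<sigma>), hence the factor 1 / \<sigma>. The hypothesis
  \<open>\<sigma> \<le> b\<close> keeps the remaining constant uniform in \<sigma>.\<close>

lemma nn_integral_dyadic_le:
  fixes F :: "'a::euclidean_space \<Rightarrow> real"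
  assumes \<sigma>: "0 < \<sigma>" "\<sigma> \<le> b" and c: "0 \<le> c"
    and r: "\<And>j. 0 \<le> r j"
    and F: "\<And>z. F z = 0 \<or> (\<exists>j. F z \<le> m j \<and> z \<in> ball 0 (r j))"
    and m: "\<And>j. 0 \<le> m j" "\<And>j. m j * r j ^ DIM('a) \<le> c * (2 powr (- \<sigma>)) ^ j"
  shows "(\<integral>\<^sup>+z. ennreal (F z) \<partial>lborel) \<le> ennreal (unit_ball_vol DIM('a) * c * (2 * (1 + b) / \<sigma>))"
proof -
  have q: "2 powr (- \<sigma>) < (1::real)" "0 \<le> 2 powr (-\<sigma>)"  using one_minus_two_powr(2)[OF \<sigma>(1)] by auto
  have "(\<integral>\<^sup>+z. ennreal (F z) \<partial>lborel) \<le> (\<integral>\<^sup>+z. (\<Sum>j. ennreal (m j) * indicator (ball 0 (r j)) z) \<partial>(lborel::'a measure))"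
  proof (intro nn_integral_mono)
    fix z
    show "ennreal (F z) \<le> (\<Sum>j. ennreal (m j) * indicator (ball 0 (r j)) z)"
    proof (cases "F z = 0")
      case False
      then obtain j where j: "F z \<le> m j" "z \<in> ball 0 (r j)" using F[of z] by auto
      have "ennreal (F z) \<le> ennreal (m j) * indicator (ball 0 (r j)) z"
        using j m(1)[of j] by (auto intro: ennreal_leI)
      also have "\<dots> = (\<Sum>i\<in>{j}. ennreal (m i) * indicator (ball 0 (r i)) z)"
        by (subst sum.insert) (auto simp: indicator_def)
      also have "\<dots> \<le> (\<Sum>j. ennreal (m j) * indicator (ball 0 (r j)) z)"
        by (intro sum_le_suminf) auto
      finally show ?thesis .
    qed simp
  qed
  also have "\<dots> = (\<Sum>j. ennreal (m j) * emeasure lborel (ball (0::'a) (r j)))"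
    by (subst nn_integral_suminf) (auto intro!: suminf_cong nn_integral_cmult_indicator)
  also have "\<dots> \<le> (\<Sum>j. ennreal (unit_ball_vol DIM('a) * c * (2 powr (- \<sigma>)) ^ j))"
  proof (intro suminf_le summableI)
    fix j
    have "ennreal (m j) * emeasure lborel (ball (0::'a) (r j))
       = ennreal (unit_ball_vol DIM('a) * (m j * r j ^ DIM('a)))"
      using r m by (simp add: emeasure_ball mult.left_commute flip: ennreal_mult')
    also have "\<dots> \<le> ennreal (unit_ball_vol DIM('a) * c * (2 powr (- \<sigma>)) ^ j)"
      using m(2)[of j] unfolding mult.assoc by (intro ennreal_leI mult_left_mono) auto
    finally show "ennreal (m j) * emeasure lborel (ball (0::'a) (r j)) \<le> \<dots>" .
  qed
  also have "\<dots> = ennreal (unit_ball_vol DIM('a) * c / (1 - 2 powr (- \<sigma>)))"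
    using q c by (intro suminf_geometric_ennreal) auto
  also have "\<dots> \<le> ennreal (unit_ball_vol DIM('a) * c * (2 * (1 + b) / \<sigma>))"
  proof (intro ennreal_leI)
    have "1 / (1 - 2 powr (- \<sigma>)) \<le> 2 * (1 + b) / \<sigma>"
      using \<sigma> by (intro order_trans[OF one_minus_two_powr(1)[OF \<sigma>(1)]] divide_right_mono) auto
    then have "unit_ball_vol DIM('a) * c * (1 / (1 - 2 powr (- \<sigma>))) \<le> unit_ball_vol DIM('a) * c * (2 * (1 + b) / \<sigma>)"
      using c by (intro mult_left_mono) auto
    then show "unit_ball_vol DIM('a) * c / (1 - 2 powr (- \<sigma>)) \<le> unit_ball_vol DIM('a) * c * (2 * (1 + b) / \<sigma>)"
      by simp
  qed
  finally show ?thesis .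
qed

lemma dyadic_scale:
  fixes x :: real
  assumes "1 \<le> x"
  obtains j :: nat where "2 ^ j \<le> x" "x < 2 ^ Suc j"
proof -
  obtain n where "x < 2 ^ n" using real_arch_pow[of 2 x] by auto
  define k where "k = (LEAST n. x < 2 ^ n)"
  have k: "x < 2 ^ k" unfolding k_def using \<open>x < 2 ^ n\<close> by (rule LeastI)
  then obtain j where j: "k = Suc j" using assms by (cases k) auto
  have "\<not> x < 2 ^ j" using not_less_Least[of j "\<lambda>n. x < 2 ^ n"] j k_def by auto
  then show ?thesis using that[of j] k j by (simp add: not_less)
qed

text \<open>Dyadic annuli take the place of polar coordinates: on the annulus from 2^j \<rho> to
  2^(j+1) \<rho> the kernel is at most its value at the inner radius, and the volume is that of the
  outer ball.\<close>

lemma nn_integral_krn_far: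
  fixes \<rho> :: real
  assumes \<sigma>: "0 < \<sigma>" "\<sigma> \<le> b" and \<rho>: "0 < \<rho>"
  shows "(\<integral>\<^sup>+z. ennreal (krn (real DIM('a) + \<sigma>) z) * indicator {z. \<rho> \<le> norm z} z \<partial>(lborel::'a::euclidean_space measure))
    \<le> ennreal (unit_ball_vol DIM('a) * 2 ^ DIM('a) * (2 * (1 + b)) / \<sigma> * \<rho> powr (- \<sigma>))"
proof -
  let ?N = "real DIM('a)"
  define F where "F z = krn (?N + \<sigma>) z * indicator {z. \<rho> \<le> norm z} z" for z :: 'a
  have "(\<integral>\<^sup>+z. ennreal (F z) \<partial>lborel)
     \<le> ennreal (unit_ball_vol DIM('a) * (2 ^ DIM('a) * \<rho> powr (- \<sigma>)) * (2 * (1 + b) / \<sigma>))"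
  proof (rule nn_integral_dyadic_le[where r = "\<lambda>j. 2 ^ Suc j * \<rho>" and m = "\<lambda>j. (2 ^ j * \<rho>) powr (- ?N - \<sigma>)"])
    fix z :: 'a
    show "F z = 0 \<or> (\<exists>j. F z \<le> (2 ^ j * \<rho>) powr (- ?N - \<sigma>) \<and> z \<in> ball 0 (2 ^ Suc j * \<rho>))"
    proof (cases "\<rho> \<le> norm z")
      case True
      then obtain j where j: "2 ^ j \<le> norm z / \<rho>" "norm z / \<rho> < 2 ^ Suc j"
        using dyadic_scale[of "norm z / \<rho>"] \<rho> by auto
      have "F z = norm z powr (- ?N - \<sigma>)" using True
        by (simp add: F_def krn_def powr_minus_divide[symmetric])
      also have "\<dots> \<le> (2 ^ j * \<rho>) powr (- ?N - \<sigma>)"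
        using j \<rho> \<sigma> by (intro powr_mono2') (auto simp: field_simps)
      finally show ?thesis using j \<rho> by (auto simp: field_simps)
    qed (simp add: F_def)
  next
    fix j
    have "(2 ^ j * \<rho>) powr (- ?N - \<sigma>) * (2 ^ Suc j * \<rho>) ^ DIM('a)
      = (2 ^ j * \<rho>) powr (- ?N - \<sigma>) * (2 ^ DIM('a) * (2 ^ j * \<rho>) ^ DIM('a))"
      by (simp add: power_mult_distrib)
    also have "\<dots> = 2 ^ DIM('a) * (2 ^ j * \<rho>) powr (- \<sigma>)"
      using \<rho> by (simp add: powr_diff powr_minus powr_realpow field_simps)
    also have "(2 ^ j * \<rho>) powr (- \<sigma>) = \<rho> powr (- \<sigma>) * (2 powr (- \<sigma>)) ^ j"
      using \<rho> by (simp add: powr_mult powr_powr mult.commute flip: powr_realpow)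
    finally show "(2 ^ j * \<rho>) powr (- ?N - \<sigma>) * (2 ^ Suc j * \<rho>) ^ DIM('a)
      \<le> 2 ^ DIM('a) * \<rho> powr (- \<sigma>) * (2 powr (- \<sigma>)) ^ j" by simp
  qed (use \<rho> \<sigma> in auto)
  then show ?thesis by (simp add: F_def ennreal_mult'' ennreal_indicator mult_ac)
qed

lemma nn_integral_norm_powr_near:
  fixes \<rho> :: real
  assumes \<sigma>: "0 < \<sigma>" "\<sigma> \<le> b" and \<rho>: "0 < \<rho>"
  shows "(\<integral>\<^sup>+z. ennreal (norm z powr (\<sigma> - real DIM('a))) * indicator (ball 0 \<rho>) z \<partial>(lborel::'a::euclidean_space measure))
    \<le> ennreal (unit_ball_vol DIM('a) * 2 ^ DIM('a) * (2 * (1 + b)) / \<sigma> * \<rho> powr \<sigma>)"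
proof -
  let ?N = "real DIM('a)"
  define F where "F z = norm z powr (\<sigma> - ?N) * indicator (ball 0 \<rho>) z" for z :: 'a
  have "(\<integral>\<^sup>+z. ennreal (F z) \<partial>lborel)
     \<le> ennreal (unit_ball_vol DIM('a) * (2 ^ DIM('a) * \<rho> powr \<sigma>) * (2 * (1 + b) / \<sigma>))"
  proof (rule nn_integral_dyadic_le[where r = "\<lambda>j. \<rho> / 2 ^ j" and m = "\<lambda>j. 2 ^ DIM('a) * (\<rho> / 2 ^ j) powr (\<sigma> - ?N)"])
    fix z :: 'a
    show "F z = 0 \<or> (\<exists>j. F z \<le> 2 ^ DIM('a) * (\<rho> / 2 ^ j) powr (\<sigma> - ?N) \<and> z \<in> ball 0 (\<rho> / 2 ^ j))"
    proof (cases "z \<in> ball 0 \<rho> \<and> z \<noteq> 0")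
      case True
      then have z: "0 < norm z" "norm z < \<rho>" by auto
      then obtain j where j: "2 ^ j \<le> \<rho> / norm z" "\<rho> / norm z < 2 ^ Suc j"
        using dyadic_scale[of "\<rho> / norm z"] by auto
      show ?thesis
      proof (cases "norm z = \<rho> / 2 ^ j")
        case False
        then have lt: "norm z < \<rho> / 2 ^ j" using j z by (simp add: field_simps)
        \<comment> \<open>The exponent \<sigma> - N may have either sign. So |z|^\<sigma> is bounded
          at the outer radius of the annulus and |z|^(-N) at the inner one, which costs the factor
          2^N in \<open>m\<close>.\<close>
        have "F z = norm z powr \<sigma> * norm z powr (- ?N)" using True
          by (simp add: F_def flip: powr_add)
        also have "\<dots> \<le> (\<rho> / 2 ^ j) powr \<sigma> * (\<rho> / 2 ^ j / 2) powr (- ?N)"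
          using j z lt \<sigma> by (intro mult_mono powr_mono2 powr_mono2') (auto simp: field_simps)
        also have "(\<rho> / 2 ^ j / 2) powr (- ?N) = (\<rho> / 2 ^ j) powr (- ?N) * 2 ^ DIM('a)"
          using \<rho> by (simp add: powr_divide powr_minus powr_realpow field_simps)
        also have "(\<rho> / 2 ^ j) powr \<sigma> * ((\<rho> / 2 ^ j) powr (- ?N) * 2 ^ DIM('a)) = 2 ^ DIM('a) * (\<rho> / 2 ^ j) powr (\<sigma> - ?N)"
          using \<rho> by (simp add: powr_diff powr_minus field_simps)
        finally show ?thesis using lt by (intro disjI2 exI[of _ j]) auto
      next
        \<comment> \<open>The balls are open, so a point exactly at the outer radius is assigned to
          the previous scale. That scale exists because |z| < \<rho> excludes j = 0.\<close>
        case True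
        then have jp: "j \<noteq> 0" using z by (intro notI) auto
        then obtain i where i: "j = Suc i" by (cases j) auto
        have lt: "norm z < \<rho> / 2 ^ i" using True i \<rho> by (simp add: field_simps)
        have "F z = norm z powr \<sigma> * norm z powr (- ?N)" using z
          by (simp add: F_def flip: powr_add)
        also have "\<dots> \<le> (\<rho> / 2 ^ i) powr \<sigma> * (\<rho> / 2 ^ i / 2) powr (- ?N)"
          using True z lt \<sigma> i by (intro mult_mono powr_mono2 powr_mono2') (auto simp: field_simps)
        also have "(\<rho> / 2 ^ i / 2) powr (- ?N) = (\<rho> / 2 ^ i) powr (- ?N) * 2 ^ DIM('a)"
          using \<rho> by (simp add: powr_divide powr_minus powr_realpow field_simps)
        also have "(\<rho> / 2 ^ i) powr \<sigma> * ((\<rho> / 2 ^ i) powr (- ?N) * 2 ^ DIM('a)) = 2 ^ DIM('a) * (\<rho> / 2 ^ i) powr (\<sigma> - ?N)"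
          using \<rho> by (simp add: powr_diff powr_minus field_simps)
        finally show ?thesis using lt by (intro disjI2 exI[of _ i]) auto
      qed
    qed (auto simp: F_def)
  next
    fix j
    have "2 ^ DIM('a) * (\<rho> / 2 ^ j) powr (\<sigma> - ?N) * (\<rho> / 2 ^ j) ^ DIM('a) = 2 ^ DIM('a) * (\<rho> / 2 ^ j) powr \<sigma>"
      using \<rho> by (simp add: powr_diff powr_realpow)
    also have "(\<rho> / 2 ^ j) powr \<sigma> = \<rho> powr \<sigma> * (2 powr (- \<sigma>)) ^ j"
      using \<rho> by (simp add: powr_divide powr_powr powr_minus field_simps flip: powr_realpow)
    finally show "2 ^ DIM('a) * (\<rho> / 2 ^ j) powr (\<sigma> - ?N) * (\<rho> / 2 ^ j) ^ DIM('a)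
      \<le> 2 ^ DIM('a) * \<rho> powr \<sigma> * (2 powr (- \<sigma>)) ^ j" by simp
  qed (use \<rho> \<sigma> in auto)
  then show ?thesis by (simp add: F_def ennreal_mult'' ennreal_indicator mult_ac)
qed

subsection \<open>Finite differences\<close>

lemma Lpow_mono_set: "E \<subseteq> F \<Longrightarrow> Lpow q E v \<le> Lpow q F v"
  unfolding Lpow_def by (intro nn_integral_mono) (auto simp: indicator_def)

lemma Lpow_cmult:
  fixes v :: "'a::euclidean_space \<Rightarrow> real"
  assumes [measurable]: "v \<in> borel_measurable borel" "E \<in> sets borel"
  shows "Lpow q E (\<lambda>x. a * v x) = ennreal (\<bar>a\<bar> powr q) * Lpow q E v"
  unfolding Lpow_def by (subst nn_integral_cmult[symmetric])
    (auto simp: abs_mult powr_mult ennreal_mult mult.assoc)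

lemma Lpow_add_le:
  fixes v w :: "'a::euclidean_space \<Rightarrow> real"
  assumes [measurable]: "v \<in> borel_measurable borel" "w \<in> borel_measurable borel" "E \<in> sets borel"
    and q: "1 \<le> q"
  shows "Lpow q E (\<lambda>x. v x + w x) \<le> ennreal (2 powr (q - 1)) * (Lpow q E v + Lpow q E w)"
proof -
  have "Lpow q E (\<lambda>x. v x + w x)
    \<le> (\<integral>\<^sup>+x. ennreal (2 powr (q - 1)) * (ennreal (\<bar>v x\<bar> powr q) * indicator E x + ennreal (\<bar>w x\<bar> powr q) * indicator E x) \<partial>lborel)"
    unfolding Lpow_def
    using abs_add_powr_le[OF q]
    by (intro nn_integral_mono)
       (auto simp: indicator_def ennreal_mult[symmetric] ennreal_plus[symmetric] simp del: ennreal_plus)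
  also have "\<dots> = ennreal (2 powr (q - 1)) * (Lpow q E v + Lpow q E w)"
    unfolding Lpow_def by (simp add: nn_integral_cmult nn_integral_add)
  finally show ?thesis .
qed

lemma Lpow_shift_le:
  fixes v :: "'a::euclidean_space \<Rightarrow> real"
  assumes [measurable]: "v \<in> borel_measurable borel" and "r + norm h \<le> r'"
  shows "Lpow q (ball c r) (\<lambda>x. v (x + h)) \<le> Lpow q (ball c r') v"
proof -
  have "x + h \<in> ball c r'" if "x \<in> ball c r" for x
  proof -
    have "dist c (x + h) \<le> dist c x + norm h" by norm
    then show ?thesis using that assms(2) by auto
  qed
  then have "Lpow q (ball c r) (\<lambda>x. v (x + h))
      \<le> (\<integral>\<^sup>+x. ennreal (\<bar>v (x + h)\<bar> powr q) * indicator (ball c r') (x + h) \<partial>lborel)"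
    unfolding Lpow_def by (intro nn_integral_mono) (auto simp: indicator_def)
  also have "\<dots> = Lpow q (ball c r') v"
    unfolding Lpow_def by (rule nn_integral_lborel_plus) measurable
  finally show ?thesis .
qed

lemma Lpow_dlt_halve:
  fixes v :: "'a::euclidean_space \<Rightarrow> real"
  assumes [measurable]: "v \<in> borel_measurable borel" and q: "1 \<le> q"
  shows "Lpow q (ball c r) (dlt k v) \<le> ennreal (2 powr q) * Lpow q (ball c (r + norm k / 2)) (dlt (k /\<^sub>R 2) v)"
proof -
  have e: "dlt k v = (\<lambda>x. dlt (k /\<^sub>R 2) v (x + k /\<^sub>R 2) + dlt (k /\<^sub>R 2) v x)"
  proof
    fix x
    have "k /\<^sub>R 2 + k /\<^sub>R 2 = k" by (metis scaleR_half_double scaleR_right_distrib inverse_eq_divide)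
    then show "dlt k v x = dlt (k /\<^sub>R 2) v (x + k /\<^sub>R 2) + dlt (k /\<^sub>R 2) v x"
      by (simp add: dlt_def add.assoc)
  qed
  have "Lpow q (ball c r) (dlt k v) \<le> ennreal (2 powr (q - 1)) *
    (Lpow q (ball c r) (\<lambda>x. dlt (k /\<^sub>R 2) v (x + k /\<^sub>R 2)) + Lpow q (ball c r) (dlt (k /\<^sub>R 2) v))"
    by (subst e, rule Lpow_add_le) (use q in measurable)
  also have "\<dots> \<le> ennreal (2 powr (q - 1)) *
    (Lpow q (ball c (r + norm k / 2)) (dlt (k /\<^sub>R 2) v) + Lpow q (ball c (r + norm k / 2)) (dlt (k /\<^sub>R 2) v))"
    by (intro mult_left_mono add_mono Lpow_shift_le Lpow_mono_set subset_ball) auto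
  also have "\<dots> = ennreal (2 powr (q - 1) * 2) * Lpow q (ball c (r + norm k / 2)) (dlt (k /\<^sub>R 2) v)"
    by (simp add: ennreal_mult mult_2[symmetric] mult.assoc[symmetric])
  finally show ?thesis by (simp add: powr_diff)
qed

text \<open>Halving the step j times enlarges the radius by |k|/2 + |k|/4 + ..., which stays below
  |k| for every j.\<close>

lemma Lpow_dlt_dyadic:
  fixes v :: "'a::euclidean_space \<Rightarrow> real"
  assumes [measurable]: "v \<in> borel_measurable borel" and q: "1 \<le> q"
  shows "Lpow q (ball c r) (dlt k v) \<le> ennreal ((2 powr q) ^ j) * Lpow q (ball c (r + norm k)) (dlt (k /\<^sub>R 2 ^ j) v)"
proof (induction j arbitrary: k r)
  case 0
  show ?case by (simp add: Lpow_mono_set subset_ball)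
next
  case (Suc j)
  have "Lpow q (ball c r) (dlt k v) \<le> ennreal (2 powr q) * Lpow q (ball c (r + norm k / 2)) (dlt (k /\<^sub>R 2) v)"
    by (rule Lpow_dlt_halve[OF assms])
  also have "\<dots> \<le> ennreal (2 powr q) * (ennreal ((2 powr q) ^ j) *
      Lpow q (ball c (r + norm k / 2 + norm (k /\<^sub>R 2))) (dlt (k /\<^sub>R 2 /\<^sub>R 2 ^ j) v))"
    by (intro mult_left_mono Suc.IH) auto
  also have "r + norm k / 2 + norm (k /\<^sub>R 2) = r + norm k" by simp
  finally show ?case by (simp add: ennreal_mult mult.assoc)
qed

lemma ennreal_mult_cancel:
  assumes "a * (b * c) = 1" "0 \<le> b" "0 \<le> c"
  shows "ennreal a * (ennreal b * (ennreal c * X)) = X"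
  using assms by (simp add: mult.assoc[symmetric] ennreal_mult''[symmetric])

lemma half_reflect:
  fixes y z :: "'a::real_vector"
  shows "y /\<^sub>R 2 - (y - z) = - (y /\<^sub>R 2 - z)"
proof -
  have y: "y = y /\<^sub>R 2 + y /\<^sub>R 2" by (metis scaleR_half_double scaleR_right_distrib inverse_eq_divide)
  define h where "h = y /\<^sub>R 2"
  have "h - (h + h - z) = - (h - z)" by simp
  then show ?thesis using y unfolding h_def by metis
qed

lemma norm_bounds_near_half:
  fixes y z :: "'a::real_normed_vector"
  assumes "norm y = e / 2" "norm (y - z) < e / 6"
  shows "e / 3 < norm z" "norm z < 2 / 3 * e"
  using assms norm_triangle_sub[of y z] norm_triangle_sub[of z y] norm_minus_commute[of y z] by linarith+

text \<open>The factor \<open>1 - s\<close> is gained by using every dyadic scale \<open>k / 2 ^ j\<close>: averaging over the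
  pairwise disjoint balls \<open>S j\<close>, each scale contributes a lower bound of comparable size.\<close>

lemma nikolskii:
  fixes v :: "'a::euclidean_space \<Rightarrow> real"
  assumes v[measurable]: "v \<in> borel_measurable borel" and q: "1 \<le> q" and s: "0 < s" "s < 1"
    and r': "r + 3 * norm k \<le> r'"
  shows "Lpow q (ball c r) (dlt k v)
    \<le> ennreal (2 powr q * 6 ^ DIM('a) * q / unit_ball_vol DIM('a) * (1 - s) * norm k powr (s * q))
      * Wpow s q (ball c r') v"
proof (cases "k = 0")
  case True
  then have "Lpow q (ball c r) (dlt k v) = 0" using q by (simp add: Lpow_def dlt_def)
  then show ?thesis by simp
next
  case k: False
  let ?N = "real DIM('a)"
  let ?\<omega> = "unit_ball_vol ?N"
  define K where "K = norm k"
  have K: "K > 0" using k by (simp add: K_def)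
  define G where "G z = Lpow q (ball c (r + 2 * K)) (dlt z v)" for z
  have G[measurable]: "G \<in> borel_measurable borel"
    unfolding G_def Lpow_def dlt_def by measurable
  \<comment> \<open>The centre is the midpoint of k / 2^j and the radius is a sixth of its length.
    Hence |z| lies between 1/3 and 2/3 of |k| / 2^j, which makes the balls disjoint, and each ball
    is invariant under z \<mapsto> k / 2^j - z.\<close>
  define S where "S j = ball (k /\<^sub>R 2 ^ j /\<^sub>R 2) (K / 2 ^ j / 6)" for j :: nat
  have [measurable]: "S j \<in> sets borel" for j by (simp add: S_def)
  define L where "L = Lpow q (ball c r) (dlt k v)"
  define c0 where "c0 = ?\<omega> / (6 ^ DIM('a) * 2 powr q)"
  have c0: "c0 > 0" by (simp add: c0_def)
  define I where "I j = (\<integral>\<^sup>+z. (G z * ennreal (krn (?N + s * q) z)) * indicator (S j) z \<partial>lborel)" for j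
  \<comment> \<open>Ratio between consecutive scales: the loss 2^q of each halving of the step
    against the gain 2^(-sq) of the kernel leaves 2^(-q(1-s)). Summing its powers produces the
    factor 1 / (1 - s) on the left, that is, the gain.\<close>
  define x where "x = 2 powr (- (q * (1 - s)))"
  have x: "0 \<le> x" "x < 1" using one_minus_two_powr(2)[of "q * (1 - s)"] q s by (auto simp: x_def)
  define e where "e j = K / 2 ^ j" for j :: nat
  have e: "0 < e j" "e j \<le> K" for j using K by (auto simp: e_def field_simps)
  have SK: "e j / 3 < norm z \<and> norm z < 2 / 3 * e j" if "z \<in> S j" for z j
  proof -
    have "norm (k /\<^sub>R 2 ^ j /\<^sub>R 2) = K / 2 ^ j / 2"
      unfolding norm_scaleR by (simp add: K_def field_simps)
    moreover have "norm (k /\<^sub>R 2 ^ j /\<^sub>R 2 - z) < K / 2 ^ j / 6" using that by (simp add: S_def dist_norm)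
    ultimately show ?thesis unfolding e_def using norm_bounds_near_half by blast
  qed
  have disj: "disjoint_family S"
  proof -
    have "S i \<inter> S j = {}" if "i < j" for i j
    proof (rule ccontr)
      assume "S i \<inter> S j \<noteq> {}"
      then obtain z where z: "z \<in> S i" "z \<in> S j" by auto
      have "(2::real) * 2 ^ i \<le> 2 ^ j" using power_increasing[of "Suc i" j "2::real"] that by simp
      then have "2 * e j \<le> e i" using K by (simp add: e_def field_simps)
      then show False using SK[OF z(1)] SK[OF z(2)] e(1)[of j] by linarith
    qed
    then show ?thesis unfolding disjoint_family_on_def by (metis Int_commute linorder_neqE_nat)
  qed
  have main: "ennreal (c0 * K powr (- (s * q)) * x ^ j) * L \<le> I j" for j
  proof -
    define k' where "k' = k /\<^sub>R 2 ^ j"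
    have nk': "norm k' = K / 2 ^ j" unfolding k'_def norm_scaleR by (simp add: K_def field_simps)
    have nk'pos: "norm k' > 0" using K by (simp add: nk')
    have nk'K: "norm k' \<le> K" using K by (simp add: nk' field_simps)
    define M where "M = Lpow q (ball c (r + K)) (dlt k' v)"
    have LM: "L \<le> ennreal ((2 powr q) ^ j) * M"
      unfolding L_def M_def k'_def K_def by (rule Lpow_dlt_dyadic[OF v q])
    \<comment> \<open>A step k' is split as z followed by k' - z. After averaging over
      \<open>S j\<close> both terms contribute equally, by the reflection z \<mapsto> k' -
      z.\<close>
    have b: "M \<le> ennreal (2 powr (q - 1)) * (G z + G (k' - z))" if "z \<in> S j" for z
    proof -
      have zK: "norm z \<le> K" using SK[OF that] e[of j] by linarith
      have dlt_eq: "dlt k' v = (\<lambda>x. dlt z v x + dlt (k' - z) v (x + z))"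
        by (auto simp: dlt_def)
      have "M \<le> ennreal (2 powr (q - 1)) * (Lpow q (ball c (r + K)) (dlt z v) + Lpow q (ball c (r + K)) (\<lambda>x. dlt (k' - z) v (x + z)))"
        unfolding M_def by (subst dlt_eq, rule Lpow_add_le) (use q in measurable)
      also have "\<dots> \<le> ennreal (2 powr (q - 1)) * (G z + G (k' - z))"
        unfolding G_def
      proof (intro mult_left_mono add_mono)
        show "Lpow q (ball c (r + K)) (dlt z v) \<le> Lpow q (ball c (r + 2 * K)) (dlt z v)"
          using K by (intro Lpow_mono_set subset_ball) simp
        show "Lpow q (ball c (r + K)) (\<lambda>x. dlt (k' - z) v (x + z)) \<le> Lpow q (ball c (r + 2 * K)) (dlt (k' - z) v)"
          using zK by (intro Lpow_shift_le) auto
      qed simp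
      finally show ?thesis .
    qed
    have refl: "k' - z \<in> S j \<longleftrightarrow> z \<in> S j" for z
    proof -
      have "norm (k' /\<^sub>R 2 - (k' - z)) = norm (k' /\<^sub>R 2 - z)"
        by (simp only: half_reflect norm_minus_cancel)
      then show ?thesis by (simp add: S_def dist_norm k'_def[symmetric])
    qed
    have "M * ennreal (?\<omega> * (norm k' / 6) ^ DIM('a)) = (\<integral>\<^sup>+z. M * indicator (S j) z \<partial>lborel)"
      using K by (subst nn_integral_cmult_indicator) (auto simp: S_def nk' emeasure_ball)
    also have "\<dots> \<le> (\<integral>\<^sup>+z. ennreal (2 powr (q - 1)) * (G z * indicator (S j) z + G (k' - z) * indicator (S j) (k' - z)) \<partial>lborel)"
      by (intro nn_integral_mono) (use b refl in \<open>auto simp: indicator_def\<close>)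
    also have "\<dots> = ennreal (2 powr (q - 1)) * ((\<integral>\<^sup>+z. G z * indicator (S j) z \<partial>lborel) + (\<integral>\<^sup>+z. G (k' - z) * indicator (S j) (k' - z) \<partial>lborel))"
      by (simp add: nn_integral_cmult nn_integral_add)
    also have "(\<integral>\<^sup>+z. G (k' - z) * indicator (S j) (k' - z) \<partial>lborel) = (\<integral>\<^sup>+z. G z * indicator (S j) z \<partial>lborel)"
      by (rule nn_integral_lborel_reflect) measurable
    also have "ennreal (2 powr (q - 1)) * ((\<integral>\<^sup>+z. G z * indicator (S j) z \<partial>lborel) + (\<integral>\<^sup>+z. G z * indicator (S j) z \<partial>lborel))
      = ennreal (2 powr q) * (\<integral>\<^sup>+z. G z * indicator (S j) z \<partial>lborel)"
      by (simp add: powr_diff mult_2[symmetric] mult.assoc[symmetric] ennreal_mult''[symmetric] flip: ennreal_numeral)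
    also have "\<dots> \<le> ennreal (2 powr q) * (\<integral>\<^sup>+z. ennreal (norm k' powr (?N + s * q)) * (G z * ennreal (krn (?N + s * q) z) * indicator (S j) z) \<partial>lborel)"
    proof (intro mult_left_mono nn_integral_mono)
      fix z
      show "G z * indicator (S j) z \<le> ennreal (norm k' powr (?N + s * q)) * (G z * ennreal (krn (?N + s * q) z) * indicator (S j) z)"
      proof (cases "z \<in> S j")
        case True
        have z: "0 < norm z" "norm z \<le> norm k'"
          using SK[OF True] e(1)[of j] nk' by (auto simp: e_def)
        then have "1 \<le> norm k' powr (?N + s * q) * krn (?N + s * q) z"
          using q s by (simp add: krn_def le_divide_eq_1 powr_mono2)
        then have "1 \<le> ennreal (norm k' powr (?N + s * q)) * ennreal (krn (?N + s * q) z)"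
          by (simp add: ennreal_mult[symmetric])
        then have "G z * 1 \<le> G z * (ennreal (norm k' powr (?N + s * q)) * ennreal (krn (?N + s * q) z))"
          by (intro mult_left_mono) auto
        then show ?thesis using True by (simp add: mult_ac)
      qed simp
    qed simp
    also have "\<dots> = ennreal (2 powr q) * (ennreal (norm k' powr (?N + s * q)) * I j)"
      unfolding I_def by (simp add: nn_integral_cmult)
    finally have h: "M * ennreal (?\<omega> * (norm k' / 6) ^ DIM('a)) \<le> ennreal (2 powr q) * (ennreal (norm k' powr (?N + s * q)) * I j)" .
    have eq1: "c0 * K powr (- (s * q)) * x ^ j * (2 powr q) ^ j
      = (1 / (2 powr q * norm k' powr (?N + s * q))) * (?\<omega> * (norm k' / 6) ^ DIM('a))"
    proof -
      have "x ^ j * (2 powr q) ^ j = (2 ^ j) powr (s * q)"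
        unfolding x_def by (simp add: algebra_simps powr_powr powr_add[symmetric] powr_realpow[symmetric])
      moreover have "norm k' powr (?N + s * q) = norm k' ^ DIM('a) * norm k' powr (s * q)"
        using nk'pos by (simp add: powr_add powr_realpow)
      moreover have "norm k' powr (s * q) = K powr (s * q) / (2 ^ j) powr (s * q)"
        using K by (simp add: nk' powr_divide)
      ultimately show ?thesis using K nk'pos
        by (simp add: c0_def powr_minus field_simps power_divide) (metis mult.left_commute)
    qed
    have "ennreal (c0 * K powr (- (s * q)) * x ^ j) * L
      \<le> ennreal (c0 * K powr (- (s * q)) * x ^ j) * (ennreal ((2 powr q) ^ j) * M)"
      by (intro mult_left_mono LM) auto
    also have "\<dots> = ennreal (1 / (2 powr q * norm k' powr (?N + s * q))) * (M * ennreal (?\<omega> * (norm k' / 6) ^ DIM('a)))"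
      using eq1 c0 x by (simp add: mult.assoc[symmetric] ennreal_mult''[symmetric] mult.commute[of M])
    also have "\<dots> \<le> ennreal (1 / (2 powr q * norm k' powr (?N + s * q))) * (ennreal (2 powr q) * (ennreal (norm k' powr (?N + s * q)) * I j))"
      by (intro mult_left_mono h) auto
    also have "\<dots> = I j"
      using nk'pos by (intro ennreal_mult_cancel) auto
    finally show ?thesis .
  qed
  \<comment> \<open>By disjointness the lower bounds of all scales are paid for by one and the same
    seminorm.\<close>
  have sumI: "(\<Sum>j. I j) \<le> Wpow s q (ball c r') v"
  proof -
    have "(\<Sum>j. I j) = (\<integral>\<^sup>+z. (G z * ennreal (krn (?N + s * q) z)) * indicator (\<Union>j. S j) z \<partial>lborel)"
      unfolding I_def by (rule nn_integral_disjoint_family[symmetric]) (use disj in auto)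
    also have "\<dots> \<le> (\<integral>\<^sup>+z. \<integral>\<^sup>+x. ennreal (\<bar>v x - v (x + z)\<bar> powr q * krn (?N + s * q) (x - (x + z)))
      * (indicator (ball c r') x * indicator (ball c r') (x + z)) \<partial>lborel \<partial>lborel)"
    proof (intro nn_integral_mono)
      fix z
      show "(G z * ennreal (krn (?N + s * q) z)) * indicator (\<Union>j. S j) z
        \<le> (\<integral>\<^sup>+x. ennreal (\<bar>v x - v (x + z)\<bar> powr q * krn (?N + s * q) (x - (x + z)))
      * (indicator (ball c r') x * indicator (ball c r') (x + z)) \<partial>lborel)"
      proof (cases "z \<in> (\<Union>j. S j)")
        case True
        then obtain j where j: "z \<in> S j" by auto
        have zK: "norm z \<le> K" using SK[OF j] e[of j] by linarith
        have "G z * ennreal (krn (?N + s * q) z) = (\<integral>\<^sup>+x. ennreal (krn (?N + s * q) z) * (ennreal (\<bar>dlt z v x\<bar> powr q) * indicator (ball c (r + 2 * K)) x) \<partial>lborel)"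
          unfolding G_def Lpow_def by (subst nn_integral_cmult) (auto simp: mult.commute)
        also have "\<dots> \<le> (\<integral>\<^sup>+x. ennreal (\<bar>v x - v (x + z)\<bar> powr q * krn (?N + s * q) (x - (x + z)))
      * (indicator (ball c r') x * indicator (ball c r') (x + z)) \<partial>lborel)"
        proof (intro nn_integral_mono)
          fix x
          have "x + z \<in> ball c r'" "x \<in> ball c r'" if "x \<in> ball c (r + 2 * K)"
          proof -
            have "dist c (x + z) \<le> dist c x + norm z" by norm
            then show "x + z \<in> ball c r'" using that r' zK by (auto simp: K_def)
            have "r + 3 * K \<le> r'" using r' by (simp add: K_def)
            then show "x \<in> ball c r'" using that K by auto
          qed
          then show "ennreal (krn (?N + s * q) z) * (ennreal (\<bar>dlt z v x\<bar> powr q) * indicator (ball c (r + 2 * K)) x)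
            \<le> ennreal (\<bar>v x - v (x + z)\<bar> powr q * krn (?N + s * q) (x - (x + z)))
              * (indicator (ball c r') x * indicator (ball c r') (x + z))"
            by (auto simp: indicator_def dlt_def abs_minus_commute ennreal_mult mult.commute)
        qed
        finally show ?thesis using True by simp
      qed simp
    qed
    also have "\<dots> = Wpow s q (ball c r') v"
      unfolding Wpow_def by (rule dint_diff_var[symmetric]) measurable
    finally show ?thesis .
  qed
  have "ennreal (c0 * K powr (- (s * q)) / (q * (1 - s))) * L \<le> ennreal (c0 * K powr (- (s * q)) / (1 - x)) * L"
  proof (intro mult_right_mono ennreal_leI)
    have "1 / (q * (1 - s)) \<le> 1 / (1 - x)" unfolding x_def
      using one_minus_two_powr_upper[of "q * (1 - s)"] q s by simp
    then have "c0 * K powr (- (s * q)) * (1 / (q * (1 - s))) \<le> c0 * K powr (- (s * q)) * (1 / (1 - x))"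
      using c0 by (intro mult_left_mono) auto
    then show "c0 * K powr (- (s * q)) / (q * (1 - s)) \<le> c0 * K powr (- (s * q)) / (1 - x)" by simp
  qed simp
  also have "ennreal (c0 * K powr (- (s * q)) / (1 - x)) = (\<Sum>j. ennreal (c0 * K powr (- (s * q)) * x ^ j))"
    using c0 x by (intro suminf_geometric_ennreal[symmetric]) auto
  also have "(\<Sum>j. ennreal (c0 * K powr (- (s * q)) * x ^ j)) * L = (\<Sum>j. ennreal (c0 * K powr (- (s * q)) * x ^ j) * L)"
    by simp
  also have "\<dots> \<le> (\<Sum>j. I j)" by (intro suminf_le main summableI)
  also note sumI
  finally have fin: "ennreal (c0 * K powr (- (s * q)) / (q * (1 - s))) * L \<le> Wpow s q (ball c r') v" .
  define a where "a = c0 * K powr (- (s * q)) / (q * (1 - s))"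
  have a: "a > 0" using c0 K q s by (simp add: a_def)
  have "L = ennreal (1 / a) * (ennreal a * L)" using a by (simp add: mult.assoc[symmetric] ennreal_mult[symmetric])
  also have "\<dots> \<le> ennreal (1 / a) * Wpow s q (ball c r') v"
    using fin by (intro mult_left_mono) (auto simp: a_def)
  also have "1 / a = 2 powr q * 6 ^ DIM('a) * q / ?\<omega> * (1 - s) * norm k powr (s * q)"
    using K q s by (simp add: a_def c0_def K_def powr_minus field_simps)
  finally show ?thesis by (simp add: L_def)
qed

section \<open>Telescoping of dyadic second differences\<close>

lemma dyadic_half: "(v::'a::real_vector) /\<^sub>R 2 ^ Suc j + v /\<^sub>R 2 ^ Suc j = v /\<^sub>R 2 ^ j"
proof -
  have "v /\<^sub>R 2 ^ Suc j = (v /\<^sub>R 2 ^ j) /\<^sub>R 2" by simp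
  then show ?thesis by (metis scaleR_half_double scaleR_right_distrib inverse_eq_divide)
qed

lemma dlt_dlt_self: "dlt h (dlt h U) x = dlt (h + h) U x - 2 * dlt h U x"
  by (simp add: dlt_def add.assoc)

lemma dlt_commute: "dlt h (dlt k U) = dlt k (dlt h U)"
  by (auto simp: dlt_def algebra_simps)

lemma dlt_telescope:
  "2 ^ n * dlt (v /\<^sub>R 2 ^ n) U x
    = dlt v U x - (\<Sum>j<n. 2 ^ j * dlt (v /\<^sub>R 2 ^ Suc j) (dlt (v /\<^sub>R 2 ^ Suc j) U) x)"
proof (induction n)
  case (Suc n)
  have "2 ^ n * dlt (v /\<^sub>R 2 ^ Suc n) (dlt (v /\<^sub>R 2 ^ Suc n) U) x
    = 2 ^ n * dlt (v /\<^sub>R 2 ^ n) U x - 2 ^ Suc n * dlt (v /\<^sub>R 2 ^ Suc n) U x"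
    unfolding dlt_dlt_self dyadic_half by (simp add: algebra_simps)
  then show ?case using Suc unfolding sum.lessThan_Suc by linarith
qed simp

text \<open>The reason for the Jensen weights \<open>q ^ j\<close>: if the j-th second difference
  has p-th power 2^(-p \<sigma> j), then after multiplication by 2^j its weighted term is again
  \<open>q ^ j\<close>. Both factors of \<open>sum_powr_weighted\<close> are then the same geometric
  series.\<close>

lemma dyadic_weight:
  assumes "q = 2 powr (- (\<sigma> - 1))"
  shows "(q ^ j) powr (1 - p) * (2 ^ j) powr p * (2 powr (- (p * \<sigma>))) ^ j = (q::real) ^ j"
proof -
  have q: "q ^ j = 2 powr (- (\<sigma> - 1) * j)" by (simp add: assms powr_powr flip: powr_realpow)
  have 2: "(2::real) ^ j = 2 powr j" "(2 powr (- (p * \<sigma>))) ^ j = 2 powr (- (p * \<sigma>) * j)"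
    by (auto simp: powr_powr simp flip: powr_realpow)
  show ?thesis unfolding q 2 by (simp add: powr_powr powr_add[symmetric] algebra_simps)
qed

text \<open>Second differences of an order \<sigma> above 1 are summable against the factors 2^j of
  \<open>dlt_telescope\<close>, uniformly in n. The geometric sum is at most 4 / (\<sigma> - 1) and
  enters to the power p: p - 1 times through Jensen and once through the remaining sum.\<close>

lemma Lpow_telescope:
  fixes U :: "'a::euclidean_space \<Rightarrow> real"
  assumes U[measurable]: "U \<in> borel_measurable borel" and B[measurable]: "B \<in> sets borel"
    and p: "1 \<le> p" and \<sigma>: "1 < \<sigma>" "\<sigma> \<le> 2" and P: "0 \<le> P"
    and h0: "Lpow p B (dlt v U) \<le> ennreal P"
    and h: "\<And>j. Lpow p B (dlt (v /\<^sub>R 2 ^ Suc j) (dlt (v /\<^sub>R 2 ^ Suc j) U)) \<le> ennreal (P * (2 powr (- (p * \<sigma>))) ^ j)"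
  shows "Lpow p B (\<lambda>x. 2 ^ n * dlt (v /\<^sub>R 2 ^ n) U x) \<le> ennreal (2 powr p * (1 + 4 powr p) * P / (\<sigma> - 1) powr p)"
proof -
  define d where "d j = dlt (v /\<^sub>R 2 ^ Suc j) (dlt (v /\<^sub>R 2 ^ Suc j) U)" for j
  have [measurable]: "d j \<in> borel_measurable borel" for j unfolding d_def by measurable
  define q where "q = 2 powr (- (\<sigma> - 1))"
  have q: "0 < q" "q < 1" using one_minus_two_powr(2)[of "\<sigma> - 1"] \<sigma> by (auto simp: q_def)
  define T where "T = 4 / (\<sigma> - 1)"
  have T: "0 < T" using \<sigma> by (simp add: T_def)
  have sq: "(\<Sum>j<n. q ^ j) \<le> T"
  proof -
    have "(\<Sum>j<n. q ^ j) \<le> (\<Sum>j. q ^ j)" using q by (intro sum_le_suminf) (auto simp: summable_geometric)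
    also have "\<dots> = 1 / (1 - q)" using q by (simp add: suminf_geometric)
    also have "\<dots> \<le> 2 * (1 + (\<sigma> - 1)) / (\<sigma> - 1)"
      using one_minus_two_powr(1)[of "\<sigma> - 1"] \<sigma> by (simp add: q_def)
    also have "\<dots> \<le> T" unfolding T_def using \<sigma> by (intro divide_right_mono) auto
    finally show ?thesis .
  qed
  define w where "w j = (q ^ j) powr (1 - p) * (2 ^ j) powr p" for j :: nat
  have w0: "0 \<le> w j" for j by (simp add: w_def)
  have pt: "\<bar>2 ^ n * dlt (v /\<^sub>R 2 ^ n) U x\<bar> powr p
      \<le> 2 powr p * (\<bar>dlt v U x\<bar> powr p + T powr (p - 1) * (\<Sum>j<n. w j * \<bar>d j x\<bar> powr p))" for x
  proof -
    have "\<bar>2 ^ n * dlt (v /\<^sub>R 2 ^ n) U x\<bar> = \<bar>dlt v U x - (\<Sum>j<n. 2 ^ j * d j x)\<bar>"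
      unfolding dlt_telescope d_def by simp
    then have "\<bar>2 ^ n * dlt (v /\<^sub>R 2 ^ n) U x\<bar> powr p \<le> 2 powr p * (\<bar>dlt v U x\<bar> powr p + \<bar>\<Sum>j<n. 2 ^ j * d j x\<bar> powr p)"
      using abs_diff_powr_le[OF p] by simp
    also have "\<bar>\<Sum>j<n. 2 ^ j * d j x\<bar> powr p \<le> (\<Sum>j<n. 2 ^ j * \<bar>d j x\<bar>) powr p"
      using p by (intro powr_mono2 order_trans[OF sum_abs]) (auto simp: abs_mult)
    also have "\<dots> \<le> (\<Sum>j<n. q ^ j) powr (p - 1) * (\<Sum>j<n. (q ^ j) powr (1 - p) * (2 ^ j * \<bar>d j x\<bar>) powr p)"
      using q by (intro sum_powr_weighted p) auto
    also have "\<dots> \<le> T powr (p - 1) * (\<Sum>j<n. (q ^ j) powr (1 - p) * (2 ^ j * \<bar>d j x\<bar>) powr p)"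
      using q p sq by (intro mult_right_mono powr_mono2 sum_nonneg) auto
    also have "(\<Sum>j<n. (q ^ j) powr (1 - p) * (2 ^ j * \<bar>d j x\<bar>) powr p) = (\<Sum>j<n. w j * \<bar>d j x\<bar> powr p)"
      by (intro sum.cong) (auto simp: w_def powr_mult)
    finally show ?thesis by simp
  qed
  have "Lpow p B (\<lambda>x. 2 ^ n * dlt (v /\<^sub>R 2 ^ n) U x)
    \<le> (\<integral>\<^sup>+x. ennreal (2 powr p) * (ennreal (\<bar>dlt v U x\<bar> powr p) * indicator B x + ennreal (T powr (p - 1)) * (\<Sum>j<n. ennreal (w j) * (ennreal (\<bar>d j x\<bar> powr p) * indicator B x))) \<partial>lborel)"
    unfolding Lpow_def
  proof (intro nn_integral_mono)
    fix x
    show "ennreal (\<bar>2 ^ n * dlt (v /\<^sub>R 2 ^ n) U x\<bar> powr p) * indicator B x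
      \<le> ennreal (2 powr p) * (ennreal (\<bar>dlt v U x\<bar> powr p) * indicator B x + ennreal (T powr (p - 1)) * (\<Sum>j<n. ennreal (w j) * (ennreal (\<bar>d j x\<bar> powr p) * indicator B x)))"
    proof (cases "x \<in> B")
      case True
      have "ennreal (\<bar>2 ^ n * dlt (v /\<^sub>R 2 ^ n) U x\<bar> powr p) \<le> ennreal (2 powr p * (\<bar>dlt v U x\<bar> powr p + T powr (p - 1) * (\<Sum>j<n. w j * \<bar>d j x\<bar> powr p)))"
        by (rule ennreal_leI[OF pt])
      also have "\<dots> = ennreal (2 powr p) * (ennreal (\<bar>dlt v U x\<bar> powr p) + ennreal (T powr (p - 1)) * (\<Sum>j<n. ennreal (w j) * ennreal (\<bar>d j x\<bar> powr p)))"
        using w0 by (simp add: ennreal_mult ennreal_plus sum_nonneg flip: sum_ennreal)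
      finally show ?thesis using True by simp
    qed simp
  qed
  also have "\<dots> = ennreal (2 powr p) * (Lpow p B (dlt v U) + ennreal (T powr (p - 1)) * (\<Sum>j<n. ennreal (w j) * Lpow p B (d j)))"
    unfolding Lpow_def by (simp add: nn_integral_cmult nn_integral_add nn_integral_sum)
  also have "\<dots> \<le> ennreal (2 powr p) * (ennreal P + ennreal (T powr (p - 1)) * (\<Sum>j<n. ennreal (w j) * ennreal (P * (2 powr (- (p * \<sigma>))) ^ j)))"
    using h0 h unfolding d_def by (intro mult_left_mono add_mono sum_mono) auto
  also have "(\<Sum>j<n. ennreal (w j) * ennreal (P * (2 powr (- (p * \<sigma>))) ^ j)) = (\<Sum>j<n. ennreal (P * q ^ j))"
  proof (intro sum.cong refl)
    fix j
    have "w j * (P * (2 powr (- (p * \<sigma>))) ^ j) = P * (w j * (2 powr (- (p * \<sigma>))) ^ j)" by simp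
    also have "w j * (2 powr (- (p * \<sigma>))) ^ j = q ^ j" unfolding w_def by (rule dyadic_weight[OF q_def])
    finally have e: "w j * (P * (2 powr (- (p * \<sigma>))) ^ j) = P * q ^ j" .
    have "ennreal (w j) * ennreal (P * (2 powr (- (p * \<sigma>))) ^ j) = ennreal (w j * (P * (2 powr (- (p * \<sigma>))) ^ j))"
      using w0 P by (intro ennreal_mult[symmetric]) auto
    then show "ennreal (w j) * ennreal (P * (2 powr (- (p * \<sigma>))) ^ j) = ennreal (P * q ^ j)"
      by (simp only: e)
  qed
  also have "\<dots> = ennreal (P * (\<Sum>j<n. q ^ j))"
    using P q by (subst sum_ennreal) (auto simp: sum_distrib_left)
  also have "\<dots> \<le> ennreal (P * T)" using sq P by (intro ennreal_leI mult_left_mono)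
  also have "ennreal (2 powr p) * (ennreal P + ennreal (T powr (p - 1)) * ennreal (P * T))
      = ennreal (2 powr p * (P + T powr (p - 1) * (P * T)))"
    using P T by (simp add: ennreal_mult ennreal_plus)
  also have "\<dots> \<le> ennreal (2 powr p * (1 + 4 powr p) * P / (\<sigma> - 1) powr p)"
  proof (intro ennreal_leI)
    have "T powr (p - 1) * (P * T) = P * T powr p" using T by (simp add: powr_diff)
    also have "T powr p = 4 powr p / (\<sigma> - 1) powr p" using \<sigma> by (simp add: T_def powr_divide)
    finally have t: "T powr (p - 1) * (P * T) = P * (4 powr p / (\<sigma> - 1) powr p)" .
    \<comment> \<open>As \<sigma> \<le> 2, the plain term \<open>P\<close> can be put over the same
      denominator.\<close>
    have "(\<sigma> - 1) powr p \<le> 1" using \<sigma> p by (intro powr_le1) auto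
    then have "P \<le> P * (1 / (\<sigma> - 1) powr p)" using P \<sigma> mult_left_mono[of 1 "1 / (\<sigma> - 1) powr p" P] by (simp add: field_simps)
    moreover have "(1 + 4 powr p) * P / (\<sigma> - 1) powr p = P * (1 / (\<sigma> - 1) powr p) + P * (4 powr p / (\<sigma> - 1) powr p)"
      by (simp add: add_divide_distrib algebra_simps)
    ultimately have "P + P * (4 powr p / (\<sigma> - 1) powr p) \<le> (1 + 4 powr p) * P / (\<sigma> - 1) powr p"
      by linarith
    then have "2 powr p * (P + P * (4 powr p / (\<sigma> - 1) powr p)) \<le> 2 powr p * ((1 + 4 powr p) * P / (\<sigma> - 1) powr p)"
      by (intro mult_left_mono) auto
    then show "2 powr p * (P + T powr (p - 1) * (P * T)) \<le> 2 powr p * (1 + 4 powr p) * P / (\<sigma> - 1) powr p"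
      unfolding t by (simp add: mult.assoc)
  qed
  finally show ?thesis by (simp add: mult_left_mono add_left_mono)
qed

text \<open>Qualitative companion of \<open>Lpow_telescope\<close>, for almost everywhere
  convergence. Decay is assumed only from index m on, since the decay estimate holds for short
  steps; for the earlier indices finiteness is enough.\<close>

lemma nn_integral_dyadic_second_differences_finite:
  fixes d :: "nat \<Rightarrow> 'a::euclidean_space \<Rightarrow> real"
  assumes d[measurable]: "\<And>j. d j \<in> borel_measurable borel" and B[measurable]: "B \<in> sets borel" "emeasure lborel B < \<infinity>"
    and p: "1 \<le> p" and \<sigma>: "1 < \<sigma>" and fin: "\<And>j. Lpow p B (d j) < \<infinity>"
    and P: "\<And>j. m \<le> j \<Longrightarrow> Lpow p B (d j) \<le> ennreal (P * (2 powr (- (p * \<sigma>))) ^ j)"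
  shows "(\<integral>\<^sup>+x. (\<Sum>j. ennreal (2 ^ j * \<bar>d j x\<bar>)) * indicator B x \<partial>lborel) < \<infinity>"
proof -
  define q where "q = 2 powr (- (\<sigma> - 1))"
  have q: "0 < q" "q < 1" using one_minus_two_powr(2)[of "\<sigma> - 1"] \<sigma> by (auto simp: q_def)
  define x where "x = 2 powr (- (p * \<sigma>))"
  have x: "x > 0" by (simp add: x_def)
  \<comment> \<open>A larger constant makes the decay bound hold also for the finitely many early
    indices.\<close>
  define Q where "Q = \<bar>P\<bar> + (\<Sum>j<m. enn2real (Lpow p B (d j)) / x ^ j)"
  have PQ: "\<bar>P\<bar> \<le> Q" unfolding Q_def using x by (simp add: sum_nonneg)
  have LQ: "Lpow p B (d j) \<le> ennreal (Q * x ^ j)" for j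
  proof (cases "m \<le> j")
    case True
    have "P * x ^ j \<le> Q * x ^ j" using PQ x by (intro mult_right_mono) auto
    then show ?thesis using P[OF True] unfolding x_def by (meson ennreal_leI order_trans)
  next
    case False
    have "enn2real (Lpow p B (d j)) / x ^ j \<le> (\<Sum>j<m. enn2real (Lpow p B (d j)) / x ^ j)"
      using False x by (intro member_le_sum) auto
    also have "\<dots> \<le> Q" by (simp add: Q_def)
    finally have "enn2real (Lpow p B (d j)) \<le> Q * x ^ j" using x by (simp add: field_simps)
    then have "ennreal (enn2real (Lpow p B (d j))) \<le> ennreal (Q * x ^ j)" by (rule ennreal_leI)
    then show ?thesis using fin[of j] by (simp add: ennreal_enn2real)
  qed
  have Q0: "0 \<le> Q" using PQ by simp
  obtain b where b: "emeasure lborel B = ennreal b" "0 \<le> b"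
    using B(2) by (metis infinity_ennreal_def less_top_ennreal)
  define w where "w j = (q ^ j) powr (1 - p) * (2 ^ j) powr p" for j :: nat
  have w0: "0 \<le> w j" for j by (simp add: w_def)
  have one: "(\<integral>\<^sup>+y. ennreal (2 ^ j * \<bar>d j y\<bar>) * indicator B y \<partial>lborel) \<le> ennreal ((b + Q) * q ^ j)" for j
  proof -
    have pt: "2 ^ j * \<bar>d j y\<bar> \<le> q ^ j + w j * \<bar>d j y\<bar> powr p" for y
    proof -
      \<comment> \<open>With this normalisation z \<le> 1 + z^p trades the L^1 bound for the L^p
        bound plus the finite measure of \<open>B\<close>, and both terms are of size
        \<open>q ^ j\<close>.\<close>
      define z where "z = 2 ^ j * \<bar>d j y\<bar> / q ^ j"
      have z: "0 \<le> z" using q by (simp add: z_def)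
      have "z \<le> 1 + z powr p"
      proof (cases "z \<le> 1")
        case False
        then have "z powr 1 \<le> z powr p" using p by (intro powr_mono) auto
        then show ?thesis using False by simp
      qed (simp add: add_increasing2)
      then have "q ^ j * z \<le> q ^ j * (1 + z powr p)" using q by (intro mult_left_mono) auto
      also have "q ^ j * (1 + z powr p) = q ^ j + w j * \<bar>d j y\<bar> powr p"
        using q by (simp add: z_def w_def powr_divide powr_mult powr_diff field_simps)
      finally show ?thesis using q by (simp add: z_def)
    qed
    have "(\<integral>\<^sup>+y. ennreal (2 ^ j * \<bar>d j y\<bar>) * indicator B y \<partial>lborel)
      \<le> (\<integral>\<^sup>+y. (ennreal (q ^ j) * indicator B y + ennreal (w j) * (ennreal (\<bar>d j y\<bar> powr p) * indicator B y)) \<partial>lborel)"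
    proof (intro nn_integral_mono)
      fix y
      show "ennreal (2 ^ j * \<bar>d j y\<bar>) * indicator B y \<le> ennreal (q ^ j) * indicator B y + ennreal (w j) * (ennreal (\<bar>d j y\<bar> powr p) * indicator B y)"
        using ennreal_leI[OF pt[of y]] q w0[of j] by (cases "y \<in> B") (auto simp: ennreal_mult)
    qed
    also have "\<dots> = ennreal (q ^ j) * emeasure lborel B + ennreal (w j) * Lpow p B (d j)"
      unfolding Lpow_def by (simp add: nn_integral_add nn_integral_cmult nn_integral_cmult_indicator)
    also have "\<dots> \<le> ennreal (q ^ j) * ennreal b + ennreal (w j) * ennreal (Q * x ^ j)"
      using LQ b by (intro add_mono mult_left_mono) auto
    also have "\<dots> = ennreal (q ^ j * b + w j * (Q * x ^ j))"
      using b q w0 Q0 x by (simp add: ennreal_mult ennreal_plus)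
    also have "q ^ j * b + w j * (Q * x ^ j) = q ^ j * b + Q * (w j * x ^ j)" by simp
    also have "w j * x ^ j = q ^ j" unfolding w_def x_def by (rule dyadic_weight[OF q_def])
    finally show ?thesis by (simp add: algebra_simps)
  qed
  have "(\<integral>\<^sup>+y. (\<Sum>j. ennreal (2 ^ j * \<bar>d j y\<bar>)) * indicator B y \<partial>lborel) = (\<integral>\<^sup>+y. (\<Sum>j. ennreal (2 ^ j * \<bar>d j y\<bar>) * indicator B y) \<partial>lborel)"
    by simp
  also have "\<dots> = (\<Sum>j. \<integral>\<^sup>+y. ennreal (2 ^ j * \<bar>d j y\<bar>) * indicator B y \<partial>lborel)"
    by (intro nn_integral_suminf) measurable
  also have "\<dots> \<le> (\<Sum>j. ennreal ((b + Q) * q ^ j))" by (intro suminf_le one summableI)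
  also have "\<dots> = ennreal ((b + Q) / (1 - q))" using q b Q0 by (intro suminf_geometric_ennreal) auto
  also have "\<dots> < \<infinity>" by simp
  finally show ?thesis .
qed

subsection \<open>The monotone nonlinearity\<close>

text \<open>The nonlinearity of the p-Laplacian. For \<open>p = 2\<close> and \<open>a = 0\<close>
  the convention \<open>0 powr 0 = 0\<close> still gives the right value.\<close>

definition Jp :: "real \<Rightarrow> real \<Rightarrow> real" where
  "Jp p a = \<bar>a\<bar> powr (p - 2) * a"

lemma Jp_minus[simp]: "Jp p (- a) = - Jp p a"
  by (simp add: Jp_def)

lemma Jp_nonneg: "0 \<le> a \<Longrightarrow> Jp p a = a powr (p - 1)"
  by (cases "a = 0") (auto simp: Jp_def powr_diff power2_eq_square field_simps)

lemma abs_Jp: "\<bar>Jp p a\<bar> = \<bar>a\<bar> powr (p - 1)"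
  using Jp_nonneg[of "\<bar>a\<bar>" p] by (simp add: Jp_def abs_mult)

lemma borel_measurable_Jp[measurable]: "Jp p \<in> borel_measurable borel"
  unfolding Jp_def[abs_def] by measurable

lemma powr_super_additive:
  fixes a b r :: real
  assumes "1 \<le> r" "0 \<le> b" "b \<le> a"
  shows "(a - b) powr r \<le> a powr r - b powr r"
proof -
  have pr: "c * c powr (r - 1) = c powr r" if "0 \<le> c" for c
    using that by (cases "c = 0") (auto simp: powr_diff)
  have "(a - b) powr r + b powr r = (a - b) * (a - b) powr (r - 1) + b * b powr (r - 1)"
    using assms by (simp add: pr)
  also have "\<dots> \<le> (a - b) * a powr (r - 1) + b * a powr (r - 1)"
    using assms by (intro add_mono mult_left_mono powr_mono2) auto
  also have "\<dots> = a powr r" using assms by (simp add: algebra_simps pr)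
  finally show ?thesis by simp
qed

lemma powr_diff_upper:
  fixes a b r :: real
  assumes "1 \<le> r" "0 \<le> b" "b \<le> a"
  shows "a powr r - b powr r \<le> r * a powr (r - 1) * (a - b)"
proof (cases "b = a \<or> b = 0")
  case True
  have pr: "c powr (r - 1) * c = c powr r" if "0 \<le> c" for c
    using that by (cases "c = 0") (auto simp: powr_diff)
  have "a powr r \<le> r * a powr r" using assms mult_right_mono[of 1 r "a powr r"] by simp
  with True assms show ?thesis by (auto simp: mult.assoc pr)
next
  case False
  then have ab: "0 < b" "b < a" using assms by auto
  have "\<And>x. b \<le> x \<Longrightarrow> x \<le> a \<Longrightarrow> DERIV (\<lambda>x. x powr r) x :> r * x powr (r - 1)"
    using ab by (auto intro!: derivative_eq_intros simp: powr_diff)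
  from MVT2[OF ab(2) this] obtain z where z: "b < z" "z < a" "a powr r - b powr r = (a - b) * (r * z powr (r - 1))"
    by auto
  have "z powr (r - 1) \<le> a powr (r - 1)" using z ab assms by (intro powr_mono2) auto
  then have "(a - b) * (r * z powr (r - 1)) \<le> (a - b) * (r * a powr (r - 1))"
    using ab assms by (intro mult_left_mono) auto
  then show ?thesis using z by (simp add: mult_ac)
qed

text \<open>For arguments of equal sign these are inequalities for differences of powers with
  exponent p - 1 \<ge> 1. For opposite signs a - b = |a| + |b|, and the differences of powers become
  sums. Oddness gives the case of negative \<open>a\<close> in
  \<open>Jp_estimates_le\<close>.\<close>

lemma Jp_estimates_ordered:
  assumes p: "2 \<le> p" and ab: "b \<le> a" "0 \<le> a"
  shows "2 powr (1 - p) * (a - b) powr (p - 1) \<le> Jp p a - Jp p b"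
    "Jp p a - Jp p b \<le> (p - 1) * (\<bar>a\<bar> powr (p - 2) + \<bar>b\<bar> powr (p - 2)) * (a - b)"
proof -
  have "2 powr (1 - p) * (a - b) powr (p - 1) \<le> Jp p a - Jp p b \<and>
    Jp p a - Jp p b \<le> (p - 1) * (\<bar>a\<bar> powr (p - 2) + \<bar>b\<bar> powr (p - 2)) * (a - b)"
  proof (cases "0 \<le> b")
    case True
    have "2 powr (1 - p) \<le> (1::real)" using p powr_mono[of "1 - p" 0 "2::real"] by simp
    then have "2 powr (1 - p) * (a - b) powr (p - 1) \<le> 1 * (a - b) powr (p - 1)"
      by (intro mult_right_mono) auto
    also have "\<dots> \<le> a powr (p - 1) - b powr (p - 1)"
      using powr_super_additive[of "p - 1" b a] p True ab by simp
    finally have 1: "2 powr (1 - p) * (a - b) powr (p - 1) \<le> Jp p a - Jp p b"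
      using True ab by (simp add: Jp_nonneg)
    have "a powr (p - 1) - b powr (p - 1) \<le> (p - 1) * a powr (p - 2) * (a - b)"
      using powr_diff_upper[of "p - 1" b a] p True ab by simp
    also have "\<dots> \<le> (p - 1) * (a powr (p - 2) + b powr (p - 2)) * (a - b)"
      using ab p by (intro mult_right_mono mult_left_mono) auto
    finally show ?thesis using 1 True ab by (simp add: Jp_nonneg)
  next
    case False
    define c where "c = - b"
    have c: "0 < c" "b = - c" using False by (auto simp: c_def)
    have J: "Jp p a - Jp p b = a powr (p - 1) + c powr (p - 1)"
      using c ab by (simp add: Jp_nonneg)
    have r1: "(a + c) powr (p - 1) \<le> 2 powr (p - 1) * (a powr (p - 1) + c powr (p - 1))"
      using abs_add_powr_le'[of "p - 1" a c] p ab c by simp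
    have "2 powr (1 - p) * (a + c) powr (p - 1) \<le> 2 powr (1 - p) * (2 powr (p - 1) * (a powr (p - 1) + c powr (p - 1)))"
      using r1 by (intro mult_left_mono) auto
    also have "\<dots> = a powr (p - 1) + c powr (p - 1)"
      by (simp add: mult.assoc[symmetric] powr_add[symmetric])
    finally have 1: "2 powr (1 - p) * (a - b) powr (p - 1) \<le> Jp p a - Jp p b"
      unfolding J using c by simp
    have pr: "x powr (p - 1) = x powr (p - 2) * x" if "0 \<le> x" for x
      using that by (cases "x = 0") (auto simp: powr_diff power2_eq_square)
    have "a powr (p - 1) + c powr (p - 1) \<le> 1 * (a powr (p - 2) + c powr (p - 2)) * (a + c)"
      using ab c by (simp add: pr algebra_simps)
    also have "\<dots> \<le> (p - 1) * (a powr (p - 2) + c powr (p - 2)) * (a + c)"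
      using p ab c by (intro mult_right_mono) auto
    finally show ?thesis using 1 J c ab by simp
  qed
  then show "2 powr (1 - p) * (a - b) powr (p - 1) \<le> Jp p a - Jp p b"
    "Jp p a - Jp p b \<le> (p - 1) * (\<bar>a\<bar> powr (p - 2) + \<bar>b\<bar> powr (p - 2)) * (a - b)" by auto
qed

lemma Jp_estimates_le:
  assumes p: "2 \<le> p" and ab: "b \<le> a"
  shows "2 powr (1 - p) * (a - b) powr (p - 1) \<le> Jp p a - Jp p b \<and>
    Jp p a - Jp p b \<le> (p - 1) * (\<bar>a\<bar> powr (p - 2) + \<bar>b\<bar> powr (p - 2)) * (a - b)"
proof (cases "0 \<le> a")
  case True
  then show ?thesis using Jp_estimates_ordered[OF p ab] by auto
next
  case False
  then have "- a \<le> - b" "0 \<le> - b" using ab by auto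
  from Jp_estimates_ordered[OF p this] show ?thesis by (simp add: add.commute)
qed

lemma Jp_lipschitz:
  assumes p: "2 \<le> p"
  shows "\<bar>Jp p a - Jp p b\<bar> \<le> (p - 1) * (\<bar>a\<bar> powr (p - 2) + \<bar>b\<bar> powr (p - 2)) * \<bar>a - b\<bar>"
proof (cases "b \<le> a")
  case True
  have "0 \<le> 2 powr (1 - p) * (a - b) powr (p - 1)" by simp
  then have "0 \<le> Jp p a - Jp p b" using Jp_estimates_le[OF p True] by linarith
  then show ?thesis using Jp_estimates_le[OF p True] True by simp
next
  case False
  then have ab: "a \<le> b" by simp
  have "0 \<le> 2 powr (1 - p) * (b - a) powr (p - 1)" by simp
  then have "0 \<le> Jp p b - Jp p a" using Jp_estimates_le[OF p ab] by linarith
  then show ?thesis using Jp_estimates_le[OF p ab] ab by (simp add: add.commute)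
qed

text \<open>Monotonicity makes the product nonnegative. The second form, as a product of absolute
  values, is what allows the commutator to be absorbed in
  \<open>Jp_test_lower_bound\<close>.\<close>

lemma Jp_coercive:
  assumes p: "2 \<le> p"
  shows "2 powr (1 - p) * \<bar>a - b\<bar> powr p \<le> (Jp p a - Jp p b) * (a - b)"
    "(Jp p a - Jp p b) * (a - b) = \<bar>Jp p a - Jp p b\<bar> * \<bar>a - b\<bar>"
proof -
  have pr: "x powr p = x powr (p - 1) * x" if "0 \<le> x" for x
    using that by (cases "x = 0") (auto simp: powr_diff)
  have main: "2 powr (1 - p) * \<bar>a - b\<bar> powr p \<le> (Jp p a - Jp p b) * (a - b) \<and> 0 \<le> (Jp p a - Jp p b) * (a - b)"
    if ab: "b \<le> a" for a b
  proof -
    have "2 powr (1 - p) * (a - b) powr (p - 1) * (a - b) \<le> (Jp p a - Jp p b) * (a - b)"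
      using Jp_estimates_le[OF p ab] ab by (intro mult_right_mono) auto
    moreover have "0 \<le> 2 powr (1 - p) * (a - b) powr (p - 1) * (a - b)" using ab by simp
    ultimately have "2 powr (1 - p) * (a - b) powr (p - 1) * (a - b) \<le> (Jp p a - Jp p b) * (a - b) \<and> 0 \<le> (Jp p a - Jp p b) * (a - b)"
      by linarith
    then show ?thesis using ab by (simp add: pr mult.assoc)
  qed
  have sw: "(Jp p a - Jp p b) * (a - b) = (Jp p b - Jp p a) * (b - a)" by (simp add: algebra_simps)
  show "2 powr (1 - p) * \<bar>a - b\<bar> powr p \<le> (Jp p a - Jp p b) * (a - b)"
    using main[of b a] main[of a b] sw by (cases "b \<le> a") (auto simp: abs_minus_commute)
  have "0 \<le> (Jp p a - Jp p b) * (a - b)"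
    using main[of b a] main[of a b] sw by (cases "b \<le> a") auto
  then show "(Jp p a - Jp p b) * (a - b) = \<bar>Jp p a - Jp p b\<bar> * \<bar>a - b\<bar>"
    by (metis abs_mult abs_of_nonneg)
qed

text \<open>The test increment splits into (a - b)(e^2 + g^2)/2 and the commutator (\<alpha> +
  \<beta>)(e^2 - g^2)/2. With A = Jp a - Jp b and X = A (a - b), the Lipschitz bound gives A^2 \<le>
  m X. So half of the good term absorbs the commutator, and the remainder is quadratic in \<alpha>,
  \<beta>; this quadratic form is what later produces \<theta>^2.\<close>

lemma Jp_test_lower_bound:
  assumes p: "2 \<le> p" and d: "\<alpha> - \<beta> = a - b" and eg: "0 \<le> e" "0 \<le> g"
  shows "(Jp p a - Jp p b) * (a - b) * (e\<^sup>2 + g\<^sup>2) / 4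
     - (p - 1) * (\<bar>a\<bar> powr (p - 2) + \<bar>b\<bar> powr (p - 2)) * ((\<bar>\<alpha>\<bar> + \<bar>\<beta>\<bar>) * \<bar>e - g\<bar>)\<^sup>2 / 2
    \<le> (Jp p a - Jp p b) * (\<alpha> * e\<^sup>2 - \<beta> * g\<^sup>2)"
proof -
  define A where "A = Jp p a - Jp p b"
  define m where "m = (p - 1) * (\<bar>a\<bar> powr (p - 2) + \<bar>b\<bar> powr (p - 2))"
  define X where "X = A * (a - b)"
  have X: "X = \<bar>A\<bar> * \<bar>a - b\<bar>" unfolding X_def A_def by (rule Jp_coercive(2)[OF p])
  have X0: "0 \<le> X" by (simp add: X)
  have m0: "0 \<le> m" using p by (simp add: m_def)
  have "\<bar>A\<bar> \<le> m * \<bar>a - b\<bar>" unfolding A_def m_def by (rule Jp_lipschitz[OF p])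
  then have "\<bar>A\<bar> * \<bar>A\<bar> \<le> \<bar>A\<bar> * (m * \<bar>a - b\<bar>)" by (intro mult_left_mono) auto
  then have "\<bar>A\<bar>\<^sup>2 \<le> m * X" by (simp add: X power2_eq_square mult_ac)
  then have A: "\<bar>A\<bar> \<le> sqrt m * sqrt X"
    by (metis real_sqrt_abs real_sqrt_le_iff real_sqrt_mult real_sqrt_power power2_abs abs_ge_zero real_sqrt_unique)
  define S where "S = (\<bar>\<alpha>\<bar> + \<bar>\<beta>\<bar>) * \<bar>e - g\<bar>"
  have S0: "0 \<le> S" by (simp add: S_def)
  have id: "\<alpha> * e\<^sup>2 - \<beta> * g\<^sup>2 = (a - b) * (e\<^sup>2 + g\<^sup>2) / 2 + (\<alpha> + \<beta>) / 2 * ((e - g) * (e + g))"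
    unfolding d[symmetric] by (simp add: power2_eq_square field_simps)
  have "\<bar>A * ((\<alpha> + \<beta>) / 2 * ((e - g) * (e + g)))\<bar> = \<bar>A\<bar> * (\<bar>\<alpha> + \<beta>\<bar> * \<bar>e - g\<bar>) * (e + g) / 2"
    using eg by (simp add: abs_mult)
  also have "\<dots> \<le> (sqrt m * sqrt X) * S * (e + g) / 2"
    unfolding S_def using A eg X0 m0 by (intro divide_right_mono mult_mono mult_right_mono) auto
  also have "\<dots> = (sqrt X * (e + g)) * (sqrt m * S / 2)" by (simp add: field_simps)
  also have "\<dots> \<le> (sqrt X * (e + g))\<^sup>2 / 8 + 2 * (sqrt m * S / 2)\<^sup>2"
    using zero_le_power2[of "(sqrt X * (e + g)) / 2 - 2 * (sqrt m * S / 2)"]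
    by (simp add: power2_eq_square algebra_simps)
  also have "\<dots> = X * (e + g)\<^sup>2 / 8 + m * S\<^sup>2 / 2"
    using X0 m0 by (simp add: power_mult_distrib power_divide)
  also have "X * (e + g)\<^sup>2 / 8 \<le> X * (2 * (e\<^sup>2 + g\<^sup>2)) / 8"
    using X0 zero_le_power2[of "e - g"] by (intro divide_right_mono mult_left_mono) (auto simp: power2_eq_square algebra_simps)
  also have "X * (2 * (e\<^sup>2 + g\<^sup>2)) / 8 = X * (e\<^sup>2 + g\<^sup>2) / 4" by simp
  finally have "\<bar>A * ((\<alpha> + \<beta>) / 2 * ((e - g) * (e + g)))\<bar> \<le> X * (e\<^sup>2 + g\<^sup>2) / 4 + m * S\<^sup>2 / 2" by simp
  moreover have "A * (\<alpha> * e\<^sup>2 - \<beta> * g\<^sup>2) = X * (e\<^sup>2 + g\<^sup>2) / 2 + A * ((\<alpha> + \<beta>) / 2 * ((e - g) * (e + g)))"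
    unfolding id X_def by (simp add: algebra_simps)
  ultimately have "X * (e\<^sup>2 + g\<^sup>2) / 4 - m * S\<^sup>2 / 2 \<le> A * (\<alpha> * e\<^sup>2 - \<beta> * g\<^sup>2)"
    by linarith
  then show ?thesis by (simp add: A_def X_def m_def S_def mult.assoc)
qed

subsection \<open>Pointwise inequalities for the localized test function\<close>

lemma young_three:
  fixes x y z p :: real
  assumes "2 \<le> p" "0 \<le> x" "0 \<le> y" "0 \<le> z"
  shows "x powr (p - 2) * y * z \<le> x powr p + y powr p + z powr p"
proof -
  define m where "m = max x (max y z)"
  have m: "x \<le> m" "y \<le> m" "z \<le> m" "0 \<le> m" using assms by (auto simp: m_def)
  have "x powr (p - 2) * y * z \<le> m powr (p - 2) * m * m"
    using assms m by (intro mult_mono powr_mono2) auto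
  also have "\<dots> = m powr p" using m(4)
    by (cases "m = 0") (auto simp: powr_diff power2_eq_square)
  also have "\<dots> \<le> x powr p + y powr p + z powr p" unfolding m_def max_def by auto
  finally show ?thesis .
qed

text \<open>\<open>young_three\<close> applied to x, y / l and z / \<theta>. When x, y, z have the
  sizes 1, l, \<theta>, each of the three terms is of size l \<theta>, so nothing is lost.\<close>

lemma young_scaled:
  fixes x y z p :: real
  assumes "2 \<le> p" "0 \<le> x" "0 \<le> y" "0 \<le> z" "0 < \<theta>" "0 < l"
  shows "x powr (p - 2) * y * z \<le> l * \<theta> * x powr p + \<theta> * l powr (1 - p) * y powr p + l * \<theta> powr (1 - p) * z powr p"
proof -
  have "x powr (p - 2) * y * z = l * \<theta> * (x powr (p - 2) * (y / l) * (z / \<theta>))" using assms by simp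
  also have "\<dots> \<le> l * \<theta> * (x powr p + (y / l) powr p + (z / \<theta>) powr p)"
    using assms by (intro mult_left_mono young_three) auto
  also have "\<dots> = l * \<theta> * x powr p + \<theta> * l powr (1 - p) * y powr p + l * \<theta> powr (1 - p) * z powr p"
    using assms by (simp add: powr_divide powr_diff field_simps)
  finally show ?thesis .
qed

text \<open>Weights on pairs of points. \<open>X2\<close>, \<open>X3\<close> (\<open>Y2\<close>, \<open>Y3\<close>) say that the first (second) point lies in
  the support of the cutoff or in the larger ball; \<open>a\<close>, \<open>b\<close> are the increments of the translated
  function and the function, \<open>\<alpha>\<close>, \<open>\<beta>\<close> the values of the finite difference, \<open>e\<close>, \<open>g\<close> those of the
  cutoff, and \<open>k\<close> is the kernel.\<close>

definition wt1 :: "real \<Rightarrow> bool \<Rightarrow> bool \<Rightarrow> real \<Rightarrow> real \<Rightarrow> real \<Rightarrow> real" where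
  "wt1 p X2 Y2 a b k = (if X2 \<or> Y2 then (\<bar>a\<bar> powr p + \<bar>b\<bar> powr p) * k else 0)"

definition wt2 :: "real \<Rightarrow> bool \<Rightarrow> bool \<Rightarrow> real \<Rightarrow> real \<Rightarrow> real \<Rightarrow> real \<Rightarrow> real \<Rightarrow> real" where
  "wt2 p X3 Y3 \<alpha> \<beta> e g k = (if X3 \<and> Y3 then (\<bar>\<alpha>\<bar> powr p + \<bar>\<beta>\<bar> powr p) * (\<bar>e - g\<bar> powr p * k) else 0)"

definition wt3 :: "real \<Rightarrow> bool \<Rightarrow> bool \<Rightarrow> bool \<Rightarrow> bool \<Rightarrow> real \<Rightarrow> real \<Rightarrow> real \<Rightarrow> real" where
  "wt3 p X2 Y2 X3 Y3 \<alpha> \<beta> k = (if X2 \<and> \<not> Y3 then \<bar>\<alpha>\<bar> powr p * k else 0) + (if Y2 \<and> \<not> X3 then \<bar>\<beta>\<bar> powr p * k else 0)"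

lemma wt_nonneg:
  assumes "0 \<le> k"
  shows "0 \<le> wt1 p X2 Y2 a b k" "0 \<le> wt2 p X3 Y3 \<alpha> \<beta> e g k" "0 \<le> wt3 p X2 Y2 X3 Y3 \<alpha> \<beta> k"
  using assms by (auto simp: wt1_def wt2_def wt3_def)

text \<open>Shows that the localized difference is an admissible test function: its energy density
  is dominated by the weights, whose integrals are finite.\<close>

lemma cutoff_difference_bound:
  assumes p: "2 \<le> p" and d: "\<alpha> - \<beta> = a - b" and k: "0 \<le> k"
    and eg: "0 \<le> e" "e \<le> 1" "0 \<le> g" "g \<le> 1"
    and X: "e \<noteq> 0 \<Longrightarrow> X2" "g \<noteq> 0 \<Longrightarrow> Y2" "X2 \<Longrightarrow> X3" "Y2 \<Longrightarrow> Y3"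
  shows "\<bar>\<alpha> * e\<^sup>2 - \<beta> * g\<^sup>2\<bar> powr p * k
    \<le> 4 powr p * (wt1 p X2 Y2 a b k + wt2 p X3 Y3 \<alpha> \<beta> e g k + wt3 p X2 Y2 X3 Y3 \<alpha> \<beta> k)"
proof -
  let ?W = "wt1 p X2 Y2 a b k + wt2 p X3 Y3 \<alpha> \<beta> e g k + wt3 p X2 Y2 X3 Y3 \<alpha> \<beta> k"
  have nn: "0 \<le> wt1 p X2 Y2 a b k" "0 \<le> wt2 p X3 Y3 \<alpha> \<beta> e g k" "0 \<le> wt3 p X2 Y2 X3 Y3 \<alpha> \<beta> k"
    by (rule wt_nonneg[OF k])+
  have p4: "(1::real) \<le> 4 powr p" using p by (simp add: ge_one_powr_ge_zero)
  have sq: "e\<^sup>2 \<le> 1" "g\<^sup>2 \<le> 1" using eg by (simp_all add: power_le_one)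
  \<comment> \<open>If a point is in the support of the cutoff, then either both points are in the
    larger ball or the other one lies outside it, where the cutoff vanishes.\<close>
  consider (none) "\<not> X2" "\<not> Y2" | (near) "X3" "Y3" "X2 \<or> Y2" | (x) "X2" "\<not> Y3" | (y) "Y2" "\<not> X3"
    using X(3,4) by auto
  then show ?thesis
  proof cases
    case none
    then have "e = 0" "g = 0" using X by auto
    then show ?thesis using nn p4 p by simp
  next
    case near
    have "\<alpha> * e\<^sup>2 - \<beta> * g\<^sup>2 = (a - b) * e\<^sup>2 + \<beta> * ((e - g) * (e + g))"
      unfolding d[symmetric] by (simp add: power2_eq_square algebra_simps)
    then have "\<bar>\<alpha> * e\<^sup>2 - \<beta> * g\<^sup>2\<bar> powr p \<le> 2 powr p * (\<bar>(a - b) * e\<^sup>2\<bar> powr p + \<bar>\<beta> * ((e - g) * (e + g))\<bar> powr p)"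
      using abs_add_powr_le'[of p] p by simp
    also have "\<bar>(a - b) * e\<^sup>2\<bar> powr p \<le> \<bar>a - b\<bar> powr p"
      using p sq by (intro powr_mono2) (auto simp: abs_mult mult_left_le)
    also have "\<bar>a - b\<bar> powr p \<le> 2 powr p * (\<bar>a\<bar> powr p + \<bar>b\<bar> powr p)"
      using abs_diff_powr_le[of p] p by simp
    also have "\<bar>\<beta> * ((e - g) * (e + g))\<bar> powr p \<le> (2 * (\<bar>\<beta>\<bar> * \<bar>e - g\<bar>)) powr p"
    proof (intro powr_mono2)
      have "\<bar>\<beta> * ((e - g) * (e + g))\<bar> = (\<bar>\<beta>\<bar> * \<bar>e - g\<bar>) * (e + g)" using eg by (simp add: abs_mult)
      also have "\<dots> \<le> (\<bar>\<beta>\<bar> * \<bar>e - g\<bar>) * 2" using eg by (intro mult_left_mono) auto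
      finally show "\<bar>\<beta> * ((e - g) * (e + g))\<bar> \<le> 2 * (\<bar>\<beta>\<bar> * \<bar>e - g\<bar>)" by simp
    qed (use p in auto)
    also have "(2 * (\<bar>\<beta>\<bar> * \<bar>e - g\<bar>)) powr p = 2 powr p * (\<bar>\<beta>\<bar> powr p * \<bar>e - g\<bar> powr p)"
      by (simp add: powr_mult)
    also have "2 powr p * (2 powr p * (\<bar>a\<bar> powr p + \<bar>b\<bar> powr p) + 2 powr p * (\<bar>\<beta>\<bar> powr p * \<bar>e - g\<bar> powr p))
       \<le> 4 powr p * ((\<bar>a\<bar> powr p + \<bar>b\<bar> powr p) + (\<bar>\<alpha>\<bar> powr p + \<bar>\<beta>\<bar> powr p) * \<bar>e - g\<bar> powr p)"
    proof -
      have "(4::real) powr p = 2 powr p * 2 powr p" by (simp add: powr_mult[symmetric])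
      then show ?thesis by (simp add: algebra_simps)
    qed
    finally have "\<bar>\<alpha> * e\<^sup>2 - \<beta> * g\<^sup>2\<bar> powr p * k \<le> 4 powr p * ((\<bar>a\<bar> powr p + \<bar>b\<bar> powr p) + (\<bar>\<alpha>\<bar> powr p + \<bar>\<beta>\<bar> powr p) * \<bar>e - g\<bar> powr p) * k"
      using p k by (intro mult_right_mono) (auto intro: mult_left_mono add_left_mono)
    also have "\<dots> = 4 powr p * (wt1 p X2 Y2 a b k + wt2 p X3 Y3 \<alpha> \<beta> e g k)"
      using near by (auto simp: wt1_def wt2_def algebra_simps)
    also have "\<dots> \<le> 4 powr p * ?W" using nn by (intro mult_left_mono) auto
    finally show ?thesis .
  next
    case x
    then have g: "g = 0" using X by auto
    have "\<bar>\<alpha> * e\<^sup>2 - \<beta> * g\<^sup>2\<bar> powr p \<le> \<bar>\<alpha>\<bar> powr p"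
      using p sq g by (intro powr_mono2) (auto simp: abs_mult mult_left_le)
    then have "\<bar>\<alpha> * e\<^sup>2 - \<beta> * g\<^sup>2\<bar> powr p * k \<le> \<bar>\<alpha>\<bar> powr p * k" using k by (rule mult_right_mono)
    also have "\<dots> \<le> wt3 p X2 Y2 X3 Y3 \<alpha> \<beta> k" using x k by (simp add: wt3_def)
    also have "\<dots> \<le> 1 * ?W" using nn by simp
    also have "\<dots> \<le> 4 powr p * ?W" using p4 nn by (intro mult_right_mono) auto
    finally show ?thesis .
  next
    case y
    then have e: "e = 0" using X by auto
    have "\<bar>\<alpha> * e\<^sup>2 - \<beta> * g\<^sup>2\<bar> powr p \<le> \<bar>\<beta>\<bar> powr p"
      using p sq e by (intro powr_mono2) (auto simp: abs_mult mult_left_le)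
    then have "\<bar>\<alpha> * e\<^sup>2 - \<beta> * g\<^sup>2\<bar> powr p * k \<le> \<bar>\<beta>\<bar> powr p * k" using k by (rule mult_right_mono)
    also have "\<dots> \<le> wt3 p X2 Y2 X3 Y3 \<alpha> \<beta> k" using y k by (simp add: wt3_def)
    also have "\<dots> \<le> 1 * ?W" using nn by simp
    also have "\<dots> \<le> 4 powr p * ?W" using p4 nn by (intro mult_right_mono) auto
    finally show ?thesis .
  qed
qed

text \<open>Gives integrability of the flux of the function and of its translate separately, which
  is required before the two equations can be subtracted. The choice of \<open>c\<close> covers
  both.\<close>

lemma flux_difference_bound:
  assumes p: "2 \<le> p" and d: "\<alpha> - \<beta> = a - b" and k: "0 \<le> k"
    and eg: "0 \<le> e" "e \<le> 1" "0 \<le> g" "g \<le> 1"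
    and X: "e \<noteq> 0 \<Longrightarrow> X2" "g \<noteq> 0 \<Longrightarrow> Y2" "X2 \<Longrightarrow> X3" "Y2 \<Longrightarrow> Y3"
    and \<kappa>: "0 \<le> \<kappa>" "\<kappa> \<le> \<Lambda> * k" and \<Lambda>: "0 \<le> \<Lambda>" and c: "c = a \<or> c = b"
  shows "\<bar>Jp p c * \<kappa> * (\<alpha> * e\<^sup>2 - \<beta> * g\<^sup>2)\<bar>
    \<le> \<Lambda> * (1 + 4 powr p) * (wt1 p X2 Y2 a b k + wt2 p X3 Y3 \<alpha> \<beta> e g k + wt3 p X2 Y2 X3 Y3 \<alpha> \<beta> k)"
proof (cases "X2 \<or> Y2")
  case True
  let ?W = "wt1 p X2 Y2 a b k + wt2 p X3 Y3 \<alpha> \<beta> e g k + wt3 p X2 Y2 X3 Y3 \<alpha> \<beta> k"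
  have nn: "0 \<le> wt1 p X2 Y2 a b k" "0 \<le> wt2 p X3 Y3 \<alpha> \<beta> e g k" "0 \<le> wt3 p X2 Y2 X3 Y3 \<alpha> \<beta> k"
    by (rule wt_nonneg[OF k])+
  define D where "D = \<bar>\<alpha> * e\<^sup>2 - \<beta> * g\<^sup>2\<bar>"
  have D: "0 \<le> D" by (simp add: D_def)
  have "\<bar>c\<bar> powr (p - 1) * D \<le> \<bar>c\<bar> powr p + D powr p"
  proof -
    define m where "m = max \<bar>c\<bar> D"
    have m: "\<bar>c\<bar> \<le> m" "D \<le> m" "0 \<le> m" using D by (auto simp: m_def)
    have "\<bar>c\<bar> powr (p - 1) * D \<le> m powr (p - 1) * m"
      using m D p by (intro mult_mono powr_mono2) auto
    also have "\<dots> = m powr p" using m by (cases "m = 0") (auto simp: powr_diff)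
    also have "\<dots> \<le> \<bar>c\<bar> powr p + D powr p" unfolding m_def max_def by auto
    finally show ?thesis .
  qed
  also have "\<bar>c\<bar> powr p \<le> \<bar>a\<bar> powr p + \<bar>b\<bar> powr p" using c by auto
  finally have "\<bar>c\<bar> powr (p - 1) * D * k \<le> (\<bar>a\<bar> powr p + \<bar>b\<bar> powr p + D powr p) * k"
    using k by (intro mult_right_mono) auto
  also have "\<dots> = wt1 p X2 Y2 a b k + D powr p * k" using True by (simp add: wt1_def algebra_simps)
  also have "\<dots> \<le> 1 * ?W + 4 powr p * ?W"
  proof (rule add_mono)
    show "D powr p * k \<le> 4 powr p * ?W"
      unfolding D_def by (rule cutoff_difference_bound[OF p d k eg X])
  qed (use nn in simp)
  finally have m: "\<bar>c\<bar> powr (p - 1) * D * k \<le> (1 + 4 powr p) * ?W" unfolding distrib_right .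
  have "\<bar>Jp p c * \<kappa> * (\<alpha> * e\<^sup>2 - \<beta> * g\<^sup>2)\<bar> = \<bar>c\<bar> powr (p - 1) * D * \<kappa>"
    using \<kappa> by (simp add: abs_mult abs_Jp D_def)
  also have "\<dots> \<le> \<bar>c\<bar> powr (p - 1) * D * (\<Lambda> * k)" using \<kappa> D by (intro mult_left_mono) auto
  also have "\<dots> = \<Lambda> * (\<bar>c\<bar> powr (p - 1) * D * k)" by simp
  also have "\<dots> \<le> \<Lambda> * ((1 + 4 powr p) * ?W)" using \<Lambda> m by (intro mult_left_mono)
  finally show ?thesis by (simp add: mult.assoc)
next
  case False
  then have "e = 0" "g = 0" using X by auto
  then show ?thesis using wt_nonneg[OF k] \<Lambda> by simp
qed

text \<open>For a point in the support and a partner outside the larger ball there is no good term,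
  so the flux is estimated in absolute value. Since |a - b| \<le> |\<alpha>| + |\<beta>|, Young is
  applied twice: with sizes \<theta>, \<theta> for the part containing \<alpha> twice, and with l,
  \<theta> for the mixed part, where \<beta> belongs to the tail.\<close>

lemma far_error_bound:
  assumes p: "2 \<le> p" and d: "\<alpha> - \<beta> = a - b" and k: "0 \<le> k" and e: "0 \<le> e" "e \<le> 1"
    and \<kappa>: "0 \<le> \<kappa>" "\<kappa> \<le> \<Lambda> * k" and \<Lambda>: "0 \<le> \<Lambda>" and \<theta>: "0 < \<theta>" "0 < l"
  shows "\<bar>(Jp p a - Jp p b) * \<kappa> * (\<alpha> * e\<^sup>2)\<bar>
    \<le> \<Lambda> * (p - 1) * 4 * ((\<theta> * \<theta> + l * \<theta>) * ((\<bar>a\<bar> powr p + \<bar>b\<bar> powr p) * k)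
      + (\<theta> * \<theta> powr (1 - p) + l * \<theta> powr (1 - p)) * (\<bar>\<alpha>\<bar> powr p * k) + \<theta> * l powr (1 - p) * (\<bar>\<beta>\<bar> powr p * k))"
proof -
  have sq: "e\<^sup>2 \<le> 1" using e by (simp add: power_le_one)
  have y: "\<bar>c\<bar> powr (p - 2) * (\<bar>\<alpha>\<bar> + \<bar>\<beta>\<bar>) * \<bar>\<alpha>\<bar> \<le> (\<theta> * \<theta> + l * \<theta>) * \<bar>c\<bar> powr p
      + 2 * (\<theta> * \<theta> powr (1 - p) + l * \<theta> powr (1 - p)) * \<bar>\<alpha>\<bar> powr p + \<theta> * l powr (1 - p) * \<bar>\<beta>\<bar> powr p" for c
  proof -
    have "\<bar>c\<bar> powr (p - 2) * \<bar>\<alpha>\<bar> * \<bar>\<alpha>\<bar> \<le> \<theta> * \<theta> * \<bar>c\<bar> powr p + \<theta> * \<theta> powr (1 - p) * \<bar>\<alpha>\<bar> powr p + \<theta> * \<theta> powr (1 - p) * \<bar>\<alpha>\<bar> powr p"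
      using p \<theta> by (intro young_scaled) auto
    moreover have "\<bar>c\<bar> powr (p - 2) * \<bar>\<beta>\<bar> * \<bar>\<alpha>\<bar> \<le> l * \<theta> * \<bar>c\<bar> powr p + \<theta> * l powr (1 - p) * \<bar>\<beta>\<bar> powr p + l * \<theta> powr (1 - p) * \<bar>\<alpha>\<bar> powr p"
      using p \<theta> by (intro young_scaled) auto
    moreover have "0 \<le> l * \<theta> powr (1 - p) * \<bar>\<alpha>\<bar> powr p" using \<theta> by simp
    ultimately show ?thesis by (simp add: algebra_simps)
  qed
  have "\<bar>(Jp p a - Jp p b) * \<kappa> * (\<alpha> * e\<^sup>2)\<bar> = \<bar>Jp p a - Jp p b\<bar> * \<kappa> * (\<bar>\<alpha>\<bar> * e\<^sup>2)"
    using \<kappa> by (simp add: abs_mult)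
  also have "\<dots> \<le> ((p - 1) * (\<bar>a\<bar> powr (p - 2) + \<bar>b\<bar> powr (p - 2)) * (\<bar>\<alpha>\<bar> + \<bar>\<beta>\<bar>)) * (\<Lambda> * k) * (\<bar>\<alpha>\<bar> * 1)"
  proof (intro mult_mono)
    have "\<bar>Jp p a - Jp p b\<bar> \<le> (p - 1) * (\<bar>a\<bar> powr (p - 2) + \<bar>b\<bar> powr (p - 2)) * \<bar>a - b\<bar>" by (rule Jp_lipschitz[OF p])
    also have "\<dots> \<le> (p - 1) * (\<bar>a\<bar> powr (p - 2) + \<bar>b\<bar> powr (p - 2)) * (\<bar>\<alpha>\<bar> + \<bar>\<beta>\<bar>)"
      unfolding d[symmetric] using p by (intro mult_left_mono) auto
    finally show "\<bar>Jp p a - Jp p b\<bar> \<le> (p - 1) * (\<bar>a\<bar> powr (p - 2) + \<bar>b\<bar> powr (p - 2)) * (\<bar>\<alpha>\<bar> + \<bar>\<beta>\<bar>)" .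
  qed (use \<kappa> sq p k \<Lambda> in auto)
  also have "\<dots> = \<Lambda> * (p - 1) * k * (\<bar>a\<bar> powr (p - 2) * (\<bar>\<alpha>\<bar> + \<bar>\<beta>\<bar>) * \<bar>\<alpha>\<bar> + \<bar>b\<bar> powr (p - 2) * (\<bar>\<alpha>\<bar> + \<bar>\<beta>\<bar>) * \<bar>\<alpha>\<bar>)"
    by (simp add: algebra_simps)
  also have "\<dots> \<le> \<Lambda> * (p - 1) * k * (4 * ((\<theta> * \<theta> + l * \<theta>) * (\<bar>a\<bar> powr p + \<bar>b\<bar> powr p)
      + (\<theta> * \<theta> powr (1 - p) + l * \<theta> powr (1 - p)) * \<bar>\<alpha>\<bar> powr p + \<theta> * l powr (1 - p) * \<bar>\<beta>\<bar> powr p))"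
  proof (intro mult_left_mono)
    have gen: "u + v \<le> 4 * (x + y + Z + w)"
      if "u \<le> x + 2 * Z + w" "v \<le> y + 2 * Z + w" "0 \<le> x" "0 \<le> y" "0 \<le> w"
      for u v x y Z w :: real using that by (simp add: algebra_simps)
    show "\<bar>a\<bar> powr (p - 2) * (\<bar>\<alpha>\<bar> + \<bar>\<beta>\<bar>) * \<bar>\<alpha>\<bar> + \<bar>b\<bar> powr (p - 2) * (\<bar>\<alpha>\<bar> + \<bar>\<beta>\<bar>) * \<bar>\<alpha>\<bar>
      \<le> 4 * ((\<theta> * \<theta> + l * \<theta>) * (\<bar>a\<bar> powr p + \<bar>b\<bar> powr p) + (\<theta> * \<theta> powr (1 - p) + l * \<theta> powr (1 - p)) * \<bar>\<alpha>\<bar> powr p + \<theta> * l powr (1 - p) * \<bar>\<beta>\<bar> powr p)"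
      unfolding distrib_left[of "\<theta> * \<theta> + l * \<theta>"]
      by (rule gen[OF y[of a, unfolded mult.assoc[of 2]] y[of b, unfolded mult.assoc[of 2]]]) (use \<theta> in auto)
  qed (use \<Lambda> p k in auto)
  finally show ?thesis by (simp add: algebra_simps)
qed

text \<open>Here \<open>\<theta>\<close> and \<open>l\<close> are free Young parameters: \<open>\<theta>\<close> is later the size of the finite difference on the
  ball, \<open>l\<close> that of the finite difference in the tail.\<close>

lemma test_pointwise:
  assumes p: "2 \<le> p" and d: "\<alpha> - \<beta> = a - b" and k: "0 \<le> k"
    and eg: "0 \<le> e" "e \<le> 1" "0 \<le> g" "g \<le> 1"
    and X: "e \<noteq> 0 \<Longrightarrow> X2" "g \<noteq> 0 \<Longrightarrow> Y2" "X2 \<Longrightarrow> X3" "Y2 \<Longrightarrow> Y3" "X1 \<Longrightarrow> e = 1" "Y1 \<Longrightarrow> g = 1"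
    and \<kappa>: "k / \<Lambda> \<le> \<kappa>" "\<kappa> \<le> \<Lambda> * k" and \<Lambda>: "0 < \<Lambda>" and \<theta>: "0 < \<theta>" "0 < l"
  shows "(if X1 \<and> Y1 then 2 powr (1 - p) / (2 * \<Lambda>) * (\<bar>\<alpha> - \<beta>\<bar> powr p * k) else 0)
    \<le> (Jp p a - Jp p b) * \<kappa> * (\<alpha> * e\<^sup>2 - \<beta> * g\<^sup>2)
      + \<Lambda> * (p - 1) * (4 * 2 powr p) * ((\<theta> * \<theta> + l * \<theta>) * wt1 p X2 Y2 a b k
        + \<theta> * \<theta> powr (1 - p) * wt2 p X3 Y3 \<alpha> \<beta> e g k
        + (\<theta> * \<theta> powr (1 - p) + l * \<theta> powr (1 - p)) * wt3 p X2 Y2 X3 Y3 \<alpha> \<beta> k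
        + \<theta> * l powr (1 - p) * wt3 p X2 Y2 X3 Y3 \<beta> \<alpha> k)"
  (is "?L \<le> ?Q + ?C * (?E1 + ?E2 + ?E3 + ?E4)")
proof -
  have nn: "0 \<le> ?E1" "0 \<le> ?E2" "0 \<le> ?E3" "0 \<le> ?E4"
    using \<theta> wt_nonneg[OF k] by (auto intro!: mult_nonneg_nonneg)
  have \<kappa>0: "0 \<le> \<kappa>" using k \<Lambda> \<kappa>(1) by (meson divide_nonneg_pos order_trans)
  have C0: "0 \<le> ?C" using p \<Lambda> by simp
  have two: "1 \<le> (2::real) powr p" using p by (simp add: ge_one_powr_ge_zero)
  consider (none) "\<not> X2" "\<not> Y2" | (near) "X3" "Y3" "X2 \<or> Y2" | (x) "X2" "\<not> Y3" | (y) "Y2" "\<not> X3"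
    using X(3,4) by auto
  then show ?thesis
  proof cases
    case none
    then have "e = 0" "g = 0" using X(1,2) by auto
    then show ?thesis using X(5,6) nn C0 by auto
  next
    case near
    define T where "T = (\<bar>\<alpha>\<bar> + \<bar>\<beta>\<bar>) * \<bar>e - g\<bar>"
    define m where "m = (p - 1) * (\<bar>a\<bar> powr (p - 2) + \<bar>b\<bar> powr (p - 2))"
    have T: "0 \<le> T" "T powr p \<le> 2 powr p * ((\<bar>\<alpha>\<bar> powr p + \<bar>\<beta>\<bar> powr p) * \<bar>e - g\<bar> powr p)"
      using mult_right_mono[OF abs_add_powr_le'[of p "\<bar>\<alpha>\<bar>" "\<bar>\<beta>\<bar>"], of "\<bar>e - g\<bar> powr p"] p
      by (auto simp: T_def powr_mult mult.assoc)
    have "(Jp p a - Jp p b) * (a - b) * (e\<^sup>2 + g\<^sup>2) / 4 - m * T\<^sup>2 / 2 \<le> (Jp p a - Jp p b) * (\<alpha> * e\<^sup>2 - \<beta> * g\<^sup>2)"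
      unfolding T_def m_def by (rule Jp_test_lower_bound[OF p d eg(1,3)])
    then have "\<kappa> * ((Jp p a - Jp p b) * (a - b) * (e\<^sup>2 + g\<^sup>2) / 4 - m * T\<^sup>2 / 2) \<le> \<kappa> * ((Jp p a - Jp p b) * (\<alpha> * e\<^sup>2 - \<beta> * g\<^sup>2))"
      using \<kappa>0 by (rule mult_left_mono)
    then have 1: "\<kappa> * ((Jp p a - Jp p b) * (a - b)) * (e\<^sup>2 + g\<^sup>2) / 4 \<le> ?Q + \<kappa> * (m * T\<^sup>2) / 2"
      by (simp add: algebra_simps)
    \<comment> \<open>Where e = g = 1 the factor (e^2 + g^2)/4 equals 1/2, and the lower bound for
      the kernel gives 1 / \<Lambda>; together they explain the denominator 2 \<Lambda>.\<close>
    have 2: "?L \<le> \<kappa> * ((Jp p a - Jp p b) * (a - b)) * (e\<^sup>2 + g\<^sup>2) / 4"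
    proof (cases "X1 \<and> Y1")
      case True
      have "k / \<Lambda> * (2 powr (1 - p) * \<bar>\<alpha> - \<beta>\<bar> powr p) \<le> \<kappa> * ((Jp p a - Jp p b) * (a - b))"
        unfolding d by (rule mult_mono[OF \<kappa>(1) Jp_coercive(1)[OF p]]) (use \<kappa>0 in auto)
      then show ?thesis using True X(5,6) \<Lambda> by (simp add: field_simps)
    next
      case False
      have "0 \<le> (Jp p a - Jp p b) * (a - b)" unfolding Jp_coercive(2)[OF p] by simp
      then show ?thesis using False \<kappa>0 by auto
    qed
    \<comment> \<open>Inside the larger ball both factors of the quadratic remainder have size
      \<theta>, so Young is used with l = \<theta>.\<close>
    have y: "\<bar>c\<bar> powr (p - 2) * T * T \<le> \<theta> * \<theta> * \<bar>c\<bar> powr p + 2 * (\<theta> * \<theta> powr (1 - p)) * T powr p" for c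
      using young_scaled[of p "\<bar>c\<bar>" T T \<theta> \<theta>] p \<theta> T by (simp add: mult_ac)
    have "\<kappa> * (m * T\<^sup>2) / 2 \<le> (\<Lambda> * k) * (m * T\<^sup>2) / 2"
      using \<kappa> p by (intro divide_right_mono mult_right_mono) (auto simp: m_def)
    also have "\<dots> = \<Lambda> * (p - 1) * k / 2 * (\<bar>a\<bar> powr (p - 2) * T * T + \<bar>b\<bar> powr (p - 2) * T * T)"
    proof -
      have "L * k * (q * (A + B) * (T * T)) / 2 = L * q * k / 2 * (A * T * T + B * T * T)" for L q A B :: real
        by (simp add: algebra_simps)
      then show ?thesis unfolding m_def power2_eq_square .
    qed
    also have "\<dots> \<le> \<Lambda> * (p - 1) * k / 2 * (\<theta> * \<theta> * (\<bar>a\<bar> powr p + \<bar>b\<bar> powr p) + 4 * (\<theta> * \<theta> powr (1 - p)) * T powr p)"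
    proof (rule mult_left_mono)
      show "0 \<le> \<Lambda> * (p - 1) * k / 2" using \<Lambda> p k by simp
    qed (use y[of a] y[of b] in \<open>simp add: algebra_simps\<close>)
    also have "\<dots> \<le> \<Lambda> * (p - 1) * k / 2 * (\<theta> * \<theta> * (\<bar>a\<bar> powr p + \<bar>b\<bar> powr p) + 4 * (\<theta> * \<theta> powr (1 - p)) * (2 powr p * ((\<bar>\<alpha>\<bar> powr p + \<bar>\<beta>\<bar> powr p) * \<bar>e - g\<bar> powr p)))"
      using T(2) \<Lambda> p k \<theta> by (intro mult_left_mono add_left_mono) auto
    also have "\<dots> = \<Lambda> * (p - 1) / 2 * (\<theta> * \<theta> * wt1 p X2 Y2 a b k + 4 * 2 powr p * ?E2)"
      using near by (auto simp: wt1_def wt2_def algebra_simps)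
    also have "\<dots> \<le> ?C * (?E1 + ?E2)"
    proof -
      have t1: "\<theta> * \<theta> * wt1 p X2 Y2 a b k \<le> 4 * 2 powr p * ?E1"
      proof -
        have "\<theta> * \<theta> * wt1 p X2 Y2 a b k \<le> ?E1" using \<theta> wt_nonneg[OF k] by (intro mult_right_mono) auto
        also have "1 * ?E1 \<le> 4 * 2 powr p * ?E1" using nn two by (intro mult_right_mono) auto
        finally show ?thesis by simp
      qed
      have "\<Lambda> * (p - 1) / 2 * (\<theta> * \<theta> * wt1 p X2 Y2 a b k + 4 * 2 powr p * ?E2) \<le> \<Lambda> * (p - 1) * (4 * 2 powr p * ?E1 + 4 * 2 powr p * ?E2)"
      proof (rule mult_mono)
        show "\<Lambda> * (p - 1) / 2 \<le> \<Lambda> * (p - 1)" "0 \<le> \<Lambda> * (p - 1)" using p \<Lambda> by auto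
        show "\<theta> * \<theta> * wt1 p X2 Y2 a b k + 4 * 2 powr p * ?E2 \<le> 4 * 2 powr p * ?E1 + 4 * 2 powr p * ?E2"
          using t1 by simp
        show "0 \<le> \<theta> * \<theta> * wt1 p X2 Y2 a b k + 4 * 2 powr p * ?E2"
          using wt_nonneg(1)[OF k] nn by simp
      qed
      then show ?thesis by (simp add: algebra_simps)
    qed
    also have "\<dots> \<le> ?C * (?E1 + ?E2 + ?E3 + ?E4)" using nn C0 by (intro mult_left_mono) auto
    finally show ?thesis using 1 2 by linarith
  next
    case x
    then have g: "g = 0" "\<not> Y2" using X by auto
    have "\<not> (X1 \<and> Y1)" using g X(6) by auto
    have "- ?Q \<le> \<bar>(Jp p a - Jp p b) * \<kappa> * (\<alpha> * e\<^sup>2)\<bar>" using g by simp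
    also have "\<dots> \<le> \<Lambda> * (p - 1) * 4 * ((\<theta> * \<theta> + l * \<theta>) * ((\<bar>a\<bar> powr p + \<bar>b\<bar> powr p) * k)
      + (\<theta> * \<theta> powr (1 - p) + l * \<theta> powr (1 - p)) * (\<bar>\<alpha>\<bar> powr p * k) + \<theta> * l powr (1 - p) * (\<bar>\<beta>\<bar> powr p * k))"
      using \<Lambda> by (intro far_error_bound[OF p d k eg(1,2) \<kappa>0 \<kappa>(2) _ \<theta>]) simp
    also have "\<dots> = \<Lambda> * (p - 1) * 4 * (?E1 + ?E3 + ?E4)" using x g by (simp add: wt1_def wt3_def)
    also have "\<dots> \<le> \<Lambda> * (p - 1) * (4 * 2 powr p) * (?E1 + ?E2 + ?E3 + ?E4)"
      using nn p \<Lambda> two by (intro mult_mono) auto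
    finally show ?thesis using \<open>\<not> (X1 \<and> Y1)\<close> by auto
  next
    case y
    then have e: "e = 0" "\<not> X2" using X by auto
    have "\<not> (X1 \<and> Y1)" using e X(5) by auto
    have d': "\<beta> - \<alpha> = b - a" using d by simp
    have "- ?Q \<le> \<bar>(Jp p b - Jp p a) * \<kappa> * (\<beta> * g\<^sup>2)\<bar>" using e by (simp add: algebra_simps)
    also have "\<dots> \<le> \<Lambda> * (p - 1) * 4 * ((\<theta> * \<theta> + l * \<theta>) * ((\<bar>b\<bar> powr p + \<bar>a\<bar> powr p) * k)
      + (\<theta> * \<theta> powr (1 - p) + l * \<theta> powr (1 - p)) * (\<bar>\<beta>\<bar> powr p * k) + \<theta> * l powr (1 - p) * (\<bar>\<alpha>\<bar> powr p * k))"
      using \<Lambda> by (intro far_error_bound[OF p d' k eg(3,4) \<kappa>0 \<kappa>(2) _ \<theta>]) simp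
    also have "\<dots> = \<Lambda> * (p - 1) * 4 * (?E1 + ?E3 + ?E4)" using y e by (simp add: wt1_def wt3_def add.commute)
    also have "\<dots> \<le> \<Lambda> * (p - 1) * (4 * 2 powr p) * (?E1 + ?E2 + ?E3 + ?E4)"
      using nn p \<Lambda> two by (intro mult_mono) auto
    finally show ?thesis using \<open>\<not> (X1 \<and> Y1)\<close> by auto
  qed
qed

subsection \<open>Tails\<close>

text \<open>The constant of the two dyadic kernel integrals with b = p. Like the next two constants
  it is fixed as a function of the exponent and the dimension, so that uniformity in
  \<open>s\<close> is visible.\<close>

definition knl_const :: "real \<Rightarrow> nat \<Rightarrow> real" where
  "knl_const p n = unit_ball_vol n * 2 ^ n * (2 * (1 + p))"

definition nik_const :: "real \<Rightarrow> nat \<Rightarrow> real" where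
  "nik_const q n = 2 powr q * 6 ^ n * q / unit_ball_vol n"

definition far_const :: "real \<Rightarrow> nat \<Rightarrow> real" where
  "far_const p n = knl_const p n * 16 powr p"

lemma const_pos:
  "0 \<le> p \<Longrightarrow> 0 < knl_const p n" "0 < q \<Longrightarrow> 0 < nik_const q n" "0 \<le> p \<Longrightarrow> 0 < far_const p n"
  by (auto simp: knl_const_def nik_const_def far_const_def intro!: mult_pos_pos)

lemma const_nonneg[simp]:
  "0 \<le> p \<Longrightarrow> 0 \<le> knl_const p n" "0 \<le> p \<Longrightarrow> 0 \<le> nik_const p n" "0 \<le> p \<Longrightarrow> 0 \<le> far_const p n"
  by (auto simp: knl_const_def nik_const_def far_const_def)

text \<open>A gap of R/16 between balls of radius at most R gives |x - c| \<le> (15/16) |y - c|,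
  hence |x - y| \<ge> |y - c| / 16. The kernel may thus be recentred at c.\<close>

lemma far_kernel_le:
  fixes c x y :: "'a::euclidean_space"
  assumes b: "0 \<le> b" "b \<le> b'" and r: "r + R / 16 \<le> r'" "r' \<le> R" "0 < R" "0 \<le> r"
    and x: "x \<in> ball c r" and y: "y \<notin> ball c r'"
  shows "krn b (x - y) \<le> 16 powr b' * krn b (y - c)"
proof -
  have xc: "norm (x - c) < r" using x by (simp add: dist_norm norm_minus_commute)
  have yc: "r' \<le> norm (y - c)" using y by (simp add: dist_norm norm_minus_commute not_less)
  have pos: "0 < norm (y - c)" using yc r by linarith
  have "y - c = (x - c) - (x - y)" by simp
  then have tri: "norm (y - c) \<le> norm (x - c) + norm (x - y)" by (metis norm_triangle_ineq4)
  have "norm (y - c) / 16 \<le> norm (x - y)"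
  proof -
    have "norm (x - c) \<le> 15 / 16 * norm (y - c)" using xc yc r by linarith
    then show ?thesis using tri by linarith
  qed
  then have "(norm (y - c) / 16) powr b \<le> norm (x - y) powr b"
    using b by (intro powr_mono2) auto
  then have "krn b (x - y) \<le> 1 / (norm (y - c) / 16) powr b"
    unfolding krn_def using pos by (intro divide_left_mono) (auto intro!: mult_pos_pos less_le_trans[OF _ \<open>norm (y - c) / 16 \<le> norm (x - y)\<close>])
  also have "\<dots> = 16 powr b * krn b (y - c)" using pos by (simp add: powr_divide krn_def)
  also have "\<dots> \<le> 16 powr b' * krn b (y - c)" using b by (intro mult_right_mono powr_mono) auto
  finally show ?thesis .
qed

text \<open>The points are at distance at least R/16, so no singularity is met; \<sigma> \<ge> 1
  absorbs the factor 1 / \<sigma> of the tail integral.\<close>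

lemma far_mass_le:
  fixes c x :: "'a::euclidean_space"
  assumes sp: "1 \<le> \<sigma>" "\<sigma> \<le> p" and r: "r + R / 16 \<le> r'" "0 < R" and x: "x \<in> ball c r"
  shows "(\<integral>\<^sup>+y. ennreal (krn (real DIM('a) + \<sigma>) (x - y)) * indicator (- ball c r') y \<partial>lborel)
    \<le> ennreal (far_const p DIM('a) * R powr (- \<sigma>))"
proof -
  have "R / 16 \<le> norm (x - y)" if "y \<notin> ball c r'" for y
  proof -
    have "dist c y \<le> dist c x + dist x y" by (rule dist_triangle)
    then show ?thesis using that x r by (simp add: dist_norm)
  qed
  then have "(\<integral>\<^sup>+y. ennreal (krn (real DIM('a) + \<sigma>) (x - y)) * indicator (- ball c r') y \<partial>lborel)
     \<le> (\<integral>\<^sup>+y. ennreal (krn (real DIM('a) + \<sigma>) (x - y)) * indicator {z. R / 16 \<le> norm z} (x - y) \<partial>lborel)"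
    by (intro nn_integral_mono) (auto simp: indicator_def)
  also have "\<dots> = (\<integral>\<^sup>+z. ennreal (krn (real DIM('a) + \<sigma>) z) * indicator {z::'a. R / 16 \<le> norm z} z \<partial>lborel)"
    by (rule nn_integral_lborel_reflect) measurable
  also have "\<dots> \<le> ennreal (knl_const p DIM('a) / \<sigma> * (R / 16) powr (- \<sigma>))"
    unfolding knl_const_def using sp r by (intro nn_integral_krn_far) auto
  also have "\<dots> \<le> ennreal (far_const p DIM('a) * R powr (- \<sigma>))"
  proof (intro ennreal_leI)
    have k: "0 < knl_const p DIM('a)" using sp by (intro const_pos) simp
    have e: "(R / 16) powr (- \<sigma>) = 16 powr \<sigma> * R powr (- \<sigma>)" using r by (simp add: powr_divide powr_minus field_simps)
    have "knl_const p DIM('a) / \<sigma> * (16 powr \<sigma> * R powr (- \<sigma>)) \<le> knl_const p DIM('a) * (16 powr p * R powr (- \<sigma>))"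
    proof (intro mult_mono)
      show "knl_const p DIM('a) / \<sigma> \<le> knl_const p DIM('a)" using sp k by (simp add: field_simps)
    qed (use sp k in auto)
    then show "knl_const p DIM('a) / \<sigma> * (R / 16) powr (- \<sigma>) \<le> far_const p DIM('a) * R powr (- \<sigma>)"
      unfolding e far_const_def by (simp add: mult_ac)
  qed
  finally show ?thesis .
qed

lemma far_weight_le:
  fixes c :: "'a::euclidean_space"
  assumes v[measurable]: "v \<in> borel_measurable borel"
    and sp: "1 \<le> \<sigma>" "\<sigma> \<le> p" and r: "r + R / 16 \<le> r'" "0 < R"
  shows "dint (\<lambda>x y. ennreal (if x \<in> ball c r \<and> y \<notin> ball c r' then \<bar>v x\<bar> powr p * krn (real DIM('a) + \<sigma>) (x - y) else 0))
    \<le> ennreal (far_const p DIM('a) * R powr (- \<sigma>)) * Lpow p (ball c r) v"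
proof -
  have "dint (\<lambda>x y. ennreal (if x \<in> ball c r \<and> y \<notin> ball c r' then \<bar>v x\<bar> powr p * krn (real DIM('a) + \<sigma>) (x - y) else 0))
    = dint (\<lambda>x y. (ennreal (\<bar>v x\<bar> powr p) * indicator (ball c r) x) * (ennreal (krn (real DIM('a) + \<sigma>) (x - y)) * indicator (- ball c r') y))"
    by (intro arg_cong[where f = dint] ext) (auto simp: ennreal_mult indicator_def)
  also have "\<dots> \<le> ennreal (far_const p DIM('a) * R powr (- \<sigma>)) * (\<integral>\<^sup>+x. ennreal (\<bar>v x\<bar> powr p) * indicator (ball c r) x \<partial>lborel)"
  proof (rule dint_weight_le)
    fix x assume "ennreal (\<bar>v x\<bar> powr p) * indicator (ball c r) x \<noteq> 0"
    then have "x \<in> ball c r" by (auto simp: indicator_def split: if_splits)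
    then show "(\<integral>\<^sup>+y. ennreal (krn (real DIM('a) + \<sigma>) (x - y)) * indicator (- ball c r') y \<partial>lborel) \<le> ennreal (far_const p DIM('a) * R powr (- \<sigma>))"
      using sp r by (intro far_mass_le)
  qed measurable
  finally show ?thesis by (simp add: Lpow_def)
qed

text \<open>The nonlocal tail centred at \<open>c\<close>. By \<open>far_kernel_le\<close> this
  single number controls the tails seen from all points of a smaller concentric ball.\<close>

definition tail_int :: "real \<Rightarrow> real \<Rightarrow> 'a::euclidean_space \<Rightarrow> real \<Rightarrow> ('a \<Rightarrow> real) \<Rightarrow> ennreal" where
  "tail_int \<sigma> p c r v = (\<integral>\<^sup>+y. ennreal (\<bar>v y\<bar> powr p * krn (real DIM('a) + \<sigma>) (y - c)) * indicator (- ball c r) y \<partial>lborel)"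

definition tail_const :: "real \<Rightarrow> nat \<Rightarrow> real" where
  "tail_const p n = unit_ball_vol n * 16 powr (n + p)"

lemma tail_const_nonneg[simp]: "0 \<le> tail_const p n" by (simp add: tail_const_def)

text \<open>Once the kernel is recentred the integrand is a product, and the integration in x
  contributes only the volume of the ball, of order R^N.\<close>

lemma far_tail_le:
  fixes c :: "'a::euclidean_space"
  assumes v[measurable]: "v \<in> borel_measurable borel"
    and sp: "1 \<le> \<sigma>" "\<sigma> \<le> p" and r: "r + R / 16 \<le> r'" "r' \<le> R" "0 < R" "0 \<le> r"
  shows "dint (\<lambda>x y. ennreal (if x \<in> ball c r \<and> y \<notin> ball c r' then \<bar>v y\<bar> powr p * krn (real DIM('a) + \<sigma>) (x - y) else 0))
    \<le> ennreal (tail_const p DIM('a) * R powr DIM('a)) * tail_int \<sigma> p c r' v"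
proof -
  let ?N = "real DIM('a)"
  have "dint (\<lambda>x y. ennreal (if x \<in> ball c r \<and> y \<notin> ball c r' then \<bar>v y\<bar> powr p * krn (?N + \<sigma>) (x - y) else 0))
    \<le> dint (\<lambda>x y. indicator (ball c r) x * (ennreal (16 powr (?N + p)) * (ennreal (\<bar>v y\<bar> powr p * krn (?N + \<sigma>) (y - c)) * indicator (- ball c r') y)))"
  proof (intro dint_mono)
    fix x y
    show "ennreal (if x \<in> ball c r \<and> y \<notin> ball c r' then \<bar>v y\<bar> powr p * krn (?N + \<sigma>) (x - y) else 0)
      \<le> indicator (ball c r) x * (ennreal (16 powr (?N + p)) * (ennreal (\<bar>v y\<bar> powr p * krn (?N + \<sigma>) (y - c)) * indicator (- ball c r') y))"
    proof (cases "x \<in> ball c r \<and> y \<notin> ball c r'")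
      case True
      have "\<bar>v y\<bar> powr p * krn (?N + \<sigma>) (x - y) \<le> \<bar>v y\<bar> powr p * (16 powr (?N + p) * krn (?N + \<sigma>) (y - c))"
        using True sp r by (intro mult_left_mono far_kernel_le[of _ _ r R r']) auto
      then have "ennreal (\<bar>v y\<bar> powr p * krn (?N + \<sigma>) (x - y)) \<le> ennreal (16 powr (?N + p) * (\<bar>v y\<bar> powr p * krn (?N + \<sigma>) (y - c)))"
        by (intro ennreal_leI) (simp add: mult_ac)
      then show ?thesis using True by (simp add: ennreal_mult)
    qed (simp only: if_False ennreal_0 zero_le)
  qed
  also have "\<dots> = ennreal (16 powr (?N + p)) * tail_int \<sigma> p c r' v * emeasure lborel (ball c r)"
    unfolding dint_def tail_int_def
    by (simp add: nn_integral_cmult nn_integral_multc mult.commute[of "indicator _ _"])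
  also have "\<dots> \<le> ennreal (16 powr (?N + p)) * tail_int \<sigma> p c r' v * ennreal (unit_ball_vol ?N * R powr ?N)"
  proof (intro mult_left_mono)
    have "r ^ DIM('a) \<le> R powr ?N" using r by (simp add: powr_realpow power_mono)
    then show "emeasure lborel (ball c r) \<le> ennreal (unit_ball_vol ?N * R powr ?N)"
      using r by (simp add: emeasure_ball ennreal_leI mult_left_mono)
  qed simp
  also have "\<dots> = ennreal (tail_const p DIM('a) * R powr DIM('a)) * tail_int \<sigma> p c r' v"
    by (simp add: tail_const_def ennreal_mult mult_ac)
  finally show ?thesis .
qed

definition energy_const :: "real \<Rightarrow> nat \<Rightarrow> real" where
  "energy_const p n = 1 + 2 * 2 powr p * (far_const p n + tail_const p n)"

lemma energy_const_nonneg[simp]: "0 \<le> p \<Longrightarrow> 0 \<le> energy_const p n"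
  by (simp add: energy_const_def)

subsection \<open>Borel solutions on a ball\<close>

text \<open>\<open>A\<close> stands for a constant multiple of \<open>A_quantity\<close>, and \<open>\<kappa>\<close> for a Borel version of \<open>1 / K\<close>
  which also obeys the bounds on the null set where \<open>K\<close> is changed.\<close>

locale borel_solution =
  fixes p \<Lambda> s t :: real and c :: "'a::euclidean_space" and R A :: real and u f \<kappa> :: "'a \<Rightarrow> real"
  assumes p: "2 \<le> p" and \<Lambda>: "1 \<le> \<Lambda>" and s: "1 / 2 < s" "s < 1" and t: "0 \<le> t" "t \<le> s"
    and R: "0 < R" and A: "0 \<le> A"
    and u[measurable]: "u \<in> borel_measurable borel" and f[measurable]: "f \<in> borel_measurable borel"
    and \<kappa>[measurable]: "\<kappa> \<in> borel_measurable borel"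
    and \<kappa>_bounds: "\<And>z. krn (real DIM('a) + s * p) z / \<Lambda> \<le> \<kappa> z" "\<And>z. \<kappa> z \<le> \<Lambda> * krn (real DIM('a) + s * p) z"
    and u_W: "Wpow s p (ball c R) u \<le> ennreal (A * R powr (- (s * p)))"
    and u_L: "Lpow p (ball c R) u \<le> ennreal ((1 - s) * A)"
    and u_X: "tail_int (s * p) p c R u \<le> ennreal (A * R powr (- real DIM('a) - s * p))"
    and u_Y: "\<And>h. 0 < norm h \<Longrightarrow> norm h < R / 16 \<Longrightarrow> tail_int (s * p) p c (7 / 8 * R) (dlt h u)
      \<le> ennreal (A * R powr (- real DIM('a) - s * p) * (norm h / R) powr (t * p))"
    and f_W: "Wpow s (conj_exp p) (ball c R) f
      \<le> ennreal (A * R powr (- (s * p * conj_exp p) - s * conj_exp p) / (1 - s) powr conj_exp p)"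
    and f_L: "Lpow (conj_exp p) (ball c R) f < \<infinity>"
    and weak: "\<And>\<phi>. \<phi> \<in> borel_measurable borel \<Longrightarrow> (\<And>x. x \<notin> ball c R \<Longrightarrow> \<phi> x = 0) \<Longrightarrow>
      Lpow p UNIV \<phi> < \<infinity> \<Longrightarrow> Wpow s p UNIV \<phi> < \<infinity> \<Longrightarrow>
      (LINT z|(lborel \<Otimes>\<^sub>M lborel). (case z of (x, y) \<Rightarrow> Jp p (u x - u y) * \<kappa> (x - y) * (\<phi> x - \<phi> y)))
        = (LINT x|lborel. f x * \<phi> x)"
begin

abbreviation k0 :: "'a \<Rightarrow> real" where "k0 \<equiv> krn (real DIM('a) + s * p)"
text \<open>The natural unit of energy on the ball of radius R: the energy estimates below are
  multiples of \<open>D\<close>.\<close>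

abbreviation "D \<equiv> A * R powr (- (s * p))"
abbreviation "p' \<equiv> conj_exp p"

lemma sp: "1 \<le> s * p" "s * p \<le> p"
  using s p mult_mono[of "1/2" s 2 p] by auto

lemma D_nonneg: "0 \<le> D" using A by simp

lemma conj: "1 < p'" "p' \<le> 2" "1 / p' + 1 / p = 1"
  using p by (auto simp: conj_exp_def field_simps)

text \<open>The starting information on first differences, of order only s but with the gain 1 - s.
  The radius fits because 7/8 + 3/64 < 1.\<close>

lemma difference_bound:
  assumes h: "norm h \<le> R / 64"
  shows "Lpow p (ball c (7 / 8 * R)) (dlt h u)
    \<le> ennreal (nik_const p DIM('a) * ((norm h / R) powr (s * p) * ((1 - s) * A)))"
proof -
  have "Lpow p (ball c (7 / 8 * R)) (dlt h u) \<le> ennreal (nik_const p DIM('a) * (1 - s) * norm h powr (s * p)) * Wpow s p (ball c R) u"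
    unfolding nik_const_def using p s R h by (intro nikolskii) auto
  also have "\<dots> \<le> ennreal (nik_const p DIM('a) * (1 - s) * norm h powr (s * p)) * ennreal D"
    by (intro mult_left_mono u_W) auto
  also have "\<dots> = ennreal (nik_const p DIM('a) * (1 - s) * norm h powr (s * p) * D)"
    using p s A by (intro ennreal_mult[symmetric]) auto
  also have "nik_const p DIM('a) * (1 - s) * norm h powr (s * p) * D = nik_const p DIM('a) * ((norm h / R) powr (s * p) * ((1 - s) * A))"
    using R by (simp add: powr_divide powr_minus field_simps)
  finally show ?thesis .
qed

text \<open>The same with the dual exponent. The right-hand side is written so that \<mu> =
  (|h|/R)^s R^(-sp) / (1 - s) appears as the size of the difference of the source, ready for Young's
  inequality.\<close>

lemma source_difference_bound:
  assumes h: "norm h \<le> R / 64"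
  shows "Lpow p' (ball c (7 / 8 * R)) (dlt h f)
    \<le> ennreal (nik_const p' DIM('a) * (((norm h / R) powr s * R powr (- (s * p)) / (1 - s)) powr p' * ((1 - s) * A)))"
proof -
  let ?B = "A * R powr (- (s * p * p') - s * p') / (1 - s) powr p'"
  have "Lpow p' (ball c (7 / 8 * R)) (dlt h f) \<le> ennreal (nik_const p' DIM('a) * (1 - s) * norm h powr (s * p')) * Wpow s p' (ball c R) f"
    unfolding nik_const_def using conj p s R h by (intro nikolskii) auto
  also have "\<dots> \<le> ennreal (nik_const p' DIM('a) * (1 - s) * norm h powr (s * p')) * ennreal ?B"
    by (intro mult_left_mono f_W) auto
  also have "\<dots> = ennreal (nik_const p' DIM('a) * (1 - s) * norm h powr (s * p') * ?B)"
    using conj(1) s A by (intro ennreal_mult[symmetric]) auto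
  also have "nik_const p' DIM('a) * (1 - s) * norm h powr (s * p') * ?B
    = nik_const p' DIM('a) * (((norm h / R) powr s * R powr (- (s * p)) / (1 - s)) powr p' * ((1 - s) * A))"
  proof -
    have "((norm h / R) powr s * R powr (- (s * p)) / (1 - s)) powr p'
      = norm h powr (s * p') * R powr (- (s * p * p') - s * p') / (1 - s) powr p'"
      using R s by (simp add: powr_divide powr_mult powr_powr powr_diff mult.assoc)
    then show ?thesis by simp
  qed
  finally show ?thesis .
qed

text \<open>Pairs inside B_R are covered by the seminorm. For pairs with one point outside B_R the
  increment is split by the triangle inequality: the inner value is paid for by the kernel mass, the
  outer one by the tail. The radius 13/16 R leaves room for a shift of 3/4 R by h.\<close>

lemma energy_bound:
  "dint (\<lambda>x y. ennreal (if x \<in> ball c (13 / 16 * R) \<or> y \<in> ball c (13 / 16 * R) then \<bar>u x - u y\<bar> powr p * k0 (x - y) else 0))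
    \<le> ennreal (energy_const p DIM('a) * D)"
proof -
  let ?B = "ball c (13 / 16 * R)" and ?BR = "ball c R"
  define G where "G x y = ennreal (if x \<in> ?B \<and> y \<notin> ?BR then \<bar>u x\<bar> powr p * k0 (x - y) else 0)
    + ennreal (if x \<in> ?B \<and> y \<notin> ?BR then \<bar>u y\<bar> powr p * k0 (x - y) else 0)" for x y
  define G0 where "G0 x y = ennreal (\<bar>u x - u y\<bar> powr p * k0 (x - y)) * (indicator ?BR x * indicator ?BR y)" for x y
  have [measurable]: "case_prod G \<in> borel_measurable (borel \<Otimes>\<^sub>M borel)" unfolding G_def by measurable
  have [measurable]: "case_prod G0 \<in> borel_measurable (borel \<Otimes>\<^sub>M borel)" unfolding G0_def by measurable
  have sub: "x \<in> ?BR" if "x \<in> ?B" for x using that R by auto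
  have far: "ennreal (\<bar>u x - u y\<bar> powr p * k0 (x - y)) \<le> ennreal (2 powr p) * G x y"
    if "x \<in> ?B" "y \<notin> ?BR" for x y
  proof -
    have "\<bar>u x - u y\<bar> powr p * k0 (x - y) \<le> (2 powr p * (\<bar>u x\<bar> powr p + \<bar>u y\<bar> powr p)) * k0 (x - y)"
      using p by (intro mult_right_mono abs_diff_powr_le) auto
    then have "ennreal (\<bar>u x - u y\<bar> powr p * k0 (x - y)) \<le> ennreal (2 powr p * (\<bar>u x\<bar> powr p * k0 (x - y) + \<bar>u y\<bar> powr p * k0 (x - y)))"
      by (intro ennreal_leI) (simp add: algebra_simps)
    also have "\<dots> = ennreal (2 powr p) * G x y" using that unfolding G_def by (simp add: ennreal_mult ennreal_plus)
    finally show ?thesis .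
  qed
  have "dint (\<lambda>x y. ennreal (if x \<in> ?B \<or> y \<in> ?B then \<bar>u x - u y\<bar> powr p * k0 (x - y) else 0))
    \<le> dint (\<lambda>x y. G0 x y + ennreal (2 powr p) * (G x y + G y x))"
  proof (intro dint_mono)
    fix x y
    show "ennreal (if x \<in> ?B \<or> y \<in> ?B then \<bar>u x - u y\<bar> powr p * k0 (x - y) else 0) \<le> G0 x y + ennreal (2 powr p) * (G x y + G y x)"
    proof (cases "x \<in> ?BR \<and> y \<in> ?BR")
      case True
      then show ?thesis by (simp add: G0_def add_increasing2)
    next
      case False
      then consider "x \<in> ?B" "y \<notin> ?BR" | "y \<in> ?B" "x \<notin> ?BR" | "x \<notin> ?B" "y \<notin> ?B" using sub by blast
      then show ?thesis
      proof cases
        case 1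
        then show ?thesis using far[OF 1] by (simp add: distrib_left add_increasing add_increasing2)
      next
        case 2
        then show ?thesis using far[OF 2] by (simp add: distrib_left add_increasing add_increasing2 abs_minus_commute krn_minus_commute)
      qed simp
    qed
  qed
  also have "\<dots> = dint G0 + ennreal (2 powr p) * (dint G + dint G)"
    by (simp add: dint_add dint_cmult dint_swap[of G])
  also have "\<dots> \<le> ennreal D + ennreal (2 powr p) * (ennreal ((far_const p DIM('a) + tail_const p DIM('a)) * D) + ennreal ((far_const p DIM('a) + tail_const p DIM('a)) * D))"
  proof -
  have "dint G0 \<le> ennreal D" using u_W unfolding Wpow_def G0_def .
  moreover have "dint G \<le> ennreal ((far_const p DIM('a) + tail_const p DIM('a)) * D)"
  proof -
    have "dint G = dint (\<lambda>x y. ennreal (if x \<in> ?B \<and> y \<notin> ?BR then \<bar>u x\<bar> powr p * k0 (x - y) else 0))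
       + dint (\<lambda>x y. ennreal (if x \<in> ?B \<and> y \<notin> ?BR then \<bar>u y\<bar> powr p * k0 (x - y) else 0))"
      unfolding G_def by (intro dint_add) measurable
    also have "\<dots> \<le> ennreal (far_const p DIM('a) * R powr (- (s * p))) * Lpow p ?B u
      + ennreal (tail_const p DIM('a) * R powr DIM('a)) * tail_int (s * p) p c R u"
      using sp R by (intro add_mono far_weight_le far_tail_le) auto
    also have "\<dots> \<le> ennreal (far_const p DIM('a) * R powr (- (s * p))) * ennreal A
      + ennreal (tail_const p DIM('a) * R powr DIM('a)) * ennreal (A * R powr (- real DIM('a) - s * p))"
    proof (intro add_mono mult_left_mono u_X)
      have "Lpow p ?B u \<le> Lpow p ?BR u" using R by (intro Lpow_mono_set subset_ball) auto
      also have "\<dots> \<le> ennreal ((1 - s) * A)" by (rule u_L)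
      also have "\<dots> \<le> ennreal (1 * A)" using s A by (intro ennreal_leI mult_right_mono) auto
      finally show "Lpow p ?B u \<le> ennreal A" by simp
    qed auto
    also have "\<dots> = ennreal (far_const p DIM('a) * R powr (- (s * p)) * A + tail_const p DIM('a) * R powr DIM('a) * (A * R powr (- real DIM('a) - s * p)))"
      using A p by (simp add: ennreal_mult ennreal_plus less_imp_le)
    also have "far_const p DIM('a) * R powr (- (s * p)) * A + tail_const p DIM('a) * R powr DIM('a) * (A * R powr (- real DIM('a) - s * p))
       = (far_const p DIM('a) + tail_const p DIM('a)) * D"
      using R by (simp add: powr_diff powr_minus field_simps)
    finally show ?thesis .
  qed
  ultimately show ?thesis by (intro add_mono mult_left_mono) auto
  qed
  also have "ennreal D + ennreal (2 powr p) * (ennreal ((far_const p DIM('a) + tail_const p DIM('a)) * D) + ennreal ((far_const p DIM('a) + tail_const p DIM('a)) * D))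
    = ennreal (energy_const p DIM('a) * D)"
    using A p
    by (simp add: ennreal_mult[symmetric] ennreal_plus[symmetric] energy_const_def algebra_simps add_nonneg_nonneg less_imp_le del: ennreal_plus)
  finally show ?thesis .
qed

end

subsection \<open>The cutoff function\<close>

text \<open>Piecewise linear in the radius: 1 up to r, 0 from r + R/16 on, slope 16/R. Lipschitz
  regularity suffices because test functions are only required to have finite W^{s,p}
  energy.\<close>

definition cutoff :: "'a::euclidean_space \<Rightarrow> real \<Rightarrow> real \<Rightarrow> 'a \<Rightarrow> real" where
  "cutoff c r R x = max 0 (min 1 ((r + R / 16 - dist c x) * 16 / R))"

lemma borel_measurable_cutoff[measurable]: "cutoff c r R \<in> borel_measurable borel"
  unfolding cutoff_def[abs_def] by measurable

lemma cutoff_bounds: "0 \<le> cutoff c r R x" "cutoff c r R x \<le> 1"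
  by (auto simp: cutoff_def)

lemma cutoff_eq_1: "0 < R \<Longrightarrow> x \<in> ball c r \<Longrightarrow> cutoff c r R x = 1"
  by (simp add: cutoff_def field_simps)

lemma cutoff_support:
  assumes "0 < R" "cutoff c r R x \<noteq> 0"
  shows "x \<in> ball c (r + R / 16)"
proof -
  have "0 < (r + R / 16 - dist c x) * 16 / R" using assms(2) by (auto simp: cutoff_def)
  then show ?thesis using assms(1) by (simp add: zero_less_divide_iff)
qed

lemma cutoff_lipschitz:
  fixes c :: "'a::euclidean_space"
  assumes "0 < R"
  shows "\<bar>cutoff c r R x - cutoff c r R y\<bar> \<le> 16 / R * norm (x - y)"
proof -
  have "\<bar>max 0 (min 1 a) - max 0 (min 1 b)\<bar> \<le> \<bar>a - b\<bar>" for a b :: real by auto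
  then have "\<bar>cutoff c r R x - cutoff c r R y\<bar> \<le> \<bar>(r + R / 16 - dist c x) * 16 / R - (r + R / 16 - dist c y) * 16 / R\<bar>"
    unfolding cutoff_def .
  also have "\<dots> = \<bar>dist c y - dist c x\<bar> * (16 / R)"
  proof -
    have "(r + R / 16 - dist c x) * 16 / R - (r + R / 16 - dist c y) * 16 / R = (dist c y - dist c x) * (16 / R)"
      by (simp add: diff_divide_distrib algebra_simps)
    then show ?thesis using assms by (simp only: abs_mult) simp
  qed
  also have "\<dots> \<le> norm (x - y) * (16 / R)"
  proof (rule mult_right_mono)
    show "\<bar>dist c y - dist c x\<bar> \<le> norm (x - y)"
      using dist_triangle[of c y x] dist_triangle[of c x y] by (auto simp: dist_norm norm_minus_commute)
  qed (use assms in simp)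
  finally show ?thesis by (simp only: mult.commute)
qed

text \<open>The exponent exceeds -N by p(1 - s), which is the source of 1 / (1 - s). The difference
  bounds carry the compensating factor.\<close>

lemma near_kernel_le:
  fixes c x :: "'a::euclidean_space"
  assumes "1 \<le> p" "0 < s" "s < 1" "0 < R" "x \<in> ball c R"
  shows "(\<integral>\<^sup>+y. ennreal (norm (x - y) powr (p - s * p - real DIM('a))) * indicator (ball c R) y \<partial>lborel)
    \<le> ennreal (knl_const p DIM('a) * 2 powr p / (1 - s) * R powr (p - s * p))"
proof -
  have sp: "0 < p - s * p" "p - s * p \<le> p" using assms by auto
  have "(\<integral>\<^sup>+y. ennreal (norm (x - y) powr (p - s * p - real DIM('a))) * indicator (ball c R) y \<partial>lborel)
    \<le> (\<integral>\<^sup>+y. ennreal (norm (x - y) powr (p - s * p - real DIM('a))) * indicator (ball 0 (2 * R)) (x - y) \<partial>lborel)"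
  proof (intro nn_integral_mono)
    fix y
    have "norm (x - y) < 2 * R" if "y \<in> ball c R"
      using dist_triangle2[of x y c] that assms(5) by (simp add: dist_norm norm_minus_commute)
    then show "ennreal (norm (x - y) powr (p - s * p - real DIM('a))) * indicator (ball c R) y
      \<le> ennreal (norm (x - y) powr (p - s * p - real DIM('a))) * indicator (ball 0 (2 * R)) (x - y)"
      by (auto simp: indicator_def)
  qed
  also have "\<dots> = (\<integral>\<^sup>+z. ennreal (norm z powr (p - s * p - real DIM('a))) * indicator (ball (0::'a) (2 * R)) z \<partial>lborel)"
    by (rule nn_integral_lborel_reflect) measurable
  also have "\<dots> \<le> ennreal (knl_const p DIM('a) / (p - s * p) * (2 * R) powr (p - s * p))"
    unfolding knl_const_def using sp assms by (intro nn_integral_norm_powr_near) auto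
  also have "\<dots> \<le> ennreal (knl_const p DIM('a) * 2 powr p / (1 - s) * R powr (p - s * p))"
  proof (intro ennreal_leI)
    have "(1 - s) * 1 \<le> (1 - s) * p" using assms by (intro mult_left_mono) auto
    then have "knl_const p DIM('a) / (p - s * p) \<le> knl_const p DIM('a) / (1 - s)"
      using assms sp mult_pos_pos[OF sp(1), of "1 - s"] by (intro divide_left_mono) (auto simp: left_diff_distrib)
    moreover have "(2 * R) powr (p - s * p) \<le> 2 powr p * R powr (p - s * p)"
      using assms sp by (simp add: powr_mult mult_right_mono)
    ultimately have "knl_const p DIM('a) / (p - s * p) * (2 * R) powr (p - s * p) \<le> knl_const p DIM('a) / (1 - s) * (2 powr p * R powr (p - s * p))"
      using assms sp by (intro mult_mono) auto
    then show "knl_const p DIM('a) / (p - s * p) * (2 * R) powr (p - s * p) \<le> knl_const p DIM('a) * 2 powr p / (1 - s) * R powr (p - s * p)"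
      by simp
  qed
  finally show ?thesis .
qed

definition core_tail_const :: "real \<Rightarrow> nat \<Rightarrow> real" where
  "core_tail_const p n = tail_const p n * (1 + 8 powr (n + p) * nik_const p n)"

lemma core_tail_const_nonneg[simp]: "0 \<le> p \<Longrightarrow> 0 \<le> core_tail_const p n"
  by (simp add: core_tail_const_def)

section \<open>Energies of the weights and the tail of a difference\<close>

context borel_solution
begin

text \<open>Two copies of \<open>energy_bound\<close>, one of them translated by h; the shifted
  support stays within radius 13/16 R.\<close>

lemma wt1_energy:
  assumes h: "norm h \<le> R / 64" and r: "r \<le> 3 / 4 * R"
  shows "dint (\<lambda>x y. ennreal (wt1 p (x \<in> ball c r) (y \<in> ball c r) (u (x + h) - u (y + h)) (u x - u y) (k0 (x - y))))
    \<le> ennreal (2 * energy_const p DIM('a) * D)"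
proof -
  let ?B = "ball c (13 / 16 * R)"
  define E where "E x y = ennreal (if x \<in> ?B \<or> y \<in> ?B then \<bar>u x - u y\<bar> powr p * k0 (x - y) else 0)" for x y
  have [measurable]: "case_prod E \<in> borel_measurable (borel \<Otimes>\<^sub>M borel)" unfolding E_def by measurable
  have sub: "x \<in> ?B" "x + h \<in> ?B" if "x \<in> ball c r" for x
  proof -
    have "dist c (x + h) \<le> dist c x + norm h" by norm
    then show "x \<in> ?B" "x + h \<in> ?B" using that h r R by auto
  qed
  have "dint (\<lambda>x y. ennreal (wt1 p (x \<in> ball c r) (y \<in> ball c r) (u (x + h) - u (y + h)) (u x - u y) (k0 (x - y))))
    \<le> dint (\<lambda>x y. E (x + h) (y + h) + E x y)"
  proof (intro dint_mono)
    fix x y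
    show "ennreal (wt1 p (x \<in> ball c r) (y \<in> ball c r) (u (x + h) - u (y + h)) (u x - u y) (k0 (x - y))) \<le> E (x + h) (y + h) + E x y"
    proof (cases "x \<in> ball c r \<or> y \<in> ball c r")
      case True
      then have "x \<in> ?B \<or> y \<in> ?B" "x + h \<in> ?B \<or> y + h \<in> ?B" using sub by auto
      then show ?thesis using True by (simp only: wt1_def E_def if_True) (simp add: distrib_right)
    qed (simp only: wt1_def if_False ennreal_0 zero_le)
  qed
  also have "\<dots> = dint E + dint E"
    by (subst dint_add) (auto simp: dint_shift)
  also have "\<dots> \<le> ennreal (energy_const p DIM('a) * D) + ennreal (energy_const p DIM('a) * D)"
    unfolding E_def by (intro add_mono energy_bound)
  also have "\<dots> = ennreal (2 * energy_const p DIM('a) * D)"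
    using p A by (simp add: ennreal_plus[symmetric] del: ennreal_plus)
  finally show ?thesis .
qed

text \<open>The Lipschitz cutoff turns the kernel into (16/R)^p |x - y|^(p - sp - N), which is
  integrable near the diagonal with mass of order 1 / (1 - s). This cancels against the factor 1 - s
  in the hypothesis on \<open>w\<close>; 32 is 16 from the slope times 2 from the diameter.\<close>

lemma wt2_energy:
  assumes w[measurable]: "w \<in> borel_measurable borel" and r: "r3 \<le> R" and \<theta>: "0 < \<theta>"
    and L: "Lpow p (ball c r3) w \<le> ennreal (\<theta> powr p * ((1 - s) * A))"
  shows "dint (\<lambda>x y. ennreal (wt2 p (x \<in> ball c r3) (y \<in> ball c r3) (w x) (w y) (cutoff c r R x) (cutoff c r R y) (k0 (x - y))))
    \<le> ennreal (2 * (32 powr p * knl_const p DIM('a)) * (\<theta> powr p * D))"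
proof -
  let ?B = "ball c r3" and ?\<eta> = "cutoff c r R"
  define q where "q x y = ennreal ((16 / R) powr p) * (ennreal (norm (x - y) powr (p - s * p - real DIM('a))) * indicator (ball c R) y)" for x y
  define F where "F x y = (ennreal (\<bar>w x\<bar> powr p) * indicator ?B x) * q x y" for x y
  have [measurable]: "case_prod q \<in> borel_measurable (borel \<Otimes>\<^sub>M borel)" unfolding q_def by measurable
  have [measurable]: "case_prod F \<in> borel_measurable (borel \<Otimes>\<^sub>M borel)" unfolding F_def by measurable
  have sub: "x \<in> ball c R" if "x \<in> ?B" for x using that r by auto
  have kq: "ennreal (\<bar>?\<eta> x - ?\<eta> y\<bar> powr p * k0 (x - y)) \<le> q x y" if "y \<in> ball c R" for x y
  proof (cases "x = y")
    case False
    have "\<bar>?\<eta> x - ?\<eta> y\<bar> powr p * k0 (x - y) \<le> (16 / R * norm (x - y)) powr p * k0 (x - y)"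
      using cutoff_lipschitz[OF R] p by (intro mult_right_mono powr_mono2) auto
    also have "\<dots> = (16 / R) powr p * norm (x - y) powr (p - s * p - real DIM('a))"
      unfolding powr_mult using False R by (simp add: krn_def powr_diff powr_add mult.commute)
    finally show ?thesis using that unfolding q_def by (simp add: ennreal_mult[symmetric] ennreal_leI)
  qed (use p in auto)
  have q_sym: "q x y = q y x" if "x \<in> ball c R" "y \<in> ball c R" for x y
    using that by (simp add: q_def norm_minus_commute)
  have "dint (\<lambda>x y. ennreal (wt2 p (x \<in> ?B) (y \<in> ?B) (w x) (w y) (?\<eta> x) (?\<eta> y) (k0 (x - y)))) \<le> dint (\<lambda>x y. F x y + F y x)"
  proof (intro dint_mono)
    fix x y
    show "ennreal (wt2 p (x \<in> ?B) (y \<in> ?B) (w x) (w y) (?\<eta> x) (?\<eta> y) (k0 (x - y))) \<le> F x y + F y x"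
    proof (cases "x \<in> ?B \<and> y \<in> ?B")
      case True
      have "ennreal (wt2 p (x \<in> ?B) (y \<in> ?B) (w x) (w y) (?\<eta> x) (?\<eta> y) (k0 (x - y)))
        = (ennreal (\<bar>w x\<bar> powr p) + ennreal (\<bar>w y\<bar> powr p)) * ennreal (\<bar>?\<eta> x - ?\<eta> y\<bar> powr p * k0 (x - y))"
        using True by (simp add: wt2_def ennreal_mult ennreal_plus)
      also have "\<dots> \<le> (ennreal (\<bar>w x\<bar> powr p) + ennreal (\<bar>w y\<bar> powr p)) * q x y"
        using True sub by (intro mult_left_mono kq) auto
      also have "\<dots> = F x y + F y x" using True sub q_sym[of x y] by (simp add: F_def distrib_right)
      finally show ?thesis .
    qed (auto simp: wt2_def)
  qed
  also have "\<dots> = dint F + dint F" by (simp add: dint_add dint_swap[of F])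
  also have "\<dots> \<le> ennreal (32 powr p * knl_const p DIM('a) * (\<theta> powr p * D)) + ennreal (32 powr p * knl_const p DIM('a) * (\<theta> powr p * D))"
  proof -
    let ?c = "(16 / R) powr p * (knl_const p DIM('a) * 2 powr p / (1 - s) * R powr (p - s * p))"
    have "dint F \<le> ennreal ?c * (\<integral>\<^sup>+x. ennreal (\<bar>w x\<bar> powr p) * indicator ?B x \<partial>lborel)"
      unfolding F_def
    proof (rule dint_weight_le)
      fix x assume "ennreal (\<bar>w x\<bar> powr p) * indicator ?B x \<noteq> 0"
      then have x: "x \<in> ball c R" using sub by (auto simp: indicator_def split: if_splits)
      have "(\<integral>\<^sup>+y. q x y \<partial>lborel) = ennreal ((16 / R) powr p) * (\<integral>\<^sup>+y. ennreal (norm (x - y) powr (p - s * p - real DIM('a))) * indicator (ball c R) y \<partial>lborel)"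
        unfolding q_def by (rule nn_integral_cmult) measurable
      also have "\<dots> \<le> ennreal ((16 / R) powr p) * ennreal (knl_const p DIM('a) * 2 powr p / (1 - s) * R powr (p - s * p))"
        using p s R x by (intro mult_left_mono near_kernel_le) auto
      also have "\<dots> = ennreal ?c" using p s by (intro ennreal_mult[symmetric]) auto
      finally show "(\<integral>\<^sup>+y. q x y \<partial>lborel) \<le> ennreal ?c" .
    qed measurable
    also have "\<dots> \<le> ennreal ?c * ennreal (\<theta> powr p * ((1 - s) * A))"
      using L unfolding Lpow_def by (intro mult_left_mono) auto
    also have "\<dots> = ennreal (?c * (\<theta> powr p * ((1 - s) * A)))"
      using p s A by (intro ennreal_mult[symmetric]) auto
    also have "?c * (\<theta> powr p * ((1 - s) * A)) = 32 powr p * knl_const p DIM('a) * (\<theta> powr p * D)"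
    proof -
      have "(32::real) powr p = 16 powr p * 2 powr p" by (simp add: powr_mult[symmetric])
      then show ?thesis using R s by (simp add: powr_divide powr_diff powr_minus field_simps)
    qed
    finally show ?thesis by (intro add_mono)
  qed
  also have "\<dots> = ennreal (2 * (32 powr p * knl_const p DIM('a)) * (\<theta> powr p * D))"
    using p A by (simp add: ennreal_plus[symmetric] del: ennreal_plus)
  finally show ?thesis .
qed

lemma wt3_split:
  assumes G: "\<And>x y. G x y = ennreal (if x \<in> B2 \<and> y \<notin> B3 then F x y else 0)"
    and F: "\<And>x y. 0 \<le> F x y" and sym: "\<And>x y. F y x = \<bar>b x y\<bar> powr p * k0 (x - y)" "\<And>x y. F x y = \<bar>a x y\<bar> powr p * k0 (x - y)"
  shows "ennreal (wt3 p (x \<in> B2) (y \<in> B2) (x \<in> B3) (y \<in> B3) (a x y) (b x y) (k0 (x - y))) = G x y + G y x"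
  unfolding wt3_def G sym(1)[symmetric] sym(2)[symmetric] using F by (auto simp: ennreal_plus[symmetric] simp del: ennreal_plus)

text \<open>The kernel is not singular at distance R/16, so here the factor 1 - s is simply bounded
  by 1.\<close>

lemma wt3_energy:
  assumes w[measurable]: "w \<in> borel_measurable borel" and r: "r2 + R / 16 \<le> r3" and \<theta>: "0 < \<theta>"
    and L: "Lpow p (ball c r3) w \<le> ennreal (\<theta> powr p * ((1 - s) * A))"
  shows "dint (\<lambda>x y. ennreal (wt3 p (x \<in> ball c r2) (y \<in> ball c r2) (x \<in> ball c r3) (y \<in> ball c r3) (w x) (w y) (k0 (x - y))))
    \<le> ennreal (2 * far_const p DIM('a) * (\<theta> powr p * D))"
proof -
  define G where "G x y = ennreal (if x \<in> ball c r2 \<and> y \<notin> ball c r3 then \<bar>w x\<bar> powr p * k0 (x - y) else 0)" for x y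
  have [measurable]: "case_prod G \<in> borel_measurable (borel \<Otimes>\<^sub>M borel)" unfolding G_def by measurable
  have "dint (\<lambda>x y. ennreal (wt3 p (x \<in> ball c r2) (y \<in> ball c r2) (x \<in> ball c r3) (y \<in> ball c r3) (w x) (w y) (k0 (x - y))))
     = dint (\<lambda>x y. G x y + G y x)"
    by (intro arg_cong[where f = dint] ext wt3_split) (auto simp: G_def krn_minus_commute)
  also have "\<dots> = dint G + dint G" by (simp add: dint_add dint_swap[of G])
  also have "\<dots> \<le> ennreal (far_const p DIM('a) * (\<theta> powr p * D)) + ennreal (far_const p DIM('a) * (\<theta> powr p * D))"
  proof -
    have "dint G \<le> ennreal (far_const p DIM('a) * R powr (- (s * p))) * Lpow p (ball c r2) w"
      unfolding G_def using sp R r by (intro far_weight_le) auto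
    also have "\<dots> \<le> ennreal (far_const p DIM('a) * R powr (- (s * p))) * ennreal (\<theta> powr p * A)"
    proof (intro mult_left_mono)
      have "Lpow p (ball c r2) w \<le> Lpow p (ball c r3) w" using r R by (intro Lpow_mono_set subset_ball) auto
      also have "\<dots> \<le> ennreal (\<theta> powr p * ((1 - s) * A))" by (rule L)
      also have "\<dots> \<le> ennreal (\<theta> powr p * (1 * A))" using s A by (intro ennreal_leI mult_left_mono mult_right_mono) auto
      finally show "Lpow p (ball c r2) w \<le> ennreal (\<theta> powr p * A)" by simp
    qed simp
    also have "\<dots> = ennreal (far_const p DIM('a) * R powr (- (s * p)) * (\<theta> powr p * A))"
      using p A by (intro ennreal_mult[symmetric]) auto
    also have "far_const p DIM('a) * R powr (- (s * p)) * (\<theta> powr p * A) = far_const p DIM('a) * (\<theta> powr p * D)" by simp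
    finally show ?thesis by (intro add_mono)
  qed
  also have "\<dots> = ennreal (2 * far_const p DIM('a) * (\<theta> powr p * D))"
    using p A by (simp add: ennreal_plus[symmetric] del: ennreal_plus)
  finally show ?thesis .
qed

text \<open>Beyond 7/8 R this is the assumption \<open>u_Y\<close>. On the annulus in between the
  weight is at most (R/8)^(-N - sp) and \<open>difference_bound\<close> applies; its order s is at
  least the tail order t, and |h| \<le> R.\<close>

lemma difference_tail:
  assumes h: "0 < norm h" "norm h \<le> R / 64" and r: "R / 8 \<le> r3"
  shows "tail_int (s * p) p c r3 (dlt h u)
    \<le> ennreal ((1 + 8 powr (real DIM('a) + p) * nik_const p DIM('a)) * (A * R powr (- real DIM('a) - s * p) * (norm h / R) powr (t * p)))"
proof -
  let ?w = "dlt h u"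
  define b where "b = real DIM('a) + s * p"
  have b: "0 \<le> b" "b \<le> real DIM('a) + p" using sp by (auto simp: b_def)
  have \<rho>: "0 < norm h / R" "norm h / R \<le> 1" using h R by auto
  have "tail_int (s * p) p c r3 ?w \<le> (\<integral>\<^sup>+y. (ennreal (\<bar>?w y\<bar> powr p * krn b (y - c)) * indicator (- ball c (7 / 8 * R)) y
    + ennreal ((R / 8) powr (- b)) * (ennreal (\<bar>?w y\<bar> powr p) * indicator (ball c (7 / 8 * R)) y)) \<partial>lborel)"
    unfolding tail_int_def b_def[symmetric]
  proof (intro nn_integral_mono)
    fix y
    show "ennreal (\<bar>?w y\<bar> powr p * krn b (y - c)) * indicator (- ball c r3) y
      \<le> ennreal (\<bar>?w y\<bar> powr p * krn b (y - c)) * indicator (- ball c (7 / 8 * R)) y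
    + ennreal ((R / 8) powr (- b)) * (ennreal (\<bar>?w y\<bar> powr p) * indicator (ball c (7 / 8 * R)) y)"
    proof (cases "y \<in> ball c (7 / 8 * R) \<and> y \<notin> ball c r3")
      case True
      have yR: "R / 8 \<le> norm (y - c)" using True r by (simp add: dist_norm norm_minus_commute)
      have "krn b (y - c) = norm (y - c) powr (- b)" by (simp add: krn_def powr_minus_divide)
      also have "\<dots> \<le> (R / 8) powr (- b)" using yR R b by (intro powr_mono2') auto
      finally have "\<bar>?w y\<bar> powr p * krn b (y - c) \<le> (R / 8) powr (- b) * \<bar>?w y\<bar> powr p"
        unfolding mult.commute[of "(R / 8) powr (- b)"] by (intro mult_left_mono) auto
      then have "ennreal (\<bar>?w y\<bar> powr p * krn b (y - c)) \<le> ennreal ((R / 8) powr (- b)) * ennreal (\<bar>?w y\<bar> powr p)"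
        by (simp add: ennreal_mult[symmetric] ennreal_leI)
      then show ?thesis using True by simp
    qed (auto simp: indicator_def)
  qed
  also have "\<dots> = tail_int (s * p) p c (7 / 8 * R) ?w + ennreal ((R / 8) powr (- b)) * Lpow p (ball c (7 / 8 * R)) ?w"
    unfolding tail_int_def Lpow_def b_def by (simp add: nn_integral_add nn_integral_cmult)
  also have "\<dots> \<le> ennreal (A * R powr (- real DIM('a) - s * p) * (norm h / R) powr (t * p))
    + ennreal ((R / 8) powr (- b)) * ennreal (nik_const p DIM('a) * ((norm h / R) powr (s * p) * ((1 - s) * A)))"
    using h R by (intro add_mono mult_left_mono u_Y difference_bound) auto
  also have "\<dots> = ennreal (A * R powr (- real DIM('a) - s * p) * (norm h / R) powr (t * p)
    + (R / 8) powr (- b) * (nik_const p DIM('a) * ((norm h / R) powr (s * p) * ((1 - s) * A))))"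
    using p s A by (simp add: ennreal_plus ennreal_mult)
  also have "\<dots> \<le> ennreal ((1 + 8 powr (real DIM('a) + p) * nik_const p DIM('a)) * (A * R powr (- real DIM('a) - s * p) * (norm h / R) powr (t * p)))"
  proof (intro ennreal_leI)
    have e: "(R / 8) powr (- b) = 8 powr b * R powr (- real DIM('a) - s * p)"
      using R by (simp add: b_def powr_divide powr_minus powr_diff powr_add field_simps)
    have pw: "8 powr b \<le> 8 powr (real DIM('a) + p)" "(norm h / R) powr (s * p) \<le> (norm h / R) powr (t * p)"
      using b(2) powr_mono'[of "t * p" "s * p" "norm h / R"] \<rho> t p by (auto intro!: powr_mono mult_right_mono)
    have "8 powr b * R powr (- real DIM('a) - s * p) * (nik_const p DIM('a) * ((norm h / R) powr (s * p) * ((1 - s) * A)))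
      \<le> 8 powr (real DIM('a) + p) * R powr (- real DIM('a) - s * p) * (nik_const p DIM('a) * ((norm h / R) powr (t * p) * (1 * A)))"
    proof (intro mult_mono[OF mult_right_mono[OF pw(1)]] mult_left_mono mult_mono[OF pw(2)] mult_right_mono)
    qed (use p s A in auto)
    moreover have "(1 + E * n) * (A * r * q) = A * r * q + E * r * (n * (q * (1 * A)))" for E n r q :: real
      by (simp add: algebra_simps)
    ultimately show "A * R powr (- real DIM('a) - s * p) * (norm h / R) powr (t * p)
    + (R / 8) powr (- b) * (nik_const p DIM('a) * ((norm h / R) powr (s * p) * ((1 - s) * A)))
     \<le> (1 + 8 powr (real DIM('a) + p) * nik_const p DIM('a)) * (A * R powr (- real DIM('a) - s * p) * (norm h / R) powr (t * p))"
      unfolding e by simp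
  qed
  finally show ?thesis .
qed

text \<open>Here the value at the far point enters, so the bound is governed by the tail and has
  order tp in |h| / R, independently of \<theta>.\<close>

lemma wt3_swapped_energy:
  assumes h: "0 < norm h" "norm h \<le> R / 64" and r: "r2 + R / 16 \<le> r3" "r3 \<le> R" "R / 8 \<le> r3" "0 \<le> r2"
  shows "dint (\<lambda>x y. ennreal (wt3 p (x \<in> ball c r2) (y \<in> ball c r2) (x \<in> ball c r3) (y \<in> ball c r3) (dlt h u y) (dlt h u x) (k0 (x - y))))
    \<le> ennreal (2 * core_tail_const p DIM('a) * ((norm h / R) powr (t * p) * D))"
proof -
  let ?w = "dlt h u"
  define G where "G x y = ennreal (if x \<in> ball c r2 \<and> y \<notin> ball c r3 then \<bar>?w y\<bar> powr p * k0 (x - y) else 0)" for x y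
  have [measurable]: "case_prod G \<in> borel_measurable (borel \<Otimes>\<^sub>M borel)" unfolding G_def by measurable
  have "dint (\<lambda>x y. ennreal (wt3 p (x \<in> ball c r2) (y \<in> ball c r2) (x \<in> ball c r3) (y \<in> ball c r3) (?w y) (?w x) (k0 (x - y))))
     = dint (\<lambda>x y. G x y + G y x)"
    by (intro arg_cong[where f = dint] ext wt3_split) (auto simp: G_def krn_minus_commute)
  also have "\<dots> = dint G + dint G" by (simp add: dint_add dint_swap[of G])
  also have "\<dots> \<le> ennreal (core_tail_const p DIM('a) * ((norm h / R) powr (t * p) * D)) + ennreal (core_tail_const p DIM('a) * ((norm h / R) powr (t * p) * D))"
  proof -
    let ?T = "(1 + 8 powr (real DIM('a) + p) * nik_const p DIM('a)) * (A * R powr (- real DIM('a) - s * p) * (norm h / R) powr (t * p))"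
    have "dint G \<le> ennreal (tail_const p DIM('a) * R powr DIM('a)) * tail_int (s * p) p c r3 ?w"
      unfolding G_def using sp R r by (intro far_tail_le) auto
    also have "\<dots> \<le> ennreal (tail_const p DIM('a) * R powr DIM('a)) * ennreal ?T"
      by (intro mult_left_mono difference_tail h r) simp
    also have "\<dots> = ennreal (tail_const p DIM('a) * R powr DIM('a) * ?T)"
      using p A by (intro ennreal_mult[symmetric]) auto
    also have "tail_const p DIM('a) * R powr DIM('a) * ?T = core_tail_const p DIM('a) * ((norm h / R) powr (t * p) * D)"
    proof -
      have "R powr DIM('a) * R powr (- real DIM('a) - s * p) = R powr (- (s * p))"
        using R by (simp add: powr_add[symmetric] powr_gt_zero)
      moreover have "T * r * ((1 + K) * (A * r' * q)) = T * (1 + K) * (q * (A * (r * r')))" for T r r' K q :: real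
        by (simp only: mult_ac)
      ultimately show ?thesis by (simp only: core_tail_const_def)
    qed
    finally show ?thesis by (intro add_mono)
  qed
  also have "\<dots> = ennreal (2 * core_tail_const p DIM('a) * ((norm h / R) powr (t * p) * D))"
    using p A by (simp add: ennreal_plus[symmetric] del: ennreal_plus)
  finally show ?thesis .
qed

end

subsection \<open>Testing the equation with a localized finite difference\<close>

lemma lborel_pair_integral_shift:
  fixes F :: "'a::euclidean_space \<Rightarrow> 'a \<Rightarrow> real"
  assumes [measurable]: "case_prod F \<in> borel_measurable (borel \<Otimes>\<^sub>M borel)"
  shows "(LINT z|(lborel \<Otimes>\<^sub>M lborel). (case z of (x, y) \<Rightarrow> F (x + h) (y + h)))
    = (LINT z|(lborel \<Otimes>\<^sub>M lborel). case_prod F z)"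
proof -
  have [measurable]: "case_prod F \<in> borel_measurable (borel :: ('a \<times> 'a) measure)"
    using assms by (simp add: borel_prod)
  have "(LINT z|lborel. case_prod F z) = (LINT z|distr lborel borel ((+) (h, h)). case_prod F z)"
    by (simp add: lborel_distr_plus)
  also have "\<dots> = (LINT z|lborel. case_prod F ((h, h) + z))"
    by (rule integral_distr) auto
  also have "(\<lambda>z. case_prod F ((h, h) + z)) = (\<lambda>z. case z of (x, y) \<Rightarrow> F (x + h) (y + h))"
    by (auto simp: add.commute)
  finally show ?thesis by (simp add: lborel_prod)
qed

lemma lborel_integral_shift:
  fixes g :: "'a::euclidean_space \<Rightarrow> real"
  assumes [measurable]: "g \<in> borel_measurable borel"
  shows "(LINT x|lborel. g (x + h)) = (LINT x|lborel. g x)"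
proof -
  have "(LINT x|lborel. g x) = (LINT x|distr lborel borel ((+) h). g x)"
    by (simp add: lborel_distr_plus)
  also have "\<dots> = (LINT x|lborel. g (h + x))"
    by (rule integral_distr) auto
  finally show ?thesis by (simp add: add.commute)
qed

lemma integral_le_ennreal:
  fixes F :: "'b \<Rightarrow> real"
  assumes F[measurable]: "F \<in> borel_measurable M" and le: "(\<integral>\<^sup>+x. ennreal \<bar>F x\<bar> \<partial>M) \<le> ennreal q" and q: "0 \<le> q"
  shows "integrable M F" "(LINT x|M. F x) \<le> q"
proof -
  show I: "integrable M F"
    by (rule integrableI_bounded) (use le in \<open>auto intro: le_less_trans\<close>)
  have "ennreal (LINT x|M. \<bar>F x\<bar>) = (\<integral>\<^sup>+x. ennreal \<bar>F x\<bar> \<partial>M)"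
    using I by (intro nn_integral_eq_integral[symmetric]) auto
  then have "ennreal (LINT x|M. \<bar>F x\<bar>) \<le> ennreal q" using le by simp
  then have "(LINT x|M. \<bar>F x\<bar>) \<le> q" using q by (simp add: ennreal_le_iff)
  moreover have "(LINT x|M. F x) \<le> (LINT x|M. \<bar>F x\<bar>)" using I by (intro integral_mono) auto
  ultimately show "(LINT x|M. F x) \<le> q" by simp
qed

text \<open>The flux \<open>Q\<close> has no sign, so its integral cannot be taken in
  \<open>ennreal\<close>. The pointwise inequality is integrated in the reals, where finiteness of
  \<open>E\<close> and integrability of \<open>Q\<close> are available.\<close>

lemma nn_integral_le_of_pointwise:
  fixes G Q E :: "'b \<Rightarrow> real"
  assumes [measurable]: "G \<in> borel_measurable M" "E \<in> borel_measurable M"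
    and Q: "integrable M Q" "(LINT x|M. Q x) \<le> q" and E: "\<And>x. 0 \<le> E x" "(\<integral>\<^sup>+x. ennreal (E x) \<partial>M) \<le> ennreal e"
    and e: "0 \<le> e" and G: "\<And>x. 0 \<le> G x" "\<And>x. G x \<le> Q x + E x"
  shows "(\<integral>\<^sup>+x. ennreal (G x) \<partial>M) \<le> ennreal (q + e)"
proof -
  have E': "integrable M E" "(LINT x|M. E x) \<le> e"
    using integral_le_ennreal[of E M e] E e by auto
  have "(\<integral>\<^sup>+x. ennreal (G x) \<partial>M) \<le> (\<integral>\<^sup>+x. ennreal (Q x + E x) \<partial>M)"
    by (intro nn_integral_mono ennreal_leI G)
  also have "\<dots> = ennreal (LINT x|M. Q x + E x)"
    using Q(1) E'(1) order_trans[OF G(1) G(2)] by (intro nn_integral_eq_integral) auto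
  also have "\<dots> \<le> ennreal (q + e)"
    using Q E' by (intro ennreal_leI) simp
  finally show ?thesis .
qed

text \<open>The factor in front inverts the coercivity constant of \<open>test_pointwise\<close>.
  The bracket collects the source term and the energies of the four weights.\<close>

definition core_const :: "real \<Rightarrow> real \<Rightarrow> nat \<Rightarrow> real" where
  "core_const p \<Lambda> n = 2 * \<Lambda> * 2 powr (p - 1) * (nik_const (conj_exp p) n + 1
     + \<Lambda> * (p - 1) * (4 * 2 powr p) * (2 * energy_const p n + 2 * (32 powr p * knl_const p n) + 2 * far_const p n + 2 * core_tail_const p n))"

context borel_solution
begin

lemma young_conj:
  assumes "0 \<le> x" "0 \<le> y"
  shows "x * y \<le> x powr p' + y powr p"
proof -
  have "x * y \<le> x powr p' / p' + y powr p / p"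
    using conj p assms by (intro Youngs_inequality) auto
  also have "\<dots> \<le> x powr p' / 1 + y powr p / 1"
    using conj p by (intro add_mono divide_left_mono) auto
  finally show ?thesis by simp
qed

lemma product_integrable:
  assumes [measurable]: "g \<in> borel_measurable borel" "\<phi> \<in> borel_measurable borel" "B \<in> sets borel"
    and fin: "Lpow p' B g < \<infinity>" "Lpow p UNIV \<phi> < \<infinity>" and supp: "\<And>x. x \<notin> B \<Longrightarrow> \<phi> x = 0"
  shows "integrable lborel (\<lambda>x. g x * \<phi> x)"
proof (rule integrableI_bounded)
  have "(\<integral>\<^sup>+x. ennreal (norm (g x * \<phi> x)) \<partial>lborel) \<le> (\<integral>\<^sup>+x. (ennreal (\<bar>g x\<bar> powr p') * indicator B x + ennreal (\<bar>\<phi> x\<bar> powr p) * indicator UNIV x) \<partial>lborel)"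
  proof (intro nn_integral_mono)
    fix x
    show "ennreal (norm (g x * \<phi> x)) \<le> ennreal (\<bar>g x\<bar> powr p') * indicator B x + ennreal (\<bar>\<phi> x\<bar> powr p) * indicator UNIV x"
      using ennreal_leI[OF young_conj[of "\<bar>g x\<bar>" "\<bar>\<phi> x\<bar>"]] supp[of x]
      by (cases "x \<in> B") (auto simp: abs_mult)
  qed
  also have "\<dots> = Lpow p' B g + Lpow p UNIV \<phi>"
    unfolding Lpow_def by (rule nn_integral_add) measurable
  also have "\<dots> < \<infinity>" using fin by simp
  finally show "(\<integral>\<^sup>+x. ennreal (norm (g x * \<phi> x)) \<partial>lborel) < \<infinity>" .
qed measurable

text \<open>Young's inequality with \<mu> as size of the source difference and \<theta> as size of
  d_h u. Both terms become multiples of \<mu> (1 - s) \<theta> A, and the 1 - s cancels the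
  denominator of \<mu>. Finally order s is weakened to order t.\<close>

lemma source_term_bound:
  assumes h: "0 < norm h" "norm h \<le> R / 64" and \<theta>: "0 < \<theta>" and r: "r \<le> 7 / 8 * R"
    and L: "Lpow p (ball c r) (dlt h u) \<le> ennreal (\<theta> powr p * ((1 - s) * A))"
    and [measurable]: "\<phi> \<in> borel_measurable borel"
    and \<phi>: "\<And>x. \<bar>\<phi> x\<bar> \<le> \<bar>dlt h u x\<bar>" "\<And>x. x \<notin> ball c r \<Longrightarrow> \<phi> x = 0"
  shows "(LINT x|lborel. dlt h f x * \<phi> x) \<le> (nik_const p' DIM('a) + 1) * ((norm h / R) powr t * \<theta> * D)"
proof -
  define \<mu> where "\<mu> = (norm h / R) powr s * R powr (- (s * p)) / (1 - s)"
  have \<mu>: "0 < \<mu>" using h R s by (simp add: \<mu>_def)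
  have \<rho>: "0 < norm h / R" "norm h / R \<le> 1" using h R by auto
  have pt: "\<bar>dlt h f x * \<phi> x\<bar> \<le> \<theta> * \<mu> powr (1 - p') * \<bar>dlt h f x\<bar> powr p' + \<mu> * \<theta> powr (1 - p) * \<bar>dlt h u x\<bar> powr p" for x
  proof -
    have "\<bar>dlt h f x * \<phi> x\<bar> \<le> \<bar>dlt h f x\<bar> * \<bar>dlt h u x\<bar>" unfolding abs_mult by (intro mult_left_mono \<phi>) auto
    also have "\<dots> = \<mu> * \<theta> * ((\<bar>dlt h f x\<bar> / \<mu>) * (\<bar>dlt h u x\<bar> / \<theta>))" using \<mu> \<theta> by simp
    also have "\<dots> \<le> \<mu> * \<theta> * ((\<bar>dlt h f x\<bar> / \<mu>) powr p' + (\<bar>dlt h u x\<bar> / \<theta>) powr p)"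
      using \<mu> \<theta> by (intro mult_left_mono young_conj) auto
    also have "\<dots> = \<theta> * \<mu> powr (1 - p') * \<bar>dlt h f x\<bar> powr p' + \<mu> * \<theta> powr (1 - p) * \<bar>dlt h u x\<bar> powr p"
      using \<mu> \<theta> by (simp add: powr_divide powr_diff field_simps)
    finally show ?thesis .
  qed
  have "(\<integral>\<^sup>+x. ennreal \<bar>dlt h f x * \<phi> x\<bar> \<partial>lborel)
    \<le> (\<integral>\<^sup>+x. (ennreal (\<theta> * \<mu> powr (1 - p')) * (ennreal (\<bar>dlt h f x\<bar> powr p') * indicator (ball c (7 / 8 * R)) x)
       + ennreal (\<mu> * \<theta> powr (1 - p)) * (ennreal (\<bar>dlt h u x\<bar> powr p) * indicator (ball c r) x)) \<partial>lborel)"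
  proof (intro nn_integral_mono)
    fix x
    show "ennreal \<bar>dlt h f x * \<phi> x\<bar> \<le> ennreal (\<theta> * \<mu> powr (1 - p')) * (ennreal (\<bar>dlt h f x\<bar> powr p') * indicator (ball c (7 / 8 * R)) x)
       + ennreal (\<mu> * \<theta> powr (1 - p)) * (ennreal (\<bar>dlt h u x\<bar> powr p) * indicator (ball c r) x)"
    proof (cases "x \<in> ball c r")
      case True
      then have "x \<in> ball c (7 / 8 * R)" using r by auto
      then show ?thesis using ennreal_leI[OF pt[of x]] True \<mu> \<theta>
        by (simp add: ennreal_mult ennreal_plus)
    qed (simp add: \<phi>(2))
  qed
  also have "\<dots> = ennreal (\<theta> * \<mu> powr (1 - p')) * Lpow p' (ball c (7 / 8 * R)) (dlt h f) + ennreal (\<mu> * \<theta> powr (1 - p)) * Lpow p (ball c r) (dlt h u)"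
    unfolding Lpow_def by (simp add: nn_integral_add nn_integral_cmult)
  also have "\<dots> \<le> ennreal (\<theta> * \<mu> powr (1 - p')) * ennreal (nik_const p' DIM('a) * (\<mu> powr p' * ((1 - s) * A))) + ennreal (\<mu> * \<theta> powr (1 - p)) * ennreal (\<theta> powr p * ((1 - s) * A))"
    unfolding \<mu>_def using h L by (intro add_mono mult_left_mono source_difference_bound) auto
  also have "\<dots> = ennreal (\<theta> * \<mu> powr (1 - p') * (nik_const p' DIM('a) * (\<mu> powr p' * ((1 - s) * A))) + \<mu> * \<theta> powr (1 - p) * (\<theta> powr p * ((1 - s) * A)))"
    using \<mu> \<theta> conj(1) s A by (simp add: ennreal_mult ennreal_plus)
  also have "\<theta> * \<mu> powr (1 - p') * (nik_const p' DIM('a) * (\<mu> powr p' * ((1 - s) * A))) + \<mu> * \<theta> powr (1 - p) * (\<theta> powr p * ((1 - s) * A))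
    = (nik_const p' DIM('a) + 1) * (\<mu> * (1 - s) * (\<theta> * A))"
    using \<mu> \<theta> by (simp add: powr_diff field_simps)
  also have "\<mu> * (1 - s) * (\<theta> * A) = (norm h / R) powr s * \<theta> * D" using s by (simp add: \<mu>_def)
  finally have "(LINT x|lborel. dlt h f x * \<phi> x) \<le> (nik_const p' DIM('a) + 1) * ((norm h / R) powr s * \<theta> * D)"
    using conj(1) \<theta> A by (intro integral_le_ennreal) auto
  also have "\<dots> \<le> (nik_const p' DIM('a) + 1) * ((norm h / R) powr t * \<theta> * D)"
    using conj(1) \<theta> A t powr_mono'[OF t(2), of "norm h / R"] \<rho> by (intro mult_left_mono mult_right_mono) auto
  finally show ?thesis .
qed

text \<open>Conditional on purpose: an L^p bound of size \<theta> for the difference is converted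
  into a seminorm bound, and the lemma is applied again once a better \<theta> is known. Three radii
  with gaps R/16 are used: r, where the cutoff is 1; r + R/16, containing its support; r + R/8,
  separating near from far.\<close>

lemma core_estimate:
  assumes h: "0 < norm h" "norm h \<le> R / 64" and \<theta>: "0 < \<theta>" and r: "0 \<le> r" "r + R / 8 \<le> 3 / 4 * R"
    and L: "Lpow p (ball c (r + R / 8)) (dlt h u) \<le> ennreal (\<theta> powr p * ((1 - s) * A))"
  shows "Wpow s p (ball c r) (dlt h u)
    \<le> ennreal (core_const p \<Lambda> DIM('a) * ((\<theta> * \<theta> + (norm h / R) powr t * \<theta>) * D))"
proof -
  define w where "w = dlt h u"
  have w[measurable]: "w \<in> borel_measurable borel" by (simp add: w_def)
  define \<eta> where "\<eta> = cutoff c r R"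
  have [measurable]: "\<eta> \<in> borel_measurable borel" by (simp add: \<eta>_def)
  define \<phi> where "\<phi> x = w x * (\<eta> x)\<^sup>2" for x
  have [measurable]: "\<phi> \<in> borel_measurable borel" unfolding \<phi>_def by measurable
  define l where "l = (norm h / R) powr t"
  have l: "0 < l" using h R by (simp add: l_def)
  let ?B2 = "ball c (r + R / 16)" and ?B3 = "ball c (r + R / 8)"
  define W1 where "W1 x y = wt1 p (x \<in> ?B2) (y \<in> ?B2) (u (x + h) - u (y + h)) (u x - u y) (k0 (x - y))" for x y
  define W2 where "W2 x y = wt2 p (x \<in> ?B3) (y \<in> ?B3) (w x) (w y) (\<eta> x) (\<eta> y) (k0 (x - y))" for x y
  define W3 where "W3 x y = wt3 p (x \<in> ?B2) (y \<in> ?B2) (x \<in> ?B3) (y \<in> ?B3) (w x) (w y) (k0 (x - y))" for x y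
  define W4 where "W4 x y = wt3 p (x \<in> ?B2) (y \<in> ?B2) (x \<in> ?B3) (y \<in> ?B3) (w y) (w x) (k0 (x - y))" for x y
  have [measurable]: "case_prod W1 \<in> borel_measurable (borel \<Otimes>\<^sub>M borel)" unfolding W1_def wt1_def by measurable
  have [measurable]: "case_prod W2 \<in> borel_measurable (borel \<Otimes>\<^sub>M borel)" unfolding W2_def wt2_def by measurable
  have [measurable]: "case_prod W3 \<in> borel_measurable (borel \<Otimes>\<^sub>M borel)" unfolding W3_def wt3_def by measurable
  have [measurable]: "case_prod W4 \<in> borel_measurable (borel \<Otimes>\<^sub>M borel)" unfolding W4_def wt3_def by measurable
  have nn: "0 \<le> W1 x y" "0 \<le> W2 x y" "0 \<le> W3 x y" "0 \<le> W4 x y" for x y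
    unfolding W1_def W2_def W3_def W4_def by (auto intro: wt_nonneg)
  have i1: "dint (\<lambda>x y. ennreal (W1 x y)) \<le> ennreal (2 * energy_const p DIM('a) * D)"
    unfolding W1_def using h r R by (intro wt1_energy) auto
  have i2: "dint (\<lambda>x y. ennreal (W2 x y)) \<le> ennreal (2 * (32 powr p * knl_const p DIM('a)) * (\<theta> powr p * D))"
    unfolding W2_def \<eta>_def using r R L \<theta> by (intro wt2_energy) (auto simp: w_def)
  have i3: "dint (\<lambda>x y. ennreal (W3 x y)) \<le> ennreal (2 * far_const p DIM('a) * (\<theta> powr p * D))"
    unfolding W3_def using r R L \<theta> by (intro wt3_energy) (auto simp: w_def)
  have i4: "dint (\<lambda>x y. ennreal (W4 x y)) \<le> ennreal (2 * core_tail_const p DIM('a) * ((norm h / R) powr (t * p) * D))"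
    unfolding W4_def w_def using h r R by (intro wt3_swapped_energy) auto
  have eg: "0 \<le> \<eta> x" "\<eta> x \<le> 1" for x unfolding \<eta>_def by (rule cutoff_bounds)+
  have supp: "\<eta> x \<noteq> 0 \<Longrightarrow> x \<in> ?B2" for x unfolding \<eta>_def using R by (rule cutoff_support)
  have one: "x \<in> ball c r \<Longrightarrow> \<eta> x = 1" for x unfolding \<eta>_def using R by (rule cutoff_eq_1)
  have B23: "x \<in> ?B2 \<Longrightarrow> x \<in> ?B3" for x using R by auto
  have d: "w x - w y = (u (x + h) - u (y + h)) - (u x - u y)" for x y by (simp add: w_def dlt_def)
  \<comment> \<open>These three weights dominate the energy of the test function and both fluxes.
    The tail weight \<open>W4\<close> enters only the quantitative estimate.\<close>
  define S where "S x y = W1 x y + W2 x y + W3 x y" for x y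
  have [measurable]: "case_prod S \<in> borel_measurable (borel \<Otimes>\<^sub>M borel)" unfolding S_def by measurable
  have S_fin: "dint (\<lambda>x y. ennreal (S x y)) < \<infinity>"
  proof -
    have "dint (\<lambda>x y. ennreal (S x y)) = dint (\<lambda>x y. ennreal (W1 x y) + ennreal (W2 x y) + ennreal (W3 x y))"
      unfolding S_def using nn by (simp add: ennreal_plus)
    also have "\<dots> = dint (\<lambda>x y. ennreal (W1 x y)) + dint (\<lambda>x y. ennreal (W2 x y)) + dint (\<lambda>x y. ennreal (W3 x y))"
      by (simp add: dint_add)
    also have "\<dots> < \<infinity>" using i1 i2 i3 by (auto intro: le_less_trans)
    finally show ?thesis .
  qed
  have \<phi>_le: "\<bar>\<phi> x\<bar> \<le> \<bar>w x\<bar>" for x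
    unfolding \<phi>_def using eg[of x] by (simp add: abs_mult mult_left_le power_le_one)
  have \<phi>_supp: "x \<notin> ?B2 \<Longrightarrow> \<phi> x = 0" for x unfolding \<phi>_def using supp by auto
  have \<phi>_diff: "\<bar>\<phi> x - \<phi> y\<bar> powr p * k0 (x - y) \<le> 4 powr p * S x y" for x y
    unfolding \<phi>_def S_def W1_def W2_def W3_def
    using p d eg supp B23 by (intro cutoff_difference_bound) auto
  have \<phi>_L: "Lpow p UNIV \<phi> < \<infinity>"
  proof -
    have "Lpow p UNIV \<phi> \<le> Lpow p ?B3 w"
      unfolding Lpow_def
    proof (intro nn_integral_mono)
      fix x show "ennreal (\<bar>\<phi> x\<bar> powr p) * indicator UNIV x \<le> ennreal (\<bar>w x\<bar> powr p) * indicator ?B3 x"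
        using \<phi>_le[of x] \<phi>_supp[of x] B23[of x] p
        by (cases "x \<in> ?B2") (auto intro!: ennreal_leI powr_mono2)
    qed
    also have "\<dots> < \<infinity>" using L unfolding w_def by (auto intro: le_less_trans)
    finally show ?thesis .
  qed
  have \<phi>_W: "Wpow s p UNIV \<phi> < \<infinity>"
  proof -
    have "Wpow s p UNIV \<phi> \<le> dint (\<lambda>x y. ennreal (4 powr p) * ennreal (S x y))"
      unfolding Wpow_def using \<phi>_diff by (intro dint_mono) (simp add: ennreal_mult'[symmetric] ennreal_leI)
    also have "\<dots> = ennreal (4 powr p) * dint (\<lambda>x y. ennreal (S x y))" by (rule dint_cmult) measurable
    also have "\<dots> < \<infinity>" using S_fin by (simp add: ennreal_mult_less_top)
    finally show ?thesis .
  qed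
  define Q where "Q v z = (case z of (x, y) \<Rightarrow> Jp p (v x - v y) * \<kappa> (x - y) * (\<phi> x - \<phi> y))" for v :: "'a \<Rightarrow> real" and z
  define uh where "uh x = u (x + h)" for x
  have [measurable]: "uh \<in> borel_measurable borel" unfolding uh_def by measurable
  \<comment> \<open>Each flux is integrable by itself, so the integral of the difference is the
    difference of the two weak formulations.\<close>
  have Q_int: "integrable (lborel \<Otimes>\<^sub>M lborel) (Q v)" if v: "v = uh \<or> v = u" for v
  proof -
    have vm[measurable]: "v \<in> borel_measurable borel" using v by auto
    have [measurable]: "Q v \<in> borel_measurable (borel \<Otimes>\<^sub>M borel)" unfolding Q_def by measurable
    show ?thesis
    proof (rule integrableI_bounded)
      have "(\<integral>\<^sup>+z. ennreal (norm (Q v z)) \<partial>(lborel \<Otimes>\<^sub>M lborel)) \<le> (\<integral>\<^sup>+z. ennreal (\<Lambda> * (1 + 4 powr p)) * ennreal (case_prod S z) \<partial>(lborel \<Otimes>\<^sub>M lborel))"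
      proof (intro nn_integral_mono)
        fix z :: "'a \<times> 'a"
        obtain x y where z: "z = (x, y)" by (cases z)
        have \<kappa>0: "0 \<le> \<kappa> (x - y)" using \<kappa>_bounds(1)[of "x - y"] \<Lambda> by (meson divide_nonneg_nonneg krn_nonneg order_trans zero_le_one)
        have "\<bar>Jp p (v x - v y) * \<kappa> (x - y) * (\<phi> x - \<phi> y)\<bar> \<le> \<Lambda> * (1 + 4 powr p) * S x y"
          unfolding \<phi>_def S_def W1_def W2_def W3_def
          using p d eg supp B23 \<kappa>0 \<kappa>_bounds \<Lambda> v by (intro flux_difference_bound) (auto simp: uh_def)
        then show "ennreal (norm (Q v z)) \<le> ennreal (\<Lambda> * (1 + 4 powr p)) * ennreal (case_prod S z)"
          using \<Lambda> by (simp add: z Q_def ennreal_mult'[symmetric] ennreal_leI)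
      qed
      also have "\<dots> = ennreal (\<Lambda> * (1 + 4 powr p)) * (\<integral>\<^sup>+z. ennreal (case_prod S z) \<partial>(lborel \<Otimes>\<^sub>M lborel))"
        by (rule nn_integral_cmult) measurable
      also have "(\<integral>\<^sup>+z. ennreal (case_prod S z) \<partial>(lborel \<Otimes>\<^sub>M lborel)) = dint (\<lambda>x y. ennreal (S x y))"
        by (subst dint_pair[symmetric]) (auto simp: case_prod_beta' intro!: nn_integral_cong)
      also have "ennreal (\<Lambda> * (1 + 4 powr p)) * dint (\<lambda>x y. ennreal (S x y)) < \<infinity>" using S_fin by (simp add: ennreal_mult_less_top)
      finally show "(\<integral>\<^sup>+z. ennreal (norm (Q v z)) \<partial>(lborel \<Otimes>\<^sub>M lborel)) < \<infinity>" .
    qed measurable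
  qed
  have eq1: "(LINT z|(lborel \<Otimes>\<^sub>M lborel). Q u z) = (LINT x|lborel. f x * \<phi> x)"
    unfolding Q_def by (rule weak) (use \<phi>_L \<phi>_W \<phi>_supp r R in auto)
  have eq2: "(LINT z|(lborel \<Otimes>\<^sub>M lborel). Q uh z) = (LINT x|lborel. f (x + h) * \<phi> x)"
  proof -
    \<comment> \<open>The equation for the translate of u is the equation for u tested with the
      back-translated function; since |h| \<le> R/64 its support is still in B_R.\<close>
    define \<psi> where "\<psi> x = \<phi> (x - h)" for x
    have [measurable]: "\<psi> \<in> borel_measurable borel" unfolding \<psi>_def by measurable
    have "(LINT z|(lborel \<Otimes>\<^sub>M lborel). Q uh z)
      = (LINT z|(lborel \<Otimes>\<^sub>M lborel). (case z of (x, y) \<Rightarrow> Jp p (u (x + h) - u (y + h)) * \<kappa> ((x + h) - (y + h)) * (\<psi> (x + h) - \<psi> (y + h))))"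
      unfolding Q_def uh_def \<psi>_def by simp
    also have "\<dots> = (LINT z|(lborel \<Otimes>\<^sub>M lborel). (case z of (x, y) \<Rightarrow> Jp p (u x - u y) * \<kappa> (x - y) * (\<psi> x - \<psi> y)))"
      by (rule lborel_pair_integral_shift) measurable
    also have "\<dots> = (LINT x|lborel. f x * \<psi> x)"
    proof (rule weak)
      fix x assume x: "x \<notin> ball c R"
      have "dist c x \<le> dist c (x - h) + norm h" by norm
      then have "x - h \<notin> ?B2" using x h r by auto
      then show "\<psi> x = 0" by (simp add: \<psi>_def \<phi>_supp)
    next
      have "Lpow p UNIV \<psi> = (\<integral>\<^sup>+x. ennreal (\<bar>\<phi> (x + - h)\<bar> powr p) * indicator UNIV (x + - h) \<partial>lborel)"
        by (simp add: Lpow_def \<psi>_def)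
      also have "\<dots> = Lpow p UNIV \<phi>" unfolding Lpow_def by (rule nn_integral_lborel_plus) measurable
      finally show "Lpow p UNIV \<psi> < \<infinity>" using \<phi>_L by simp
      have "Wpow s p UNIV \<psi> = dint (\<lambda>x y. ennreal (\<bar>\<phi> (x + - h) - \<phi> (y + - h)\<bar> powr p * krn (real DIM('a) + s * p) ((x + - h) - (y + - h))) * (indicator UNIV (x + - h) * indicator UNIV (y + - h)))"
        by (simp add: Wpow_def \<psi>_def)
      also have "\<dots> = Wpow s p UNIV \<phi>" unfolding Wpow_def by (rule dint_shift) measurable
      finally show "Wpow s p UNIV \<psi> < \<infinity>" using \<phi>_W by simp
    qed measurable
    also have "\<dots> = (LINT x|lborel. f (x + h) * \<psi> (x + h))" by (rule lborel_integral_shift[symmetric]) measurable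
    finally show ?thesis by (simp add: \<psi>_def)
  qed
  have f1: "integrable lborel (\<lambda>x. f x * \<phi> x)"
  proof (rule product_integrable[of _ _ ?B2])
    have "Lpow p' ?B2 f \<le> Lpow p' (ball c R) f" using r R by (intro Lpow_mono_set subset_ball) auto
    then show "Lpow p' ?B2 f < \<infinity>" using f_L by (auto intro: le_less_trans)
  qed (use \<phi>_L \<phi>_supp in auto)
  have f2: "integrable lborel (\<lambda>x. f (x + h) * \<phi> x)"
  proof (rule product_integrable[of _ _ ?B2])
    have "Lpow p' ?B2 (\<lambda>x. f (x + h)) \<le> Lpow p' (ball c R) f" using r R h by (intro Lpow_shift_le) auto
    then show "Lpow p' ?B2 (\<lambda>x. f (x + h)) < \<infinity>" using f_L by (auto intro: le_less_trans)
  qed (use \<phi>_L \<phi>_supp in auto)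
  have "(LINT z|(lborel \<Otimes>\<^sub>M lborel). Q uh z - Q u z) = (LINT x|lborel. dlt h f x * \<phi> x)"
    using Q_int[of uh] Q_int[of u] f1 f2 by (simp add: eq1 eq2 dlt_def left_diff_distrib)
  also have "\<dots> \<le> (nik_const p' DIM('a) + 1) * (l * \<theta> * D)"
    unfolding l_def
  proof (rule source_term_bound[OF h \<theta>])
    show "Lpow p (ball c (r + R / 8)) (dlt h u) \<le> ennreal (\<theta> powr p * ((1 - s) * A))" by (rule L)
  qed (use r R \<phi>_le \<phi>_supp B23 in \<open>auto simp: w_def\<close>)
  finally have Qle: "(LINT z|(lborel \<Otimes>\<^sub>M lborel). Q uh z - Q u z) \<le> (nik_const p' DIM('a) + 1) * (l * \<theta> * D)" .
  define C0 where "C0 = \<Lambda> * (p - 1) * (4 * 2 powr p)"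
  have C0: "0 \<le> C0" using p \<Lambda> by (simp add: C0_def)
  define E where "E x y = C0 * ((\<theta> * \<theta> + l * \<theta>) * W1 x y + \<theta> * \<theta> powr (1 - p) * W2 x y
    + (\<theta> * \<theta> powr (1 - p) + l * \<theta> powr (1 - p)) * W3 x y + \<theta> * l powr (1 - p) * W4 x y)" for x y
  have [measurable]: "case_prod E \<in> borel_measurable (borel \<Otimes>\<^sub>M borel)" unfolding E_def by measurable
  have E0: "0 \<le> E x y" for x y unfolding E_def using C0 nn \<theta> l by (intro mult_nonneg_nonneg add_nonneg_nonneg) auto
  define K where "K = 2 * energy_const p DIM('a) + 2 * (32 powr p * knl_const p DIM('a)) + 2 * far_const p DIM('a) + 2 * core_tail_const p DIM('a)"
  have K: "0 \<le> K" using p by (simp add: K_def)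
  have Ebound: "dint (\<lambda>x y. ennreal (E x y)) \<le> ennreal (C0 * K * ((\<theta> * \<theta> + l * \<theta>) * D))"
  proof -
    have "dint (\<lambda>x y. ennreal (E x y)) = dint (\<lambda>x y. ennreal C0 * (ennreal (\<theta> * \<theta> + l * \<theta>) * ennreal (W1 x y) + ennreal (\<theta> * \<theta> powr (1 - p)) * ennreal (W2 x y)
       + ennreal (\<theta> * \<theta> powr (1 - p) + l * \<theta> powr (1 - p)) * ennreal (W3 x y) + ennreal (\<theta> * l powr (1 - p)) * ennreal (W4 x y)))"
      unfolding E_def using C0 nn \<theta> l
      by (simp add: ennreal_mult[symmetric] ennreal_plus[symmetric] del: ennreal_plus)
    also have "\<dots> = ennreal C0 * (ennreal (\<theta> * \<theta> + l * \<theta>) * dint (\<lambda>x y. ennreal (W1 x y)) + ennreal (\<theta> * \<theta> powr (1 - p)) * dint (\<lambda>x y. ennreal (W2 x y))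
       + ennreal (\<theta> * \<theta> powr (1 - p) + l * \<theta> powr (1 - p)) * dint (\<lambda>x y. ennreal (W3 x y)) + ennreal (\<theta> * l powr (1 - p)) * dint (\<lambda>x y. ennreal (W4 x y)))"
      by (simp add: dint_cmult dint_add)
    also have "\<dots> \<le> ennreal C0 * (ennreal (\<theta> * \<theta> + l * \<theta>) * ennreal (2 * energy_const p DIM('a) * D)
       + ennreal (\<theta> * \<theta> powr (1 - p)) * ennreal (2 * (32 powr p * knl_const p DIM('a)) * (\<theta> powr p * D))
       + ennreal (\<theta> * \<theta> powr (1 - p) + l * \<theta> powr (1 - p)) * ennreal (2 * far_const p DIM('a) * (\<theta> powr p * D))
       + ennreal (\<theta> * l powr (1 - p)) * ennreal (2 * core_tail_const p DIM('a) * ((norm h / R) powr (t * p) * D)))"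
      by (intro mult_left_mono add_mono i1 i2 i3 i4) auto
    also have "\<dots> = ennreal (C0 * ((\<theta> * \<theta> + l * \<theta>) * (2 * energy_const p DIM('a) * D)
       + (\<theta> * \<theta> powr (1 - p)) * (2 * (32 powr p * knl_const p DIM('a)) * (\<theta> powr p * D))
       + (\<theta> * \<theta> powr (1 - p) + l * \<theta> powr (1 - p)) * (2 * far_const p DIM('a) * (\<theta> powr p * D))
       + (\<theta> * l powr (1 - p)) * (2 * core_tail_const p DIM('a) * ((norm h / R) powr (t * p) * D))))"
      using C0 \<theta> l p A by (simp add: ennreal_mult[symmetric] ennreal_plus[symmetric] del: ennreal_plus)
    also have "\<dots> \<le> ennreal (C0 * K * ((\<theta> * \<theta> + l * \<theta>) * D))"
    proof (intro ennreal_leI)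
      \<comment> \<open>The Young weights were chosen for this: \<theta>^(1-p) meets an energy of
        order \<theta>^p and l^(1-p) one of order l^p, so every term is at most \<theta>^2 + l
        \<theta>.\<close>
      have t1: "\<theta> powr (1 - p) * \<theta> powr p = \<theta>" using \<theta> by (simp add: powr_add[symmetric])
      have t2: "l powr (1 - p) * (norm h / R) powr (t * p) = l"
      proof -
        have "(norm h / R) powr (t * p) = l powr p" by (simp add: l_def powr_powr)
        then show ?thesis using l by (simp add: powr_add[symmetric])
      qed
      have "(\<theta> * \<theta> + l * \<theta>) * (2 * energy_const p DIM('a) * D)
       + (\<theta> * \<theta> powr (1 - p)) * (2 * (32 powr p * knl_const p DIM('a)) * (\<theta> powr p * D))
       + (\<theta> * \<theta> powr (1 - p) + l * \<theta> powr (1 - p)) * (2 * far_const p DIM('a) * (\<theta> powr p * D))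
       + (\<theta> * l powr (1 - p)) * (2 * core_tail_const p DIM('a) * ((norm h / R) powr (t * p) * D))
       = (\<theta> * \<theta> + l * \<theta>) * (2 * energy_const p DIM('a) * D)
       + \<theta> * (\<theta> powr (1 - p) * \<theta> powr p) * (2 * (32 powr p * knl_const p DIM('a)) * D)
       + (\<theta> + l) * (\<theta> powr (1 - p) * \<theta> powr p) * (2 * far_const p DIM('a) * D)
       + \<theta> * (l powr (1 - p) * (norm h / R) powr (t * p)) * (2 * core_tail_const p DIM('a) * D)"
        by (simp add: algebra_simps)
      also have "\<dots> = (\<theta> * \<theta> + l * \<theta>) * (2 * energy_const p DIM('a) * D)
       + \<theta> * \<theta> * (2 * (32 powr p * knl_const p DIM('a)) * D)
       + (\<theta> * \<theta> + l * \<theta>) * (2 * far_const p DIM('a) * D)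
       + l * \<theta> * (2 * core_tail_const p DIM('a) * D)"
        unfolding t1 t2 by (simp add: algebra_simps)
      also have "\<dots> \<le> (\<theta> * \<theta> + l * \<theta>) * (2 * energy_const p DIM('a) * D)
       + (\<theta> * \<theta> + l * \<theta>) * (2 * (32 powr p * knl_const p DIM('a)) * D)
       + (\<theta> * \<theta> + l * \<theta>) * (2 * far_const p DIM('a) * D)
       + (\<theta> * \<theta> + l * \<theta>) * (2 * core_tail_const p DIM('a) * D)"
        using \<theta> l p A by (intro add_mono mult_right_mono) auto
      also have "\<dots> = K * ((\<theta> * \<theta> + l * \<theta>) * D)" by (simp add: K_def algebra_simps)
      finally show "C0 * ((\<theta> * \<theta> + l * \<theta>) * (2 * energy_const p DIM('a) * D)
       + (\<theta> * \<theta> powr (1 - p)) * (2 * (32 powr p * knl_const p DIM('a)) * (\<theta> powr p * D))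
       + (\<theta> * \<theta> powr (1 - p) + l * \<theta> powr (1 - p)) * (2 * far_const p DIM('a) * (\<theta> powr p * D))
       + (\<theta> * l powr (1 - p)) * (2 * core_tail_const p DIM('a) * ((norm h / R) powr (t * p) * D))) \<le> C0 * K * ((\<theta> * \<theta> + l * \<theta>) * D)"
        using C0 by (simp add: mult.assoc mult_left_mono)
    qed
    finally show ?thesis .
  qed
  define c1 where "c1 = 2 powr (1 - p) / (2 * \<Lambda>)"
  have c1: "0 < c1" using \<Lambda> by (simp add: c1_def)
  define G where "G x y = (if x \<in> ball c r \<and> y \<in> ball c r then c1 * (\<bar>w x - w y\<bar> powr p * k0 (x - y)) else 0)" for x y
  have [measurable]: "case_prod G \<in> borel_measurable (borel \<Otimes>\<^sub>M borel)" unfolding G_def by measurable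
  have "(\<integral>\<^sup>+z. ennreal (case_prod G z) \<partial>(lborel \<Otimes>\<^sub>M lborel))
    \<le> ennreal ((nik_const p' DIM('a) + 1) * (l * \<theta> * D) + C0 * K * ((\<theta> * \<theta> + l * \<theta>) * D))"
  proof (rule nn_integral_le_of_pointwise[where Q = "\<lambda>z. Q uh z - Q u z" and E = "case_prod E"])
    show "integrable (lborel \<Otimes>\<^sub>M lborel) (\<lambda>z. Q uh z - Q u z)" using Q_int by auto
    show "(\<integral>\<^sup>+z. ennreal (case_prod E z) \<partial>(lborel \<Otimes>\<^sub>M lborel)) \<le> ennreal (C0 * K * ((\<theta> * \<theta> + l * \<theta>) * D))"
      using Ebound by (subst (asm) dint_pair[symmetric]) (auto simp: case_prod_beta')
    fix z :: "'a \<times> 'a"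
    obtain x y where z: "z = (x, y)" by (cases z)
    show "0 \<le> case_prod E z" using E0 by (simp add: z)
    show "0 \<le> case_prod G z" using c1 by (simp add: z G_def)
    have "G x y \<le> (Jp p (uh x - uh y) - Jp p (u x - u y)) * \<kappa> (x - y) * (\<phi> x - \<phi> y) + E x y"
      unfolding G_def E_def c1_def C0_def \<phi>_def W1_def W2_def W3_def W4_def uh_def
      using p d eg supp B23 one \<kappa>_bounds \<Lambda> \<theta> l by (intro test_pointwise) auto
    then show "case_prod G z \<le> Q uh z - Q u z + case_prod E z"
      by (simp add: z Q_def left_diff_distrib)
  qed (use Qle C0 K \<theta> l A in auto)
  also have "\<dots> \<le> ennreal ((nik_const p' DIM('a) + 1 + C0 * K) * ((\<theta> * \<theta> + l * \<theta>) * D))"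
  proof (intro ennreal_leI)
    have "(nik_const p' DIM('a) + 1) * (l * \<theta> * D) \<le> (nik_const p' DIM('a) + 1) * ((\<theta> * \<theta> + l * \<theta>) * D)"
      using conj(1) \<theta> l A by (intro mult_left_mono mult_right_mono) auto
    then show "(nik_const p' DIM('a) + 1) * (l * \<theta> * D) + C0 * K * ((\<theta> * \<theta> + l * \<theta>) * D) \<le> (nik_const p' DIM('a) + 1 + C0 * K) * ((\<theta> * \<theta> + l * \<theta>) * D)"
      by (simp only: distrib_right)
  qed
  also have "(\<integral>\<^sup>+z. ennreal (case_prod G z) \<partial>(lborel \<Otimes>\<^sub>M lborel)) = ennreal c1 * Wpow s p (ball c r) w"
  proof -
    have "(\<integral>\<^sup>+z. ennreal (case_prod G z) \<partial>(lborel \<Otimes>\<^sub>M lborel)) = dint (\<lambda>x y. ennreal (G x y))"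
      by (subst dint_pair[symmetric]) (auto simp: case_prod_beta' intro!: nn_integral_cong)
    also have "\<dots> = dint (\<lambda>x y. ennreal c1 * (ennreal (\<bar>w x - w y\<bar> powr p * k0 (x - y)) * (indicator (ball c r) x * indicator (ball c r) y)))"
      using c1 by (intro arg_cong[where f = dint] ext) (auto simp: G_def ennreal_mult indicator_def)
    also have "\<dots> = ennreal c1 * Wpow s p (ball c r) w"
      unfolding Wpow_def by (rule dint_cmult) measurable
    finally show ?thesis .
  qed
  finally have fin: "ennreal c1 * Wpow s p (ball c r) w \<le> ennreal ((nik_const p' DIM('a) + 1 + C0 * K) * ((\<theta> * \<theta> + l * \<theta>) * D))" .
  have "Wpow s p (ball c r) w = ennreal (1 / c1) * (ennreal c1 * Wpow s p (ball c r) w)"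
    using c1 by (simp add: mult.assoc[symmetric] ennreal_mult[symmetric])
  also have "\<dots> \<le> ennreal (1 / c1) * ennreal ((nik_const p' DIM('a) + 1 + C0 * K) * ((\<theta> * \<theta> + l * \<theta>) * D))"
    by (intro mult_left_mono fin) auto
  also have "\<dots> = ennreal (1 / c1 * ((nik_const p' DIM('a) + 1 + C0 * K) * ((\<theta> * \<theta> + l * \<theta>) * D)))"
    using c1 conj(1) C0 K \<theta> l A by (intro ennreal_mult[symmetric]) auto
  also have "1 / c1 * ((nik_const p' DIM('a) + 1 + C0 * K) * ((\<theta> * \<theta> + l * \<theta>) * D)) = core_const p \<Lambda> DIM('a) * ((\<theta> * \<theta> + l * \<theta>) * D)"
  proof -
    have "1 / c1 = 2 * \<Lambda> * 2 powr (p - 1)" using \<Lambda> by (simp add: c1_def powr_diff field_simps)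
    then show ?thesis by (simp add: core_const_def C0_def K_def mult.assoc)
  qed
  finally show ?thesis by (simp add: w_def l_def)
qed

end

subsection \<open>Improved differentiability\<close>

text \<open>The summand 1 makes K \<ge> 1, so that K \<le> K^p and \<theta> = K (|h|/R)^s has a p-th
  power above the bound of \<open>difference_bound\<close>.\<close>

definition theta_const :: "real \<Rightarrow> nat \<Rightarrow> real" where
  "theta_const p n = 1 + nik_const p n"

definition second_const :: "real \<Rightarrow> real \<Rightarrow> nat \<Rightarrow> real" where
  "second_const p \<Lambda> n = nik_const p n * (core_const p \<Lambda> n * (2 * (theta_const p n)\<^sup>2))"

text \<open>\<open>128 powr p\<close> comes from a starting step of length between R/128 and R/64,
  and \<open>p powr p\<close> from (l0/p - 1)^p = (l0 - p)^p / p^p. The factor in between is the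
  telescoping constant.\<close>

definition first_const :: "real \<Rightarrow> real \<Rightarrow> nat \<Rightarrow> real" where
  "first_const p \<Lambda> n = 128 powr p * (2 powr p * (1 + 4 powr p) * p powr p) * (nik_const p n + second_const p \<Lambda> n)"

text \<open>The 3 counts \<theta>^2 once and (|h|/R)^t \<theta> twice, as l0 - p \<le> 2.
  \<open>2 powr p\<close> pays for passing from (l0 - p)^(-2) to (l0 - p)^(-p).\<close>

definition mixed_const :: "real \<Rightarrow> real \<Rightarrow> nat \<Rightarrow> real" where
  "mixed_const p \<Lambda> n = nik_const p n * (core_const p \<Lambda> n * (3 * (1 + first_const p \<Lambda> n)\<^sup>2 * 2 powr p))"

definition slope_const :: "real \<Rightarrow> real \<Rightarrow> nat \<Rightarrow> real" where
  "slope_const p \<Lambda> n = 2 powr p * (1 + 4 powr p) * (2 * 2 powr p * mixed_const p \<Lambda> n)"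

lemma core_const_nonneg[simp]: "2 \<le> p \<Longrightarrow> 1 \<le> \<Lambda> \<Longrightarrow> 0 \<le> core_const p \<Lambda> n"
  by (auto simp: core_const_def conj_exp_def intro!: mult_nonneg_nonneg add_nonneg_nonneg)

lemma diff_const_nonneg[simp]:
  "2 \<le> p \<Longrightarrow> 1 \<le> \<Lambda> \<Longrightarrow> 0 \<le> second_const p \<Lambda> n"
  "2 \<le> p \<Longrightarrow> 1 \<le> \<Lambda> \<Longrightarrow> 0 \<le> first_const p \<Lambda> n"
  "2 \<le> p \<Longrightarrow> 1 \<le> \<Lambda> \<Longrightarrow> 0 \<le> mixed_const p \<Lambda> n"
  "2 \<le> p \<Longrightarrow> 1 \<le> \<Lambda> \<Longrightarrow> 0 \<le> slope_const p \<Lambda> n"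
proof -
  assume a: "2 \<le> p" "1 \<le> \<Lambda>"
  have n: "0 \<le> nik_const p n" "0 \<le> core_const p \<Lambda> n" using a by auto
  show s: "0 \<le> second_const p \<Lambda> n" using n by (simp add: second_const_def)
  show f: "0 \<le> first_const p \<Lambda> n" using n s by (simp add: first_const_def)
  show m: "0 \<le> mixed_const p \<Lambda> n" using n f by (simp add: mixed_const_def)
  show "0 \<le> slope_const p \<Lambda> n" using m by (simp add: slope_const_def)
qed

lemma norm_dyadic: "norm (v /\<^sub>R 2 ^ j) = norm (v :: 'a::real_normed_vector) / 2 ^ j"
  unfolding norm_scaleR by (simp add: field_simps)

lemma dyadic_le: "0 \<le> x \<Longrightarrow> x / 2 ^ j \<le> (x::real)"
  using divide_left_mono[of 1 "2 ^ j" x] by simp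

lemma powr_quotient: "0 < (R::real) \<Longrightarrow> x powr a * R powr (- a) = (x / R) powr a"
  by (simp add: powr_divide powr_minus_divide)

lemma dyadic_powr:
  fixes a :: real
  shows "(1 / 2 ^ j) powr a = (2 powr - a) ^ j"
proof -
  have "(2 powr - a) ^ j = 2 powr (- a * j)" by (simp add: powr_powr flip: powr_realpow)
  moreover have "(1 / 2 ^ j) powr a = (2 powr (- real j)) powr a"
    by (simp add: powr_minus powr_realpow divide_inverse)
  ultimately show ?thesis by (simp add: powr_powr mult.commute)
qed

lemma Lpow_dlt_le:
  fixes v :: "'a::euclidean_space \<Rightarrow> real"
  assumes v[measurable]: "v \<in> borel_measurable borel" and p: "1 \<le> p" and r: "r + norm k \<le> r'"
  shows "Lpow p (ball c r) (dlt k v) \<le> ennreal (2 powr p) * Lpow p (ball c r') v"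
proof -
  have rr: "r \<le> r'" using r norm_ge_zero[of k] by linarith
  have "Lpow p (ball c r) (dlt k v) = Lpow p (ball c r) (\<lambda>x. v (x + k) + (- 1) * v x)"
    by (simp add: dlt_def[abs_def])
  also have "\<dots> \<le> ennreal (2 powr (p - 1)) * (Lpow p (ball c r) (\<lambda>x. v (x + k)) + Lpow p (ball c r) (\<lambda>x. (- 1) * v x))"
    by (rule Lpow_add_le) (use p in measurable)
  also have "\<dots> \<le> ennreal (2 powr (p - 1)) * (Lpow p (ball c r') v + Lpow p (ball c r') v)"
  proof (intro mult_left_mono add_mono)
    show "Lpow p (ball c r) (\<lambda>x. v (x + k)) \<le> Lpow p (ball c r') v" using r by (intro Lpow_shift_le) auto
    have "Lpow p (ball c r) (\<lambda>x. (- 1) * v x) = Lpow p (ball c r) v" by (subst Lpow_cmult) auto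
    also have "\<dots> \<le> Lpow p (ball c r') v" using rr by (intro Lpow_mono_set subset_ball)
    finally show "Lpow p (ball c r) (\<lambda>x. (- 1) * v x) \<le> Lpow p (ball c r') v" .
  qed simp
  also have "\<dots> = ennreal (2 powr (p - 1) * 2) * Lpow p (ball c r') v"
    by (simp add: ennreal_mult mult_2[symmetric] mult.assoc[symmetric])
  finally show ?thesis by (simp add: powr_diff)
qed

locale borel_solution_diff = borel_solution +
  fixes l0 :: real
  assumes l0: "p < l0" "l0 \<le> t + s * (p + 1)"
begin

text \<open>The improved unit for first differences: the loss (l0 - p)^(-p) is incurred here once
  and carried through all later bounds.\<close>

definition "M = (1 - s) * A / (l0 - p) powr p"

lemma M_nonneg: "0 \<le> M" using s A by (simp add: M_def)

lemma l0_le: "l0 - p \<le> 2" "l0 / p \<le> 2" "1 < l0 / p"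
proof -
  have "s * p \<le> 1 * p" using s p by (intro mult_right_mono) auto
  then have "t + s * (p + 1) \<le> 2 + p" using s t by (simp add: distrib_left)
  then show "l0 - p \<le> 2" using l0 by linarith
  then show "l0 / p \<le> 2" using p by (simp add: field_simps)
  show "1 < l0 / p" using l0 p by (simp add: field_simps)
qed

lemma second_difference:
  assumes h: "norm h \<le> R / 64"
  shows "Lpow p (ball c (R / 2)) (dlt h (dlt h u)) \<le> ennreal (second_const p \<Lambda> DIM('a) * ((1 - s) * A * (norm h / R) powr l0))"
proof (cases "h = 0")
  case True
  then have "Lpow p (ball c (R / 2)) (dlt h (dlt h u)) = 0" using p by (simp add: Lpow_def dlt_def)
  then show ?thesis by simp
next
  case False
  then have h0: "0 < norm h" by simp
  define \<rho> where "\<rho> = norm h / R"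
  have \<rho>: "0 < \<rho>" "\<rho> \<le> 1" using h h0 R by (auto simp: \<rho>_def)
  define K where "K = theta_const p DIM('a)"
  have K: "1 \<le> K" "nik_const p DIM('a) \<le> K" using p by (auto simp: K_def theta_const_def)
  define cc where "cc = core_const p \<Lambda> DIM('a)"
  have cc: "0 \<le> cc" using p \<Lambda> by (simp add: cc_def)
  \<comment> \<open>First use of \<open>core_estimate\<close>: only the order s supplied by the
    seminorm of u is known so far.\<close>
  define \<theta> where "\<theta> = K * \<rho> powr s"
  have \<theta>: "0 < \<theta>" using K \<rho> by (simp add: \<theta>_def)
  have \<theta>p: "nik_const p DIM('a) * \<rho> powr (s * p) \<le> \<theta> powr p"
  proof -
    have "K \<le> K powr p" using K p powr_mono[of 1 p K] by simp
    then have "nik_const p DIM('a) * \<rho> powr (s * p) \<le> K powr p * \<rho> powr (s * p)"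
      using K by (intro mult_right_mono) auto
    then show ?thesis by (simp add: \<theta>_def powr_mult powr_powr)
  qed
  have L: "Lpow p (ball c (9 / 16 * R + R / 8)) (dlt h u) \<le> ennreal (\<theta> powr p * ((1 - s) * A))"
  proof -
    have "Lpow p (ball c (9 / 16 * R + R / 8)) (dlt h u) \<le> Lpow p (ball c (7 / 8 * R)) (dlt h u)"
      using R by (intro Lpow_mono_set subset_ball) auto
    also have "\<dots> \<le> ennreal (nik_const p DIM('a) * (\<rho> powr (s * p) * ((1 - s) * A)))"
      unfolding \<rho>_def by (rule difference_bound[OF h])
    also have "\<dots> \<le> ennreal (\<theta> powr p * ((1 - s) * A))"
      using mult_right_mono[OF \<theta>p, of "(1 - s) * A"] s A by (intro ennreal_leI) (simp add: mult.assoc)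
    finally show ?thesis .
  qed
  have W: "Wpow s p (ball c (9 / 16 * R)) (dlt h u) \<le> ennreal (cc * ((2 * K\<^sup>2) * (\<rho> powr (s + t) * D)))"
  proof -
    have "Wpow s p (ball c (9 / 16 * R)) (dlt h u) \<le> ennreal (cc * ((\<theta> * \<theta> + \<rho> powr t * \<theta>) * D))"
      unfolding \<rho>_def cc_def using h h0 R \<theta> L by (intro core_estimate) auto
    also have "\<dots> \<le> ennreal (cc * ((2 * K\<^sup>2) * (\<rho> powr (s + t) * D)))"
    proof (intro ennreal_leI mult_left_mono cc)
      have "\<theta> * \<theta> = K\<^sup>2 * \<rho> powr (s + s)" unfolding \<theta>_def powr_add power2_eq_square by (simp only: mult_ac)
      also have "\<dots> \<le> K\<^sup>2 * \<rho> powr (s + t)" using \<rho> t by (intro mult_left_mono powr_mono') auto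
      finally have 1: "\<theta> * \<theta> \<le> K\<^sup>2 * \<rho> powr (s + t)" .
      have "\<rho> powr t * \<theta> = K * \<rho> powr (s + t)" by (simp add: \<theta>_def powr_add)
      also have "\<dots> \<le> K\<^sup>2 * \<rho> powr (s + t)" using K by (intro mult_right_mono) (auto simp: power2_eq_square)
      finally have "\<theta> * \<theta> + \<rho> powr t * \<theta> \<le> 2 * K\<^sup>2 * \<rho> powr (s + t)" using 1 by simp
      then have "(\<theta> * \<theta> + \<rho> powr t * \<theta>) * D \<le> 2 * K\<^sup>2 * \<rho> powr (s + t) * D"
        using D_nonneg by (rule mult_right_mono)
      then show "(\<theta> * \<theta> + \<rho> powr t * \<theta>) * D \<le> 2 * K\<^sup>2 * (\<rho> powr (s + t) * D)" by (simp add: mult.assoc)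
    qed
    finally show ?thesis .
  qed
  have "Lpow p (ball c (R / 2)) (dlt h (dlt h u)) \<le> ennreal (nik_const p DIM('a) * (1 - s) * norm h powr (s * p)) * Wpow s p (ball c (9 / 16 * R)) (dlt h u)"
    unfolding nik_const_def using p s R h by (intro nikolskii) auto
  also have "\<dots> \<le> ennreal (nik_const p DIM('a) * (1 - s) * norm h powr (s * p)) * ennreal (cc * ((2 * K\<^sup>2) * (\<rho> powr (s + t) * D)))"
    by (intro mult_left_mono W) simp
  also have "\<dots> = ennreal (nik_const p DIM('a) * (1 - s) * norm h powr (s * p) * (cc * ((2 * K\<^sup>2) * (\<rho> powr (s + t) * D))))"
    using p s A cc by (intro ennreal_mult[symmetric]) auto
  also have "nik_const p DIM('a) * (1 - s) * norm h powr (s * p) * (cc * ((2 * K\<^sup>2) * (\<rho> powr (s + t) * D)))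
    = second_const p \<Lambda> DIM('a) * ((1 - s) * A * (\<rho> powr (s + t) * (norm h powr (s * p) * R powr (- (s * p)))))"
    by (simp add: second_const_def cc_def K_def mult_ac)
  also have "norm h powr (s * p) * R powr (- (s * p)) = \<rho> powr (s * p)"
    unfolding \<rho>_def by (rule powr_quotient[OF R])
  \<comment> \<open>The orders s + t of the seminorm bound and sp of \<open>nikolskii\<close> add up
    to t + s(p + 1), which is at least \<open>l0\<close>; since \<rho> \<le> 1 the exponent may be
    lowered to \<open>l0\<close>.\<close>
  also have "\<rho> powr (s + t) * \<rho> powr (s * p) = \<rho> powr (t + s * (p + 1))"
    by (simp add: powr_add[symmetric] algebra_simps)
  also have "ennreal (second_const p \<Lambda> DIM('a) * ((1 - s) * A * \<rho> powr (t + s * (p + 1))))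
     \<le> ennreal (second_const p \<Lambda> DIM('a) * ((1 - s) * A * \<rho> powr l0))"
    using p \<Lambda> s A \<rho> l0 by (intro ennreal_leI mult_left_mono powr_mono') auto
  finally show ?thesis unfolding \<rho>_def .
qed

lemma first_difference:
  assumes h: "0 < norm h" "norm h \<le> R / 64"
  shows "Lpow p (ball c (R / 2)) (dlt h u) \<le> ennreal (first_const p \<Lambda> DIM('a) * (M * (norm h / R) powr p))"
proof -
  obtain n where n: "2 ^ n \<le> (R / 64) / norm h" "(R / 64) / norm h < 2 ^ Suc n"
    using dyadic_scale[of "(R / 64) / norm h"] h by (auto simp: field_simps)
  \<comment> \<open>The step h is doubled until its length is comparable with R/64. Telescoping then
    runs from this fixed scale down to h, with \<sigma> = l0 / p > 1.\<close>
  define v where "v = (2 ^ n) *\<^sub>R h"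
  have nv: "norm v = 2 ^ n * norm h" by (simp add: v_def)
  have v: "norm v \<le> R / 64" "R / 128 < norm v" using n h by (auto simp: nv field_simps)
  have vn: "v /\<^sub>R 2 ^ n = h" by (simp add: v_def)
  define P where "P = (nik_const p DIM('a) + second_const p \<Lambda> DIM('a)) * ((1 - s) * A)"
  have sA: "0 \<le> (1 - s) * A" using s A by simp
  have P: "0 \<le> P" using p \<Lambda> sA by (simp add: P_def)
  have v1: "norm v / R \<le> 1" "0 \<le> norm v / R" using v R by auto
  have "Lpow p (ball c (R / 2)) (\<lambda>x. 2 ^ n * dlt (v /\<^sub>R 2 ^ n) u x) \<le> ennreal (2 powr p * (1 + 4 powr p) * P / (l0 / p - 1) powr p)"
  proof (rule Lpow_telescope)
    have "Lpow p (ball c (R / 2)) (dlt v u) \<le> Lpow p (ball c (7 / 8 * R)) (dlt v u)"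
      using R by (intro Lpow_mono_set subset_ball) auto
    also have "\<dots> \<le> ennreal (nik_const p DIM('a) * ((norm v / R) powr (s * p) * ((1 - s) * A)))"
      by (rule difference_bound[OF v(1)])
    also have "\<dots> \<le> ennreal P"
    proof (intro ennreal_leI)
      have "(norm v / R) powr (s * p) \<le> 1" using v1 sp by (intro powr_le1) auto
      then have "nik_const p DIM('a) * ((norm v / R) powr (s * p) * ((1 - s) * A)) \<le> nik_const p DIM('a) * (1 * ((1 - s) * A))"
        using p sA by (intro mult_left_mono mult_right_mono) auto
      also have "\<dots> \<le> P" using p \<Lambda> sA by (simp add: P_def distrib_right)
      finally show "nik_const p DIM('a) * ((norm v / R) powr (s * p) * ((1 - s) * A)) \<le> P" .
    qed
    finally show "Lpow p (ball c (R / 2)) (dlt v u) \<le> ennreal P" .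
  next
    fix j
    have nvj: "norm (v /\<^sub>R 2 ^ Suc j) = norm v / 2 ^ Suc j" by (rule norm_dyadic)
    have vle: "norm v / 2 ^ Suc j \<le> norm v" by (rule dyadic_le) simp
    have "Lpow p (ball c (R / 2)) (dlt (v /\<^sub>R 2 ^ Suc j) (dlt (v /\<^sub>R 2 ^ Suc j) u))
      \<le> ennreal (second_const p \<Lambda> DIM('a) * ((1 - s) * A * (norm (v /\<^sub>R 2 ^ Suc j) / R) powr l0))"
      using vle v(1) unfolding nvj[symmetric] by (intro second_difference) linarith
    also have "\<dots> \<le> ennreal (P * (2 powr - (p * (l0 / p))) ^ j)"
    proof (intro ennreal_leI)
      have "(norm (v /\<^sub>R 2 ^ Suc j) / R) powr l0 \<le> (1 / 2 ^ j) powr l0"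
      proof (intro powr_mono2)
        show "norm (v /\<^sub>R 2 ^ Suc j) / R \<le> 1 / 2 ^ j"
        proof -
          have "norm v / R / 2 ^ Suc j \<le> 1 / 2 ^ j" using v1 by (intro frac_le) auto
          then show ?thesis unfolding nvj by (simp only: divide_divide_eq_left mult.commute)
        qed
      qed (use l0 p R in auto)
      also have "(1 / 2 ^ j) powr l0 = (2 powr - (p * (l0 / p))) ^ j"
        using p by (simp add: dyadic_powr)
      finally have "second_const p \<Lambda> DIM('a) * ((1 - s) * A * (norm (v /\<^sub>R 2 ^ Suc j) / R) powr l0)
        \<le> second_const p \<Lambda> DIM('a) * ((1 - s) * A * (2 powr - (p * (l0 / p))) ^ j)"
        using p \<Lambda> sA by (intro mult_left_mono) auto
      also have "\<dots> \<le> P * (2 powr - (p * (l0 / p))) ^ j"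
        using p sA s A unfolding P_def mult.assoc[symmetric] by (intro mult_right_mono) auto
      finally show "second_const p \<Lambda> DIM('a) * ((1 - s) * A * (norm (v /\<^sub>R 2 ^ Suc j) / R) powr l0) \<le> P * (2 powr - (p * (l0 / p))) ^ j" .
    qed
    finally show "Lpow p (ball c (R / 2)) (dlt (v /\<^sub>R 2 ^ Suc j) (dlt (v /\<^sub>R 2 ^ Suc j) u)) \<le> ennreal (P * (2 powr - (p * (l0 / p))) ^ j)" .
  qed (use p P l0_le in auto)
  then have "Lpow p (ball c (R / 2)) (\<lambda>x. 2 ^ n * dlt h u x) \<le> ennreal (2 powr p * (1 + 4 powr p) * P / (l0 / p - 1) powr p)"
    unfolding vn .
  then have b: "ennreal ((2 ^ n) powr p) * Lpow p (ball c (R / 2)) (dlt h u) \<le> ennreal (2 powr p * (1 + 4 powr p) * P / (l0 / p - 1) powr p)"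
    by (subst (asm) Lpow_cmult) auto
  have "Lpow p (ball c (R / 2)) (dlt h u) = ennreal (1 / (2 ^ n) powr p) * (ennreal ((2 ^ n) powr p) * Lpow p (ball c (R / 2)) (dlt h u))"
    by (simp add: mult.assoc[symmetric] ennreal_mult[symmetric])
  also have "\<dots> \<le> ennreal (1 / (2 ^ n) powr p) * ennreal (2 powr p * (1 + 4 powr p) * P / (l0 / p - 1) powr p)"
    by (intro mult_left_mono b) simp
  also have "\<dots> = ennreal (1 / (2 ^ n) powr p * (2 powr p * (1 + 4 powr p) * P / (l0 / p - 1) powr p))"
    using P by (intro ennreal_mult[symmetric]) auto
  also have "\<dots> \<le> ennreal ((128 * (norm h / R)) powr p * (2 powr p * (1 + 4 powr p) * P / (l0 / p - 1) powr p))"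
  proof (intro ennreal_leI mult_right_mono)
    have "1 / 2 ^ n \<le> 128 * (norm h / R)" using v(2) R by (simp add: nv field_simps)
    then have "(1 / 2 ^ n) powr p \<le> (128 * (norm h / R)) powr p" using p by (intro powr_mono2) auto
    then show "1 / (2 ^ n) powr p \<le> (128 * (norm h / R)) powr p" by (simp add: powr_divide)
  qed (use P in auto)
  also have "(128 * (norm h / R)) powr p * (2 powr p * (1 + 4 powr p) * P / (l0 / p - 1) powr p) = first_const p \<Lambda> DIM('a) * (M * (norm h / R) powr p)"
  proof -
    have "(l0 / p - 1) powr p = (l0 - p) powr p / p powr p"
      using l0 p by (simp add: powr_divide[symmetric] diff_divide_distrib)
    moreover have "(128 * (norm h / R)) powr p = 128 powr p * (norm h / R) powr p" by (rule powr_mult)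
    ultimately show ?thesis by (simp add: first_const_def P_def M_def mult_ac)
  qed
  finally show ?thesis .
qed

lemma mixed_difference:
  assumes h: "0 < norm h" "norm h \<le> R / 64" and k: "0 < norm k" "norm k \<le> R / 64"
  shows "Lpow p (ball c (17 / 64 * R)) (dlt k (dlt h u))
    \<le> ennreal (mixed_const p \<Lambda> DIM('a) * (M * ((norm k / R) powr (s * p) * (norm h / R) powr (1 + t))))"
proof -
  define \<rho> where "\<rho> = norm h / R"
  have \<rho>: "0 < \<rho>" "\<rho> \<le> 1" using h R by (auto simp: \<rho>_def)
  define m where "m = l0 - p"
  have m: "0 < m" "m \<le> 2" using l0 l0_le by (auto simp: m_def)
  define K where "K = 1 + first_const p \<Lambda> DIM('a)"
  have K: "1 \<le> K" "first_const p \<Lambda> DIM('a) \<le> K" using p \<Lambda> by (auto simp: K_def)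
  define cc where "cc = core_const p \<Lambda> DIM('a)"
  have cc: "0 \<le> cc" using p \<Lambda> by (simp add: cc_def)
  \<comment> \<open>Second use of \<open>core_estimate\<close>, now with the order 1 from
    \<open>first_difference\<close>; dividing by m turns \<open>M\<close> back into (1 - s)
    A.\<close>
  define \<theta> where "\<theta> = K * \<rho> / m"
  have \<theta>: "0 < \<theta>" using K \<rho> m by (simp add: \<theta>_def)
  have L: "Lpow p (ball c (5 / 16 * R + R / 8)) (dlt h u) \<le> ennreal (\<theta> powr p * ((1 - s) * A))"
  proof -
    have "Lpow p (ball c (5 / 16 * R + R / 8)) (dlt h u) \<le> Lpow p (ball c (R / 2)) (dlt h u)"
      using R by (intro Lpow_mono_set subset_ball) auto
    also have "\<dots> \<le> ennreal (first_const p \<Lambda> DIM('a) * (M * \<rho> powr p))"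
      unfolding \<rho>_def by (rule first_difference[OF h])
    also have "\<dots> \<le> ennreal (K powr p * (M * \<rho> powr p))"
    proof (intro ennreal_leI mult_right_mono)
      have "K \<le> K powr p" using K p powr_mono[of 1 p K] by simp
      then show "first_const p \<Lambda> DIM('a) \<le> K powr p" using K by simp
    qed (use M_nonneg in auto)
    also have "K powr p * (M * \<rho> powr p) = \<theta> powr p * ((1 - s) * A)"
      using K \<rho> m by (simp add: \<theta>_def M_def m_def powr_mult powr_divide)
    finally show ?thesis .
  qed
  have W: "Wpow s p (ball c (5 / 16 * R)) (dlt h u) \<le> ennreal (cc * ((3 * K\<^sup>2 * 2 powr p) * (\<rho> powr (1 + t) * D / m powr p)))"
  proof -
    have "Wpow s p (ball c (5 / 16 * R)) (dlt h u) \<le> ennreal (cc * ((\<theta> * \<theta> + \<rho> powr t * \<theta>) * D))"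
      unfolding \<rho>_def cc_def using h R \<theta> L by (intro core_estimate) auto
    also have "\<dots> \<le> ennreal (cc * ((3 * K\<^sup>2 * 2 powr p) * (\<rho> powr (1 + t) * D / m powr p)))"
    proof (intro ennreal_leI mult_left_mono cc)
      define y where "y = \<rho> powr (1 + t)"
      have y: "0 \<le> y" by (simp add: y_def)
      have "\<theta> * \<theta> = K\<^sup>2 * \<rho> powr 2 / m\<^sup>2" using \<rho> by (simp add: \<theta>_def power2_eq_square)
      also have "\<dots> \<le> K\<^sup>2 * y / m\<^sup>2"
        unfolding y_def using \<rho> t s by (intro divide_right_mono mult_left_mono powr_mono') auto
      finally have 1: "\<theta> * \<theta> \<le> K\<^sup>2 * y / m\<^sup>2" .
      have "\<rho> powr t * \<theta> = K * y * m / m\<^sup>2" using \<rho> m by (simp add: \<theta>_def y_def powr_add power2_eq_square)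
      also have "\<dots> \<le> K\<^sup>2 * y * 2 / m\<^sup>2"
        using K m y by (intro divide_right_mono mult_mono) (auto simp: power2_eq_square)
      finally have "\<theta> * \<theta> + \<rho> powr t * \<theta> \<le> 3 * K\<^sup>2 * y / m\<^sup>2" using 1 by (simp add: add_divide_distrib[symmetric])
      also have "\<dots> \<le> 3 * K\<^sup>2 * y * (2 powr p / m powr p)"
      proof -
        \<comment> \<open>As m \<le> 2 and p \<ge> 2, the quadratic loss m^(-2) is dominated by the
          loss m^(-p) already contained in \<open>M\<close>.\<close>
        have "m powr (p - 2) \<le> 2 powr (p - 2)" using m p by (intro powr_mono2) auto
        also have "\<dots> \<le> 2 powr p" by (intro powr_mono) auto
        finally have "m powr p \<le> 2 powr p * m\<^sup>2" using m by (simp add: powr_diff field_simps)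
        then have "1 / m\<^sup>2 \<le> 2 powr p / m powr p" using m by (simp add: field_simps)
        then have "3 * K\<^sup>2 * y * (1 / m\<^sup>2) \<le> 3 * K\<^sup>2 * y * (2 powr p / m powr p)" using y by (intro mult_left_mono) auto
        then show ?thesis by simp
      qed
      finally have "(\<theta> * \<theta> + \<rho> powr t * \<theta>) * D \<le> 3 * K\<^sup>2 * y * (2 powr p / m powr p) * D"
        using D_nonneg by (intro mult_right_mono)
      then show "(\<theta> * \<theta> + \<rho> powr t * \<theta>) * D \<le> 3 * K\<^sup>2 * 2 powr p * (\<rho> powr (1 + t) * D / m powr p)" by (simp add: y_def mult_ac)
    qed
    finally show ?thesis .
  qed
  have "Lpow p (ball c (17 / 64 * R)) (dlt k (dlt h u)) \<le> ennreal (nik_const p DIM('a) * (1 - s) * norm k powr (s * p)) * Wpow s p (ball c (5 / 16 * R)) (dlt h u)"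
    unfolding nik_const_def using p s R k by (intro nikolskii) auto
  also have "\<dots> \<le> ennreal (nik_const p DIM('a) * (1 - s) * norm k powr (s * p)) * ennreal (cc * ((3 * K\<^sup>2 * 2 powr p) * (\<rho> powr (1 + t) * D / m powr p)))"
    by (intro mult_left_mono W) simp
  also have "\<dots> = ennreal (nik_const p DIM('a) * (1 - s) * norm k powr (s * p) * (cc * ((3 * K\<^sup>2 * 2 powr p) * (\<rho> powr (1 + t) * D / m powr p))))"
    using p s A cc by (intro ennreal_mult[symmetric]) auto
  also have "nik_const p DIM('a) * (1 - s) * norm k powr (s * p) * (cc * ((3 * K\<^sup>2 * 2 powr p) * (\<rho> powr (1 + t) * D / m powr p)))
    = mixed_const p \<Lambda> DIM('a) * (M * ((norm k powr (s * p) * R powr (- (s * p))) * \<rho> powr (1 + t)))"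
    by (simp add: mixed_const_def cc_def K_def M_def m_def mult_ac)
  also have "norm k powr (s * p) * R powr (- (s * p)) = (norm k / R) powr (s * p)"
    by (rule powr_quotient[OF R])
  finally show ?thesis unfolding \<rho>_def .
qed

definition "Gam = (1 + t + s * p) / p"

lemma Gam: "1 < Gam" "Gam < 2" "p * Gam = s * p + (1 + t)"
proof -
  have "p < t + s * p + s" using l0 by (simp add: distrib_left)
  then have "p < 1 + t + s * p" using s by linarith
  then show "1 < Gam" using p by (simp add: Gam_def field_simps)
  have "s * p < 1 * p" using s p by (intro mult_strict_right_mono) auto
  then have "1 + t + s * p < 2 * p" using s t p by linarith
  then show "Gam < 2" using p by (simp add: Gam_def field_simps)
  show "p * Gam = s * p + (1 + t)" using p by (simp add: Gam_def)
qed

text \<open>Telescoping for the function d_k u, with \<sigma> = \<Gamma> > 1. The starting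
  difference is mixed and v is at most as long as k, so its p-th power is of order |k|^(sp + 1 + t)
  = |k|^(p \<Gamma>).\<close>

lemma slope_difference:
  assumes k: "0 < norm k" "norm k \<le> R / 64" and v: "0 < norm v" "norm v \<le> norm k"
  shows "Lpow p (ball c (R / 4)) (\<lambda>x. 2 ^ n * dlt (v /\<^sub>R 2 ^ n) (dlt k u) x)
    \<le> ennreal (slope_const p \<Lambda> DIM('a) * (M * (norm k / R) powr (p * Gam) / (Gam - 1) powr p))"
proof -
  define \<rho> where "\<rho> = norm k / R"
  have \<rho>: "0 < \<rho>" using k R by (simp add: \<rho>_def)
  define mc where "mc = mixed_const p \<Lambda> DIM('a)"
  have mc: "0 \<le> mc" using p \<Lambda> by (simp add: mc_def)
  define P where "P = 2 * 2 powr p * mc * (M * \<rho> powr (p * Gam))"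
  have P: "0 \<le> P" using mc M_nonneg by (simp add: P_def)
  have two: "1 \<le> 2 * (2::real) powr p" using p ge_one_powr_ge_zero[of 2 p] by simp
  have "Lpow p (ball c (R / 4)) (\<lambda>x. 2 ^ n * dlt (v /\<^sub>R 2 ^ n) (dlt k u) x) \<le> ennreal (2 powr p * (1 + 4 powr p) * P / (Gam - 1) powr p)"
  proof (rule Lpow_telescope)
    have "Lpow p (ball c (R / 4)) (dlt v (dlt k u)) \<le> Lpow p (ball c (17 / 64 * R)) (dlt v (dlt k u))"
      using R by (intro Lpow_mono_set subset_ball) auto
    also have "\<dots> \<le> ennreal (mc * (M * ((norm v / R) powr (s * p) * \<rho> powr (1 + t))))"
      unfolding mc_def \<rho>_def using k v by (intro mixed_difference) auto
    also have "\<dots> \<le> ennreal P"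
    proof (intro ennreal_leI)
      have "(norm v / R) powr (s * p) \<le> \<rho> powr (s * p)"
        unfolding \<rho>_def using v R sp by (intro powr_mono2 divide_right_mono) auto
      then have "mc * (M * ((norm v / R) powr (s * p) * \<rho> powr (1 + t))) \<le> mc * (M * (\<rho> powr (s * p) * \<rho> powr (1 + t)))"
        using mc M_nonneg by (intro mult_left_mono mult_right_mono) auto
      also have "\<dots> = 1 * (mc * (M * \<rho> powr (p * Gam)))" by (simp add: Gam(3) powr_add)
      also have "\<dots> \<le> (2 * 2 powr p) * (mc * (M * \<rho> powr (p * Gam)))"
        using two mc M_nonneg by (intro mult_right_mono) auto
      finally show "mc * (M * ((norm v / R) powr (s * p) * \<rho> powr (1 + t))) \<le> P" by (simp add: P_def mult.assoc)
    qed
    finally show "Lpow p (ball c (R / 4)) (dlt v (dlt k u)) \<le> ennreal P" .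
  next
    fix j
    define w where "w = v /\<^sub>R 2 ^ Suc j"
    have nw: "norm w = norm v / 2 ^ Suc j" unfolding w_def by (rule norm_dyadic)
    have wle: "norm w \<le> norm v" unfolding nw by (rule dyadic_le) simp
    have w0: "0 < norm w" using v by (simp add: nw)
    have w: "norm w \<le> R / 64" using wle v k by linarith
    \<comment> \<open>Moving d_k outermost costs only 2^p by the triangle inequality. The remaining
      d_w d_w u is the mixed difference with equal steps and decays like |w|^(p \<Gamma>).\<close>
    have "Lpow p (ball c (R / 4)) (dlt w (dlt w (dlt k u))) = Lpow p (ball c (R / 4)) (dlt k (dlt w (dlt w u)))"
      by (simp add: dlt_commute[of w k])
    also have "\<dots> \<le> ennreal (2 powr p) * Lpow p (ball c (17 / 64 * R)) (dlt w (dlt w u))"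
      using k p by (intro Lpow_dlt_le) auto
    also have "\<dots> \<le> ennreal (2 powr p) * ennreal (mc * (M * ((norm w / R) powr (s * p) * (norm w / R) powr (1 + t))))"
      unfolding mc_def using w w0 by (intro mult_left_mono mixed_difference) auto
    also have "\<dots> = ennreal (2 powr p) * ennreal (mc * (M * (norm w / R) powr (p * Gam)))"
      by (simp only: Gam(3) powr_add)
    also have "\<dots> = ennreal (2 powr p * (mc * (M * (norm w / R) powr (p * Gam))))"
      using mc M_nonneg by (intro ennreal_mult[symmetric]) auto
    also have "\<dots> \<le> ennreal (P * (2 powr - (p * Gam)) ^ j)"
    proof (intro ennreal_leI)
      have "(norm w / R) powr (p * Gam) \<le> (\<rho> * (1 / 2 ^ j)) powr (p * Gam)"
      proof (intro powr_mono2)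
        have "norm v \<le> norm k * 2" using v by linarith
        then have "norm w \<le> norm k * (1 / 2 ^ j)" unfolding nw by (simp add: field_simps)
        then show "norm w / R \<le> \<rho> * (1 / 2 ^ j)" using R by (simp add: \<rho>_def field_simps)
      qed (use p R Gam sp t in auto)
      also have "\<dots> = \<rho> powr (p * Gam) * (1 / 2 ^ j) powr (p * Gam)" by (rule powr_mult)
      also have "(1 / 2 ^ j) powr (p * Gam) = (2 powr - (p * Gam)) ^ j"
        by (rule dyadic_powr)
      finally have "2 powr p * (mc * (M * (norm w / R) powr (p * Gam))) \<le> 2 powr p * (mc * (M * (\<rho> powr (p * Gam) * (2 powr - (p * Gam)) ^ j)))"
        using mc M_nonneg by (intro mult_left_mono) auto
      also have "\<dots> \<le> 2 * (2 powr p * (mc * (M * (\<rho> powr (p * Gam) * (2 powr - (p * Gam)) ^ j))))"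
        using mc M_nonneg by simp
      finally show "2 powr p * (mc * (M * (norm w / R) powr (p * Gam))) \<le> P * (2 powr - (p * Gam)) ^ j"
        by (simp add: P_def mult.assoc)
    qed
    finally show "Lpow p (ball c (R / 4)) (dlt (v /\<^sub>R 2 ^ Suc j) (dlt (v /\<^sub>R 2 ^ Suc j) (dlt k u))) \<le> ennreal (P * (2 powr - (p * Gam)) ^ j)"
      unfolding w_def .
  qed (use p P Gam in auto)
  also have "2 powr p * (1 + 4 powr p) * P / (Gam - 1) powr p = slope_const p \<Lambda> DIM('a) * (M * \<rho> powr (p * Gam) / (Gam - 1) powr p)"
    by (simp add: slope_const_def P_def mc_def mult_ac)
  finally show ?thesis unfolding \<rho>_def .
qed

end

subsection \<open>Dyadic directional derivatives\<close>

text \<open>The value of \<open>dyadic_deriv\<close> is arbitrary where the dyadic quotients diverge. Only the steps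
  \<open>e / 2 ^ n\<close> are used, so that convergence follows from summable second differences.\<close>

definition dyadic_deriv :: "'a::euclidean_space \<Rightarrow> ('a \<Rightarrow> real) \<Rightarrow> 'a \<Rightarrow> real" where
  "dyadic_deriv e u x = lim (\<lambda>n. 2 ^ n * dlt (e /\<^sub>R 2 ^ n) u x)"

definition dyadic_differentiable :: "'a::euclidean_space \<Rightarrow> ('a \<Rightarrow> real) \<Rightarrow> 'a \<Rightarrow> bool" where
  "dyadic_differentiable e u x \<longleftrightarrow> convergent (\<lambda>n. 2 ^ n * dlt (e /\<^sub>R 2 ^ n) u x)"

lemma borel_measurable_dyadic_deriv[measurable]:
  assumes [measurable]: "u \<in> borel_measurable borel"
  shows "dyadic_deriv e u \<in> borel_measurable borel"
  unfolding dyadic_deriv_def[abs_def] by measurable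

lemma dyadic_deriv_LIMSEQ:
  "dyadic_differentiable e u x \<Longrightarrow> (\<lambda>n. 2 ^ n * dlt (e /\<^sub>R 2 ^ n) u x) \<longlonglongrightarrow> dyadic_deriv e u x"
  unfolding dyadic_deriv_def dyadic_differentiable_def by (simp add: convergent_LIMSEQ_iff)

lemma AE_lborel_shift:
  fixes P :: "'a::euclidean_space \<Rightarrow> bool"
  assumes "AE x in lborel. P x"
  shows "AE x in lborel. P (x + h)"
proof -
  obtain N where N: "{x. \<not> P x} \<subseteq> N" "N \<in> sets borel" "emeasure lborel N = 0"
    using assms by (auto elim!: AE_E)
  note [measurable] = N(2)
  have ind: "indicator N (x + h) = (indicator {x. x + h \<in> N} x :: ennreal)" for x
    by (simp add: indicator_def)
  have "emeasure lborel {x. x + h \<in> N} = (\<integral>\<^sup>+x. indicator N (x + h) \<partial>lborel)"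
    unfolding ind by (rule nn_integral_indicator[symmetric]) measurable
  also have "\<dots> = (\<integral>\<^sup>+x. indicator N x \<partial>lborel)" by (rule nn_integral_lborel_plus) measurable
  also have "\<dots> = 0" using N by simp
  finally have "{x. x + h \<in> N} \<in> null_sets lborel" by (intro null_setsI) auto
  then show ?thesis by (rule AE_I') (use N(1) in auto)
qed

text \<open>The bound is required from an index m on only, because the difference estimates hold for
  steps of length at most R/64.\<close>

lemma Lpow_fatou:
  fixes v :: "'a::euclidean_space \<Rightarrow> real"
  assumes [measurable]: "\<And>n. w n \<in> borel_measurable borel" "v \<in> borel_measurable borel" "B \<in> sets borel"
    and p: "0 < p" and lim: "AE x in lborel. x \<in> B \<longrightarrow> (\<lambda>n. w n x) \<longlonglongrightarrow> v x"
    and C: "\<And>n. m \<le> n \<Longrightarrow> Lpow p B (w n) \<le> C"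
  shows "Lpow p B v \<le> C"
proof -
  have "Lpow p B v = (\<integral>\<^sup>+x. liminf (\<lambda>n. ennreal (\<bar>w n x\<bar> powr p) * indicator B x) \<partial>lborel)"
    unfolding Lpow_def
  proof (rule nn_integral_cong_AE, use lim in eventually_elim)
    fix x assume x: "x \<in> B \<longrightarrow> (\<lambda>n. w n x) \<longlonglongrightarrow> v x"
    have "(\<lambda>n. ennreal (\<bar>w n x\<bar> powr p) * indicator B x) \<longlonglongrightarrow> ennreal (\<bar>v x\<bar> powr p) * indicator B x"
    proof (cases "x \<in> B")
      case True
      then have "(\<lambda>n. \<bar>w n x\<bar> powr p) \<longlonglongrightarrow> \<bar>v x\<bar> powr p"
        using x p by (intro tendsto_powr' tendsto_rabs tendsto_const) auto
      then show ?thesis using True by (simp add: tendsto_ennrealI)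
    qed simp
    then show "ennreal (\<bar>v x\<bar> powr p) * indicator B x = liminf (\<lambda>n. ennreal (\<bar>w n x\<bar> powr p) * indicator B x)"
      by (simp add: lim_imp_Liminf)
  qed
  also have "\<dots> \<le> liminf (\<lambda>n. Lpow p B (w n))"
    unfolding Lpow_def by (rule nn_integral_liminf) measurable
  also have "\<dots> \<le> liminf (\<lambda>n. C)"
    by (rule Liminf_mono) (use C in \<open>auto simp: eventually_sequentially\<close>)
  also have "\<dots> = C" by (simp add: Liminf_const)
  finally show ?thesis .
qed

text \<open>A step along the direction e of length comparable with a given a. Taking l a power of
  two, the dyadic quotients along l e are those along e with shifted index and multiplied by l, so
  convergence is inherited.\<close>

lemma dyadic_multiple:
  fixes a :: real
  assumes "0 < a"
  obtains l where "0 < l" "l \<le> a" "a < 2 * l"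
    "\<And>(e :: 'a::euclidean_space) u x L. (\<lambda>n. 2 ^ n * dlt (e /\<^sub>R 2 ^ n) u x) \<longlonglongrightarrow> L
      \<Longrightarrow> (\<lambda>n. 2 ^ n * dlt ((l *\<^sub>R e) /\<^sub>R 2 ^ n) u x) \<longlonglongrightarrow> l * L"
proof (cases "1 \<le> a")
  case True
  obtain m where m: "2 ^ m \<le> a" "a < 2 ^ Suc m" using dyadic_scale[OF True] by auto
  show ?thesis
  proof (rule that[of "2 ^ m"])
    fix e :: 'a and u :: "'a \<Rightarrow> real" and x L
    assume "(\<lambda>n. 2 ^ n * dlt (e /\<^sub>R 2 ^ n) u x) \<longlonglongrightarrow> L"
    then have "(\<lambda>n. 2 ^ m * (2 ^ n * dlt (e /\<^sub>R 2 ^ n) u x)) \<longlonglongrightarrow> 2 ^ m * L" by (intro tendsto_mult_left)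
    also have "(\<lambda>n. 2 ^ m * (2 ^ n * dlt (e /\<^sub>R 2 ^ n) u x)) = (\<lambda>n. 2 ^ (n + m) * dlt ((2 ^ m *\<^sub>R e) /\<^sub>R 2 ^ (n + m)) u x)"
    proof
      fix n
      have "(2 ^ m *\<^sub>R e) /\<^sub>R 2 ^ (n + m) = e /\<^sub>R 2 ^ n"
        unfolding scaleR_scaleR by (simp add: power_add)
      then show "2 ^ m * (2 ^ n * dlt (e /\<^sub>R 2 ^ n) u x) = 2 ^ (n + m) * dlt ((2 ^ m *\<^sub>R e) /\<^sub>R 2 ^ (n + m)) u x"
        by (simp only: power_add mult_ac)
    qed
    finally show "(\<lambda>n. 2 ^ n * dlt ((2 ^ m *\<^sub>R e) /\<^sub>R 2 ^ n) u x) \<longlonglongrightarrow> 2 ^ m * L" by (rule LIMSEQ_offset)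
  qed (use m in auto)
next
  case False
  then have "1 \<le> 1 / a" using assms by simp
  then obtain i where i: "2 ^ i \<le> 1 / a" "1 / a < 2 ^ Suc i" using dyadic_scale[of "1 / a"] by auto
  have "\<exists>m. 1 / 2 ^ m \<le> a \<and> a < 2 * (1 / 2 ^ m)"
  proof (cases "a = 1 / 2 ^ i")
    case True
    then show ?thesis using assms by (intro exI[of _ i]) (simp add: True[symmetric])
  next
    case False
    then have "a < 1 / 2 ^ i" using i(1) assms by (simp add: field_simps)
    then show ?thesis using i(2) assms by (intro exI[of _ "Suc i"]) (auto simp: field_simps)
  qed
  then obtain m where m: "1 / 2 ^ m \<le> a" "a < 2 * (1 / 2 ^ m)" by auto
  show ?thesis
  proof (rule that[of "1 / 2 ^ m"])
    show "1 / 2 ^ m \<le> a" "a < 2 * (1 / 2 ^ m)" by (rule m)+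
    fix e :: 'a and u :: "'a \<Rightarrow> real" and x L
    assume "(\<lambda>n. 2 ^ n * dlt (e /\<^sub>R 2 ^ n) u x) \<longlonglongrightarrow> L"
    then have "(\<lambda>n. 2 ^ (n + m) * dlt (e /\<^sub>R 2 ^ (n + m)) u x) \<longlonglongrightarrow> L" by (rule LIMSEQ_ignore_initial_segment)
    then have "(\<lambda>n. 1 / 2 ^ m * (2 ^ (n + m) * dlt (e /\<^sub>R 2 ^ (n + m)) u x)) \<longlonglongrightarrow> 1 / 2 ^ m * L" by (intro tendsto_mult_left)
    also have "(\<lambda>n. 1 / 2 ^ m * (2 ^ (n + m) * dlt (e /\<^sub>R 2 ^ (n + m)) u x)) = (\<lambda>n. 2 ^ n * dlt (((1 / 2 ^ m) *\<^sub>R e) /\<^sub>R 2 ^ n) u x)"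
    proof
      fix n
      have 1: "((1 / 2 ^ m) *\<^sub>R e) /\<^sub>R 2 ^ n = e /\<^sub>R 2 ^ (n + m)"
        unfolding scaleR_scaleR by (simp add: power_add divide_inverse)
      have 2: "1 / 2 ^ m * (2 ^ (n + m) * y) = 2 ^ n * y" for y :: real
        by (simp add: power_add)
      show "1 / 2 ^ m * (2 ^ (n + m) * dlt (e /\<^sub>R 2 ^ (n + m)) u x) = 2 ^ n * dlt (((1 / 2 ^ m) *\<^sub>R e) /\<^sub>R 2 ^ n) u x"
        unfolding 1 2 ..
    qed
    finally show "(\<lambda>n. 2 ^ n * dlt (((1 / 2 ^ m) *\<^sub>R e) /\<^sub>R 2 ^ n) u x) \<longlonglongrightarrow> 1 / 2 ^ m * L" .
  qed auto
qed

section \<open>Bounds for the dyadic directional derivative\<close>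

definition grad_const :: "real \<Rightarrow> real \<Rightarrow> nat \<Rightarrow> real" where
  "grad_const p \<Lambda> n = knl_const p n * (2 powr p * slope_const p \<Lambda> n + 2 * 2 powr p * first_const p \<Lambda> n * 64 powr p)"

context borel_solution_diff
begin

context
  fixes e :: 'a
  assumes e: "norm e = 1"
    and conv: "AE x in lborel. x \<in> ball c (R / 2) \<longrightarrow> dyadic_differentiable e u x"
begin

lemma derivative_bound:
  "Lpow p (ball c (R / 2)) (dyadic_deriv e u) \<le> ennreal (first_const p \<Lambda> DIM('a) * (M * R powr (- p)))"
proof -
  obtain m :: nat where m: "64 / R < 2 ^ m" using real_arch_pow[of 2 "64 / R"] by auto
  show ?thesis
  proof (rule Lpow_fatou[where w = "\<lambda>n x. 2 ^ n * dlt (e /\<^sub>R 2 ^ n) u x" and m = m])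
    show "AE x in lborel. x \<in> ball c (R / 2) \<longrightarrow> (\<lambda>n. 2 ^ n * dlt (e /\<^sub>R 2 ^ n) u x) \<longlonglongrightarrow> dyadic_deriv e u x"
      using conv by eventually_elim (auto intro: dyadic_deriv_LIMSEQ)
    fix n assume n: "m \<le> n"
    have "(2::real) ^ m \<le> 2 ^ n" using n by (intro power_increasing) auto
    then have n64: "64 / R < 2 ^ n" using m by linarith
    have ne: "norm (e /\<^sub>R 2 ^ n) = 1 / 2 ^ n" unfolding norm_dyadic e ..
    have le: "norm (e /\<^sub>R 2 ^ n) \<le> R / 64" unfolding ne using n64 R by (simp add: field_simps)
    have "Lpow p (ball c (R / 2)) (\<lambda>x. 2 ^ n * dlt (e /\<^sub>R 2 ^ n) u x) = ennreal ((2 ^ n) powr p) * Lpow p (ball c (R / 2)) (dlt (e /\<^sub>R 2 ^ n) u)"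
      by (subst Lpow_cmult) auto
    also have "\<dots> \<le> ennreal ((2 ^ n) powr p) * ennreal (first_const p \<Lambda> DIM('a) * (M * (1 / 2 ^ n / R) powr p))"
    proof (intro mult_left_mono)
      have "0 < norm (e /\<^sub>R 2 ^ n)" unfolding ne by simp
      then show "Lpow p (ball c (R / 2)) (dlt (e /\<^sub>R 2 ^ n) u) \<le> ennreal (first_const p \<Lambda> DIM('a) * (M * (1 / 2 ^ n / R) powr p))"
        unfolding ne[symmetric] using le by (intro first_difference)
    qed simp
    also have "\<dots> = ennreal ((2 ^ n) powr p * (first_const p \<Lambda> DIM('a) * (M * (1 / 2 ^ n / R) powr p)))"
      using p \<Lambda> M_nonneg by (intro ennreal_mult[symmetric]) auto
    also have "(2 ^ n) powr p * (first_const p \<Lambda> DIM('a) * (M * (1 / 2 ^ n / R) powr p)) = first_const p \<Lambda> DIM('a) * (M * R powr (- p))"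
      using R by (simp add: powr_divide powr_mult powr_minus_divide)
    finally show "Lpow p (ball c (R / 2)) (\<lambda>x. 2 ^ n * dlt (e /\<^sub>R 2 ^ n) u x) \<le> ennreal (first_const p \<Lambda> DIM('a) * (M * R powr (- p)))" .
  qed (use p in auto)
qed

text \<open>With v = l e and l comparable with |k|, the quotients of d_k u along v converge to l
  times the difference of the derivative. \<open>slope_difference\<close> and Fatou give order p
  \<Gamma> in |k|, and dividing by l^p leaves p(\<Gamma> - 1).\<close>

lemma derivative_difference_bound:
  assumes k: "0 < norm k" "norm k \<le> R / 64"
  shows "Lpow p (ball c (R / 4)) (dlt k (dyadic_deriv e u))
    \<le> ennreal (2 powr p * slope_const p \<Lambda> DIM('a) * (M * R powr (- p) / (Gam - 1) powr p) * (norm k / R) powr (p * (Gam - 1)))"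
proof -
  obtain l where l: "0 < l" "l \<le> norm k" "norm k < 2 * l"
    and lim: "\<And>(e :: 'a) u x L. (\<lambda>n. 2 ^ n * dlt (e /\<^sub>R 2 ^ n) u x) \<longlonglongrightarrow> L \<Longrightarrow> (\<lambda>n. 2 ^ n * dlt ((l *\<^sub>R e) /\<^sub>R 2 ^ n) u x) \<longlonglongrightarrow> l * L"
    by (rule dyadic_multiple[OF k(1)]) (rule that)
  define v where "v = l *\<^sub>R e"
  have v: "0 < norm v" "norm v \<le> norm k" using l e by (auto simp: v_def)
  let ?C = "slope_const p \<Lambda> DIM('a) * (M * (norm k / R) powr (p * Gam) / (Gam - 1) powr p)"
  have "Lpow p (ball c (R / 4)) (\<lambda>x. l * dlt k (dyadic_deriv e u) x) \<le> ennreal ?C"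
  proof (rule Lpow_fatou[where w = "\<lambda>n x. 2 ^ n * dlt (v /\<^sub>R 2 ^ n) (dlt k u) x" and m = 0])
    show "AE x in lborel. x \<in> ball c (R / 4) \<longrightarrow> (\<lambda>n. 2 ^ n * dlt (v /\<^sub>R 2 ^ n) (dlt k u) x) \<longlonglongrightarrow> l * dlt k (dyadic_deriv e u) x"
      using conv AE_lborel_shift[OF conv, of k]
    proof eventually_elim
      fix x
      assume a: "x \<in> ball c (R / 2) \<longrightarrow> dyadic_differentiable e u x" "x + k \<in> ball c (R / 2) \<longrightarrow> dyadic_differentiable e u (x + k)"
      show "x \<in> ball c (R / 4) \<longrightarrow> (\<lambda>n. 2 ^ n * dlt (v /\<^sub>R 2 ^ n) (dlt k u) x) \<longlonglongrightarrow> l * dlt k (dyadic_deriv e u) x"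
      proof
        assume x: "x \<in> ball c (R / 4)"
        have "dist c (x + k) \<le> dist c x + norm k" by norm
        then have x2: "x \<in> ball c (R / 2)" "x + k \<in> ball c (R / 2)" using x k R by auto
        have "(\<lambda>n. 2 ^ n * dlt (v /\<^sub>R 2 ^ n) u (x + k) - 2 ^ n * dlt (v /\<^sub>R 2 ^ n) u x) \<longlonglongrightarrow> l * dyadic_deriv e u (x + k) - l * dyadic_deriv e u x"
          unfolding v_def using a x2 by (intro tendsto_diff lim dyadic_deriv_LIMSEQ) auto
        moreover have "(\<lambda>n. 2 ^ n * dlt (v /\<^sub>R 2 ^ n) u (x + k) - 2 ^ n * dlt (v /\<^sub>R 2 ^ n) u x) = (\<lambda>n. 2 ^ n * dlt (v /\<^sub>R 2 ^ n) (dlt k u) x)"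
          by (auto simp: dlt_def algebra_simps)
        ultimately show "(\<lambda>n. 2 ^ n * dlt (v /\<^sub>R 2 ^ n) (dlt k u) x) \<longlonglongrightarrow> l * dlt k (dyadic_deriv e u) x"
          by (simp add: dlt_def right_diff_distrib)
      qed
    qed
    fix n
    show "Lpow p (ball c (R / 4)) (\<lambda>x. 2 ^ n * dlt (v /\<^sub>R 2 ^ n) (dlt k u) x) \<le> ennreal ?C"
      by (rule slope_difference[OF k v])
  qed (use p in auto)
  then have b: "ennreal (l powr p) * Lpow p (ball c (R / 4)) (dlt k (dyadic_deriv e u)) \<le> ennreal ?C"
    using l by (subst (asm) Lpow_cmult) auto
  have C0: "0 \<le> ?C" using p \<Lambda> M_nonneg by simp
  have "Lpow p (ball c (R / 4)) (dlt k (dyadic_deriv e u)) = ennreal (1 / l powr p) * (ennreal (l powr p) * Lpow p (ball c (R / 4)) (dlt k (dyadic_deriv e u)))"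
    using l by (simp add: mult.assoc[symmetric] ennreal_mult[symmetric])
  also have "\<dots> \<le> ennreal (1 / l powr p) * ennreal ?C" by (intro mult_left_mono b) simp
  also have "\<dots> = ennreal (1 / l powr p * ?C)" using C0 by (intro ennreal_mult[symmetric]) auto
  also have "\<dots> \<le> ennreal ((2 / norm k) powr p * ?C)"
  proof (intro ennreal_leI mult_right_mono C0)
    have "1 / l \<le> 2 / norm k" using l k by (simp add: field_simps)
    then have "(1 / l) powr p \<le> (2 / norm k) powr p" using l p by (intro powr_mono2) auto
    then show "1 / l powr p \<le> (2 / norm k) powr p" using l by (simp add: powr_divide)
  qed
  also have "(2 / norm k) powr p * ?C = 2 powr p * slope_const p \<Lambda> DIM('a) * (M * R powr (- p) / (Gam - 1) powr p) * (norm k / R) powr (p * (Gam - 1))"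
  proof -
    define x where "x = (norm k / R) powr (p * (Gam - 1))"
    define y where "y = (norm k / R) powr p"
    define S where "S = slope_const p \<Lambda> DIM('a)"
    define G where "G = (Gam - 1) powr p"
    have "(norm k / R) powr (p * Gam) = x * y"
      by (simp add: x_def y_def powr_add[symmetric] algebra_simps)
    then have "(2 / norm k) powr p * ?C = ((2 / norm k) powr p * y) * (S * (M / G) * x)"
      unfolding S_def[symmetric] G_def[symmetric] by simp
    also have "(2 / norm k) powr p * y = 2 powr p * R powr (- p)"
      using k R by (simp add: y_def powr_divide powr_minus_divide)
    finally show ?thesis unfolding S_def[symmetric] G_def[symmetric] x_def[symmetric] by simp
  qed
  finally show ?thesis .
qed

text \<open>Integration over increments z. For |z| < R/64 the difference bound leaves an integrable
  power at the origin, with loss 1 / (\<Gamma> - 1 - \<tau>). For larger z the triangle inequality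
  and the L^p bound of the derivative suffice, with loss 1 / \<tau> from the tail of the
  kernel.\<close>

lemma derivative_seminorm_bound:
  assumes \<tau>: "0 < \<tau>" "\<tau> < Gam - 1"
  shows "Wpow \<tau> p (ball c (R / 4)) (dyadic_deriv e u)
    \<le> ennreal (grad_const p \<Lambda> DIM('a) * (M * R powr (- (p * (1 + \<tau>))) / ((Gam - 1) powr p * ((Gam - 1 - \<tau>) * \<tau>))))"
proof -
  define g where "g = dyadic_deriv e u"
  have g[measurable]: "g \<in> borel_measurable borel" by (simp add: g_def)
  let ?B = "ball c (R / 4)" and ?k = "krn (real DIM('a) + \<tau> * p) :: 'a \<Rightarrow> real"
  \<comment> \<open>The exponent left when |z|^(p(\<Gamma> - 1)) is divided by |z|^(\<tau> p); it is
    positive exactly when \<tau> < \<Gamma> - 1.\<close>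
  define \<sigma> where "\<sigma> = p * (Gam - 1 - \<tau>)"
  have \<sigma>: "0 < \<sigma>" "\<sigma> \<le> p" using \<tau> p Gam mult_left_mono[of "Gam - 1 - \<tau>" 1 p] by (auto simp: \<sigma>_def)
  have \<tau>p: "0 < \<tau> * p" "\<tau> * p \<le> p" using \<tau> p Gam by auto
  define C1 where "C1 = 2 powr p * slope_const p \<Lambda> DIM('a) * (M * R powr (- p) / (Gam - 1) powr p) * R powr (- (p * (Gam - 1)))"
  define C2 where "C2 = 2 * 2 powr p * (first_const p \<Lambda> DIM('a) * (M * R powr (- p)))"
  have C: "0 \<le> C1" "0 \<le> C2" using p \<Lambda> M_nonneg by (auto simp: C1_def C2_def)
  define F where "F x y = ennreal (\<bar>g x - g y\<bar> powr p * ?k (x - y)) * (indicator ?B x * indicator ?B y)" for x y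
  have [measurable]: "case_prod F \<in> borel_measurable (borel \<Otimes>\<^sub>M borel)" unfolding F_def by measurable
  have H: "(\<integral>\<^sup>+x. F x (x + z) \<partial>lborel) \<le> ennreal C1 * (ennreal (norm z powr (\<sigma> - real DIM('a))) * indicator (ball 0 R) z)
      + ennreal C2 * (ennreal (?k z) * indicator {z. R / 64 \<le> norm z} z)" for z
  proof (cases "norm z < R / 64")
    case True
    show ?thesis
    proof (cases "z = 0")
      case False
      have "(\<integral>\<^sup>+x. F x (x + z) \<partial>lborel) \<le> (\<integral>\<^sup>+x. ennreal (?k z) * (ennreal (\<bar>dlt z g x\<bar> powr p) * indicator ?B x) \<partial>lborel)"
        by (intro nn_integral_mono) (auto simp: F_def dlt_def indicator_def abs_minus_commute ennreal_mult mult.commute)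
      also have "\<dots> = ennreal (?k z) * Lpow p ?B (dlt z g)"
        unfolding Lpow_def by (rule nn_integral_cmult) measurable
      also have "\<dots> \<le> ennreal (?k z) * ennreal (2 powr p * slope_const p \<Lambda> DIM('a) * (M * R powr (- p) / (Gam - 1) powr p) * (norm z / R) powr (p * (Gam - 1)))"
        unfolding g_def using True False by (intro mult_left_mono derivative_difference_bound) auto
      also have "\<dots> = ennreal (?k z * (2 powr p * slope_const p \<Lambda> DIM('a) * (M * R powr (- p) / (Gam - 1) powr p) * (norm z / R) powr (p * (Gam - 1))))"
        using p \<Lambda> M_nonneg by (intro ennreal_mult[symmetric]) auto
      also have "?k z * (2 powr p * slope_const p \<Lambda> DIM('a) * (M * R powr (- p) / (Gam - 1) powr p) * (norm z / R) powr (p * (Gam - 1)))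
         = C1 * norm z powr (\<sigma> - real DIM('a))"
      proof -
        have "norm z powr (\<sigma> - real DIM('a)) = norm z powr (p * (Gam - 1)) * ?k z"
          using False by (simp add: krn_def \<sigma>_def powr_add powr_diff algebra_simps)
        moreover have "(norm z / R) powr (p * (Gam - 1)) = norm z powr (p * (Gam - 1)) * R powr (- (p * (Gam - 1)))"
          using R by (simp add: powr_quotient)
        ultimately show ?thesis by (simp add: C1_def mult_ac)
      qed
      also have "ennreal (C1 * norm z powr (\<sigma> - real DIM('a))) = ennreal C1 * (ennreal (norm z powr (\<sigma> - real DIM('a))) * indicator (ball 0 R) z)"
        using True R C by (simp add: ennreal_mult)
      finally show ?thesis by (rule order_trans) simp
    next
      case True
      then have "(\<integral>\<^sup>+x. F x (x + z) \<partial>lborel) = 0" using p by (simp add: F_def)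
      then show ?thesis by simp
    qed
  next
    case False
    have "(\<integral>\<^sup>+x. F x (x + z) \<partial>lborel) \<le> (\<integral>\<^sup>+x. ennreal (2 powr p * ?k z) * (ennreal (\<bar>g x\<bar> powr p) * indicator ?B x + ennreal (\<bar>g (x + z)\<bar> powr p) * indicator ?B (x + z)) \<partial>lborel)"
    proof (intro nn_integral_mono)
      fix x
      show "F x (x + z) \<le> ennreal (2 powr p * ?k z) * (ennreal (\<bar>g x\<bar> powr p) * indicator ?B x + ennreal (\<bar>g (x + z)\<bar> powr p) * indicator ?B (x + z))"
      proof (cases "x \<in> ?B \<and> x + z \<in> ?B")
        case True
        have "\<bar>g x - g (x + z)\<bar> powr p * ?k z \<le> (2 powr p * (\<bar>g x\<bar> powr p + \<bar>g (x + z)\<bar> powr p)) * ?k z"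
          using p by (intro mult_right_mono abs_diff_powr_le) auto
        then have "ennreal (\<bar>g x - g (x + z)\<bar> powr p * ?k z) \<le> ennreal ((2 powr p * ?k z) * (\<bar>g x\<bar> powr p + \<bar>g (x + z)\<bar> powr p))"
          by (intro ennreal_leI) (simp add: mult_ac)
        then show ?thesis using True by (simp add: F_def ennreal_mult ennreal_plus)
      qed (auto simp: F_def indicator_def)
    qed
    also have "\<dots> = ennreal (2 powr p * ?k z) * ((\<integral>\<^sup>+x. ennreal (\<bar>g x\<bar> powr p) * indicator ?B x \<partial>lborel) + (\<integral>\<^sup>+x. ennreal (\<bar>g (x + z)\<bar> powr p) * indicator ?B (x + z) \<partial>lborel))"
      by (subst nn_integral_cmult) (auto simp: nn_integral_add)
    also have "(\<integral>\<^sup>+x. ennreal (\<bar>g (x + z)\<bar> powr p) * indicator ?B (x + z) \<partial>lborel) = (\<integral>\<^sup>+x. ennreal (\<bar>g x\<bar> powr p) * indicator ?B x \<partial>lborel)"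
      by (rule nn_integral_lborel_plus) measurable
    also have "ennreal (2 powr p * ?k z) * ((\<integral>\<^sup>+x. ennreal (\<bar>g x\<bar> powr p) * indicator ?B x \<partial>lborel) + (\<integral>\<^sup>+x. ennreal (\<bar>g x\<bar> powr p) * indicator ?B x \<partial>lborel))
      \<le> ennreal (2 powr p * ?k z) * (ennreal (first_const p \<Lambda> DIM('a) * (M * R powr (- p))) + ennreal (first_const p \<Lambda> DIM('a) * (M * R powr (- p))))"
    proof -
      have "Lpow p ?B g \<le> Lpow p (ball c (R / 2)) g" using R by (intro Lpow_mono_set subset_ball) auto
      also have "\<dots> \<le> ennreal (first_const p \<Lambda> DIM('a) * (M * R powr (- p)))" unfolding g_def by (rule derivative_bound)
      finally show ?thesis unfolding Lpow_def by (intro mult_left_mono add_mono) auto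
    qed
    also have "\<dots> = ennreal ((2 powr p * ?k z) * (first_const p \<Lambda> DIM('a) * (M * R powr (- p)) + first_const p \<Lambda> DIM('a) * (M * R powr (- p))))"
      using p \<Lambda> M_nonneg by (simp add: ennreal_mult[symmetric] ennreal_plus[symmetric] del: ennreal_plus)
    also have "(2 powr p * ?k z) * (first_const p \<Lambda> DIM('a) * (M * R powr (- p)) + first_const p \<Lambda> DIM('a) * (M * R powr (- p))) = C2 * ?k z"
      by (simp add: C2_def)
    also have "ennreal (C2 * ?k z) = ennreal C2 * (ennreal (?k z) * indicator {z. R / 64 \<le> norm z} z)"
      using False C by (simp add: ennreal_mult)
    finally show ?thesis by (rule order_trans) simp
  qed
  have "Wpow \<tau> p ?B g = dint F" unfolding Wpow_def F_def ..
  also have "\<dots> = (\<integral>\<^sup>+z. \<integral>\<^sup>+x. F x (x + z) \<partial>lborel \<partial>lborel)" by (rule dint_diff_var) measurable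
  also have "\<dots> \<le> (\<integral>\<^sup>+z. (ennreal C1 * (ennreal (norm z powr (\<sigma> - real DIM('a))) * indicator (ball 0 R) z)
      + ennreal C2 * (ennreal (?k z) * indicator {z. R / 64 \<le> norm z} z)) \<partial>lborel)"
    by (intro nn_integral_mono H)
  also have "\<dots> = ennreal C1 * (\<integral>\<^sup>+z. ennreal (norm z powr (\<sigma> - real DIM('a))) * indicator (ball (0::'a) R) z \<partial>lborel)
      + ennreal C2 * (\<integral>\<^sup>+z. ennreal (?k z) * indicator {z. R / 64 \<le> norm z} z \<partial>lborel)"
    by (simp add: nn_integral_add nn_integral_cmult)
  also have "\<dots> \<le> ennreal C1 * ennreal (knl_const p DIM('a) / \<sigma> * R powr \<sigma>) + ennreal C2 * ennreal (knl_const p DIM('a) / (\<tau> * p) * (R / 64) powr (- (\<tau> * p)))"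
    unfolding knl_const_def using \<sigma> \<tau>p R
    by (intro add_mono mult_left_mono nn_integral_norm_powr_near nn_integral_krn_far) auto
  also have "\<dots> = ennreal (C1 * (knl_const p DIM('a) / \<sigma> * R powr \<sigma>) + C2 * (knl_const p DIM('a) / (\<tau> * p) * (R / 64) powr (- (\<tau> * p))))"
    using C \<sigma> \<tau>p p by (simp add: ennreal_mult[symmetric] ennreal_plus[symmetric] del: ennreal_plus)
  also have "\<dots> \<le> ennreal (grad_const p \<Lambda> DIM('a) * (M * R powr (- (p * (1 + \<tau>))) / ((Gam - 1) powr p * ((Gam - 1 - \<tau>) * \<tau>))))"
  proof (intro ennreal_leI)
    define K where "K = knl_const p DIM('a)"
    define G where "G = (Gam - 1) powr p"
    \<comment> \<open>A common denominator for the near and the far part: both factors are below 1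
      \<le> p, so \<open>T\<close> is at most \<sigma> and at most \<tau> p.\<close>
    define T where "T = (Gam - 1 - \<tau>) * \<tau>"
    define Z where "Z = M * R powr (- (p * (1 + \<tau>)))"
    have K: "0 \<le> K" using p by (simp add: K_def)
    have G: "0 < G" "G \<le> 1" unfolding G_def using Gam p by (auto intro!: powr_le1)
    have Z: "0 \<le> Z" using M_nonneg by (simp add: Z_def)
    have T: "0 < T" "T \<le> \<sigma>" "T \<le> \<tau> * p"
    proof -
      show "0 < T" using \<tau> by (simp add: T_def)
      have "T \<le> (Gam - 1 - \<tau>) * p" unfolding T_def using \<tau> Gam p by (intro mult_left_mono) auto
      then show "T \<le> \<sigma>" by (simp add: \<sigma>_def mult.commute)
      have "T \<le> p * \<tau>" unfolding T_def using \<tau> Gam p by (intro mult_right_mono) auto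
      then show "T \<le> \<tau> * p" by (simp add: mult.commute)
    qed
    have "R powr (- p) * R powr (- (p * (Gam - 1))) * R powr \<sigma> = R powr (- (p * (1 + \<tau>)))"
      by (simp add: \<sigma>_def powr_add[symmetric] algebra_simps)
    then have e1: "C1 * (K / \<sigma> * R powr \<sigma>) = (K * (2 powr p * slope_const p \<Lambda> DIM('a))) * (Z / (G * \<sigma>))"
    proof -
      assume a: "R powr (- p) * R powr (- (p * (Gam - 1))) * R powr \<sigma> = R powr (- (p * (1 + \<tau>)))"
      have "b * (M * r / G) * r' * (K / \<sigma> * r'') = (K * b) * (M * (r * r' * r'') / (G * \<sigma>))" for b r r' r'' :: real
        by (simp add: mult_ac)
      then show ?thesis unfolding C1_def Z_def G_def[symmetric] a[symmetric] .
    qed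
    have "(K * (2 powr p * slope_const p \<Lambda> DIM('a))) * (Z / (G * \<sigma>)) \<le> (K * (2 powr p * slope_const p \<Lambda> DIM('a))) * (Z / (G * T))"
      using K p \<Lambda> Z G T \<sigma> by (intro mult_left_mono divide_left_mono) auto
    then have b1: "C1 * (K / \<sigma> * R powr \<sigma>) \<le> (K * (2 powr p * slope_const p \<Lambda> DIM('a))) * (Z / (G * T))" unfolding e1 .
    have r: "(R / 64) powr (- (\<tau> * p)) = 64 powr (\<tau> * p) * R powr (- (\<tau> * p))"
      using R by (simp add: powr_divide powr_minus_divide)
    have "R powr (- p) * R powr (- (\<tau> * p)) = R powr (- (p * (1 + \<tau>)))"
      by (simp add: powr_add[symmetric] algebra_simps)
    then have e2: "C2 * (K / (\<tau> * p) * (R / 64) powr (- (\<tau> * p))) = (K * (2 * 2 powr p * first_const p \<Lambda> DIM('a) * 64 powr (\<tau> * p))) * (Z / (1 * (\<tau> * p)))"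
    proof -
      assume a: "R powr (- p) * R powr (- (\<tau> * p)) = R powr (- (p * (1 + \<tau>)))"
      have "b * (S * (M * q)) * (K / (\<tau> * p) * (x * q')) = (K * (b * S * x)) * (M * (q * q') / (1 * (\<tau> * p)))" for b S q q' x :: real
        by (simp add: mult_ac)
      then show ?thesis unfolding C2_def Z_def r a[symmetric] .
    qed
    have "(K * (2 * 2 powr p * first_const p \<Lambda> DIM('a) * 64 powr (\<tau> * p))) * (Z / (1 * (\<tau> * p))) \<le> (K * (2 * 2 powr p * first_const p \<Lambda> DIM('a) * 64 powr p)) * (Z / (G * T))"
    proof (intro mult_mono mult_left_mono divide_left_mono)
      show "64 powr (\<tau> * p) \<le> 64 powr p" using \<tau>p by (intro powr_mono) auto
      show "G \<le> 1" "T \<le> \<tau> * p" using G T by auto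
    qed (use K p \<Lambda> Z G T \<tau>p \<tau> in auto)
    then have b2: "C2 * (K / (\<tau> * p) * (R / 64) powr (- (\<tau> * p))) \<le> (K * (2 * 2 powr p * first_const p \<Lambda> DIM('a) * 64 powr p)) * (Z / (G * T))" unfolding e2 .
    have "C1 * (K / \<sigma> * R powr \<sigma>) + C2 * (K / (\<tau> * p) * (R / 64) powr (- (\<tau> * p))) \<le> grad_const p \<Lambda> DIM('a) * (Z / (G * T))"
      unfolding grad_const_def K_def[symmetric] distrib_left distrib_right using b1 b2 by (rule add_mono)
    then show "C1 * (knl_const p DIM('a) / \<sigma> * R powr \<sigma>) + C2 * (knl_const p DIM('a) / (\<tau> * p) * (R / 64) powr (- (\<tau> * p)))
      \<le> grad_const p \<Lambda> DIM('a) * (M * R powr (- (p * (1 + \<tau>))) / ((Gam - 1) powr p * ((Gam - 1 - \<tau>) * \<tau>)))"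
      unfolding K_def Z_def G_def T_def .
  qed
  finally show ?thesis unfolding g_def .
qed

end

end

subsection \<open>Borel representatives\<close>

lemma epow_top[simp]: "epow top a = top"
  by (simp add: epow_def)

lemma epow_ennreal: "0 \<le> r \<Longrightarrow> epow (ennreal r) a = ennreal (r powr a)"
  by (simp add: epow_def)

lemma epow_inverse: "0 < q \<Longrightarrow> epow (epow X (1 / q)) q = X"
  by (cases X) (auto simp: epow_ennreal powr_powr)

lemma epow_less_top: "0 < a \<Longrightarrow> epow X a < \<infinity> \<longleftrightarrow> X < \<infinity>"
  by (cases X) (auto simp: epow_ennreal)

lemma epow_mono:
  assumes "0 < a" "X \<le> Y"
  shows "epow X a \<le> epow Y a"
proof (cases Y)
  case (real y)
  then obtain x where x: "X = ennreal x" "0 \<le> x" using assms(2) by (cases X) (auto simp: top_unique)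
  then have "x \<le> y" using assms(2) real by simp
  then show ?thesis using x real assms(1) by (auto simp: epow_ennreal intro!: ennreal_leI powr_mono2)
qed simp

text \<open>Completeness of Lebesgue measure. It yields measurability of the original integrands,
  which are known only to agree almost everywhere with Borel ones.\<close>

lemma borel_measurable_lebesgue_AE:
  fixes f g :: "'a::euclidean_space \<Rightarrow> real"
  assumes g: "g \<in> borel_measurable lebesgue" and eq: "AE x in lebesgue. f x = g x"
  shows "f \<in> borel_measurable lebesgue"
proof (rule measurableI)
  fix S :: "real set" assume S: "S \<in> sets borel"
  have "AE x in lebesgue. x \<in> g -` S \<inter> space lebesgue \<longleftrightarrow> x \<in> f -` S \<inter> space lebesgue"
    using eq by eventually_elim auto
  then show "f -` S \<inter> space lebesgue \<in> sets lebesgue"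
    using measurable_sets[OF g S] by (rule completion.in_sets_AE) auto
qed simp

lemma lebesgue_borel_representative:
  fixes u :: "'a::euclidean_space \<Rightarrow> real"
  assumes "u \<in> borel_measurable lebesgue"
  obtains v where "v \<in> borel_measurable borel" "AE x in lborel. u x = v x"
  using completion_ex_borel_measurable_real[OF assms] by auto

text \<open>Restrictions to growing balls, extended by zero, are measurable and converge
  pointwise.\<close>

lemma Lp_loc_borel_measurable:
  fixes u :: "'a::euclidean_space \<Rightarrow> real"
  assumes "u \<in> Lp_loc p UNIV"
  shows "u \<in> borel_measurable lebesgue"
proof -
  have b: "(\<lambda>x. indicator (ball 0 (real n)) x *\<^sub>R u x) \<in> borel_measurable lebesgue" for n
  proof -
    have "ball (0::'a) (real n) \<Subset> UNIV" by (auto simp: compactly_in_def)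
    then have "u \<in> borel_measurable (lebesgue_on (ball 0 (real n)))"
      using assms by (auto simp: Lp_loc_def Lp_def)
    then show ?thesis by (subst (asm) borel_measurable_restrict_space_iff) auto
  qed
  show ?thesis
  proof (rule borel_measurable_LIMSEQ_real[OF _ b])
    fix x :: 'a
    obtain m where m: "norm x < real m" using reals_Archimedean2 by auto
    have "\<forall>\<^sub>F n in sequentially. indicator (ball 0 (real n)) x *\<^sub>R u x = u x"
      unfolding eventually_sequentially using m by (intro exI[of _ m]) auto
    then show "(\<lambda>n. indicator (ball 0 (real n)) x *\<^sub>R u x) \<longlonglongrightarrow> u x"
      by (rule tendsto_eventually)
  qed
qed

lemma AE_lborel_fst_snd:
  assumes "AE x in lborel. P x"
  shows "AE z in (lborel :: ('a::euclidean_space \<times> 'a) measure). P (fst z) \<and> P (snd z)"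
proof -
  obtain N where N: "{x. \<not> P x} \<subseteq> N" "N \<in> sets borel" "emeasure lborel N = 0"
    using assms by (auto elim!: AE_E)
  note [measurable] = N(2)
  have AN: "AE x in lborel. x \<notin> N" using N by (intro AE_not_in) (auto simp: null_sets_def)
  have "AE z in (lborel \<Otimes>\<^sub>M lborel). fst z \<notin> N \<and> snd z \<notin> N"
  proof (rule lborel_pair.AE_pair_measure)
    show "AE x in lborel. AE y in lborel. fst (x, y) \<notin> N \<and> snd (x, y) \<notin> N"
      using AN by eventually_elim (use AN in \<open>auto elim: eventually_mono\<close>)
  qed measurable
  then have "AE z in (lborel :: ('a \<times> 'a) measure). fst z \<notin> N \<and> snd z \<notin> N" by (simp only: lborel_prod)
  then show ?thesis by eventually_elim (use N(1) in auto)
qed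

text \<open>Needed for the kernel, which enters through x - y. Each slice of the exceptional set is
  a reflected translate of a null set, so the set is null by Fubini.\<close>

lemma AE_lborel_difference:
  assumes "AE z in lborel. P (z :: 'a::euclidean_space)"
  shows "AE z in (lborel :: ('a \<times> 'a) measure). P (fst z - snd z)"
proof -
  obtain N where N: "{x. \<not> P x} \<subseteq> N" "N \<in> sets borel" "emeasure lborel N = 0"
    using assms by (auto elim!: AE_E)
  note [measurable] = N(2)
  have "AE z in (lborel \<Otimes>\<^sub>M lborel). fst z - snd z \<notin> N"
  proof (rule lborel_pair.AE_pair_measure)
    have "AE y in lborel. x - y \<notin> N" for x
    proof -
      have ind: "indicator N (x - y) = (indicator {y. x - y \<in> N} y :: ennreal)" for y
        by (simp add: indicator_def)
      have "emeasure lborel {y. x - y \<in> N} = (\<integral>\<^sup>+y. indicator N (x - y) \<partial>lborel)"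
        unfolding ind by (rule nn_integral_indicator[symmetric]) measurable
      also have "\<dots> = (\<integral>\<^sup>+y. indicator N y \<partial>lborel)" by (rule nn_integral_lborel_reflect) measurable
      also have "\<dots> = 0" using N by simp
      finally have "{y. x - y \<in> N} \<in> null_sets lborel" by (intro null_setsI) auto
      then show ?thesis by (rule AE_I') auto
    qed
    then show "AE x in lborel. AE y in lborel. fst (x, y) - snd (x, y) \<notin> N" by simp
  qed measurable
  then have "AE z in (lborel :: ('a \<times> 'a) measure). fst z - snd z \<notin> N" by (simp only: lborel_prod)
  then show ?thesis by eventually_elim (use N(1) in auto)
qed

lemma lborel_nn_integral_pair:
  fixes F :: "'a::euclidean_space \<Rightarrow> 'a \<Rightarrow> ennreal"
  assumes [measurable]: "case_prod F \<in> borel_measurable (borel \<Otimes>\<^sub>M borel)"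
  shows "(\<integral>\<^sup>+z. case_prod F z \<partial>lborel) = dint F"
  using dint_pair[OF assms] by (simp add: lborel_prod)

lemma Lp_norm_Lpow:
  fixes u v :: "'a::euclidean_space \<Rightarrow> real"
  assumes "AE x in lborel. x \<in> E \<longrightarrow> u x = v x" and q: "0 < q"
  shows "epow (Lp_norm q E u) q = Lpow q E v"
proof -
  have "epow (Lp_norm q E u) q = (\<integral>\<^sup>+x\<in>E. ennreal (norm (u x) powr q) \<partial>lebesgue)"
    unfolding Lp_norm_def by (rule epow_inverse[OF q])
  also have "\<dots> = (\<integral>\<^sup>+x\<in>E. ennreal (norm (u x) powr q) \<partial>lborel)" by (rule nn_integral_completion)
  also have "\<dots> = Lpow q E v" unfolding Lpow_def
    by (rule nn_integral_cong_AE, use assms(1) in eventually_elim) (auto simp: indicator_def)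
  finally show ?thesis .
qed

lemma W_seminorm_Wpow:
  fixes u v :: "'a::euclidean_space \<Rightarrow> real"
  assumes eq: "AE x in lborel. x \<in> E \<longrightarrow> u x = v x" and q: "0 < q"
    and [measurable]: "v \<in> borel_measurable borel" "E \<in> sets borel"
  shows "epow (W_seminorm \<alpha> q E u) q = Wpow \<alpha> q E v"
proof -
  define F where "F x y = ennreal (\<bar>v x - v y\<bar> powr q * krn (real DIM('a) + \<alpha> * q) (x - y)) * (indicator E x * indicator E y)" for x y
  have [measurable]: "case_prod F \<in> borel_measurable (borel \<Otimes>\<^sub>M borel)" unfolding F_def by measurable
  have "epow (W_seminorm \<alpha> q E u) q = (\<integral>\<^sup>+z\<in>E \<times> E. (case z of (x, y) \<Rightarrow>
             ennreal (norm (u x - u y) powr q / norm (x - y) powr (real DIM('a) + \<alpha> * q))) \<partial>lebesgue)"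
    unfolding W_seminorm_def by (rule epow_inverse[OF q])
  also have "\<dots> = (\<integral>\<^sup>+z\<in>E \<times> E. (case z of (x, y) \<Rightarrow>
             ennreal (norm (u x - u y) powr q / norm (x - y) powr (real DIM('a) + \<alpha> * q))) \<partial>lborel)"
    by (rule nn_integral_completion)
  also have "\<dots> = (\<integral>\<^sup>+z. case_prod F z \<partial>lborel)"
    by (rule nn_integral_cong_AE, use AE_lborel_fst_snd[OF eq] in eventually_elim)
       (auto simp: F_def indicator_def krn_def split: prod.splits)
  also have "\<dots> = dint F" by (rule lborel_nn_integral_pair) measurable
  finally show ?thesis unfolding Wpow_def F_def .
qed

subsection \<open>The tail quantities\<close>

text \<open>The volume of the ball of radius 3/4 R gives the factors with 3/4;
  \<open>min 1 _ powr p\<close> bounds the power sp/N of the unit ball volume whichever side of 1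
  that volume is on; \<open>2 powr (- p)\<close> comes from r \<ge> R/2, and
  \<open>2 powr (- (n + p))\<close> from recentring the kernel.\<close>

definition tail_lower :: "real \<Rightarrow> nat \<Rightarrow> real" where
  "tail_lower p n = unit_ball_vol n * min 1 (unit_ball_vol n) powr p * (3 / 4) ^ n * 2 powr (- p) * 2 powr (- (n + p))"

lemma tail_lower_pos: "0 < tail_lower p n"
proof -
  have "0 < min 1 (unit_ball_vol (real n))" by simp
  then show ?thesis unfolding tail_lower_def by (intro mult_pos_pos) (auto simp: min_def split: if_splits)
qed

lemma Snail_power:
  fixes \<psi> v :: "'a::euclidean_space \<Rightarrow> real" and s p :: real
  assumes eq: "AE x in lborel. \<psi> x = v x" and p: "0 < p" and r: "0 \<le> r"
    and [measurable]: "v \<in> borel_measurable borel"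
  shows "epow (Snail s p \<psi> x (ball c r)) p = ennreal ((unit_ball_vol DIM('a) * r ^ DIM('a)) powr (s * p / real DIM('a)))
    * (\<integral>\<^sup>+y. ennreal (\<bar>v y\<bar> powr p * krn (real DIM('a) + s * p) (x - y)) * indicator (- ball c r) y \<partial>lborel)"
proof -
  have m: "measure lebesgue (ball c r) = unit_ball_vol DIM('a) * r ^ DIM('a)"
    using content_ball[OF r, of c] by simp
  have "(\<integral>\<^sup>+y\<in>- ball c r. ennreal (\<bar>\<psi> y\<bar> powr p / norm (x - y) powr (real DIM('a) + s * p)) \<partial>lebesgue)
    = (\<integral>\<^sup>+y\<in>- ball c r. ennreal (\<bar>\<psi> y\<bar> powr p / norm (x - y) powr (real DIM('a) + s * p)) \<partial>lborel)"
    by (rule nn_integral_completion)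
  also have "\<dots> = (\<integral>\<^sup>+y. ennreal (\<bar>v y\<bar> powr p * krn (real DIM('a) + s * p) (x - y)) * indicator (- ball c r) y \<partial>lborel)"
    by (rule nn_integral_cong_AE, use eq in eventually_elim) (auto simp: krn_def)
  finally show ?thesis unfolding Snail_def by (simp add: epow_inverse p m)
qed

text \<open>For x in the ball of radius 3/4 R and y outside the ball of radius r one has |x - y|
  \<le> 2 |y - c|. So the snail function is bounded below by the centred tail at every such x, and
  integration over x gives the claim.\<close>

lemma tail_int_le_Snail:
  fixes \<psi> v :: "'a::euclidean_space \<Rightarrow> real"
  assumes eq: "AE x in lborel. \<psi> x = v x" and p: "1 \<le> p" and s: "0 < s" "s < 1" and R: "0 < R" "3 / 4 * R \<le> r" "r \<le> R"
    and [measurable]: "v \<in> borel_measurable borel"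
  shows "ennreal (tail_lower p DIM('a) * R powr (real DIM('a) + s * p)) * tail_int (s * p) p c r v
    \<le> (\<integral>\<^sup>+x\<in>ball c (3 / 4 * R). epow (Snail s p \<psi> x (ball c r)) p \<partial>lebesgue)"
proof -
  let ?N = "real DIM('a)" and ?\<omega> = "unit_ball_vol (real DIM('a))"
  define b where "b = ?N + s * p"
  have sp: "0 < s * p" "s * p \<le> p" using s p by auto
  have b: "0 < b" "b \<le> ?N + p" using sp by (auto simp: b_def)
  define E where "E = (?\<omega> * r ^ DIM('a)) powr (s * p / ?N)"
  have E0: "0 \<le> E" by (simp add: E_def)
  have lower: "ennreal (E * 2 powr (- (?N + p))) * tail_int (s * p) p c r v \<le> epow (Snail s p \<psi> x (ball c r)) p"
    if x: "x \<in> ball c (3 / 4 * R)" for x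
  proof -
    have "ennreal (2 powr (- (?N + p))) * tail_int (s * p) p c r v
      = (\<integral>\<^sup>+y. ennreal (2 powr (- (?N + p))) * (ennreal (\<bar>v y\<bar> powr p * krn b (y - c)) * indicator (- ball c r) y) \<partial>lborel)"
      unfolding tail_int_def b_def by (rule nn_integral_cmult[symmetric]) measurable
    also have "\<dots> \<le> (\<integral>\<^sup>+y. ennreal (\<bar>v y\<bar> powr p * krn b (x - y)) * indicator (- ball c r) y \<partial>lborel)"
    proof (intro nn_integral_mono)
      fix y
      show "ennreal (2 powr (- (?N + p))) * (ennreal (\<bar>v y\<bar> powr p * krn b (y - c)) * indicator (- ball c r) y)
        \<le> ennreal (\<bar>v y\<bar> powr p * krn b (x - y)) * indicator (- ball c r) y"
      proof (cases "y \<in> ball c r")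
        case False
        have yc: "r \<le> norm (y - c)" using False by (simp add: dist_norm norm_minus_commute)
        have xc: "norm (x - c) < 3 / 4 * R" using x by (simp add: dist_norm norm_minus_commute)
        have "x - y = (x - c) - (y - c)" by simp
        then have tri: "norm (x - y) \<le> norm (x - c) + norm (y - c)" "norm (y - c) \<le> norm (x - c) + norm (x - y)"
          using norm_triangle_ineq4[of "x - c" "y - c"] norm_triangle_ineq4[of "x - c" "x - y"] by auto
        have pos: "0 < norm (x - y)" "0 < norm (y - c)" using tri xc yc R by linarith+
        have "norm (x - y) \<le> 2 * norm (y - c)" using tri xc yc R by linarith
        then have "norm (x - y) powr b \<le> (2 * norm (y - c)) powr b" using b by (intro powr_mono2) auto
        also have "\<dots> = 2 powr b * norm (y - c) powr b" by (rule powr_mult)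
        also have "\<dots> \<le> 2 powr (?N + p) * norm (y - c) powr b" using b by (intro mult_right_mono powr_mono) auto
        finally have "2 powr (- (?N + p)) * krn b (y - c) \<le> krn b (x - y)"
        proof -
          assume "norm (x - y) powr b \<le> 2 powr (?N + p) * norm (y - c) powr b"
          then have "1 / (2 powr (?N + p) * norm (y - c) powr b) \<le> 1 / norm (x - y) powr b"
            using pos by (intro divide_left_mono) auto
          then show ?thesis unfolding krn_def powr_minus_divide by simp
        qed
        then have "\<bar>v y\<bar> powr p * (2 powr (- (?N + p)) * krn b (y - c)) \<le> \<bar>v y\<bar> powr p * krn b (x - y)"
          by (intro mult_left_mono) auto
        then have "ennreal (2 powr (- (?N + p)) * (\<bar>v y\<bar> powr p * krn b (y - c))) \<le> ennreal (\<bar>v y\<bar> powr p * krn b (x - y))"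
          by (intro ennreal_leI) (simp add: mult_ac)
        then show ?thesis using False by (simp add: ennreal_mult)
      qed simp
    qed
    finally have "ennreal E * (ennreal (2 powr (- (?N + p))) * tail_int (s * p) p c r v)
      \<le> ennreal E * (\<integral>\<^sup>+y. ennreal (\<bar>v y\<bar> powr p * krn b (x - y)) * indicator (- ball c r) y \<partial>lborel)"
      by (rule mult_left_mono) simp
    also have "\<dots> = epow (Snail s p \<psi> x (ball c r)) p"
    proof -
      have p0: "0 < p" "0 \<le> r" using p R by auto
      show ?thesis unfolding E_def b_def by (rule Snail_power[OF eq p0, symmetric]) measurable
    qed
    finally show ?thesis using E0 by (simp add: ennreal_mult mult.assoc)
  qed
  have Elow: "min 1 ?\<omega> powr p * (2 powr (- p) * R powr (s * p)) \<le> E"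
  proof -
    have "min 1 ?\<omega> powr p \<le> min 1 ?\<omega> powr (s * p / ?N)"
    proof (rule powr_mono')
      have "s * p / ?N \<le> p / 1" using sp by (intro frac_le) auto
      then show "s * p / ?N \<le> p" by simp
    qed auto
    also have "\<dots> \<le> ?\<omega> powr (s * p / ?N)" using sp by (intro powr_mono2) auto
    finally have 1: "min 1 ?\<omega> powr p \<le> ?\<omega> powr (s * p / ?N)" .
    have "2 powr (- p) * R powr (s * p) \<le> 2 powr (- (s * p)) * R powr (s * p)"
      using sp by (intro mult_right_mono powr_mono) auto
    also have "\<dots> = (R / 2) powr (s * p)" using R by (simp add: powr_divide powr_minus_divide)
    also have "\<dots> \<le> r powr (s * p)" using R sp by (intro powr_mono2) auto
    also have "\<dots> = (r ^ DIM('a)) powr (s * p / ?N)" using R by (simp add: powr_realpow[symmetric] powr_powr)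
    finally have 2: "2 powr (- p) * R powr (s * p) \<le> (r ^ DIM('a)) powr (s * p / ?N)" .
    have "E = ?\<omega> powr (s * p / ?N) * (r ^ DIM('a)) powr (s * p / ?N)" unfolding E_def by (rule powr_mult)
    then show ?thesis using 1 2 by (simp add: mult_mono)
  qed
  have "ennreal (tail_lower p DIM('a) * R powr (?N + s * p)) * tail_int (s * p) p c r v
    \<le> ennreal (E * 2 powr (- (?N + p)) * (?\<omega> * (3 / 4 * R) ^ DIM('a))) * tail_int (s * p) p c r v"
  proof (intro mult_right_mono ennreal_leI)
    have "tail_lower p DIM('a) * R powr (?N + s * p)
      = min 1 ?\<omega> powr p * (2 powr (- p) * R powr (s * p)) * 2 powr (- (?N + p)) * (?\<omega> * (3 / 4 * R) ^ DIM('a))"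
      using R by (simp only: tail_lower_def powr_add power_mult_distrib powr_realpow) (simp add: mult_ac)
    also have "\<dots> \<le> E * 2 powr (- (?N + p)) * (?\<omega> * (3 / 4 * R) ^ DIM('a))"
      using Elow R by (intro mult_right_mono) auto
    finally show "tail_lower p DIM('a) * R powr (?N + s * p) \<le> E * 2 powr (- (?N + p)) * (?\<omega> * (3 / 4 * R) ^ DIM('a))" .
  qed simp
  also have "\<dots> = (\<integral>\<^sup>+x. (ennreal (E * 2 powr (- (?N + p))) * tail_int (s * p) p c r v) * indicator (ball c (3 / 4 * R)) x \<partial>lborel)"
    using R E0 by (subst nn_integral_cmult_indicator) (auto simp: emeasure_ball ennreal_mult mult_ac)
  also have "\<dots> \<le> (\<integral>\<^sup>+x\<in>ball c (3 / 4 * R). epow (Snail s p \<psi> x (ball c r)) p \<partial>lborel)"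
    using lower by (intro nn_integral_mono) (auto simp: indicator_def)
  also have "\<dots> = (\<integral>\<^sup>+x\<in>ball c (3 / 4 * R). epow (Snail s p \<psi> x (ball c r)) p \<partial>lebesgue)"
    by (rule nn_integral_completion[symmetric])
  finally show ?thesis .
qed

subsection \<open>Local weak solutions as Borel solutions\<close>

lemma Wpow_cmult:
  fixes v :: "'a::euclidean_space \<Rightarrow> real"
  assumes [measurable]: "v \<in> borel_measurable borel" "E \<in> sets borel"
  shows "Wpow \<alpha> q E (\<lambda>x. a * v x) = ennreal (\<bar>a\<bar> powr q) * Wpow \<alpha> q E v"
proof -
  have "Wpow \<alpha> q E (\<lambda>x. a * v x) = dint (\<lambda>x y. ennreal (\<bar>a\<bar> powr q) * (ennreal (\<bar>v x - v y\<bar> powr q * krn (real DIM('a) + \<alpha> * q) (x - y)) * (indicator E x * indicator E y)))"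
    unfolding Wpow_def
    by (intro arg_cong[where f = dint] ext) (simp add: right_diff_distrib[symmetric] abs_mult powr_mult ennreal_mult mult_ac)
  also have "\<dots> = ennreal (\<bar>a\<bar> powr q) * Wpow \<alpha> q E v"
    unfolding Wpow_def by (rule dint_cmult) measurable
  finally show ?thesis .
qed

lemma ennreal_le_divide:
  assumes "ennreal b * X \<le> ennreal a" "0 < b" "0 \<le> a"
  shows "X \<le> ennreal (a / b)"
proof -
  have "X = ennreal (1 / b) * (ennreal b * X)" using assms(2) by (simp add: mult.assoc[symmetric] ennreal_mult[symmetric])
  also have "\<dots> \<le> ennreal (1 / b) * ennreal a" by (intro mult_left_mono assms(1)) simp
  also have "\<dots> = ennreal (a / b)" using assms by (simp add: ennreal_mult[symmetric])
  finally show ?thesis .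
qed

lemma W_loc_borel_representative:
  fixes f :: "'a::euclidean_space \<Rightarrow> real"
  assumes "f \<in> W_loc s q \<Omega>" "B \<Subset> \<Omega>"
  obtains g where "g \<in> borel_measurable borel" "AE x in lborel. x \<in> B \<longrightarrow> f x = g x"
proof -
  have B: "B \<in> sets borel" using assms(2) by (auto simp: compactly_in_def)
  have "f \<in> borel_measurable (lebesgue_on B)" using assms by (auto simp: W_loc_def W_def Lp_def)
  then have "(\<lambda>x. indicator B x *\<^sub>R f x) \<in> borel_measurable lebesgue"
    using B by (subst (asm) borel_measurable_restrict_space_iff) auto
  then obtain g where g: "g \<in> borel_measurable borel" "AE x in lborel. indicator B x *\<^sub>R f x = g x"
    using lebesgue_borel_representative by blast
  from g(2) have "AE x in lborel. x \<in> B \<longrightarrow> f x = g x" by eventually_elim (auto simp: indicator_def)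
  with g(1) show ?thesis by (rule that)
qed

text \<open>A Borel version of K may violate the bounds on a null set. There the model kernel is
  used instead, so the bounds hold everywhere; at the origin all quantities are 0.\<close>

lemma kernel_representative:
  fixes K :: "'a::euclidean_space \<Rightarrow> real"
  assumes \<Lambda>: "1 \<le> \<Lambda>" and K: "K \<in> borel_measurable lebesgue"
    and bounds: "\<And>z. 1 / \<Lambda> * norm z powr b \<le> K z" "\<And>z. K z \<le> \<Lambda> * norm z powr b"
  obtains \<kappa> where "\<kappa> \<in> borel_measurable borel" "\<And>z. krn b z / \<Lambda> \<le> \<kappa> z" "\<And>z. \<kappa> z \<le> \<Lambda> * krn b z"
    "AE z in lborel. \<kappa> z = 1 / K z"
proof -
  obtain k where k[measurable]: "k \<in> borel_measurable borel" and eq: "AE x in lborel. K x = k x"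
    using lebesgue_borel_representative[OF K] by blast
  define \<kappa> where "\<kappa> z = (if krn b z / \<Lambda> \<le> 1 / k z \<and> 1 / k z \<le> \<Lambda> * krn b z then 1 / k z else krn b z)" for z
  have 1: "krn b z / \<Lambda> \<le> krn b z" "krn b z \<le> \<Lambda> * krn b z" for z
    using \<Lambda> krn_nonneg[of b z] mult_right_mono[OF \<Lambda>, of "krn b z"] by (auto simp: divide_le_eq mult.commute)
  have Kb: "krn b z / \<Lambda> \<le> 1 / K z \<and> 1 / K z \<le> \<Lambda> * krn b z" for z
  proof (cases "z = 0")
    case True
    then have "K z = 0" using bounds[of z] by simp
    then show ?thesis using True by (simp add: krn_def)
  next
    case False
    then have n: "0 < norm z powr b" by simp
    then have "0 < 1 / \<Lambda> * norm z powr b" using \<Lambda> by simp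
    then have Kp: "0 < K z" using bounds(1)[of z] by linarith
    have "1 / (\<Lambda> * norm z powr b) \<le> 1 / K z" using bounds(2)[of z] Kp n \<Lambda> by (intro divide_left_mono) auto
    moreover have "1 / K z \<le> 1 / (1 / \<Lambda> * norm z powr b)" using bounds(1)[of z] Kp n \<Lambda> by (intro divide_left_mono) auto
    ultimately show ?thesis using \<Lambda> by (simp add: krn_def mult.commute)
  qed
  show ?thesis
  proof (rule that[of \<kappa>])
    show "\<kappa> \<in> borel_measurable borel" unfolding \<kappa>_def by measurable
    show "krn b z / \<Lambda> \<le> \<kappa> z" "\<kappa> z \<le> \<Lambda> * krn b z" for z using 1[of z] by (auto simp: \<kappa>_def)
    show "AE z in lborel. \<kappa> z = 1 / K z"
      using eq
    proof eventually_elim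
      fix z assume "K z = k z"
      then show "\<kappa> z = 1 / K z" using Kb[of z] by (simp add: \<kappa>_def)
    qed
  qed
qed

text \<open>Replaces u, f and 1 / K by Borel versions under the integrals. For the double integral
  this uses that null sets pull back to null sets under both projections and under x - y.\<close>

lemma weak_formulation_borel:
  fixes u v f g K \<kappa> \<phi> :: "'a::euclidean_space \<Rightarrow> real"
  assumes p: "0 < p" and B: "B \<Subset> \<Omega>" and weak: "local_weak_solution s p K \<Omega> f u"
    and v[measurable]: "v \<in> borel_measurable borel" and eq: "AE x in lborel. u x = v x"
    and g[measurable]: "g \<in> borel_measurable borel" and fg: "AE x in lborel. x \<in> B \<longrightarrow> f x = g x"
    and \<kappa>[measurable]: "\<kappa> \<in> borel_measurable borel" and \<kappa>_eq: "AE z in lborel. \<kappa> z = 1 / K z"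
    and \<phi>[measurable]: "\<phi> \<in> borel_measurable borel" and supp: "\<And>x. x \<notin> B \<Longrightarrow> \<phi> x = 0"
    and fin: "Lpow p UNIV \<phi> < \<infinity>" "Wpow s p UNIV \<phi> < \<infinity>"
  shows "(LINT z|(lborel \<Otimes>\<^sub>M lborel). (case z of (x, y) \<Rightarrow> Jp p (v x - v y) * \<kappa> (x - y) * (\<phi> x - \<phi> y)))
        = (LINT x|lborel. g x * \<phi> x)"
proof -
  have \<Omega>[measurable]: "\<Omega> \<in> sets borel" using B by (auto simp: compactly_in_def)
  have \<phi>W: "\<phi> \<in> W s p \<Omega>"
  proof -
    have m: "\<phi> \<in> borel_measurable (lebesgue_on \<Omega>)"
      by (intro measurable_restrict_space1 measurable_completion) simp
    have "epow (Lp_norm p \<Omega> \<phi>) p = Lpow p \<Omega> \<phi>" using p by (intro Lp_norm_Lpow) auto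
    also have "\<dots> \<le> Lpow p UNIV \<phi>" by (rule Lpow_mono_set) simp
    finally have 1: "Lp_norm p \<Omega> \<phi> < \<infinity>" using fin(1) p epow_less_top[of p] by (auto intro: le_less_trans)
    have "epow (W_seminorm s p \<Omega> \<phi>) p = Wpow s p \<Omega> \<phi>" using p by (intro W_seminorm_Wpow) auto
    also have "\<dots> \<le> Wpow s p UNIV \<phi>" unfolding Wpow_def by (intro dint_mono) (auto simp: indicator_def)
    finally have 2: "W_seminorm s p \<Omega> \<phi> < \<infinity>" using fin(2) p epow_less_top[of p] by (auto intro: le_less_trans)
    show ?thesis using m 1 2 by (simp add: W_def Lp_def)
  qed
  define H where "H x y = Jp p (v x - v y) * \<kappa> (x - y) * (\<phi> x - \<phi> y)" for x y
  have [measurable]: "case_prod H \<in> borel_measurable (borel \<Otimes>\<^sub>M borel)" unfolding H_def by measurable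
  have Hm[measurable]: "case_prod H \<in> borel_measurable borel"
    unfolding borel_prod[symmetric] by measurable
  let ?F = "\<lambda>z. case z of (x, y) \<Rightarrow> \<bar>u x - u y\<bar> powr (p - 2) * (u x - u y) / K (x - y) * (\<phi> x - \<phi> y)"
  have ae: "AE z in (lborel :: ('a \<times> 'a) measure). ?F z = case_prod H z"
    using AE_lborel_fst_snd[OF eq] AE_lborel_difference[OF \<kappa>_eq]
    by eventually_elim (auto simp: H_def Jp_def split: prod.splits)
  have Hl: "case_prod H \<in> borel_measurable lebesgue" by (rule measurable_completion) simp
  have Fl: "?F \<in> borel_measurable lebesgue"
    by (rule borel_measurable_lebesgue_AE[OF Hl]) (rule AE_completion[OF ae])
  have "(LINT z|(lborel \<Otimes>\<^sub>M lborel). case_prod H z) = (LINT z|lborel. case_prod H z)"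
    by (simp add: lborel_prod)
  also have "\<dots> = (LINT z|lebesgue. case_prod H z)"
    by (rule integral_completion[symmetric]) simp
  also have "\<dots> = (LINT z|lebesgue. ?F z)"
    by (rule integral_cong_AE[OF Hl Fl]) (use AE_completion[OF ae] in \<open>auto elim: eventually_mono\<close>)
  also have "\<dots> = (LINT x:B|lebesgue. f x * \<phi> x)"
    using weak B \<phi>W supp unfolding local_weak_solution_def by blast
  also have "\<dots> = (LINT x|lebesgue. g x * \<phi> x)"
  proof -
    have ae2: "AE x in lborel. indicator B x *\<^sub>R (f x * \<phi> x) = g x * \<phi> x"
      using fg by eventually_elim (use supp in \<open>auto simp: indicator_def\<close>)
    have gl: "(\<lambda>x. g x * \<phi> x) \<in> borel_measurable lebesgue" by (rule measurable_completion) simp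
    have fl: "(\<lambda>x. indicator B x *\<^sub>R (f x * \<phi> x)) \<in> borel_measurable lebesgue"
      by (rule borel_measurable_lebesgue_AE[OF gl]) (rule AE_completion[OF ae2])
    show ?thesis unfolding set_lebesgue_integral_def
      by (rule integral_cong_AE[OF fl gl]) (rule AE_completion[OF ae2])
  qed
  also have "\<dots> = (LINT x|lborel. g x * \<phi> x)" by (rule integral_completion) simp
  finally show ?thesis unfolding H_def by simp
qed

definition aq_const :: "real \<Rightarrow> nat \<Rightarrow> real" where
  "aq_const p n = 1 + 1 / tail_lower p n"

lemma aq_const_ge: "1 \<le> aq_const p n" "1 / tail_lower p n \<le> aq_const p n" "0 < aq_const p n"
  using tail_lower_pos[of p n] by (auto simp: aq_const_def intro: add_pos_nonneg)

lemma AE_diff_quot: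
  fixes u v :: "'a::euclidean_space \<Rightarrow> real"
  assumes "AE x in lborel. u x = v x"
  shows "AE x in lborel. diff_quot t h u x = diff_quot t h v x"
  using assms AE_lborel_shift[OF assms, of h] by eventually_elim (simp add: diff_quot_def)

lemma borel_measurable_diff_quot[measurable]:
  assumes [measurable]: "v \<in> borel_measurable borel"
  shows "diff_quot t h v \<in> borel_measurable borel"
  unfolding diff_quot_def[abs_def] by measurable

text \<open>Each summand of \<open>A_quantity\<close> bounds one assumption of
  \<open>borel_solution\<close>; only the two tail bounds lose a constant, by
  \<open>tail_lower\<close>. Finiteness is required because the locale works with a real number
  \<open>A\<close>.\<close>

lemma borel_solution_exists:
  fixes u v f K :: "'a::euclidean_space \<Rightarrow> real"
  assumes p: "2 \<le> p" and \<Lambda>: "1 \<le> \<Lambda>" and s: "1 / 2 < s" "s < 1" and t: "0 \<le> t" "t \<le> s"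
    and R: "0 < R" and B: "ball c R \<Subset> \<Omega>"
    and K: "K \<in> borel_measurable lebesgue"
      "\<And>z. 1 / \<Lambda> * norm z powr (real DIM('a) + s * p) \<le> K z" "\<And>z. K z \<le> \<Lambda> * norm z powr (real DIM('a) + s * p)"
    and f: "f \<in> W_loc s (conj_exp p) \<Omega>" and weak: "local_weak_solution s p K \<Omega> f u"
    and v[measurable]: "v \<in> borel_measurable borel" and eq: "AE x in lborel. u x = v x"
    and fin: "A_quantity t s p c R u f < \<infinity>"
  shows "\<exists>g \<kappa>. borel_solution p \<Lambda> s t c R (aq_const p DIM('a) * enn2real (A_quantity t s p c R u f)) v g \<kappa>"
proof -
  let ?B = "ball c R" and ?p' = "conj_exp p"
  have p': "1 < ?p'" using p by (auto simp: conj_exp_def field_simps)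
  obtain g where g[measurable]: "g \<in> borel_measurable borel" and fg: "AE x in lborel. x \<in> ?B \<longrightarrow> f x = g x"
    using W_loc_borel_representative[OF f B] by blast
  obtain \<kappa> where \<kappa>[measurable]: "\<kappa> \<in> borel_measurable borel"
    and \<kappa>b: "\<And>z. krn (real DIM('a) + s * p) z / \<Lambda> \<le> \<kappa> z" "\<And>z. \<kappa> z \<le> \<Lambda> * krn (real DIM('a) + s * p) z"
    and \<kappa>_eq: "AE z in lborel. \<kappa> z = 1 / K z"
    using kernel_representative[OF \<Lambda> K] by blast
  define a where "a = enn2real (A_quantity t s p c R u f)"
  have a: "A_quantity t s p c R u f = ennreal a" "0 \<le> a" using fin by (auto simp: a_def)
  define A where "A = aq_const p DIM('a) * a"
  have aA: "a \<le> A" "a / tail_lower p DIM('a) \<le> A"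
    using mult_right_mono[OF aq_const_ge(1) a(2)] mult_right_mono[OF aq_const_ge(2) a(2)] by (auto simp: A_def)
  have A0: "0 \<le> A" using aA a by simp
  note ps = order_trans[OF _ eq_refl[OF a(1)], unfolded A_quantity_def Let_def]
  have piece1: "ennreal (R powr (s * p)) * epow (W_seminorm s p ?B u) p \<le> ennreal a"
    by (rule ps) (simp add: add.assoc add_increasing2)
  have piece2: "ennreal (1 / (s * (1 - s))) * epow (Lp_norm p ?B u) p \<le> ennreal a"
    by (rule ps) (simp add: add_increasing add_increasing2)
  have piece3: "ennreal (1 / s) * epow (X_local s p (ball c (3 / 4 * R)) ?B u) p \<le> ennreal a"
    by (rule ps) (simp add: add_increasing add_increasing2)
  have piece4: "ennreal (R powr (t * p)) * epow (Y_local t s p (ball c (3 / 4 * R)) (ball c (7 / 8 * R)) u) p \<le> ennreal a"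
    by (rule ps) (simp add: add_increasing add_increasing2)
  have piece5: "ennreal (R powr (s * p * ?p')) * (ennreal (R powr (s * ?p')) * epow (W_seminorm s ?p' ?B (\<lambda>x. (1 - s) * f x)) ?p') \<le> ennreal a"
    by (rule ps) (simp add: add_increasing add_increasing2 distrib_left)
  have W: "epow (W_seminorm s p ?B u) p = Wpow s p ?B v"
    using p eq by (intro W_seminorm_Wpow) (auto elim: eventually_mono)
  have L: "epow (Lp_norm p ?B u) p = Lpow p ?B v"
    using p eq by (intro Lp_norm_Lpow) (auto elim: eventually_mono)
  have pw: "a / R powr x \<le> A * R powr (- x)" for x
    using aA R by (simp add: powr_minus_divide divide_right_mono)
  have "borel_solution p \<Lambda> s t c R A v g \<kappa>"
  proof (unfold_locales; (rule p \<Lambda> s t R A0 v g \<kappa> \<kappa>b)?)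
    show "Wpow s p ?B v \<le> ennreal (A * R powr (- (s * p)))"
      using ennreal_le_divide[OF piece1[unfolded W]] R a ennreal_leI[OF pw] by (auto intro: order_trans)
    show "Lpow p ?B v \<le> ennreal ((1 - s) * A)"
    proof -
      have "Lpow p ?B v \<le> ennreal (a / (1 / (s * (1 - s))))"
        using piece2[unfolded L] s a by (intro ennreal_le_divide) auto
      also have "\<dots> \<le> ennreal ((1 - s) * A)"
      proof (intro ennreal_leI)
        have "s * (1 - s) * a \<le> 1 * (1 - s) * A" using s aA a by (intro mult_mono) auto
        then show "a / (1 / (s * (1 - s))) \<le> (1 - s) * A" by (simp add: mult_ac)
      qed
      finally show ?thesis .
    qed
    have tail: "X \<le> ennreal (A * R powr (- real DIM('a) - s * p) * y)"
      if X: "ennreal (tail_lower p DIM('a) * R powr (real DIM('a) + s * p)) * X \<le> ennreal (a * y)" and y: "0 \<le> y" for X y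
    proof -
      have tp: "0 < tail_lower p DIM('a) * R powr (real DIM('a) + s * p)" using tail_lower_pos R by simp
      have "X \<le> ennreal (a * y / (tail_lower p DIM('a) * R powr (real DIM('a) + s * p)))"
        using X a y tp by (intro ennreal_le_divide) auto
      also have "\<dots> \<le> ennreal (A * R powr (- real DIM('a) - s * p) * y)"
      proof (intro ennreal_leI)
        have e: "R powr (- real DIM('a) - s * p) = 1 / R powr (real DIM('a) + s * p)"
          by (simp add: powr_minus_divide[symmetric])
        have "a / tail_lower p DIM('a) * (y / R powr (real DIM('a) + s * p)) \<le> A * (y / R powr (real DIM('a) + s * p))"
          using aA y by (intro mult_right_mono) auto
        then show "a * y / (tail_lower p DIM('a) * R powr (real DIM('a) + s * p)) \<le> A * R powr (- real DIM('a) - s * p) * y"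
          unfolding e by simp
      qed
      finally show ?thesis .
    qed
    show "tail_int (s * p) p c R v \<le> ennreal (A * R powr (- real DIM('a) - s * p))"
    proof -
      have "ennreal (tail_lower p DIM('a) * R powr (real DIM('a) + s * p)) * tail_int (s * p) p c R v
        \<le> (\<integral>\<^sup>+x\<in>ball c (3 / 4 * R). epow (Snail s p u x ?B) p \<partial>lebesgue)"
        using p s R by (intro tail_int_le_Snail eq) auto
      also have "\<dots> \<le> epow (X_local s p (ball c (3 / 4 * R)) ?B u) p"
        unfolding X_local_def using p by (subst epow_inverse) (auto simp: add_increasing)
      also have "\<dots> \<le> ennreal (a / (1 / s))" using piece3 s a by (intro ennreal_le_divide) auto
      also have "\<dots> \<le> ennreal (a * 1)" using s a by (intro ennreal_leI) (simp add: mult_left_le)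
      finally show ?thesis using tail[of _ 1] by simp
    qed
    show "tail_int (s * p) p c (7 / 8 * R) (dlt h v) \<le> ennreal (A * R powr (- real DIM('a) - s * p) * (norm h / R) powr (t * p))"
      if h: "0 < norm h" "norm h < R / 16" for h
    proof -
      let ?F = "ball c (3 / 4 * R)" and ?E = "ball c (7 / 8 * R)"
      \<comment> \<open>The supremum in \<open>Y_local\<close> runs over steps shorter than half
        this distance, hence it covers all steps below R/16, the range required in
        \<open>u_Y\<close>.\<close>
      have "R / 8 \<le> setdist ?F (- ?E)"
      proof (rule le_setdistI)
        show "?F \<noteq> {}" using R by simp
        have "bounded ?E" by simp
        then show "- ?E \<noteq> {}" by (metis Compl_eq_Compl_iff double_complement not_bounded_UNIV Compl_empty_eq)
        fix x y assume "x \<in> ?F" "y \<in> - ?E"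
        then show "R / 8 \<le> dist x y" using dist_triangle[of c y x] by auto
      qed
      then have hset: "h \<in> {h. 0 < norm h \<and> norm h < setdist ?F (- ?E) / 2}" using h by auto
      have dq: "diff_quot t h v = (\<lambda>x. (1 / norm h powr t) * dlt h v x)"
        by (auto simp: diff_quot_def dlt_def)
      have tq: "tail_int (s * p) p c (7 / 8 * R) (diff_quot t h v) = ennreal (norm h powr (- (t * p))) * tail_int (s * p) p c (7 / 8 * R) (dlt h v)"
      proof -
        have "\<bar>1 / norm h powr t\<bar> powr p = norm h powr (- (t * p))"
          by (simp add: powr_divide powr_powr powr_minus_divide)
        then have pt: "\<bar>1 / norm h powr t * y\<bar> powr p = norm h powr (- (t * p)) * \<bar>y\<bar> powr p" for y
          by (simp only: abs_mult powr_mult)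
        show ?thesis unfolding tail_int_def dq pt
          by (subst nn_integral_cmult[symmetric]) (auto simp: ennreal_mult mult.assoc)
      qed
      have "ennreal (tail_lower p DIM('a) * R powr (real DIM('a) + s * p)) * tail_int (s * p) p c (7 / 8 * R) (diff_quot t h v)
        \<le> (\<integral>\<^sup>+x\<in>?F. epow (Snail s p (diff_quot t h u) x ?E) p \<partial>lebesgue)"
        using p s R by (intro tail_int_le_Snail AE_diff_quot eq) auto
      also have "\<dots> = epow (epow (\<integral>\<^sup>+x\<in>?F. epow (Snail s p (diff_quot t h u) x ?E) p \<partial>lebesgue) (1 / p)) p"
        using p by (simp add: epow_inverse)
      also have "\<dots> \<le> epow (Y_local t s p ?F ?E u) p"
        unfolding Y_local_def using p hset by (intro epow_mono SUP_upper) auto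
      also have "\<dots> \<le> ennreal (a / R powr (t * p))" using piece4 R a by (intro ennreal_le_divide) auto
      finally have b: "ennreal (norm h powr (- (t * p))) * (ennreal (tail_lower p DIM('a) * R powr (real DIM('a) + s * p)) * tail_int (s * p) p c (7 / 8 * R) (dlt h v))
         \<le> ennreal (a / R powr (t * p))"
        unfolding tq by (simp add: mult.left_commute)
      have "ennreal (tail_lower p DIM('a) * R powr (real DIM('a) + s * p)) * tail_int (s * p) p c (7 / 8 * R) (dlt h v)
         \<le> ennreal (a / R powr (t * p) / norm h powr (- (t * p)))"
        by (rule ennreal_le_divide[OF b]) (use h a in auto)
      also have "a / R powr (t * p) / norm h powr (- (t * p)) = a * (norm h / R) powr (t * p)"
        using R by (simp add: powr_divide powr_minus_divide)
      finally show ?thesis by (intro tail) auto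
    qed
    show "Wpow s ?p' ?B g \<le> ennreal (A * R powr (- (s * p * ?p') - s * ?p') / (1 - s) powr ?p')"
    proof -
      have "epow (W_seminorm s ?p' ?B (\<lambda>x. (1 - s) * f x)) ?p' = Wpow s ?p' ?B (\<lambda>x. (1 - s) * g x)"
        using p' fg by (intro W_seminorm_Wpow) (auto elim: eventually_mono)
      also have "\<dots> = ennreal ((1 - s) powr ?p') * Wpow s ?p' ?B g" using s by (subst Wpow_cmult) auto
      finally have "ennreal (R powr (s * p * ?p')) * (ennreal (R powr (s * ?p')) * (ennreal ((1 - s) powr ?p') * Wpow s ?p' ?B g)) \<le> ennreal a"
        using piece5 by simp
      then have "ennreal (R powr (s * p * ?p') * R powr (s * ?p') * (1 - s) powr ?p') * Wpow s ?p' ?B g \<le> ennreal a"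
        by (simp add: ennreal_mult mult.assoc)
      then have "Wpow s ?p' ?B g \<le> ennreal (a / (R powr (s * p * ?p') * R powr (s * ?p') * (1 - s) powr ?p'))"
        using R s a by (intro ennreal_le_divide) auto
      also have "\<dots> \<le> ennreal (A * R powr (- (s * p * ?p') - s * ?p') / (1 - s) powr ?p')"
      proof (intro ennreal_leI)
        have e: "R powr (- (s * p * ?p') - s * ?p') = 1 / (R powr (s * p * ?p') * R powr (s * ?p'))"
          by (simp add: powr_diff powr_minus_divide)
        have "a * (1 / (R powr (s * p * ?p') * R powr (s * ?p') * (1 - s) powr ?p')) \<le> A * (1 / (R powr (s * p * ?p') * R powr (s * ?p') * (1 - s) powr ?p'))"
          using aA by (intro mult_right_mono) auto
        then show "a / (R powr (s * p * ?p') * R powr (s * ?p') * (1 - s) powr ?p') \<le> A * R powr (- (s * p * ?p') - s * ?p') / (1 - s) powr ?p'"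
          unfolding e by simp
      qed
      finally show ?thesis .
    qed
    show "Lpow ?p' ?B g < \<infinity>"
    proof -
      have "Lp_norm ?p' ?B f < \<infinity>" using f B by (auto simp: W_loc_def W_def Lp_def)
      then have "epow (Lp_norm ?p' ?B f) ?p' < \<infinity>" using p' by (subst epow_less_top) auto
      then show ?thesis using p' by (subst (asm) Lp_norm_Lpow[OF fg]) auto
    qed
    show "(LINT z|(lborel \<Otimes>\<^sub>M lborel). (case z of (x, y) \<Rightarrow> Jp p (v x - v y) * \<kappa> (x - y) * (\<phi> x - \<phi> y)))
        = (LINT x|lborel. g x * \<phi> x)"
      if "\<phi> \<in> borel_measurable borel" "\<And>x. x \<notin> ?B \<Longrightarrow> \<phi> x = 0" "Lpow p UNIV \<phi> < \<infinity>" "Wpow s p UNIV \<phi> < \<infinity>" for \<phi>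
      using p by (intro weak_formulation_borel[OF _ B weak v eq g fg \<kappa> \<kappa>_eq]) (use that in auto)
  qed
  then show ?thesis unfolding A_def a_def by blast
qed

subsection \<open>Finiteness on small balls\<close>

text \<open>Qualitative only: away from the ball the kernel is dominated by the weight of
  \<open>X_space\<close>. The constant does not depend on the function, so that it serves all
  difference quotients of a given function at once.\<close>

lemma Snail_integral_finite:
  fixes c :: "'a::euclidean_space"
  assumes p: "1 \<le> p" and s: "0 < s" and R: "0 < R" "7 / 8 * R \<le> r"
  shows "\<exists>C. \<forall>\<psi> v. v \<in> borel_measurable borel \<and> (AE x in lborel. \<psi> x = v x) \<longrightarrow>
    (\<integral>\<^sup>+x\<in>ball c (3 / 4 * R). epow (Snail s p \<psi> x (ball c r)) p \<partial>lebesgue)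
      \<le> ennreal C * (\<integral>\<^sup>+y. ennreal (\<bar>\<psi> y\<bar> powr p / (1 + norm y) powr (real DIM('a) + s * p)) \<partial>lebesgue)"
proof -
  define b where "b = real DIM('a) + s * p"
  have b: "0 < b" using s p by (auto simp: b_def intro: add_pos_pos)
  \<comment> \<open>Here 1 + |y| \<le> 1 + |c| + |y - c|, which is at most ((1 + |c|)/r + 1) |y -
    c|. Moreover |y - c| \<le> 7 |x - y|, because |x - c| < 3/4 R is at most 6/7 of r.\<close>
  define q where "q = 7 * ((1 + norm c) / r + 1)"
  have r: "0 < r" using R by linarith
  have q: "0 < q" using r by (auto simp: q_def intro!: add_pos_pos divide_pos_pos add_pos_nonneg)
  define E where "E = (unit_ball_vol (real DIM('a)) * r ^ DIM('a)) powr (s * p / real DIM('a))"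
  have E: "0 \<le> E" by (simp add: E_def)
  define V where "V = unit_ball_vol (real DIM('a)) * (3 / 4 * R) ^ DIM('a)"
  have V: "0 \<le> V" using R by (simp add: V_def)
  show ?thesis
  proof (intro exI[of _ "E * q powr b * V"] allI impI; elim conjE)
    fix \<psi> v :: "'a \<Rightarrow> real"
    assume v[measurable]: "v \<in> borel_measurable borel" and eq: "AE x in lborel. \<psi> x = v x"
    define J where "J = (\<integral>\<^sup>+y. ennreal (\<bar>v y\<bar> powr p / (1 + norm y) powr b) \<partial>lborel)"
    have J: "(\<integral>\<^sup>+y. ennreal (\<bar>\<psi> y\<bar> powr p / (1 + norm y) powr b) \<partial>lebesgue) = J"
      unfolding J_def nn_integral_completion by (rule nn_integral_cong_AE) (use eq in \<open>auto elim: eventually_mono\<close>)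
    have up: "epow (Snail s p \<psi> x (ball c r)) p \<le> ennreal (E * q powr b) * J" if x: "x \<in> ball c (3 / 4 * R)" for x
    proof -
      have p0: "0 < p" "0 \<le> r" using p r by auto
      have "epow (Snail s p \<psi> x (ball c r)) p = ennreal E * (\<integral>\<^sup>+y. ennreal (\<bar>v y\<bar> powr p * krn b (x - y)) * indicator (- ball c r) y \<partial>lborel)"
        unfolding E_def b_def by (rule Snail_power[OF eq p0 v])
      also have "\<dots> \<le> ennreal E * (\<integral>\<^sup>+y. ennreal (q powr b) * ennreal (\<bar>v y\<bar> powr p / (1 + norm y) powr b) \<partial>lborel)"
      proof (intro mult_left_mono nn_integral_mono)
        fix y
        show "ennreal (\<bar>v y\<bar> powr p * krn b (x - y)) * indicator (- ball c r) y \<le> ennreal (q powr b) * ennreal (\<bar>v y\<bar> powr p / (1 + norm y) powr b)"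
        proof (cases "y \<in> ball c r")
          case False
          have yc: "r \<le> norm (y - c)" using False by (simp add: dist_norm norm_minus_commute)
          have xc: "norm (x - c) < 3 / 4 * R" using x by (simp add: dist_norm norm_minus_commute)
          have "y - c = (x - c) - (x - y)" by simp
          then have "norm (y - c) \<le> norm (x - c) + norm (x - y)" by (metis norm_triangle_ineq4)
          then have 1: "norm (y - c) / 7 \<le> norm (x - y)" using xc yc R by linarith
          have "norm y \<le> norm c + norm (y - c)" by (rule norm_triangle_sub)
          moreover have "1 + norm c \<le> (1 + norm c) / r * norm (y - c)"
          proof -
            have "(1 + norm c) / r * r \<le> (1 + norm c) / r * norm (y - c)"
              using yc r by (intro mult_left_mono) auto
            then show ?thesis using r by simp
          qed
          ultimately have "1 + norm y \<le> ((1 + norm c) / r + 1) * norm (y - c)" unfolding distrib_right by linarith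
          also have "\<dots> = q * (norm (y - c) / 7)" by (simp add: q_def)
          also have "\<dots> \<le> q * norm (x - y)" using 1 q by (intro mult_left_mono) auto
          finally have 2: "1 + norm y \<le> q * norm (x - y)" .
          then have "(1 + norm y) powr b \<le> (q * norm (x - y)) powr b" using b by (intro powr_mono2) auto
          also have "\<dots> = q powr b * norm (x - y) powr b" by (rule powr_mult)
          finally have 3: "(1 + norm y) powr b \<le> q powr b * norm (x - y) powr b" .
          have y1: "0 < (1 + norm y) powr b" using add_pos_nonneg[OF zero_less_one norm_ge_zero[of y]] by simp
          then have n0: "0 < norm (x - y) powr b" using 3 by (cases "norm (x - y) powr b = 0") auto
          have "krn b (x - y) \<le> q powr b / (1 + norm y) powr b"
            unfolding krn_def using 3 y1 n0 by (simp add: divide_simps mult.commute)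
          then have "\<bar>v y\<bar> powr p * krn b (x - y) \<le> \<bar>v y\<bar> powr p * (q powr b / (1 + norm y) powr b)"
            by (intro mult_left_mono) auto
          then have "ennreal (\<bar>v y\<bar> powr p * krn b (x - y)) \<le> ennreal (q powr b * (\<bar>v y\<bar> powr p / (1 + norm y) powr b))"
            by (intro ennreal_leI) (simp add: mult.commute)
          then show ?thesis using False by (simp add: ennreal_mult'[symmetric])
        qed simp
      qed simp
      also have "\<dots> = ennreal E * (ennreal (q powr b) * J)"
        unfolding J_def by (subst nn_integral_cmult) auto
      also have "\<dots> = ennreal (E * q powr b) * J" using E by (simp add: ennreal_mult mult.assoc)
      finally show ?thesis .
    qed
    have "(\<integral>\<^sup>+x\<in>ball c (3 / 4 * R). epow (Snail s p \<psi> x (ball c r)) p \<partial>lebesgue)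
      \<le> (\<integral>\<^sup>+x. (ennreal (E * q powr b) * J) * indicator (ball c (3 / 4 * R)) x \<partial>lborel)"
      unfolding nn_integral_completion using up by (intro nn_integral_mono) (auto simp: indicator_def)
    also have "\<dots> = ennreal (E * q powr b) * J * ennreal V"
      using R by (subst nn_integral_cmult_indicator) (auto simp: V_def emeasure_ball)
    also have "\<dots> = ennreal (E * q powr b * V) * J"
      using E V by (simp add: ennreal_mult mult_ac)
    finally show "(\<integral>\<^sup>+x\<in>ball c (3 / 4 * R). epow (Snail s p \<psi> x (ball c r)) p \<partial>lebesgue)
      \<le> ennreal (E * q powr b * V) * (\<integral>\<^sup>+y. ennreal (\<bar>\<psi> y\<bar> powr p / (1 + norm y) powr (real DIM('a) + s * p)) \<partial>lebesgue)"
      unfolding b_def[symmetric] J .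
  qed
qed

text \<open>Membership in \<open>Y_space\<close> controls only steps below some \<open>h0\<close>,
  hence the restriction to small balls. This is enough for the existence of the weak gradient, which
  is a local matter.\<close>

lemma A_quantity_finite:
  fixes u v f :: "'a::euclidean_space \<Rightarrow> real"
  assumes p: "2 \<le> p" and s: "1 / 2 < s" "s < 1" and R: "0 < R" "R \<le> h0" and B: "ball c R \<Subset> \<Omega>"
    and f: "f \<in> W_loc s (conj_exp p) \<Omega>" and u: "u \<in> W_loc s p \<Omega>"
    and v[measurable]: "v \<in> borel_measurable borel" and eq: "AE x in lborel. u x = v x"
    and X: "(\<integral>\<^sup>+x. ennreal (\<bar>u x\<bar> powr p / (1 + norm x) powr (real DIM('a) + s * p)) \<partial>lebesgue) < \<infinity>"
    and Y: "(SUP h\<in>{h. 0 < norm h \<and> norm h < h0}.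
        \<integral>\<^sup>+x. ennreal (\<bar>diff_quot t h u x\<bar> powr p / (1 + norm x) powr (real DIM('a) + s * p)) \<partial>lebesgue) < \<infinity>"
  shows "A_quantity t s p c R u f < \<infinity>"
proof -
  let ?B = "ball c R" and ?p' = "conj_exp p" and ?F = "ball c (3 / 4 * R)" and ?E = "ball c (7 / 8 * R)"
  have p': "1 < ?p'" using p by (auto simp: conj_exp_def field_simps)
  have p0: "0 < p" "0 < ?p'" using p p' by auto
  obtain g where g[measurable]: "g \<in> borel_measurable borel" and fg: "AE x in lborel. x \<in> ?B \<longrightarrow> f x = g x"
    using W_loc_borel_representative[OF f B] by blast
  have uW: "W_seminorm s p ?B u < \<infinity>" "Lp_norm p ?B u < \<infinity>" using u B by (auto simp: W_loc_def W_def Lp_def)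
  have fW: "W_seminorm s ?p' ?B f < \<infinity>" "Lp_norm ?p' ?B f < \<infinity>" using f B by (auto simp: W_loc_def W_def Lp_def)
  have fg': "AE x in lborel. x \<in> ?B \<longrightarrow> (1 - s) * f x = (1 - s) * g x" using fg by eventually_elim auto
  have 1: "epow (W_seminorm s p ?B u) p < \<infinity>" "epow (Lp_norm p ?B u) p < \<infinity>"
    using uW p0 by (simp_all add: epow_less_top del: infinity_ennreal_def)
  have 2: "epow (W_seminorm s ?p' ?B (\<lambda>x. (1 - s) * f x)) ?p' < \<infinity>"
  proof -
    have "epow (W_seminorm s ?p' ?B (\<lambda>x. (1 - s) * f x)) ?p' = Wpow s ?p' ?B (\<lambda>x. (1 - s) * g x)"
      using p0 by (intro W_seminorm_Wpow[OF fg']) auto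
    also have "\<dots> = ennreal (\<bar>1 - s\<bar> powr ?p') * Wpow s ?p' ?B g" by (rule Wpow_cmult) measurable
    also have "Wpow s ?p' ?B g = epow (W_seminorm s ?p' ?B f) ?p'" using p0 by (intro W_seminorm_Wpow[OF fg, symmetric]) auto
    also have "ennreal (\<bar>1 - s\<bar> powr ?p') * \<dots> < \<infinity>"
      using fW p0 epow_less_top[of ?p' "W_seminorm s ?p' ?B f"] by (simp add: ennreal_mult_less_top)
    finally show ?thesis .
  qed
  have 3: "epow (Lp_norm ?p' ?B (\<lambda>x. (1 - s) * f x)) ?p' < \<infinity>"
  proof -
    have "epow (Lp_norm ?p' ?B (\<lambda>x. (1 - s) * f x)) ?p' = Lpow ?p' ?B (\<lambda>x. (1 - s) * g x)"
      by (rule Lp_norm_Lpow[OF fg' p0(2)])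
    also have "\<dots> = ennreal (\<bar>1 - s\<bar> powr ?p') * Lpow ?p' ?B g" by (rule Lpow_cmult) measurable
    also have "Lpow ?p' ?B g = epow (Lp_norm ?p' ?B f) ?p'" by (rule Lp_norm_Lpow[OF fg p0(2), symmetric])
    also have "ennreal (\<bar>1 - s\<bar> powr ?p') * \<dots> < \<infinity>"
      using fW p0 epow_less_top[of ?p' "Lp_norm ?p' ?B f"] by (simp add: ennreal_mult_less_top)
    finally show ?thesis .
  qed
  have 4: "epow (X_local s p ?F ?B u) p < \<infinity>"
  proof -
    obtain C where C: "\<And>\<psi> v. v \<in> borel_measurable borel \<Longrightarrow> (AE x in lborel. \<psi> x = v x) \<Longrightarrow>
      (\<integral>\<^sup>+x\<in>?F. epow (Snail s p \<psi> x ?B) p \<partial>lebesgue) \<le> ennreal C * (\<integral>\<^sup>+y. ennreal (\<bar>\<psi> y\<bar> powr p / (1 + norm y) powr (real DIM('a) + s * p)) \<partial>lebesgue)"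
      using Snail_integral_finite[of p s R R c] p s R by auto
    have "(\<integral>\<^sup>+x\<in>?F. epow (Snail s p u x ?B) p \<partial>lebesgue) < \<infinity>"
      using C[OF v eq] X by (auto intro: le_less_trans simp: ennreal_mult_less_top)
    moreover have "(\<integral>\<^sup>+x\<in>?B. ennreal (\<bar>u x\<bar> powr p) \<partial>lebesgue) < \<infinity>"
      using 1(2) p0 unfolding Lp_norm_def by (simp add: epow_inverse)
    ultimately show ?thesis unfolding X_local_def using p0 by (simp add: epow_inverse)
  qed
  have 5: "epow (Y_local t s p ?F ?E u) p < \<infinity>"
  proof -
    obtain C where C: "\<And>\<psi> v. v \<in> borel_measurable borel \<Longrightarrow> (AE x in lborel. \<psi> x = v x) \<Longrightarrow>
      (\<integral>\<^sup>+x\<in>?F. epow (Snail s p \<psi> x ?E) p \<partial>lebesgue) \<le> ennreal C * (\<integral>\<^sup>+y. ennreal (\<bar>\<psi> y\<bar> powr p / (1 + norm y) powr (real DIM('a) + s * p)) \<partial>lebesgue)"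
      using Snail_integral_finite[of p s R "7 / 8 * R" c] p s R by auto
    define S where "S = (SUP h\<in>{h. 0 < norm h \<and> norm h < h0}.
        \<integral>\<^sup>+x. ennreal (\<bar>diff_quot t h u x\<bar> powr p / (1 + norm x) powr (real DIM('a) + s * p)) \<partial>lebesgue)"
    \<comment> \<open>With this bound the steps in \<open>Y_local\<close> are shorter than R/2,
      hence below \<open>h0\<close>.\<close>
    have sd: "setdist ?F (- ?E) \<le> R"
    proof -
      obtain i :: 'a where i: "i \<in> Basis" using SOME_Basis by blast
      have "setdist ?F (- ?E) \<le> dist c (c + R *\<^sub>R i)" using R i by (intro setdist_le_dist) (auto simp: dist_norm)
      then show ?thesis using R i by (simp add: dist_norm)
    qed
    have "Y_local t s p ?F ?E u \<le> epow (ennreal C * S) (1 / p)"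
      unfolding Y_local_def
    proof (rule SUP_least)
      fix h :: 'a assume "h \<in> {h. 0 < norm h \<and> norm h < setdist ?F (- ?E) / 2}"
      then have h: "h \<in> {h. 0 < norm h \<and> norm h < h0}" using sd R by auto
      show "epow (\<integral>\<^sup>+x\<in>?F. epow (Snail s p (diff_quot t h u) x ?E) p \<partial>lebesgue) (1 / p) \<le> epow (ennreal C * S) (1 / p)"
      proof (rule epow_mono)
        have "(\<integral>\<^sup>+x\<in>?F. epow (Snail s p (diff_quot t h u) x ?E) p \<partial>lebesgue)
          \<le> ennreal C * (\<integral>\<^sup>+y. ennreal (\<bar>diff_quot t h u y\<bar> powr p / (1 + norm y) powr (real DIM('a) + s * p)) \<partial>lebesgue)"
          by (rule C[OF borel_measurable_diff_quot[OF v] AE_diff_quot[OF eq]])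
        also have "\<dots> \<le> ennreal C * S" unfolding S_def by (intro mult_left_mono SUP_upper h) auto
        finally show "(\<integral>\<^sup>+x\<in>?F. epow (Snail s p (diff_quot t h u) x ?E) p \<partial>lebesgue) \<le> ennreal C * S" .
      qed (use p0 in auto)
    qed
    also have "\<dots> < \<infinity>"
      using Y p0 unfolding S_def[symmetric] by (subst epow_less_top) (auto simp: ennreal_mult_less_top)
    finally show ?thesis using p0 by (simp add: epow_less_top del: infinity_ennreal_def)
  qed
  show ?thesis unfolding A_quantity_def Let_def
    using 1 2 3 4 5 by (simp add: ennreal_mult_less_top)
qed

section \<open>Summability of second differences\<close>

text \<open>Plays two roles: finiteness at a point gives convergence of the dyadic quotients there,
  and local integrability provides the majorant for dominated convergence.\<close>

definition second_sum :: "'a::euclidean_space \<Rightarrow> ('a \<Rightarrow> real) \<Rightarrow> 'a \<Rightarrow> ennreal" where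
  "second_sum e u x = (\<Sum>j. ennreal (2 ^ j * \<bar>dlt (e /\<^sub>R 2 ^ Suc j) (dlt (e /\<^sub>R 2 ^ Suc j) u) x\<bar>))"

lemma borel_measurable_second_sum[measurable]:
  assumes [measurable]: "u \<in> borel_measurable borel"
  shows "second_sum e u \<in> borel_measurable borel"
  unfolding second_sum_def[abs_def] by measurable

text \<open>By \<open>dlt_telescope\<close> the n-th quotient is d_e u minus a partial sum of an
  absolutely convergent series.\<close>

lemma second_sum_finite:
  assumes "second_sum e u x < \<infinity>"
  shows "dyadic_differentiable e u x"
    "ennreal \<bar>2 ^ n * dlt (e /\<^sub>R 2 ^ n) u x\<bar> \<le> ennreal \<bar>dlt e u x\<bar> + second_sum e u x"
proof -
  define d where "d j = 2 ^ j * dlt (e /\<^sub>R 2 ^ Suc j) (dlt (e /\<^sub>R 2 ^ Suc j) u) x" for j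
  have ss: "second_sum e u x = (\<Sum>j. ennreal \<bar>d j\<bar>)" by (simp add: second_sum_def d_def abs_mult)
  have "summable (\<lambda>j. \<bar>d j\<bar>)"
    using assms unfolding ss by (intro summable_suminf_not_top) auto
  then have "summable d" by (rule summable_rabs_cancel)
  then have "(\<lambda>n. dlt e u x - (\<Sum>j<n. d j)) \<longlonglongrightarrow> dlt e u x - suminf d"
    by (intro tendsto_diff tendsto_const summable_LIMSEQ)
  then show "dyadic_differentiable e u x"
    unfolding dyadic_differentiable_def dlt_telescope d_def[symmetric] convergent_def by auto
  have "\<bar>2 ^ n * dlt (e /\<^sub>R 2 ^ n) u x\<bar> \<le> \<bar>dlt e u x\<bar> + (\<Sum>j<n. \<bar>d j\<bar>)"
    unfolding dlt_telescope d_def[symmetric] using sum_abs[of d "{..<n}"] by linarith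
  then have "ennreal \<bar>2 ^ n * dlt (e /\<^sub>R 2 ^ n) u x\<bar> \<le> ennreal (\<bar>dlt e u x\<bar> + (\<Sum>j<n. \<bar>d j\<bar>))" by (rule ennreal_leI)
  also have "\<dots> = ennreal \<bar>dlt e u x\<bar> + (\<Sum>j<n. ennreal \<bar>d j\<bar>)"
    by (simp add: ennreal_plus sum_nonneg)
  also have "\<dots> \<le> ennreal \<bar>dlt e u x\<bar> + second_sum e u x"
    unfolding ss by (intro add_left_mono sum_le_suminf) auto
  finally show "ennreal \<bar>2 ^ n * dlt (e /\<^sub>R 2 ^ n) u x\<bar> \<le> ennreal \<bar>dlt e u x\<bar> + second_sum e u x" .
qed

context borel_solution_diff
begin

text \<open>Steps below R/64 are covered by \<open>second_difference\<close>, with order l0 / p > 1.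
  For the finitely many longer ones local integrability of u suffices.\<close>

lemma second_sum_integrable:
  assumes e: "norm e = 1" and fin: "\<And>r. Lpow p (ball c r) u < \<infinity>"
  shows "(\<integral>\<^sup>+x. second_sum e u x * indicator (ball c (R / 2)) x \<partial>lborel) < \<infinity>"
proof -
  obtain m :: nat where m: "64 / R < 2 ^ m" using real_arch_pow[of 2 "64 / R"] by auto
  define P where "P = second_const p \<Lambda> DIM('a) * ((1 - s) * A * R powr (- l0))"
  have P: "0 \<le> P" using p \<Lambda> s A by (simp add: P_def)
  show ?thesis unfolding second_sum_def
  proof (rule nn_integral_dyadic_second_differences_finite[where p = p and \<sigma> = "l0 / p" and m = m and P = P])
    show "emeasure lborel (ball c (R / 2)) < \<infinity>" by (rule emeasure_lborel_ball_finite)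
    fix j
    let ?w = "e /\<^sub>R 2 ^ Suc j"
    have nw: "norm ?w = 1 / 2 ^ Suc j" unfolding norm_dyadic e ..
    have "Lpow p (ball c (R / 2)) (dlt ?w (dlt ?w u)) \<le> ennreal (2 powr p) * Lpow p (ball c (R / 2 + norm ?w)) (dlt ?w u)"
      using p by (intro Lpow_dlt_le) auto
    also have "\<dots> \<le> ennreal (2 powr p) * (ennreal (2 powr p) * Lpow p (ball c (R / 2 + norm ?w + norm ?w)) u)"
      using p by (intro mult_left_mono Lpow_dlt_le) auto
    also have "\<dots> < \<infinity>" using fin by (simp add: ennreal_mult_less_top)
    finally show "Lpow p (ball c (R / 2)) (dlt ?w (dlt ?w u)) < \<infinity>" .
    assume j: "m \<le> j"
    have "(2::real) ^ m \<le> 2 ^ Suc j" using j by (intro power_increasing) auto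
    then have "64 / R < 2 ^ Suc j" using m by linarith
    then have le: "norm ?w \<le> R / 64" unfolding nw using R by (simp add: field_simps)
    have "Lpow p (ball c (R / 2)) (dlt ?w (dlt ?w u)) \<le> ennreal (second_const p \<Lambda> DIM('a) * ((1 - s) * A * (norm ?w / R) powr l0))"
      by (rule second_difference[OF le])
    also have "\<dots> \<le> ennreal (P * (2 powr - (p * (l0 / p))) ^ j)"
    proof (intro ennreal_leI)
      have "(norm ?w / R) powr l0 \<le> (1 / 2 ^ j / R) powr l0"
        unfolding nw using R l0 p by (intro powr_mono2) (auto simp: field_simps)
      also have "\<dots> = (1 / 2 ^ j) powr l0 * R powr (- l0)" by (rule powr_quotient[OF R, symmetric])
      also have "(1 / 2 ^ j) powr l0 = (2 powr - (p * (l0 / p))) ^ j" using p by (simp add: dyadic_powr)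
      finally have "second_const p \<Lambda> DIM('a) * ((1 - s) * A * (norm ?w / R) powr l0)
        \<le> second_const p \<Lambda> DIM('a) * ((1 - s) * A * ((2 powr - (p * (l0 / p))) ^ j * R powr (- l0)))"
        using p \<Lambda> s A by (intro mult_left_mono) auto
      then show "second_const p \<Lambda> DIM('a) * ((1 - s) * A * (norm ?w / R) powr l0) \<le> P * (2 powr - (p * (l0 / p))) ^ j"
        by (simp add: P_def mult_ac)
    qed
    finally show "Lpow p (ball c (R / 2)) (dlt ?w (dlt ?w u)) \<le> ennreal (P * (2 powr - (p * (l0 / p))) ^ j)" .
  qed (use p l0_le in auto)
qed

end

subsection \<open>Integration by parts\<close>

text \<open>Passes by a finite subcover from small balls, where the solution estimates are
  available, to arbitrary compact subsets of the open set.\<close>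

lemma second_sum_compact:
  fixes v :: "'a::euclidean_space \<Rightarrow> real"
  assumes [measurable]: "v \<in> borel_measurable borel"
    and loc: "\<And>x. x \<in> \<Omega> \<Longrightarrow> \<exists>r>0. (\<integral>\<^sup>+y. second_sum e v y * indicator (ball x r) y \<partial>lborel) < \<infinity>"
    and S: "compact S" "S \<subseteq> \<Omega>"
  shows "(\<integral>\<^sup>+y. second_sum e v y * indicator S y \<partial>lborel) < \<infinity>"
proof -
  obtain r where r: "\<And>x. x \<in> \<Omega> \<Longrightarrow> 0 < r x \<and> (\<integral>\<^sup>+y. second_sum e v y * indicator (ball x (r x)) y \<partial>lborel) < \<infinity>"
    using loc by metis
  have "S \<subseteq> (\<Union>x\<in>S. ball x (r x))" using r S by force
  then obtain T where T: "T \<subseteq> S" "finite T" "S \<subseteq> (\<Union>x\<in>T. ball x (r x))"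
    using compactE_image[OF S(1), of S "\<lambda>x. ball x (r x)"] by auto
  have "(\<integral>\<^sup>+y. second_sum e v y * indicator S y \<partial>lborel) \<le> (\<integral>\<^sup>+y. (\<Sum>x\<in>T. second_sum e v y * indicator (ball x (r x)) y) \<partial>lborel)"
  proof (intro nn_integral_mono)
    fix y
    show "second_sum e v y * indicator S y \<le> (\<Sum>x\<in>T. second_sum e v y * indicator (ball x (r x)) y)"
    proof (cases "y \<in> S")
      case True
      then obtain x where x: "x \<in> T" "y \<in> ball x (r x)" using T by auto
      have "second_sum e v y * indicator S y = second_sum e v y * indicator (ball x (r x)) y" using x True by simp
      also have "\<dots> \<le> (\<Sum>x\<in>T. second_sum e v y * indicator (ball x (r x)) y)"
        using x T by (intro member_le_sum) auto
      finally show ?thesis .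
    qed simp
  qed
  also have "\<dots> = (\<Sum>x\<in>T. \<integral>\<^sup>+y. second_sum e v y * indicator (ball x (r x)) y \<partial>lborel)"
    by (rule nn_integral_sum) measurable
  also have "\<dots> < \<infinity>" using T S r by (auto simp: subset_iff)
  finally show ?thesis .
qed

lemma dyadic_deriv_le_second_sum:
  assumes "second_sum e u x < \<infinity>"
  shows "ennreal \<bar>dyadic_deriv e u x\<bar> \<le> ennreal \<bar>dlt e u x\<bar> + second_sum e u x"
proof (rule LIMSEQ_le_const2)
  show "(\<lambda>n. ennreal \<bar>2 ^ n * dlt (e /\<^sub>R 2 ^ n) u x\<bar>) \<longlonglongrightarrow> ennreal \<bar>dyadic_deriv e u x\<bar>"
    using dyadic_deriv_LIMSEQ[OF second_sum_finite(1)[OF assms]] by (intro tendsto_ennrealI tendsto_rabs)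
qed (use second_sum_finite(2)[OF assms] in auto)

lemma Lpow_one_finite:
  fixes v :: "'a::euclidean_space \<Rightarrow> real"
  assumes [measurable]: "v \<in> borel_measurable borel" and p: "1 \<le> p" and fin: "Lpow p (ball c r) v < \<infinity>"
  shows "Lpow 1 (ball c r) v < \<infinity>"
proof -
  have "Lpow 1 (ball c r) v \<le> (\<integral>\<^sup>+x. (indicator (ball c r) x + ennreal (\<bar>v x\<bar> powr p) * indicator (ball c r) x) \<partial>lborel)"
    unfolding Lpow_def
  proof (intro nn_integral_mono)
    fix x
    have "\<bar>v x\<bar> \<le> 1 + \<bar>v x\<bar> powr p"
    proof (cases "\<bar>v x\<bar> \<le> 1")
      case False
      then have "\<bar>v x\<bar> powr 1 \<le> \<bar>v x\<bar> powr p" using p by (intro powr_mono) auto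
      then show ?thesis using False by simp
    qed (simp add: add_increasing2)
    then have "ennreal (\<bar>v x\<bar> powr 1) \<le> 1 + ennreal (\<bar>v x\<bar> powr p)"
      using ennreal_leI[of "\<bar>v x\<bar>" "1 + \<bar>v x\<bar> powr p"] by (simp add: ennreal_plus)
    then show "ennreal (\<bar>v x\<bar> powr 1) * indicator (ball c r) x \<le> indicator (ball c r) x + ennreal (\<bar>v x\<bar> powr p) * indicator (ball c r) x"
      by (cases "x \<in> ball c r") auto
  qed
  also have "\<dots> = emeasure lborel (ball c r) + Lpow p (ball c r) v"
    unfolding Lpow_def by (simp add: nn_integral_add)
  also have "\<dots> < \<infinity>" using fin emeasure_lborel_ball_finite[of c r] by simp
  finally show ?thesis .
qed

text \<open>One-dimensional calculus along the line x - \<tau> e: the derivative at 0 gives the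
  limit, the mean value theorem the uniform bound.\<close>

lemma dyadic_difference_quotient_smooth:
  fixes \<phi> :: "'a::euclidean_space \<Rightarrow> real"
  assumes \<phi>: "\<phi> differentiable_on UNIV" and M: "\<And>x. \<bar>frechet_derivative \<phi> (at x) e\<bar> \<le> M"
  shows "(\<lambda>n. 2 ^ n * (\<phi> (x - e /\<^sub>R 2 ^ n) - \<phi> x)) \<longlonglongrightarrow> - frechet_derivative \<phi> (at x) e"
    "\<bar>2 ^ n * (\<phi> (x - e /\<^sub>R 2 ^ n) - \<phi> x)\<bar> \<le> M"
proof -
  let ?D = "\<lambda>x. frechet_derivative \<phi> (at x) e"
  have der: "((\<lambda>\<tau>. \<phi> (x - \<tau> *\<^sub>R e)) has_real_derivative - ?D (x - \<tau> *\<^sub>R e)) (at \<tau>)" for \<tau>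
  proof -
    have "\<phi> differentiable (at (x - \<tau> *\<^sub>R e))" using \<phi> by (auto simp: differentiable_on_def)
    then have F: "(\<phi> has_derivative frechet_derivative \<phi> (at (x - \<tau> *\<^sub>R e))) (at (x - \<tau> *\<^sub>R e))"
      by (simp add: frechet_derivative_works)
    have line: "((\<lambda>\<tau>. x - \<tau> *\<^sub>R e) has_derivative (\<lambda>d. - (d *\<^sub>R e))) (at \<tau>)"
      by (auto intro!: derivative_eq_intros)
    have "((\<lambda>\<tau>. \<phi> (x - \<tau> *\<^sub>R e)) has_derivative (\<lambda>d. frechet_derivative \<phi> (at (x - \<tau> *\<^sub>R e)) (- (d *\<^sub>R e)))) (at \<tau>)"
      using has_derivative_compose[of "\<lambda>\<tau>. x - \<tau> *\<^sub>R e" "\<lambda>d. - (d *\<^sub>R e)" \<tau> UNIV \<phi>, OF _ F] line by simp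
    moreover have "frechet_derivative \<phi> (at (x - \<tau> *\<^sub>R e)) (- (d *\<^sub>R e)) = - ?D (x - \<tau> *\<^sub>R e) * d" for d
      using linear_scale[OF has_derivative_linear[OF F], of "- d" e] by simp
    ultimately show ?thesis unfolding has_field_derivative_def by (simp only:)
  qed
  have "((\<lambda>h. (\<phi> (x - (0 + h) *\<^sub>R e) - \<phi> (x - 0 *\<^sub>R e)) / h) \<longlongrightarrow> - ?D (x - 0 *\<^sub>R e)) (at 0)"
    using der[of 0] unfolding DERIV_def .
  moreover have "filterlim (\<lambda>n. 1 / 2 ^ n) (at (0::real)) sequentially"
  proof (rule filterlim_atI)
    show "(\<lambda>n. 1 / 2 ^ n) \<longlonglongrightarrow> (0::real)"
      using LIMSEQ_power_zero[of "1 / 2 :: real"] by (simp add: power_one_over)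
  qed auto
  ultimately have "(\<lambda>n. (\<phi> (x - (0 + 1 / 2 ^ n) *\<^sub>R e) - \<phi> (x - 0 *\<^sub>R e)) / (1 / 2 ^ n)) \<longlonglongrightarrow> - ?D (x - 0 *\<^sub>R e)"
    by (rule filterlim_compose)
  then show "(\<lambda>n. 2 ^ n * (\<phi> (x - e /\<^sub>R 2 ^ n) - \<phi> x)) \<longlonglongrightarrow> - ?D x"
    by (simp add: divide_inverse mult.commute)
  have "\<exists>z. 0 < z \<and> z < 1 / 2 ^ n \<and> \<phi> (x - (1 / 2 ^ n) *\<^sub>R e) - \<phi> (x - 0 *\<^sub>R e) = (1 / 2 ^ n - 0) * (- ?D (x - z *\<^sub>R e))"
    by (rule MVT2) (auto intro: der)
  then obtain z where z: "\<phi> (x - (1 / 2 ^ n) *\<^sub>R e) - \<phi> x = (1 / 2 ^ n) * (- ?D (x - z *\<^sub>R e))" by auto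
  have "2 ^ n * (\<phi> (x - e /\<^sub>R 2 ^ n) - \<phi> x) = - ?D (x - z *\<^sub>R e)"
    using z by (simp add: divide_inverse)
  then show "\<bar>2 ^ n * (\<phi> (x - e /\<^sub>R 2 ^ n) - \<phi> x)\<bar> \<le> M" using M[of "x - z *\<^sub>R e"] by simp
qed

lemma bounded_of_compact_support:
  fixes g :: "'a::euclidean_space \<Rightarrow> real"
  assumes "continuous_on UNIV g" "compact S" "\<And>x. x \<notin> S \<Longrightarrow> g x = 0"
  obtains M where "0 \<le> M" "\<And>x. \<bar>g x\<bar> \<le> M"
proof -
  have "compact (g ` S)" using assms by (intro compact_continuous_image continuous_on_subset[OF assms(1)]) auto
  then obtain b where b: "\<And>y. y \<in> g ` S \<Longrightarrow> \<bar>y\<bar> \<le> b"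
    using compact_imp_bounded bounded_iff by (metis real_norm_def)
  have "\<bar>g x\<bar> \<le> max 0 b" for x
    using b[of "g x"] assms(3)[of x] by (cases "x \<in> S") auto
  then show ?thesis using that[of "max 0 b"] by auto
qed

lemma integrable_times_bounded:
  fixes v \<phi> :: "'a::euclidean_space \<Rightarrow> real"
  assumes [measurable]: "v \<in> borel_measurable borel" "\<phi> \<in> borel_measurable borel"
    and fin: "Lpow 1 (ball 0 r) v < \<infinity>" and \<phi>: "\<And>x. \<bar>\<phi> x\<bar> \<le> M * indicator (ball 0 r) x"
  shows "integrable lborel (\<lambda>x. v x * \<phi> x)"
proof (rule integrableI_bounded)
  have "0 \<le> \<bar>\<phi> 0\<bar>" by simp
  have "(\<integral>\<^sup>+x. ennreal (norm (v x * \<phi> x)) \<partial>lborel) \<le> (\<integral>\<^sup>+x. ennreal M * (ennreal (\<bar>v x\<bar> powr 1) * indicator (ball 0 r) x) \<partial>lborel)"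
  proof (intro nn_integral_mono)
    fix x
    show "ennreal (norm (v x * \<phi> x)) \<le> ennreal M * (ennreal (\<bar>v x\<bar> powr 1) * indicator (ball 0 r) x)"
    proof (cases "x \<in> ball 0 r")
      case True
      then have "\<bar>\<phi> x\<bar> \<le> M" using \<phi>[of x] by simp
      then have "\<bar>v x\<bar> * \<bar>\<phi> x\<bar> \<le> \<bar>v x\<bar> * M" "0 \<le> M" by (auto intro: mult_left_mono)
      then show ?thesis using True by (simp add: abs_mult ennreal_mult[symmetric] ennreal_leI mult.commute)
    next
      case False
      then show ?thesis using \<phi>[of x] by simp
    qed
  qed
  also have "\<dots> = ennreal M * Lpow 1 (ball 0 r) v" unfolding Lpow_def by (rule nn_integral_cmult) measurable
  also have "\<dots> < \<infinity>" using fin by (simp add: ennreal_mult_less_top)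
  finally show "(\<integral>\<^sup>+x. ennreal (norm (v x * \<phi> x)) \<partial>lborel) < \<infinity>" .
qed measurable

text \<open>For each dyadic step, translation moves the difference from \<phi> to v. Both sides
  converge by dominated convergence: on the side of \<phi> by its bounded derivative, on the side of
  v by \<open>second_sum\<close>.\<close>

lemma dyadic_integration_by_parts:
  fixes v \<phi> :: "'a::euclidean_space \<Rightarrow> real"
  assumes v[measurable]: "v \<in> borel_measurable borel" and e: "norm e = 1" and loc1: "\<And>r. Lpow 1 (ball 0 r) v < \<infinity>"
    and S: "compact S" and ss: "(\<integral>\<^sup>+y. second_sum e v y * indicator S y \<partial>lborel) < \<infinity>"
    and \<phi>: "\<phi> differentiable_on UNIV" "continuous_on UNIV (\<lambda>x. frechet_derivative \<phi> (at x) e)" "\<And>x. x \<notin> S \<Longrightarrow> \<phi> x = 0"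
    and D0: "\<And>x. x \<notin> S \<Longrightarrow> frechet_derivative \<phi> (at x) e = 0"
  shows "(LINT x|lborel. v x * frechet_derivative \<phi> (at x) e) = - (LINT x|lborel. dyadic_deriv e v x * \<phi> x)"
proof -
  let ?D = "\<lambda>x. frechet_derivative \<phi> (at x) e"
  have c\<phi>: "continuous_on UNIV \<phi>" by (rule differentiable_imp_continuous_on[OF \<phi>(1)])
  have [measurable]: "\<phi> \<in> borel_measurable borel" "?D \<in> borel_measurable borel"
    using c\<phi> \<phi>(2) by (auto intro: borel_measurable_continuous_onI)
  have [measurable]: "S \<in> sets borel" using S by (simp add: borel_compact)
  obtain M where M: "0 \<le> M" "\<And>x. \<bar>?D x\<bar> \<le> M" using bounded_of_compact_support[OF \<phi>(2) S D0] by blast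
  obtain m where m: "0 \<le> m" "\<And>x. \<bar>\<phi> x\<bar> \<le> m" using bounded_of_compact_support[OF c\<phi> S \<phi>(3)] by blast
  obtain r0 where r0: "\<And>x. x \<in> S \<Longrightarrow> norm x \<le> r0" using compact_imp_bounded[OF S] bounded_iff by metis
  \<comment> \<open>The steps have length at most 1, so the translates of \<phi> also vanish outside
    the ball of this radius.\<close>
  define r where "r = \<bar>r0\<bar> + 2"
  have Sr: "x \<in> S \<Longrightarrow> norm x + 1 < r" for x using r0[of x] by (auto simp: r_def)
  define w where "w n = e /\<^sub>R 2 ^ n" for n :: nat
  have nw: "norm (w n) \<le> 1" for n unfolding w_def norm_dyadic e by simp
  define \<psi> where "\<psi> n x = 2 ^ n * (\<phi> (x - w n) - \<phi> x)" for n x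
  have [measurable]: "\<psi> n \<in> borel_measurable borel" for n unfolding \<psi>_def by measurable
  have shifted0: "\<phi> (x - w n) = 0" if "x \<notin> ball 0 r" for x n
  proof (rule \<phi>(3), rule notI)
    assume "x - w n \<in> S"
    then have "norm (x - w n) + 1 < r" by (rule Sr)
    moreover have "norm x \<le> norm (x - w n) + norm (w n)" using norm_triangle_sub[of x "w n"] by simp
    ultimately show False using that nw[of n] by auto
  qed
  have \<phi>0: "\<phi> x = 0" if "x \<notin> ball 0 r" for x
    using that Sr[of x] by (intro \<phi>(3)) auto
  have \<psi>b: "\<bar>\<psi> n x\<bar> \<le> M * indicator (ball 0 r) x" for n x
  proof (cases "x \<in> ball 0 r")
    case True
    then show ?thesis using dyadic_difference_quotient_smooth(2)[OF \<phi>(1) M(2)] by (simp add: \<psi>_def w_def)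
  next
    case False
    then show ?thesis by (simp add: \<psi>_def shifted0 \<phi>0)
  qed
  have \<phi>b: "\<bar>\<phi> x\<bar> \<le> m * indicator (ball 0 r) x" "\<bar>\<phi> (x - w n)\<bar> \<le> m * indicator (ball 0 r) x" for x n
    using m shifted0[of x n] \<phi>0[of x] by (cases "x \<in> ball 0 r"; simp)+
  have i1: "integrable lborel (\<lambda>x. v x * \<phi> x)" "integrable lborel (\<lambda>x. v x * \<phi> (x - w n))" for n
    using \<phi>b by (auto intro!: integrable_times_bounded[OF _ _ loc1])
  have "(\<lambda>n. LINT x|lborel. v x * \<psi> n x) \<longlonglongrightarrow> (LINT x|lborel. v x * - ?D x)"
  proof (rule integral_dominated_convergence[where w = "\<lambda>x. \<bar>v x * (M * indicator (ball 0 r) x)\<bar>"])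
    show "integrable lborel (\<lambda>x. \<bar>v x * (M * indicator (ball 0 r) x)\<bar>)"
      using M by (intro integrable_abs integrable_times_bounded[OF _ _ loc1, where M = M]) (auto simp: indicator_def)
    show "AE x in lborel. (\<lambda>n. v x * \<psi> n x) \<longlonglongrightarrow> v x * - ?D x"
      unfolding \<psi>_def w_def using dyadic_difference_quotient_smooth(1)[OF \<phi>(1) M(2)]
      by (intro AE_I2 tendsto_mult_left)
    show "AE x in lborel. norm (v x * \<psi> n x) \<le> \<bar>v x * (M * indicator (ball 0 r) x)\<bar>" for n
      using \<psi>b[of n] M by (intro AE_I2) (simp add: abs_mult mult_left_mono)
  qed measurable
  moreover have "(LINT x|lborel. v x * \<psi> n x) = (LINT x|lborel. 2 ^ n * dlt (w n) v x * \<phi> x)" for n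
  proof -
    have i2: "integrable lborel (\<lambda>x. v (x + w n) * \<phi> x)"
    proof -
      have "integrable (distr lborel borel ((+) (w n))) (\<lambda>x. v x * \<phi> (x - w n))"
        using i1(2)[of n] by (simp add: lborel_distr_plus)
      then have "integrable lborel (\<lambda>x. v (w n + x) * \<phi> (w n + x - w n))"
        by (subst (asm) integrable_distr_eq) auto
      then show ?thesis by (simp add: add.commute)
    qed
    have "(LINT x|lborel. v x * \<psi> n x) = (LINT x|lborel. 2 ^ n * (v x * \<phi> (x - w n)) - 2 ^ n * (v x * \<phi> x))"
      by (simp add: \<psi>_def algebra_simps)
    also have "\<dots> = 2 ^ n * (LINT x|lborel. v x * \<phi> (x - w n)) - 2 ^ n * (LINT x|lborel. v x * \<phi> x)"
      using i1 by simp
    also have "(LINT x|lborel. v x * \<phi> (x - w n)) = (LINT x|lborel. v (x + w n) * \<phi> (x + w n - w n))"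
      by (rule lborel_integral_shift[symmetric]) measurable
    also have "2 ^ n * (LINT x|lborel. v (x + w n) * \<phi> (x + w n - w n)) - 2 ^ n * (LINT x|lborel. v x * \<phi> x)
      = (LINT x|lborel. 2 ^ n * (v (x + w n) * \<phi> x) - 2 ^ n * (v x * \<phi> x))"
      using i1 i2 by simp
    also have "\<dots> = (LINT x|lborel. 2 ^ n * dlt (w n) v x * \<phi> x)" by (simp add: dlt_def algebra_simps)
    finally show ?thesis .
  qed
  ultimately have lim1: "(\<lambda>n. LINT x|lborel. 2 ^ n * dlt (w n) v x * \<phi> x) \<longlonglongrightarrow> - (LINT x|lborel. v x * ?D x)" by simp
  have ssfin: "AE x in lborel. x \<in> S \<longrightarrow> second_sum e v x < \<infinity>"
  proof -
    have "AE x in lborel. second_sum e v x * indicator S x \<noteq> \<infinity>"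
      using ss by (intro nn_integral_PInf_AE) auto
    then show ?thesis by eventually_elim (auto simp: less_top)
  qed
  \<comment> \<open>The majorant from \<open>second_sum_finite\<close>, cut off to the support of
    \<phi>.\<close>
  define Z where "Z x = (\<bar>dlt e v x\<bar> + enn2real (second_sum e v x)) * (m * indicator S x)" for x
  have "(\<lambda>n. LINT x|lborel. 2 ^ n * dlt (w n) v x * \<phi> x) \<longlonglongrightarrow> (LINT x|lborel. dyadic_deriv e v x * \<phi> x)"
  proof (rule integral_dominated_convergence[where w = Z])
    show "integrable lborel Z"
    proof (rule integrableI_bounded)
      have "(\<integral>\<^sup>+x. ennreal (norm (Z x)) \<partial>lborel) \<le> (\<integral>\<^sup>+x. ennreal m * (ennreal (\<bar>dlt e v x\<bar> powr 1) * indicator (ball 0 r) x + second_sum e v x * indicator S x) \<partial>lborel)"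
      proof (intro nn_integral_mono)
        fix x
        show "ennreal (norm (Z x)) \<le> ennreal m * (ennreal (\<bar>dlt e v x\<bar> powr 1) * indicator (ball 0 r) x + second_sum e v x * indicator S x)"
        proof (cases "x \<in> S")
          case True
          then have xr: "x \<in> ball 0 r" using Sr[of x] by auto
          have "ennreal (enn2real (second_sum e v x)) \<le> second_sum e v x"
            by (cases "second_sum e v x") auto
          then show ?thesis using True xr m
            by (simp add: Z_def abs_mult ennreal_mult ennreal_plus mult.commute mult_left_mono add_left_mono)
        qed (simp add: Z_def)
      qed
      also have "\<dots> = ennreal m * (Lpow 1 (ball 0 r) (dlt e v) + (\<integral>\<^sup>+x. second_sum e v x * indicator S x \<partial>lborel))"
        unfolding Lpow_def by (simp add: nn_integral_cmult nn_integral_add)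
      also have "\<dots> < \<infinity>"
      proof -
        have "Lpow 1 (ball 0 r) (dlt e v) \<le> ennreal (2 powr 1) * Lpow 1 (ball 0 (r + 1)) v"
          using e by (intro Lpow_dlt_le) auto
        also have "\<dots> < \<infinity>" using loc1[of "r + 1"] by (simp add: ennreal_mult_less_top)
        finally show ?thesis using ss by (simp add: ennreal_mult_less_top)
      qed
      finally show "(\<integral>\<^sup>+x. ennreal (norm (Z x)) \<partial>lborel) < \<infinity>" .
    qed (unfold Z_def, measurable)
    show "AE x in lborel. (\<lambda>n. 2 ^ n * dlt (w n) v x * \<phi> x) \<longlonglongrightarrow> dyadic_deriv e v x * \<phi> x"
      using ssfin
    proof eventually_elim
      fix x assume x: "x \<in> S \<longrightarrow> second_sum e v x < \<infinity>"
      show "(\<lambda>n. 2 ^ n * dlt (w n) v x * \<phi> x) \<longlonglongrightarrow> dyadic_deriv e v x * \<phi> x"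
      proof (cases "x \<in> S")
        case True
        then show ?thesis unfolding w_def using x
          by (intro tendsto_mult_right dyadic_deriv_LIMSEQ second_sum_finite) auto
      qed (simp add: \<phi>(3))
    qed
    show "AE x in lborel. norm (2 ^ n * dlt (w n) v x * \<phi> x) \<le> Z x" for n
      using ssfin
    proof eventually_elim
      fix x assume x: "x \<in> S \<longrightarrow> second_sum e v x < \<infinity>"
      show "norm (2 ^ n * dlt (w n) v x * \<phi> x) \<le> Z x"
      proof (cases "x \<in> S")
        case True
        then have fin: "second_sum e v x < \<infinity>" using x by simp
        then obtain y where y: "second_sum e v x = ennreal y" "0 \<le> y" by (cases "second_sum e v x") auto
        have "ennreal \<bar>2 ^ n * dlt (w n) v x\<bar> \<le> ennreal (\<bar>dlt e v x\<bar> + y)"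
          using second_sum_finite(2)[OF fin, of n] y by (simp add: w_def)
        then have "\<bar>2 ^ n * dlt (w n) v x\<bar> \<le> \<bar>dlt e v x\<bar> + enn2real (second_sum e v x)"
          using y by (simp add: ennreal_le_iff del: ennreal_plus)
        then have "\<bar>2 ^ n * dlt (w n) v x\<bar> * \<bar>\<phi> x\<bar> \<le> (\<bar>dlt e v x\<bar> + enn2real (second_sum e v x)) * m"
          using m by (intro mult_mono) auto
        then show ?thesis using True unfolding Z_def real_norm_def abs_mult[of _ "\<phi> x"] by simp
      qed (simp add: \<phi>(3) Z_def)
    qed
  qed measurable
  from LIMSEQ_unique[OF lim1 this] show ?thesis by simp
qed

subsection \<open>The weak gradient\<close>

definition dyadic_gradient :: "('a::euclidean_space \<Rightarrow> real) \<Rightarrow> 'a \<Rightarrow> 'a" where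
  "dyadic_gradient v x = (\<Sum>e\<in>Basis. dyadic_deriv e v x *\<^sub>R e)"

lemma dyadic_gradient_inner: "e \<in> Basis \<Longrightarrow> dyadic_gradient v x \<bullet> e = dyadic_deriv e v x"
  by (simp add: dyadic_gradient_def inner_sum_left_Basis)

lemma borel_measurable_dyadic_gradient[measurable]:
  assumes [measurable]: "v \<in> borel_measurable borel"
  shows "dyadic_gradient v \<in> borel_measurable borel"
  unfolding dyadic_gradient_def[abs_def] by measurable

lemma norm_powr_le_sum:
  fixes y :: "'a::euclidean_space"
  assumes q: "0 \<le> q"
  shows "norm y powr q \<le> real DIM('a) powr q * (\<Sum>e\<in>Basis. \<bar>y \<bullet> e\<bar> powr q)"
proof -
  define m where "m = Max ((\<lambda>e. \<bar>y \<bullet> e\<bar>) ` Basis)"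
  have "m \<in> (\<lambda>e. \<bar>y \<bullet> e\<bar>) ` Basis" unfolding m_def by (rule Max_in) auto
  then obtain e where e: "e \<in> Basis" "m = \<bar>y \<bullet> e\<bar>" by auto
  have "norm y \<le> (\<Sum>e\<in>Basis. \<bar>y \<bullet> e\<bar>)" by (rule norm_le_l1)
  also have "\<dots> \<le> (\<Sum>e\<in>(Basis::'a set). m)" unfolding m_def by (intro sum_mono Max_ge) auto
  finally have "norm y \<le> real DIM('a) * m" by simp
  then have "norm y powr q \<le> (real DIM('a) * m) powr q" using q by (intro powr_mono2) auto
  also have "\<dots> = real DIM('a) powr q * \<bar>y \<bullet> e\<bar> powr q" unfolding e(2) by (rule powr_mult)
  also have "\<dots> \<le> real DIM('a) powr q * (\<Sum>e\<in>Basis. \<bar>y \<bullet> e\<bar> powr q)"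
    by (intro mult_left_mono member_le_sum e(1)) auto
  finally show ?thesis .
qed

lemma Lp_norm_le_sum:
  fixes G :: "'a::euclidean_space \<Rightarrow> 'b::euclidean_space"
  assumes [measurable]: "G \<in> borel_measurable borel" "E \<in> sets borel" and q: "0 < q"
  shows "epow (Lp_norm q E G) q \<le> ennreal (real DIM('b) powr q) * (\<Sum>e\<in>Basis. Lpow q E (\<lambda>x. G x \<bullet> e))"
proof -
  have "epow (Lp_norm q E G) q = (\<integral>\<^sup>+x\<in>E. ennreal (norm (G x) powr q) \<partial>lebesgue)"
    unfolding Lp_norm_def by (rule epow_inverse[OF q])
  also have "\<dots> = (\<integral>\<^sup>+x\<in>E. ennreal (norm (G x) powr q) \<partial>lborel)" by (rule nn_integral_completion)
  also have "\<dots> \<le> (\<integral>\<^sup>+x. ennreal (real DIM('b) powr q) * (\<Sum>e\<in>Basis. ennreal (\<bar>G x \<bullet> e\<bar> powr q) * indicator E x) \<partial>lborel)"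
  proof (intro nn_integral_mono)
    fix x
    have "ennreal (norm (G x) powr q) \<le> ennreal (real DIM('b) powr q * (\<Sum>e\<in>Basis. \<bar>G x \<bullet> e\<bar> powr q))"
      using q by (intro ennreal_leI norm_powr_le_sum) auto
    also have "\<dots> = ennreal (real DIM('b) powr q) * (\<Sum>e\<in>Basis. ennreal (\<bar>G x \<bullet> e\<bar> powr q))"
      by (simp add: ennreal_mult sum_nonneg)
    finally show "ennreal (norm (G x) powr q) * indicator E x
      \<le> ennreal (real DIM('b) powr q) * (\<Sum>e\<in>Basis. ennreal (\<bar>G x \<bullet> e\<bar> powr q) * indicator E x)"
      by (cases "x \<in> E") auto
  qed
  also have "\<dots> = ennreal (real DIM('b) powr q) * (\<Sum>e\<in>Basis. Lpow q E (\<lambda>x. G x \<bullet> e))"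
    unfolding Lpow_def by (subst nn_integral_cmult, measurable, subst nn_integral_sum, measurable)
  finally show ?thesis .
qed

lemma W_seminorm_le_sum:
  fixes G :: "'a::euclidean_space \<Rightarrow> 'b::euclidean_space"
  assumes [measurable]: "G \<in> borel_measurable borel" "E \<in> sets borel" and q: "0 < q"
  shows "epow (W_seminorm \<alpha> q E G) q \<le> ennreal (real DIM('b) powr q) * (\<Sum>e\<in>Basis. Wpow \<alpha> q E (\<lambda>x. G x \<bullet> e))"
proof -
  define F where "F e x y = ennreal (\<bar>G x \<bullet> e - G y \<bullet> e\<bar> powr q * krn (real DIM('a) + \<alpha> * q) (x - y)) * (indicator E x * indicator E y)" for e x y
  have F[measurable]: "case_prod (F e) \<in> borel_measurable (borel \<Otimes>\<^sub>M borel)" for e unfolding F_def by measurable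
  have F'[measurable]: "case_prod (F e) \<in> borel_measurable borel" for e using F[of e] by (simp only: borel_prod)
  have "epow (W_seminorm \<alpha> q E G) q = (\<integral>\<^sup>+z\<in>E \<times> E. (case z of (x, y) \<Rightarrow>
             ennreal (norm (G x - G y) powr q / norm (x - y) powr (real DIM('a) + \<alpha> * q))) \<partial>lebesgue)"
    unfolding W_seminorm_def by (rule epow_inverse[OF q])
  also have "\<dots> = (\<integral>\<^sup>+z\<in>E \<times> E. (case z of (x, y) \<Rightarrow>
             ennreal (norm (G x - G y) powr q / norm (x - y) powr (real DIM('a) + \<alpha> * q))) \<partial>lborel)"
    by (rule nn_integral_completion)
  also have "\<dots> \<le> (\<integral>\<^sup>+z. ennreal (real DIM('b) powr q) * (\<Sum>e\<in>Basis. case_prod (F e) z) \<partial>lborel)"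
  proof (intro nn_integral_mono)
    fix z :: "'a \<times> 'a"
    obtain x y where z: "z = (x, y)" by (cases z)
    let ?k = "krn (real DIM('a) + \<alpha> * q) (x - y)"
    have k: "0 \<le> ?k" by (simp add: krn_def)
    have "norm (G x - G y) powr q * ?k \<le> (real DIM('b) powr q * (\<Sum>e\<in>Basis. \<bar>(G x - G y) \<bullet> e\<bar> powr q)) * ?k"
      using q k by (intro mult_right_mono norm_powr_le_sum) auto
    then have "ennreal (norm (G x - G y) powr q * ?k) \<le> ennreal (real DIM('b) powr q * (\<Sum>e\<in>Basis. \<bar>G x \<bullet> e - G y \<bullet> e\<bar> powr q * ?k))"
      by (intro ennreal_leI) (simp add: sum_distrib_right inner_diff_left mult.assoc)
    also have "\<dots> = ennreal (real DIM('b) powr q) * (\<Sum>e\<in>Basis. ennreal (\<bar>G x \<bullet> e - G y \<bullet> e\<bar> powr q * ?k))"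
      using k by (subst sum_ennreal) (auto intro!: ennreal_mult' sum_nonneg)
    finally show "(case z of (x, y) \<Rightarrow> ennreal (norm (G x - G y) powr q / norm (x - y) powr (real DIM('a) + \<alpha> * q))) * indicator (E \<times> E) z
      \<le> ennreal (real DIM('b) powr q) * (\<Sum>e\<in>Basis. case_prod (F e) z)"
      by (auto simp: z F_def krn_def indicator_def)
  qed
  also have "\<dots> = ennreal (real DIM('b) powr q) * (\<Sum>e\<in>Basis. (\<integral>\<^sup>+z. case_prod (F e) z \<partial>lborel))"
    by (subst nn_integral_cmult, measurable, subst nn_integral_sum, measurable)
  also have "\<dots> = ennreal (real DIM('b) powr q) * (\<Sum>e\<in>Basis. Wpow \<alpha> q E (\<lambda>x. G x \<bullet> e))"
    by (simp only: lborel_nn_integral_pair[OF F]) (simp add: Wpow_def F_def[abs_def])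
  finally show ?thesis .
qed

lemma set_integral_lebesgue_eq:
  fixes f g :: "'a::euclidean_space \<Rightarrow> real"
  assumes g: "g \<in> borel_measurable borel" and eq: "AE x in lborel. indicator \<Omega> x *\<^sub>R f x = g x"
  shows "(LINT x:\<Omega>|lebesgue. f x) = (LINT x|lborel. g x)"
proof -
  have g': "g \<in> borel_measurable lebesgue" using g by (intro measurable_completion) simp
  have eq': "AE x in lebesgue. indicator \<Omega> x *\<^sub>R f x = g x" using eq by (rule AE_completion)
  have "(LINT x:\<Omega>|lebesgue. f x) = (LINT x|lebesgue. g x)"
    unfolding set_lebesgue_integral_def
    by (rule integral_cong_AE[OF borel_measurable_lebesgue_AE[OF g' eq'] g' eq'])
  also have "\<dots> = (LINT x|lborel. g x)" using g by (intro integral_completion) simp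
  finally show ?thesis .
qed

lemma compactly_in_ball:
  assumes "E \<Subset> \<Omega>"
  obtains r where "E \<subseteq> ball 0 r"
proof -
  have "bounded (closure E)" using assms by (auto simp: compactly_in_def intro: compact_imp_bounded)
  then have "bounded E" by (rule bounded_subset) (rule closure_subset)
  then show ?thesis using that bounded_subset_ballD by metis
qed

text \<open>Local integrability of each component follows from the majorant d_e v plus
  \<open>second_sum\<close>, integrated over the compact closure; the identity with test functions
  is the discrete integration by parts in the limit.\<close>

lemma dyadic_gradient_weak_gradient:
  fixes u v :: "'a::euclidean_space \<Rightarrow> real"
  assumes v[measurable]: "v \<in> borel_measurable borel" and eq: "AE x in lborel. u x = v x"
    and fin: "\<And>r. Lpow 1 (ball 0 r) v < \<infinity>"
    and loc: "\<And>e x. e \<in> Basis \<Longrightarrow> x \<in> \<Omega> \<Longrightarrow> \<exists>r>0. (\<integral>\<^sup>+y. second_sum e v y * indicator (ball x r) y \<partial>lborel) < \<infinity>"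
  shows "weak_gradient \<Omega> u (dyadic_gradient v)"
proof -
  let ?G = "dyadic_gradient v"
  have ss: "(\<integral>\<^sup>+y. second_sum e v y * indicator S y \<partial>lborel) < \<infinity>" if "e \<in> Basis" "compact S" "S \<subseteq> \<Omega>" for e S
    using loc that by (intro second_sum_compact) auto
  have u_meas: "u \<in> borel_measurable lebesgue"
  proof (rule borel_measurable_lebesgue_AE)
    show "v \<in> borel_measurable lebesgue" by (rule measurable_completion) simp
    show "AE x in lebesgue. u x = v x" using eq by (rule AE_completion)
  qed
  have G_meas: "?G \<in> borel_measurable lebesgue"
    by (rule measurable_completion) simp
  have "u \<in> Lp 1 E \<and> ?G \<in> Lp 1 E" if E: "E \<Subset> \<Omega>" for E
  proof -
    obtain r where r: "E \<subseteq> ball 0 r" using compactly_in_ball[OF E] .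
    have [measurable]: "E \<in> sets borel" and cl: "compact (closure E)" "closure E \<subseteq> \<Omega>"
      using E by (auto simp: compactly_in_def)
    have "epow (Lp_norm 1 E u) 1 = Lpow 1 E v"
      by (rule Lp_norm_Lpow) (use eq in auto)
    also have "\<dots> \<le> Lpow 1 (ball 0 r) v" by (rule Lpow_mono_set[OF r])
    also have "\<dots> < \<infinity>" by (rule fin)
    finally have u1: "Lp_norm 1 E u < \<infinity>" by (simp add: epow_less_top del: infinity_ennreal_def)
    have d: "Lpow 1 E (\<lambda>x. ?G x \<bullet> e) < \<infinity>" if e: "e \<in> Basis" for e
    proof -
      have ssfin: "AE x in lborel. second_sum e v x * indicator (closure E) x \<noteq> \<infinity>"
        using ss[OF e cl] by (intro nn_integral_PInf_AE) auto
      have "Lpow 1 E (\<lambda>x. ?G x \<bullet> e) \<le> (\<integral>\<^sup>+x. (ennreal (\<bar>dlt e v x\<bar> powr 1) * indicator (ball 0 r) x + second_sum e v x * indicator (closure E) x) \<partial>lborel)"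
        unfolding Lpow_def dyadic_gradient_inner[OF e]
      proof (rule nn_integral_mono_AE, use ssfin in eventually_elim)
        fix x assume x: "second_sum e v x * indicator (closure E) x \<noteq> \<infinity>"
        show "ennreal (\<bar>dyadic_deriv e v x\<bar> powr 1) * indicator E x
          \<le> ennreal (\<bar>dlt e v x\<bar> powr 1) * indicator (ball 0 r) x + second_sum e v x * indicator (closure E) x"
        proof (cases "x \<in> E")
          case True
          then have "x \<in> closure E" "x \<in> ball 0 r" using closure_subset r by auto
          then show ?thesis using True x dyadic_deriv_le_second_sum[of e v x] by (simp add: top.not_eq_extremum)
        qed simp
      qed
      also have "\<dots> = Lpow 1 (ball 0 r) (dlt e v) + (\<integral>\<^sup>+x. second_sum e v x * indicator (closure E) x \<partial>lborel)"
        unfolding Lpow_def by (rule nn_integral_add) measurable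
      also have "\<dots> < \<infinity>"
      proof -
        have "Lpow 1 (ball 0 r) (dlt e v) \<le> ennreal (2 powr 1) * Lpow 1 (ball 0 (r + norm e)) v"
          by (intro Lpow_dlt_le) auto
        also have "\<dots> < \<infinity>" using fin[of "r + norm e"] by (simp add: ennreal_mult_less_top)
        finally show ?thesis using ss[OF e cl] by simp
      qed
      finally show ?thesis .
    qed
    have "epow (Lp_norm 1 E ?G) 1 \<le> ennreal (real DIM('a) powr 1) * (\<Sum>e\<in>Basis. Lpow 1 E (\<lambda>x. ?G x \<bullet> e))"
      by (rule Lp_norm_le_sum) auto
    also have "\<dots> < \<infinity>" using d by (simp add: ennreal_mult_less_top ennreal_sum_less_top)
    finally have "Lp_norm 1 E ?G < \<infinity>" by (simp add: epow_less_top del: infinity_ennreal_def)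
    then show ?thesis using u1 u_meas G_meas by (auto simp: Lp_def intro: measurable_restrict_space1)
  qed
  then have Lp: "u \<in> Lp_loc 1 \<Omega>" "?G \<in> Lp_loc 1 \<Omega>" by (auto simp: Lp_loc_def)
  have "(LINT x:\<Omega>|lebesgue. u x * frechet_derivative \<phi> (at x) e) = - (LINT x:\<Omega>|lebesgue. (?G x \<bullet> e) * \<phi> x)"
    if \<phi>: "test_function \<Omega> \<phi>" and e: "e \<in> Basis" for \<phi> e
  proof -
    let ?D = "\<lambda>x. frechet_derivative \<phi> (at x) e"
    obtain S where S: "compact S" "S \<subseteq> \<Omega>" "\<And>x. x \<notin> S \<Longrightarrow> \<phi> x = 0" and C: "Ck (Suc 0) \<phi>"
      using \<phi> unfolding test_function_def by metis
    have diff: "\<phi> differentiable_on UNIV" and cD: "continuous_on UNIV ?D" using C e by auto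
    have c\<phi>: "continuous_on UNIV \<phi>" by (rule differentiable_imp_continuous_on[OF diff])
    have [measurable]: "\<phi> \<in> borel_measurable borel" "?D \<in> borel_measurable borel"
      using c\<phi> cD by (auto intro: borel_measurable_continuous_onI)
    \<comment> \<open>The support set is closed, so \<phi> vanishes in a neighbourhood of x.\<close>
    have D0: "?D x = 0" if x: "x \<notin> S" for x
    proof -
      have "((\<lambda>_. 0) has_derivative (\<lambda>_. 0)) (at x)" by simp
      then have "(\<phi> has_derivative (\<lambda>_. 0)) (at x)"
        by (rule has_derivative_transform_within_open[where s = "- S"]) (use x S compact_imp_closed in auto)
      then have "(\<lambda>_. 0) = frechet_derivative \<phi> (at x)" by (rule frechet_derivative_at)
      then show ?thesis by metis
    qed
    have "(LINT x:\<Omega>|lebesgue. u x * ?D x) = (LINT x|lborel. v x * ?D x)"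
    proof (rule set_integral_lebesgue_eq)
      show "AE x in lborel. indicator \<Omega> x *\<^sub>R (u x * ?D x) = v x * ?D x"
        using eq
      proof eventually_elim
        fix x assume "u x = v x"
        then show "indicator \<Omega> x *\<^sub>R (u x * ?D x) = v x * ?D x"
          using D0[of x] S(2) by (cases "x \<in> S") auto
      qed
    qed measurable
    also have "\<dots> = - (LINT x|lborel. dyadic_deriv e v x * \<phi> x)"
      using e S by (intro dyadic_integration_by_parts[OF v _ fin S(1) ss[OF e S(1,2)] diff cD S(3) D0]) auto
    also have "(LINT x|lborel. dyadic_deriv e v x * \<phi> x) = (LINT x:\<Omega>|lebesgue. (?G x \<bullet> e) * \<phi> x)"
    proof (rule set_integral_lebesgue_eq[symmetric])
      have "indicator \<Omega> x *\<^sub>R ((?G x \<bullet> e) * \<phi> x) = dyadic_deriv e v x * \<phi> x" for x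
        using S(2) S(3)[of x] by (cases "x \<in> S") (auto simp: dyadic_gradient_inner[OF e])
      then show "AE x in lborel. indicator \<Omega> x *\<^sub>R ((?G x \<bullet> e) * \<phi> x) = dyadic_deriv e v x * \<phi> x" by simp
    qed measurable
    finally show ?thesis .
  qed
  then show ?thesis using Lp by (simp add: weak_gradient_def)
qed

subsection \<open>The gradient estimates\<close>

text \<open>The powers of n come from estimating a vector by its coordinates and summing over the
  basis, \<open>aq_const\<close> from the passage to \<open>borel_solution\<close>; the summand 1
  makes the constant positive.\<close>

definition total_const :: "real \<Rightarrow> real \<Rightarrow> nat \<Rightarrow> real" where
  "total_const p \<Lambda> n = real n powr p * (real n * (first_const p \<Lambda> n + grad_const p \<Lambda> n)) * aq_const p n + 1"

lemma grad_const_nonneg: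
  assumes "2 \<le> p" "1 \<le> \<Lambda>"
  shows "0 \<le> grad_const p \<Lambda> n"
proof -
  have "0 \<le> p" using assms by simp
  then show ?thesis using assms by (simp add: grad_const_def knl_const_def)
qed

lemma total_const:
  assumes "2 \<le> p" "1 \<le> \<Lambda>"
  shows "0 < total_const p \<Lambda> n"
    "real n powr p * (real n * first_const p \<Lambda> n) * aq_const p n \<le> total_const p \<Lambda> n"
    "real n powr p * (real n * grad_const p \<Lambda> n) * aq_const p n \<le> total_const p \<Lambda> n"
proof -
  define F where "F = real n powr p * (real n * first_const p \<Lambda> n) * aq_const p n"
  define G where "G = real n powr p * (real n * grad_const p \<Lambda> n) * aq_const p n"
  have "0 \<le> aq_const p n" using aq_const_ge(3)[of p n] by simp
  moreover have "0 \<le> grad_const p \<Lambda> n" by (rule grad_const_nonneg[OF assms])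
  ultimately have "0 \<le> F" "0 \<le> G" using assms by (simp_all add: F_def G_def)
  moreover have "total_const p \<Lambda> n = F + G + 1" unfolding total_const_def F_def G_def by (simp add: algebra_simps)
  ultimately show "0 < total_const p \<Lambda> n" "F \<le> total_const p \<Lambda> n" "G \<le> total_const p \<Lambda> n" by auto
qed

lemma ennreal_sum_const_bound:
  fixes F :: "'b::euclidean_space \<Rightarrow> ennreal"
  assumes "\<And>e. e \<in> Basis \<Longrightarrow> F e \<le> ennreal (a * b)" "0 \<le> a" "0 \<le> b"
  shows "ennreal (real DIM('b) powr p) * (\<Sum>e\<in>Basis. F e) \<le> ennreal (real DIM('b) powr p * (real DIM('b) * a) * b)"
proof -
  have "(\<Sum>e\<in>Basis. F e) \<le> of_nat DIM('b) * ennreal (a * b)" using assms(1) by (rule sum_bounded_above)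
  also have "\<dots> = ennreal (real DIM('b) * (a * b))" using assms by (simp add: ennreal_mult ennreal_of_nat_eq_real_of_nat)
  finally have "ennreal (real DIM('b) powr p) * (\<Sum>e\<in>Basis. F e)
    \<le> ennreal (real DIM('b) powr p) * ennreal (real DIM('b) * (a * b))" by (rule mult_left_mono) simp
  also have "\<dots> = ennreal (real DIM('b) powr p * (real DIM('b) * (a * b)))" by (rule ennreal_mult'[symmetric]) simp
  finally show ?thesis by (simp add: mult.assoc)
qed

text \<open>If X is infinite, so is the right-hand side, because the scaling factor is positive.
  Thus the estimates need a proof only on balls where \<open>A_quantity\<close> is finite.\<close>

lemma le_ennreal_scaled:
  assumes "0 < x" "0 < y" and bound: "X < \<infinity> \<Longrightarrow> L \<le> ennreal (x * enn2real X / y)"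
  shows "L \<le> ennreal x * X / ennreal y"
proof (cases X)
  case (real r)
  then have "ennreal x * X / ennreal y = ennreal (x * enn2real X / y)"
    using assms(1,2) by (simp add: ennreal_mult[symmetric] divide_ennreal)
  then show ?thesis using bound real by simp
next
  case top
  then have "ennreal x * X / ennreal y = top"
    using assms(1,2) by (simp add: divide_ennreal_def inverse_ennreal ennreal_mult_top ennreal_top_mult)
  then show ?thesis by simp
qed

section \<open>From one ball to all balls\<close>

text \<open>The ball is not fixed here, unlike in \<open>borel_solution\<close>: one representative
  v, and hence one gradient, has to serve every ball.\<close>

locale nonlocal_equation =
  fixes p \<Lambda> l0 s t :: real and \<Omega> :: "'a::euclidean_space set" and K f u v :: "'a \<Rightarrow> real"
  assumes p: "2 \<le> p" and \<Lambda>: "1 \<le> \<Lambda>" and l0: "p < l0" "l0 \<le> t + s * (p + 1)"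
    and t: "0 \<le> t" "t \<le> s" and s: "s < 1" and \<Omega>: "open \<Omega>"
    and K: "K \<in> borel_measurable lebesgue"
      "\<And>z. 1 / \<Lambda> * norm z powr (real DIM('a) + s * p) \<le> K z" "\<And>z. K z \<le> \<Lambda> * norm z powr (real DIM('a) + s * p)"
    and f: "f \<in> W_loc s (conj_exp p) \<Omega>" and u: "u \<in> W_loc s p \<Omega>" "u \<in> Y_space t s p"
    and weak: "local_weak_solution s p K \<Omega> f u"
    and v[measurable]: "v \<in> borel_measurable borel" and eq: "AE x in lborel. u x = v x"
begin

text \<open>From t \<le> s one gets p < l0 \<le> s(p + 2), while (p + 2)/2 \<le> p for p \<ge> 2.
  Hence 1 / s < 2 and sp \<ge> 1 throughout.\<close>

lemma s_gt_half: "1 / 2 < s"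
proof (rule ccontr)
  assume "\<not> 1 / 2 < s"
  then have "s * (p + 2) \<le> 1 / 2 * (p + 2)" using p by (intro mult_right_mono) auto
  also have "\<dots> \<le> p" using p by simp
  also have "p < s * (p + 2)" using l0 t by (simp add: algebra_simps)
  finally show False by simp
qed

lemma Lpow_ball_finite: "Lpow p (ball c r) v < \<infinity>"
proof -
  have "ball c r \<Subset> UNIV" by (auto simp: compactly_in_def)
  then have "Lp_norm p (ball c r) u < \<infinity>" using u(2) by (auto simp: Y_space_def X_space_def Lp_loc_def Lp_def)
  then have "epow (Lp_norm p (ball c r) u) p < \<infinity>" using p by (simp add: epow_less_top del: infinity_ennreal_def)
  also have "epow (Lp_norm p (ball c r) u) p = Lpow p (ball c r) v"
    by (rule Lp_norm_Lpow) (use eq p in auto)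
  finally show ?thesis .
qed

lemma borel_solution_on_ball:
  assumes "0 < R" "ball c R \<Subset> \<Omega>" "A_quantity t s p c R u f < \<infinity>"
  obtains g \<kappa> where
    "borel_solution_diff p \<Lambda> s t c R (aq_const p DIM('a) * enn2real (A_quantity t s p c R u f)) v g \<kappa> l0"
proof -
  obtain g \<kappa> where "borel_solution p \<Lambda> s t c R (aq_const p DIM('a) * enn2real (A_quantity t s p c R u f)) v g \<kappa>"
    using borel_solution_exists[OF p \<Lambda> s_gt_half s t assms(1,2) K f weak v eq assms(3)] by blast
  then show ?thesis using that l0 by (simp add: borel_solution_diff_def borel_solution_diff_axioms_def)
qed

lemma second_sum_locally_finite:
  assumes x: "x \<in> \<Omega>" and e: "norm e = 1"
  shows "\<exists>r>0. (\<integral>\<^sup>+y. second_sum e v y * indicator (ball x r) y \<partial>lborel) < \<infinity>"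
proof -
  obtain r0 where r0: "0 < r0" "ball x r0 \<subseteq> \<Omega>" using \<Omega> x by (auto simp: open_contains_ball)
  have uX: "u \<in> X_space s p" using u(2) by (simp add: Y_space_def)
  obtain h0 where h0: "0 < h0" "(SUP h\<in>{h. 0 < norm h \<and> norm h < h0}.
        \<integral>\<^sup>+x. ennreal (\<bar>diff_quot t h u x\<bar> powr p / (1 + norm x) powr (real DIM('a) + s * p)) \<partial>lebesgue) < \<infinity>"
    using u(2) by (auto simp: Y_space_def)
  \<comment> \<open>Small enough for the closed ball to lie in the open set and for
    \<open>A_quantity_finite\<close> to apply.\<close>
  define R where "R = min h0 (r0 / 2)"
  have R: "0 < R" "R \<le> h0" "R < r0" using h0 r0 by (auto simp: R_def)
  have "closure (ball x R) \<subseteq> \<Omega>" using R r0 by auto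
  then have B: "ball x R \<Subset> \<Omega>" using \<Omega> by (auto simp: compactly_in_def)
  have "A_quantity t s p x R u f < \<infinity>"
    using uX unfolding X_space_def
    by (intro A_quantity_finite[OF p s_gt_half s R(1,2) B f u(1) v eq _ h0(2)]) auto
  then obtain g \<kappa> where
    "borel_solution_diff p \<Lambda> s t x R (aq_const p DIM('a) * enn2real (A_quantity t s p x R u f)) v g \<kappa> l0"
    using borel_solution_on_ball[OF R(1) B] by blast
  then interpret borel_solution_diff p \<Lambda> s t x R "aq_const p DIM('a) * enn2real (A_quantity t s p x R u f)" v g \<kappa> l0 .
  show ?thesis using second_sum_integrable[OF e Lpow_ball_finite] R(1) by (intro exI[of _ "R / 2"]) simp
qed

lemma weak_gradient: "weak_gradient \<Omega> u (dyadic_gradient v)"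
  using p by (intro dyadic_gradient_weak_gradient v eq Lpow_one_finite[OF v _ Lpow_ball_finite] second_sum_locally_finite) auto

text \<open>Convergence on a whole ball is gathered from small balls by compactness and does not
  rely on an estimate at the scale of that ball.\<close>

lemma AE_dyadic_differentiable:
  assumes e: "norm e = 1" and E: "E \<Subset> \<Omega>"
  shows "AE x in lborel. x \<in> E \<longrightarrow> dyadic_differentiable e v x"
proof -
  have cl: "compact (closure E)" "closure E \<subseteq> \<Omega>" using E by (auto simp: compactly_in_def)
  have [measurable]: "closure E \<in> sets borel" by simp
  have "AE x in lborel. second_sum e v x * indicator (closure E) x \<noteq> \<infinity>"
    using second_sum_compact[OF v second_sum_locally_finite[OF _ e] cl] by (intro nn_integral_PInf_AE) auto
  then show ?thesis
  proof eventually_elim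
    fix x assume x: "second_sum e v x * indicator (closure E) x \<noteq> \<infinity>"
    show "x \<in> E \<longrightarrow> dyadic_differentiable e v x"
    proof
      assume "x \<in> E"
      then have "x \<in> closure E" using closure_subset by auto
      then show "dyadic_differentiable e v x" using x by (intro second_sum_finite) (simp add: top.not_eq_extremum)
    qed
  qed
qed

lemma Gamma_bounds: "1 < (1 + t + s * p) / p" "(1 + t + s * p) / p < 2"
proof -
  have "p < t + s * p + s" using l0 by (simp add: distrib_left)
  then have "p < 1 + t + s * p" using s by linarith
  then show "1 < (1 + t + s * p) / p" using p by (simp add: field_simps)
  have "s * p < 1 * p" using s p by (intro mult_strict_right_mono) auto
  then have "1 + t + s * p < 2 * p" using s t p by linarith
  then show "(1 + t + s * p) / p < 2" using p by (simp add: field_simps)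
qed

lemma gradient_bound:
  assumes R: "0 < R" and B: "ball c R \<Subset> \<Omega>"
  shows "epow (Lp_norm p (ball c (R / 2)) (dyadic_gradient v)) p
    \<le> ennreal (total_const p \<Lambda> DIM('a) / (l0 - p) powr p * (1 - s)) * A_quantity t s p c R u f / ennreal (R powr p)"
proof (rule le_ennreal_scaled)
  let ?n = "DIM('a)" and ?C = "total_const p \<Lambda> DIM('a)"
  show "0 < ?C / (l0 - p) powr p * (1 - s)" using total_const(1)[OF p \<Lambda>, of ?n] l0 s by simp
  show "0 < R powr p" using R by simp
  assume fin: "A_quantity t s p c R u f < \<infinity>"
  define a where "a = enn2real (A_quantity t s p c R u f)"
  obtain g \<kappa> where "borel_solution_diff p \<Lambda> s t c R (aq_const p ?n * a) v g \<kappa> l0"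
    using borel_solution_on_ball[OF R B fin] unfolding a_def by blast
  then interpret bsd: borel_solution_diff p \<Lambda> s t c R "aq_const p ?n * a" v g \<kappa> l0 .
  define X where "X = (1 - s) * a / (l0 - p) powr p * R powr (- p)"
  have X: "0 \<le> X" using s by (simp add: X_def a_def)
  have M: "bsd.M * R powr (- p) = aq_const p ?n * X" by (simp add: bsd.M_def X_def)
  have sub: "ball c (R / 2) \<subseteq> ball c R" using R by (intro subset_ball) simp
  have conv: "AE x in lborel. x \<in> ball c (R / 2) \<longrightarrow> dyadic_differentiable e v x" if "norm e = 1" for e
    using AE_dyadic_differentiable[OF that B] by eventually_elim (use sub in blast)
  have d: "Lpow p (ball c (R / 2)) (\<lambda>x. dyadic_gradient v x \<bullet> e) \<le> ennreal (first_const p \<Lambda> ?n * (aq_const p ?n * X))"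
    if e: "e \<in> Basis" for e
    using bsd.derivative_bound[OF _ conv, of e] e unfolding M dyadic_gradient_inner[OF e] by simp
  have "epow (Lp_norm p (ball c (R / 2)) (dyadic_gradient v)) p
    \<le> ennreal (real ?n powr p) * (\<Sum>e\<in>Basis. Lpow p (ball c (R / 2)) (\<lambda>x. dyadic_gradient v x \<bullet> e))"
    using p by (intro Lp_norm_le_sum) auto
  also have "\<dots> \<le> ennreal (real ?n powr p * (real ?n * first_const p \<Lambda> ?n) * (aq_const p ?n * X))"
    using p \<Lambda> X less_imp_le[OF aq_const_ge(3)[of p ?n]] by (intro ennreal_sum_const_bound[OF d]) auto
  also have "\<dots> \<le> ennreal (?C / (l0 - p) powr p * (1 - s) * a / R powr p)"
  proof (intro ennreal_leI)
    have "real ?n powr p * (real ?n * first_const p \<Lambda> ?n) * (aq_const p ?n * X) \<le> ?C * X"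
      using mult_right_mono[OF total_const(2)[OF p \<Lambda>, of ?n] X] by (simp only: mult.assoc)
    also have "\<dots> = ?C / (l0 - p) powr p * (1 - s) * a / R powr p"
      by (simp add: X_def powr_minus_divide)
    finally show "real ?n powr p * (real ?n * first_const p \<Lambda> ?n) * (aq_const p ?n * X)
      \<le> ?C / (l0 - p) powr p * (1 - s) * a / R powr p" .
  qed
  finally show "epow (Lp_norm p (ball c (R / 2)) (dyadic_gradient v)) p
    \<le> ennreal (?C / (l0 - p) powr p * (1 - s) * enn2real (A_quantity t s p c R u f) / R powr p)"
    by (simp only: a_def)
qed

lemma gradient_seminorm_bound:
  assumes R: "0 < R" and B: "ball c R \<Subset> \<Omega>" and \<tau>: "0 < \<tau>" "\<tau> < \<Gamma> - 1" and \<Gamma>_def: "\<Gamma> = (1 + t + s * p) / p"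
  shows "epow (W_seminorm \<tau> p (ball c (R / 4)) (dyadic_gradient v)) p
    \<le> ennreal ((2 - \<Gamma>) powr (- p) * (\<Gamma> - 1) powr (- p) / ((\<Gamma> - 1 - \<tau>) * \<tau>)
        * (total_const p \<Lambda> DIM('a) / (l0 - p) powr p) * (1 - s)) * A_quantity t s p c R u f
      / ennreal (R powr (p * (1 + \<tau>)))"
proof (rule le_ennreal_scaled)
  let ?n = "DIM('a)" and ?C = "total_const p \<Lambda> DIM('a)"
  let ?Q = "(2 - \<Gamma>) powr (- p) * (\<Gamma> - 1) powr (- p) / ((\<Gamma> - 1 - \<tau>) * \<tau>) * (?C / (l0 - p) powr p) * (1 - s)"
  have \<Gamma>: "1 < \<Gamma>" "\<Gamma> < 2" using Gamma_bounds by (auto simp: \<Gamma>_def)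
  have C: "0 < ?C" by (rule total_const(1)[OF p \<Lambda>])
  show "0 < ?Q" using C l0 s \<Gamma> \<tau> by (intro mult_pos_pos divide_pos_pos) auto
  show "0 < R powr (p * (1 + \<tau>))" using R by simp
  assume fin: "A_quantity t s p c R u f < \<infinity>"
  define a where "a = enn2real (A_quantity t s p c R u f)"
  obtain g \<kappa> where "borel_solution_diff p \<Lambda> s t c R (aq_const p ?n * a) v g \<kappa> l0"
    using borel_solution_on_ball[OF R B fin] unfolding a_def by blast
  then interpret bsd: borel_solution_diff p \<Lambda> s t c R "aq_const p ?n * a" v g \<kappa> l0 .
  have Gam: "bsd.Gam = \<Gamma>" by (simp add: bsd.Gam_def \<Gamma>_def)
  define X where "X = (1 - s) * a / (l0 - p) powr p * R powr (- (p * (1 + \<tau>))) / ((\<Gamma> - 1) powr p * ((\<Gamma> - 1 - \<tau>) * \<tau>))"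
  have X: "0 \<le> X" using s \<tau> unfolding X_def a_def
    by (intro divide_nonneg_nonneg mult_nonneg_nonneg) auto
  have M: "bsd.M * R powr (- (p * (1 + \<tau>))) / ((\<Gamma> - 1) powr p * ((\<Gamma> - 1 - \<tau>) * \<tau>)) = aq_const p ?n * X"
    by (simp add: bsd.M_def X_def)
  have sub: "ball c (R / 2) \<subseteq> ball c R" using R by (intro subset_ball) simp
  have conv: "AE x in lborel. x \<in> ball c (R / 2) \<longrightarrow> dyadic_differentiable e v x" if "norm e = 1" for e
    using AE_dyadic_differentiable[OF that B] by eventually_elim (use sub in blast)
  have d: "Wpow \<tau> p (ball c (R / 4)) (\<lambda>x. dyadic_gradient v x \<bullet> e) \<le> ennreal (grad_const p \<Lambda> ?n * (aq_const p ?n * X))"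
    if e: "e \<in> Basis" for e
    using bsd.derivative_seminorm_bound[OF _ conv, of e \<tau>] e \<tau> unfolding M Gam dyadic_gradient_inner[OF e] by simp
  have "epow (W_seminorm \<tau> p (ball c (R / 4)) (dyadic_gradient v)) p
    \<le> ennreal (real ?n powr p) * (\<Sum>e\<in>Basis. Wpow \<tau> p (ball c (R / 4)) (\<lambda>x. dyadic_gradient v x \<bullet> e))"
    using p by (intro W_seminorm_le_sum) auto
  also have "\<dots> \<le> ennreal (real ?n powr p * (real ?n * grad_const p \<Lambda> ?n) * (aq_const p ?n * X))"
    using p \<Lambda> X less_imp_le[OF aq_const_ge(3)[of p ?n]] grad_const_nonneg[OF p \<Lambda>, of ?n]
    by (intro ennreal_sum_const_bound[OF d]) auto
  also have "\<dots> \<le> ennreal (?Q * a / R powr (p * (1 + \<tau>)))"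
  proof (intro ennreal_leI)
    have "real ?n powr p * (real ?n * grad_const p \<Lambda> ?n) * (aq_const p ?n * X) \<le> ?C * X"
      using mult_right_mono[OF total_const(3)[OF p \<Lambda>, of ?n] X] by (simp only: mult.assoc)
    \<comment> \<open>Since 0 < 2 - \<Gamma> < 1 the additional factor is at least 1, and the bound
      takes the stated form.\<close>
    also have "\<dots> \<le> (2 - \<Gamma>) powr (- p) * (?C * X)"
    proof -
      have "(2 - \<Gamma>) powr 0 \<le> (2 - \<Gamma>) powr (- p)" using \<Gamma> p by (intro powr_mono') auto
      then have "1 \<le> (2 - \<Gamma>) powr (- p)" using \<Gamma> by simp
      then show ?thesis using mult_right_mono[of 1 "(2 - \<Gamma>) powr (- p)" "?C * X"] C X by simp
    qed
    also have "\<dots> = ?Q * a / R powr (p * (1 + \<tau>))"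
      unfolding X_def powr_minus_divide by (simp add: mult_ac)
    finally show "real ?n powr p * (real ?n * grad_const p \<Lambda> ?n) * (aq_const p ?n * X)
      \<le> ?Q * a / R powr (p * (1 + \<tau>))" .
  qed
  finally show "epow (W_seminorm \<tau> p (ball c (R / 4)) (dyadic_gradient v)) p
    \<le> ennreal (?Q * enn2real (A_quantity t s p c R u f) / R powr (p * (1 + \<tau>)))"
    by (simp only: a_def)
qed

end

theorem mainTheorem2:
  fixes p \<Lambda> :: real
  assumes "p \<ge> 2" and "\<Lambda> \<ge> 1"
  shows "\<exists>C>0. \<forall>l\<^sub>0 s t (\<Omega> :: 'a::euclidean_space set) (K :: 'a \<Rightarrow> real) f u.
    l\<^sub>0 > p \<and> 0 \<le> t \<and> t \<le> s \<and> 0 < s \<and> s < 1 \<and> t + s * (p + 1) \<ge> l\<^sub>0 \<and>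
    open \<Omega> \<and>
    K \<in> borel_measurable lebesgue \<and> (\<forall>z. K z \<ge> 0) \<and>
    (\<forall>z. 1 / \<Lambda> * norm z powr (real DIM('a) + s * p) \<le> K z \<and>
         K z \<le> \<Lambda> * norm z powr (real DIM('a) + s * p)) \<and>
    f \<in> W_loc s (conj_exp p) \<Omega> \<and>
    u \<in> W_loc s p \<Omega> \<and> u \<in> Y_space t s p \<and>
    local_weak_solution s p K \<Omega> f u
    \<longrightarrow> (\<exists>G. weak_gradient \<Omega> u G \<and>
          (let \<Gamma> = (1 + t + s * p) / p in
           \<forall>c R. R > 0 \<and> ball c R \<Subset> \<Omega> \<longrightarrow>
             epow (Lp_norm p (ball c (R / 2)) G) p
               \<le> ennreal (C / (l\<^sub>0 - p) powr p * (1 - s)) * A_quantity t s p c R u f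
                   / ennreal (R powr p) \<and>
             (\<forall>\<tau>. 0 < \<tau> \<and> \<tau> < \<Gamma> - 1 \<longrightarrow>
               epow (W_seminorm \<tau> p (ball c (R / 4)) G) p
                 \<le> ennreal ((2 - \<Gamma>) powr (- p) * (\<Gamma> - 1) powr (- p) / ((\<Gamma> - 1 - \<tau>) * \<tau>)
                              * (C / (l\<^sub>0 - p) powr p) * (1 - s)) * A_quantity t s p c R u f
                     / ennreal (R powr (p * (1 + \<tau>))))))"
proof (intro exI[of _ "total_const p \<Lambda> DIM('a)"], rule conjI, goal_cases)
  case 1
  show ?case by (rule total_const(1)[OF assms])
next
  case 2
  show ?case
  proof (intro allI impI, elim conjE)
    fix l\<^sub>0 s t :: real and \<Omega> :: "'a set" and K f u :: "'a \<Rightarrow> real"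
    assume l0: "p < l\<^sub>0" "l\<^sub>0 \<le> t + s * (p + 1)" and t: "0 \<le> t" "t \<le> s" and s: "s < 1" and \<Omega>: "open \<Omega>"
      and K: "K \<in> borel_measurable lebesgue"
        "\<forall>z. 1 / \<Lambda> * norm z powr (real DIM('a) + s * p) \<le> K z \<and> K z \<le> \<Lambda> * norm z powr (real DIM('a) + s * p)"
      and f: "f \<in> W_loc s (conj_exp p) \<Omega>" and u: "u \<in> W_loc s p \<Omega>" "u \<in> Y_space t s p"
      and weak: "local_weak_solution s p K \<Omega> f u"
    \<comment> \<open>Membership in \<open>X_space\<close> makes u measurable on the whole space, so
      a single global Borel representative exists and the same gradient works for all balls and all
      \<tau>.\<close>
    have "u \<in> Lp_loc p UNIV" using u(2) by (simp add: Y_space_def X_space_def)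
    then obtain v where v: "v \<in> borel_measurable borel" "AE x in lborel. u x = v x"
      using lebesgue_borel_representative[OF Lp_loc_borel_measurable] by blast
    interpret nonlocal_equation p \<Lambda> l\<^sub>0 s t \<Omega> K f u v
      using assms l0 t s \<Omega> K f u weak v by unfold_locales auto
    show "\<exists>G. weak_gradient \<Omega> u G \<and>
            (let \<Gamma> = (1 + t + s * p) / p in
             \<forall>c R. R > 0 \<and> ball c R \<Subset> \<Omega> \<longrightarrow>
               epow (Lp_norm p (ball c (R / 2)) G) p
                 \<le> ennreal (total_const p \<Lambda> DIM('a) / (l\<^sub>0 - p) powr p * (1 - s)) * A_quantity t s p c R u f
                     / ennreal (R powr p) \<and>
               (\<forall>\<tau>. 0 < \<tau> \<and> \<tau> < \<Gamma> - 1 \<longrightarrow>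
                 epow (W_seminorm \<tau> p (ball c (R / 4)) G) p
                   \<le> ennreal ((2 - \<Gamma>) powr (- p) * (\<Gamma> - 1) powr (- p) / ((\<Gamma> - 1 - \<tau>) * \<tau>)
                                * (total_const p \<Lambda> DIM('a) / (l\<^sub>0 - p) powr p) * (1 - s)) * A_quantity t s p c R u f
                       / ennreal (R powr (p * (1 + \<tau>)))))"
      unfolding Let_def
      by (intro exI[of _ "dyadic_gradient v"] conjI allI impI weak_gradient gradient_bound gradient_seminorm_bound) auto
  qed
qed

end
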